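(* Let $N\ge1$, $\xi_1,\dots,\xi_N\in\mathbb R\setminus\{0\}$, let $\tau=(\tau_i)_{i\ge1}$ be i.i.d. non-negative random variables with common law $\rho$ having at most exponential tails and $\mathbb E(\tau_i)=1$, and let $m\in\mathbb N$, $m\ge1$. Let $\Phi^m_t$ and $\Psi^m_t$ be the jumping and interpolated stochastic flows defined in the context (with the singular kernel $K$). Then, for every realization of $\tau$ and every $t\ge0$: (i) $\Phi^m_t(x)$ and $\Psi^m_t(x)$ are well defined for every $x\in\mathcal X$; (ii) $H(\Phi^m_t(x))=H(x)$ and $H(\Psi^m_t(x))=H(x)$ for every $x\in\mathcal X$; (iii) $\Phi^m_t$ and $\Psi^m_t$ preserve the measure $dx^N$, i.e. $(\Phi^m_t)_*dx^N=(\Psi^m_t)_*dx^N=dx^N$; (iv) consequently $\Phi^m_t$ and $\Psi^m_t$ preserve the canonical ensemble $\nu_\beta$, for each $\beta\in\mathbb R$ for which it is well defined, and the microcanonical ensemble $\mu_E$, for each $E\in\mathbb R$ for which it is well defined.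
   Context: $\mathbb T\simeq[0,1)^2$ is the two-dimensional flat torus, $dx^N$ is the Lebesgue (Haar) measure on $\mathbb T^N$, and $\mathcal X:=\{x=(x_1,\dots,x_N)\in\mathbb T^N: x_i\ne x_j\ \forall i\neq j\}$, which has full measure. $\nabla^\perp=(-\partial_2,\partial_1)$. $G:\mathbb T\setminus\{0\}\to\mathbb R$ is the zero-average Green function of $-\Delta$ on $\mathbb T$ (so $-\Delta G=\delta_0-1$), and $K=-\nabla^\perp G:\mathbb T\setminus\{0\}\to\mathbb R^2$ is the Biot-Savart kernel. For $x\in\mathcal X$, $v_i(x)=\sum_{j\ne i}\xi_jK(x_i-x_j)\in\mathbb R^2$, and $v^{(i)}:=(0,\dots,0,v_i,0,\dots,0)$ ($v_i$ in the $i$-th slot) is a vector field on $\mathcal X$, $i=1,\dots,N$. $\Phi^{(i)}_t$ denotes the flow of $v^{(i)}$ on $\mathcal X$. For indices larger than $N$, the superscript $i$ is understood modulo $N$ with representatives in $\{1,\dots,N\}$. "At most exponential tails" means that there are constants $C,c>0$ with $\mathbb P(\tau_1>r)\le Ce^{-cr}$ for all $r\ge0$. Jumping stochastic flow: $\Phi^m_t:=\Phi^{(\ell N)}_{\tau_{\ell N}/m}\circ\dots\circ\Phi^{(1)}_{\tau_1/m}$, with $\ell=\lfloor mt\rfloor$ (the identity if $\ell=0$). Interpolated stochastic flow: $t\mapsto\Psi^m_t(x)$ is the continuous, piecewise smooth solution of $\frac{d}{dt}\Psi^m_t(x)=N\tau_i\,v^{(j)}(\Psi^m_t(x))$, $\Psi^m_0(x)=x$,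 where $i=\lfloor Nmt\rfloor+1$ and $j\in\{1,\dots,N\}$, $j\equiv i\ (\mathrm{mod}\ N)$. In particular $\Psi^m_t=\Phi^m_t$ when $mt$ is an integer. Energy: $H(x_1,\dots,x_N)=\sum_{i\ne j}\xi_i\xi_jG(x_i-x_j)$ on $\mathcal X$. Canonical ensemble: $\nu_\beta(dx^N)=Z_{\beta,N}^{-1}e^{-\beta H(x)}dx^N$ with $Z_{\beta,N}=\int_{\mathbb T^N}e^{-\beta H}dx^N$; it is well defined when $Z_{\beta,N}<\infty$. Microcanonical ensemble: $\mu_E(dx^N)=Z_{E,N}^{-1}\,\delta(H(x)-E)\,dx^N$, where $Z_{E,N}$ is the normalizing total mass. Here, for $E$ a regular value of $H:\mathcal X\to\mathbb R$, $\delta(H-E)\,dx^N$ denotes the measure on $\{x\in\mathcal X:H(x)=E\}$ having density $|\nabla H|^{-1}$ with respect to the $(2N-1)$-dimensional surface measure; $\mu_E$ is well defined when its total mass lies in $(0,\infty)$. *)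

theory Defs
  imports "HOL-Probability.Probability"
begin

text \<open>
  The torus is represented by the fundamental domain \<open>[0,1)\<^sup>2\<close>, and functions on it by
  \<open>\<int>\<^sup>2\<close>-periodic functions on the plane, so that \<open>G (x - y)\<close> needs no reduction of \<open>x - y\<close>.
  A configuration of \<open>N = CARD('n)\<close> vortices has type \<open>real^2^'n\<close>; the labels \<open>1, ..., N\<close>
  are attached to the index type by an enumeration \<open>e\<close>, a bijection from \<open>{1..CARD('n)}\<close>
  onto \<open>UNIV\<close>.
\<close>

subsection \<open>Calculus\<close>

primrec Ck_on :: "nat \<Rightarrow> 'a::euclidean_space set \<Rightarrow> ('a \<Rightarrow> real) \<Rightarrow> bool" where
  "Ck_on 0 S f \<longleftrightarrow> continuous_on S f"
| "Ck_on (Suc k) S f \<longleftrightarrow> (\<forall>x\<in>S. f differentiable (at x)) \<and>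
     (\<forall>b\<in>Basis. Ck_on k S (\<lambda>x. frechet_derivative f (at x) b))"

text \<open>Only meaningful on open sets, since the derivatives are two-sided.\<close>

definition smooth_on :: "'a::euclidean_space set \<Rightarrow> ('a \<Rightarrow> real) \<Rightarrow> bool" where
  "smooth_on S f \<longleftrightarrow> (\<forall>k. Ck_on k S f)"

definition grad :: "('a::euclidean_space \<Rightarrow> real) \<Rightarrow> 'a \<Rightarrow> 'a" where
  "grad f x = (\<Sum>b\<in>Basis. frechet_derivative f (at x) b *\<^sub>R b)"

definition laplacian :: "('a::euclidean_space \<Rightarrow> real) \<Rightarrow> 'a \<Rightarrow> real" where
  "laplacian f x =
     (\<Sum>b\<in>Basis. frechet_derivative (\<lambda>y. frechet_derivative f (at y) b) (at x) b)"

definition perp :: "real^2 \<Rightarrow> real^2" where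
  "perp v = vector [- v $ 2, v $ 1]"

subsection \<open>Torus and Green function\<close>

definition lattice2 :: "(real^2) set" where
  "lattice2 = {z. \<forall>k. z $ k \<in> \<int>}"

definition torus :: "(real^2) set" where
  "torus = {x. \<forall>k. 0 \<le> x $ k \<and> x $ k < 1}"

definition wrap :: "real^2 \<Rightarrow> real^2" where
  "wrap x = (\<chi> k. frac (x $ k))"

definition periodic2 :: "(real^2 \<Rightarrow> real) \<Rightarrow> bool" where
  "periodic2 f \<longleftrightarrow> (\<forall>x. \<forall>z\<in>lattice2. f (x + z) = f x)"

text \<open>
  The last clause is \<open>-\<Delta>G = \<delta>\<^sub>0 - 1\<close> in the sense of distributions on the torus. Smoothness
  away from the lattice follows from it by elliptic regularity up to a null set; as a
  requirement it selects the representative that is a genuine function off the origin.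
  The value at lattice points is irrelevant.
\<close>

definition green_function :: "(real^2 \<Rightarrow> real) \<Rightarrow> bool" where
  "green_function G \<longleftrightarrow>
     periodic2 G \<and> smooth_on (- lattice2) G \<and>
     set_integrable lborel torus G \<and> (LINT x:torus|lborel. G x) = 0 \<and>
     (\<forall>\<phi>. periodic2 \<phi> \<and> smooth_on UNIV \<phi> \<longrightarrow>
        (LINT x:torus|lborel. G x * (- laplacian \<phi> x)) = \<phi> 0 - (LINT x:torus|lborel. \<phi> x))"

definition biot_savart :: "(real^2 \<Rightarrow> real) \<Rightarrow> real^2 \<Rightarrow> real^2" where
  "biot_savart G x = - perp (grad G x)"

subsection \<open>Configurations, velocity and energy\<close>

definition torusN :: "(real^2^'n) set" where
  "torusN = {x. \<forall>i. x $ i \<in> torus}"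

definition wrapN :: "real^2^'n \<Rightarrow> real^2^'n" where
  "wrapN x = (\<chi> i. wrap (x $ i))"

definition conf_space :: "(real^2^'n) set" where
  "conf_space = {x \<in> torusN. \<forall>i j. i \<noteq> j \<longrightarrow> x $ i \<noteq> x $ j}"

definition lifted_conf_space :: "(real^2^'n) set" where
  "lifted_conf_space = {x. \<forall>i j. i \<noteq> j \<longrightarrow> x $ i - x $ j \<notin> lattice2}"

definition velocity ::
  "(real^2 \<Rightarrow> real) \<Rightarrow> ('n::finite \<Rightarrow> real) \<Rightarrow> 'n \<Rightarrow> real^2^'n \<Rightarrow> real^2" where
  "velocity G \<xi> i x = (\<Sum>j\<in>UNIV - {i}. \<xi> j *\<^sub>R biot_savart G (x $ i - x $ j))"

definition slot_field ::
  "(real^2 \<Rightarrow> real) \<Rightarrow> ('n::finite \<Rightarrow> real) \<Rightarrow> 'n \<Rightarrow> real^2^'n \<Rightarrow> real^2^'n" where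
  "slot_field G \<xi> i x = (\<chi> k. if k = i then velocity G \<xi> i x else 0)"

definition energy ::
  "(real^2 \<Rightarrow> real) \<Rightarrow> ('n::finite \<Rightarrow> real) \<Rightarrow> real^2^'n \<Rightarrow> real" where
  "energy G \<xi> x = (\<Sum>i\<in>UNIV. \<Sum>j\<in>UNIV - {i}. \<xi> i * \<xi> j * G (x $ i - x $ j))"

text \<open>The vortex moved at step \<open>i \<ge> 1\<close>: \<open>i\<close> is reduced modulo \<open>N\<close> into \<open>{1..N}\<close>.\<close>

definition slot :: "(nat \<Rightarrow> 'n::finite) \<Rightarrow> nat \<Rightarrow> 'n" where
  "slot e i = e ((i - 1) mod CARD('n) + 1)"

subsection \<open>Flows\<close>

text \<open>
  A curve on the torus is differentiated through a lift \<open>\<Gamma>\<close> to the universal cover, since its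
  representative in the fundamental domain jumps when it crosses the boundary.
\<close>

definition integral_curve ::
  "(real^2^'n \<Rightarrow> real^2^'n) \<Rightarrow> real \<Rightarrow> real^2^'n \<Rightarrow> (real \<Rightarrow> real^2^'n) \<Rightarrow> bool" where
  "integral_curve V T x \<gamma> \<longleftrightarrow>
     \<gamma> 0 = x \<and>
     (\<exists>\<Gamma>. \<forall>s\<in>{0..T}. \<gamma> s = wrapN (\<Gamma> s) \<and> \<gamma> s \<in> conf_space \<and>
        (\<Gamma> has_vector_derivative V (\<gamma> s)) (at s within {0..T}))"

definition flow_defined :: "(real^2^'n \<Rightarrow> real^2^'n) \<Rightarrow> real \<Rightarrow> real^2^'n \<Rightarrow> bool" where
  "flow_defined V T x \<longleftrightarrow>
     (\<exists>\<gamma>. integral_curve V T x \<gamma>) \<and>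
     (\<forall>\<gamma> \<gamma>'. integral_curve V T x \<gamma> \<and> integral_curve V T x \<gamma>' \<longrightarrow> (\<forall>s\<in>{0..T}. \<gamma> s = \<gamma>' s))"

definition flow :: "(real^2^'n \<Rightarrow> real^2^'n) \<Rightarrow> real \<Rightarrow> real^2^'n \<Rightarrow> real^2^'n" where
  "flow V T x = (THE y. \<exists>\<gamma>. integral_curve V T x \<gamma> \<and> \<gamma> T = y)"

text \<open>In what follows \<open>\<tau>\<close> is one realization \<open>\<tau>\<^sub>1, \<tau>\<^sub>2, ...\<close> of the waiting times (\<open>\<tau> 0\<close> is unused).\<close>

primrec jump_steps ::
  "(real^2 \<Rightarrow> real) \<Rightarrow> ('n::finite \<Rightarrow> real) \<Rightarrow> (nat \<Rightarrow> 'n) \<Rightarrow> (nat \<Rightarrow> real) \<Rightarrow> nat \<Rightarrow> nat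
     \<Rightarrow> real^2^'n \<Rightarrow> real^2^'n" where
  "jump_steps G \<xi> e \<tau> m 0 x = x"
| "jump_steps G \<xi> e \<tau> m (Suc k) x =
     flow (slot_field G \<xi> (slot e (Suc k))) (\<tau> (Suc k) / real m) (jump_steps G \<xi> e \<tau> m k x)"

definition num_steps :: "nat \<Rightarrow> nat \<Rightarrow> real \<Rightarrow> nat" where
  "num_steps N m t = nat \<lfloor>real m * t\<rfloor> * N"

definition jumping_flow ::
  "(real^2 \<Rightarrow> real) \<Rightarrow> ('n::finite \<Rightarrow> real) \<Rightarrow> (nat \<Rightarrow> 'n) \<Rightarrow> (nat \<Rightarrow> real) \<Rightarrow> nat \<Rightarrow> real
     \<Rightarrow> real^2^'n \<Rightarrow> real^2^'n" where
  "jumping_flow G \<xi> e \<tau> m t x = jump_steps G \<xi> e \<tau> m (num_steps CARD('n) m t) x"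

definition jumping_flow_defined ::
  "(real^2 \<Rightarrow> real) \<Rightarrow> ('n::finite \<Rightarrow> real) \<Rightarrow> (nat \<Rightarrow> 'n) \<Rightarrow> (nat \<Rightarrow> real) \<Rightarrow> nat \<Rightarrow> real
     \<Rightarrow> real^2^'n \<Rightarrow> bool" where
  "jumping_flow_defined G \<xi> e \<tau> m t x \<longleftrightarrow>
     (\<forall>k < num_steps CARD('n) m t.
        flow_defined (slot_field G \<xi> (slot e (Suc k))) (\<tau> (Suc k) / real m)
          (jump_steps G \<xi> e \<tau> m k x))"

text \<open>
  The equation is imposed off the switching times, where the right-hand side jumps; together with
  continuity and smoothness of the fields this makes the curve smooth on each closed piece.
\<close>

definition interpolated_curve ::
  "(real^2 \<Rightarrow> real) \<Rightarrow> ('n::finite \<Rightarrow> real) \<Rightarrow> (nat \<Rightarrow> 'n) \<Rightarrow> (nat \<Rightarrow> real) \<Rightarrow> nat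
     \<Rightarrow> real^2^'n \<Rightarrow> (real \<Rightarrow> real^2^'n) \<Rightarrow> bool" where
  "interpolated_curve G \<xi> e \<tau> m x \<gamma> \<longleftrightarrow>
     \<gamma> 0 = x \<and>
     (\<exists>\<Gamma>. continuous_on {0..} \<Gamma> \<and>
        (\<forall>s\<ge>0. \<gamma> s = wrapN (\<Gamma> s) \<and> \<gamma> s \<in> conf_space) \<and>
        (\<forall>s\<ge>0. real CARD('n) * real m * s \<notin> \<int> \<longrightarrow>
           (let i = nat \<lfloor>real CARD('n) * real m * s\<rfloor> + 1 in
             (\<Gamma> has_vector_derivative
               (real CARD('n) * \<tau> i) *\<^sub>R slot_field G \<xi> (slot e i) (\<gamma> s)) (at s))))"

definition interpolated_flow ::
  "(real^2 \<Rightarrow> real) \<Rightarrow> ('n::finite \<Rightarrow> real) \<Rightarrow> (nat \<Rightarrow> 'n) \<Rightarrow> (nat \<Rightarrow> real) \<Rightarrow> nat \<Rightarrow> real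
     \<Rightarrow> real^2^'n \<Rightarrow> real^2^'n" where
  "interpolated_flow G \<xi> e \<tau> m t x =
     (THE y. \<exists>\<gamma>. interpolated_curve G \<xi> e \<tau> m x \<gamma> \<and> \<gamma> t = y)"

definition interpolated_flow_defined ::
  "(real^2 \<Rightarrow> real) \<Rightarrow> ('n::finite \<Rightarrow> real) \<Rightarrow> (nat \<Rightarrow> 'n) \<Rightarrow> (nat \<Rightarrow> real) \<Rightarrow> nat
     \<Rightarrow> real^2^'n \<Rightarrow> bool" where
  "interpolated_flow_defined G \<xi> e \<tau> m x \<longleftrightarrow>
     (\<exists>\<gamma>. interpolated_curve G \<xi> e \<tau> m x \<gamma>) \<and>
     (\<forall>\<gamma> \<gamma>'. interpolated_curve G \<xi> e \<tau> m x \<gamma> \<and> interpolated_curve G \<xi> e \<tau> m x \<gamma>' \<longrightarrow>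
        (\<forall>s\<ge>0. \<gamma> s = \<gamma>' s))"

subsection \<open>Invariant measures\<close>

definition vol_torusN :: "(real^2^'n) measure" where
  "vol_torusN = restrict_space lborel torusN"

text \<open>
  All measures below live on the whole of \<open>torusN\<close>, whereas the maps are meaningful only on
  \<open>conf_space\<close>; invariance in particular forces the complement of \<open>conf_space\<close> to carry no mass
  whenever \<open>\<mu>\<close> is finite.
\<close>

definition preserves_measure :: "(real^2^'n \<Rightarrow> real^2^'n) \<Rightarrow> (real^2^'n) measure \<Rightarrow> bool" where
  "preserves_measure f \<mu> \<longleftrightarrow>
     f \<in> measurable (restrict_space \<mu> conf_space) \<mu> \<and>
     distr (restrict_space \<mu> conf_space) \<mu> f = \<mu>"

definition Z_canonical ::
  "(real^2 \<Rightarrow> real) \<Rightarrow> ('n::finite \<Rightarrow> real) \<Rightarrow> real \<Rightarrow> ennreal" where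
  "Z_canonical G \<xi> \<beta> = (\<integral>\<^sup>+ x. ennreal (exp (- \<beta> * energy G \<xi> x)) \<partial>vol_torusN)"

definition canonical ::
  "(real^2 \<Rightarrow> real) \<Rightarrow> ('n::finite \<Rightarrow> real) \<Rightarrow> real \<Rightarrow> (real^2^'n) measure" where
  "canonical G \<xi> \<beta> =
     density vol_torusN (\<lambda>x. ennreal (exp (- \<beta> * energy G \<xi> x)) / Z_canonical G \<xi> \<beta>)"

text \<open>Lebesgue measure on the coordinate hyperplane orthogonal to the basis vector \<open>b\<close>.\<close>

definition hyperplane_lborel :: "'a::euclidean_space \<Rightarrow> 'a measure" where
  "hyperplane_lborel b =
     distr (\<Pi>\<^sub>M c\<in>Basis - {b}. lborel) borel (\<lambda>f. \<Sum>c\<in>Basis - {b}. f c *\<^sub>R c)"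

text \<open>
  \<open>C\<^sup>1\<close> function \<open>g\<close> with gradient \<open>D\<close> on a relatively open subset \<open>U\<close> of that hyperplane; the
  point of its graph over \<open>y\<close> is \<open>y + g y *\<^sub>R b\<close>.
\<close>

definition C1_on_hyperplane ::
  "'a::euclidean_space \<Rightarrow> 'a set \<Rightarrow> ('a \<Rightarrow> real) \<Rightarrow> ('a \<Rightarrow> 'a) \<Rightarrow> bool" where
  "C1_on_hyperplane b U g D \<longleftrightarrow>
     openin (top_of_set {y. y \<bullet> b = 0}) U \<and> continuous_on U D \<and>
     (\<forall>y\<in>U. D y \<bullet> b = 0 \<and>
        (g has_derivative (\<lambda>h. D y \<bullet> h)) (at y within {y. y \<bullet> b = 0}))"

text \<open>
  Surface measure of a hypersurface \<open>M\<close>: carried by \<open>M\<close>, and with element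
  \<open>sqrt (1 + |\<nabla>g|\<^sup>2) dy\<close> on every piece of \<open>M\<close> that is the graph of a \<open>C\<^sup>1\<close> function \<open>g\<close> over a
  coordinate hyperplane. For a \<open>C\<^sup>1\<close> hypersurface such graphs cover \<open>M\<close>, so there is exactly one
  such measure.
\<close>

definition surface_measure_on :: "'a::euclidean_space set \<Rightarrow> 'a measure \<Rightarrow> bool" where
  "surface_measure_on M \<sigma> \<longleftrightarrow>
     sets \<sigma> = sets borel \<and> emeasure \<sigma> (- M) = 0 \<and>
     (\<forall>b\<in>Basis. \<forall>U g D.
        C1_on_hyperplane b U g D \<and> (\<lambda>y. y + g y *\<^sub>R b) ` U \<subseteq> M \<longrightarrow>
        (\<forall>A\<in>sets borel. A \<subseteq> (\<lambda>y. y + g y *\<^sub>R b) ` U \<longrightarrow>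
           emeasure \<sigma> A =
             (\<integral>\<^sup>+ y\<in>U. ennreal (sqrt (1 + (norm (D y))\<^sup>2)) * indicator A (y + g y *\<^sub>R b)
                \<partial>hyperplane_lborel b)))"

text \<open>
  The periodic lift of \<open>{x \<in> conf_space. H x = E}\<close>, a hypersurface without boundary in Euclidean
  space. Surface measure on the torus is its surface measure restricted to the fundamental domain.
\<close>

definition energy_surface ::
  "(real^2 \<Rightarrow> real) \<Rightarrow> ('n::finite \<Rightarrow> real) \<Rightarrow> real \<Rightarrow> (real^2^'n) set" where
  "energy_surface G \<xi> E = {x \<in> lifted_conf_space. energy G \<xi> x = E}"

definition regular_energy ::
  "(real^2 \<Rightarrow> real) \<Rightarrow> ('n::finite \<Rightarrow> real) \<Rightarrow> real \<Rightarrow> bool" where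
  "regular_energy G \<xi> E \<longleftrightarrow>
     (\<forall>x\<in>conf_space. energy G \<xi> x = E \<longrightarrow> grad (energy G \<xi>) x \<noteq> 0)"

text \<open>
  In the next three definitions \<open>\<sigma>\<close> stands for the surface measure of \<open>energy_surface G \<xi> E\<close>.
  As \<open>\<sigma>\<close> is carried by that surface, the indicator only discards the values of the gradient at
  collisions, where the energy is not defined.
\<close>

definition delta_energy ::
  "(real^2 \<Rightarrow> real) \<Rightarrow> ('n::finite \<Rightarrow> real) \<Rightarrow> (real^2^'n) measure \<Rightarrow> (real^2^'n) measure" where
  "delta_energy G \<xi> \<sigma> =
     density (restrict_space \<sigma> torusN)
       (\<lambda>x. indicator conf_space x * ennreal (1 / norm (grad (energy G \<xi>) x)))"

definition Z_microcanonical ::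
  "(real^2 \<Rightarrow> real) \<Rightarrow> ('n::finite \<Rightarrow> real) \<Rightarrow> (real^2^'n) measure \<Rightarrow> ennreal" where
  "Z_microcanonical G \<xi> \<sigma> = emeasure (delta_energy G \<xi> \<sigma>) torusN"

definition microcanonical ::
  "(real^2 \<Rightarrow> real) \<Rightarrow> ('n::finite \<Rightarrow> real) \<Rightarrow> (real^2^'n) measure \<Rightarrow> (real^2^'n) measure" where
  "microcanonical G \<xi> \<sigma> =
     scale_measure (1 / Z_microcanonical G \<xi> \<sigma>) (delta_energy G \<xi> \<sigma>)"

end

theory Submission
  imports Defs
begin

text \<open>
  The vortex \<open>i\<close> moved by \<open>v\<^sup>(\<^sup>i\<^sup>)\<close> sees the others at rest, so it conserves its own Hamiltonian
  \<open>\<Sum>\<^bsub>j \<noteq> i\<^esub> \<xi>\<^sub>j G (x\<^sub>i - x\<^sub>j)\<close> and with it the energy. Since \<open>G\<close> is unbounded near the origin (test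
  \<open>-\<Delta>G = \<delta>\<^sub>0 - 1\<close> against smooth approximations of the logarithm), this conserved quantity keeps the flow
  away from collisions and makes it global. A vector field that is divergence free and points in two coordinate
  directions has symplectic Euler steps that preserve volume exactly, and the flow is their limit.
  The microcanonical measure is the limit of the normalised volumes of thin energy shells, so it is invariant
  under every volume and energy preserving homeomorphism. All this is done on the universal cover, where the
  flows commute with lattice translations, and then pushed down to the torus.
\<close>

subsection \<open>Globally Lipschitz vector fields\<close>

text \<open>The sum \<open>energy\<close> cannot by itself prevent collisions: intensities of both
  signs let singular terms cancel. Moving one vortex at a time helps, because the resting ones keep
  their distances and so at most one of them can be approached. Only the growth of
  \<open>\<bar>G\<bar>\<close> is established, whence the square in \<open>barrier\<close>. A
  cut-off that is a function of the conserved quantity leaves the divergence zero, and periodicity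
  makes the cut-off field bounded and Lipschitz, so volume becomes a question about global Lipschitz
  flows. Symmetry of \<open>G\<close> is not part of \<open>green_function\<close>, yet
  \<open>energy\<close> contains both \<open>G (x - y)\<close> and \<open>G (y - x)\<close>;
  evenness is derived from the Fourier coefficients of \<open>G\<close>. Surface measure is given
  through its graph charts only; thin shells spare a transformation formula for it under the flow,
  and they show in the same way that the lifted measure is invariant under lattice
  translations.\<close>

definition is_trajectory :: "('a::real_normed_vector \<Rightarrow> 'a) \<Rightarrow> real \<Rightarrow> (real \<Rightarrow> 'a) \<Rightarrow> bool" where
  "is_trajectory W T u \<longleftrightarrow> continuous_on {0..T} u \<and>
     (\<forall>t. 0 < t \<and> t < T \<longrightarrow> (u has_vector_derivative W (u t)) (at t))"

lemma is_trajectory_subinterval: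
  assumes "is_trajectory W T u" "t \<le> T"
  shows "is_trajectory W t u"
  using assms unfolding is_trajectory_def
  by (auto intro: continuous_on_subset)

lemma is_trajectory_shift:
  assumes "is_trajectory W T u" "0 \<le> a" "a + b \<le> T"
  shows "is_trajectory W b (\<lambda>t. u (a + t))"
  unfolding is_trajectory_def
proof (intro conjI allI impI)
  have "continuous_on ((\<lambda>t. a + t) ` {0..b}) u"
    using assms unfolding is_trajectory_def
    by (auto intro: continuous_on_subset)
  then show "continuous_on {0..b} (\<lambda>t. u (a + t))"
    by (rule continuous_on_compose2) (auto intro!: continuous_intros)
next
  fix t assume t: "0 < t \<and> t < b"
  have d: "(u has_vector_derivative W (u (a + t))) (at (a + t))"
    using assms t unfolding is_trajectory_def by auto
  have "((\<lambda>t. a + t) has_real_derivative 1) (at t)"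
    by (auto intro!: derivative_eq_intros)
  then have "((\<lambda>t. a + t) has_vector_derivative 1) (at t)"
    by (simp add: has_real_derivative_iff_has_vector_derivative)
  from vector_diff_chain_at[OF this d]
  show "((\<lambda>t. u (a + t)) has_vector_derivative W (u (a + t))) (at t)"
    by (simp add: o_def)
qed

text \<open>Time runs forward only in \<open>is_trajectory\<close>; inverses of flows are obtained
  as flows of the negated field along the reversed curve.\<close>

lemma is_trajectory_reverse:
  assumes "is_trajectory W T u"
  shows "is_trajectory (\<lambda>x. - W x) T (\<lambda>t. u (T - t))"
  unfolding is_trajectory_def
proof (intro conjI allI impI)
  have "continuous_on {0..T} u"
    using assms unfolding is_trajectory_def by auto
  then show "continuous_on {0..T} (\<lambda>t. u (T - t))"
    by (rule continuous_on_compose2) (auto intro!: continuous_intros)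
next
  fix t assume t: "0 < t \<and> t < T"
  have d: "(u has_vector_derivative W (u (T - t))) (at (T - t))"
    using assms t unfolding is_trajectory_def by auto
  have "((\<lambda>t. T - t) has_real_derivative -1) (at t)"
    by (auto intro!: derivative_eq_intros)
  then have "((\<lambda>t. T - t) has_vector_derivative -1) (at t)"
    by (simp add: has_real_derivative_iff_has_vector_derivative)
  from vector_diff_chain_at[OF this d]
  show "((\<lambda>t. u (T - t)) has_vector_derivative - W (u (T - t))) (at t)"
    by (simp add: o_def)
qed

lemma is_trajectory_cong:
  assumes "is_trajectory W T u" "\<And>t. 0 < t \<Longrightarrow> t < T \<Longrightarrow> W' (u t) = W (u t)"
  shows "is_trajectory W' T u"
  using assms unfolding is_trajectory_def by auto

text \<open>The squared distance weighted by \<open>exp (- 2 * L * t)\<close> has a derivative that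
  is at most 0. Squares are used because the norm is not differentiable where the curves
  meet.\<close>

lemma gronwall_trajectories:
  fixes W :: "'a::euclidean_space \<Rightarrow> 'a"
  assumes lip: "L-lipschitz_on UNIV W" and T: "0 \<le> T"
    and u: "is_trajectory W T u" and v: "is_trajectory W T v"
  shows "norm (u T - v T) \<le> exp (L * T) * norm (u 0 - v 0)"
proof -
  define f where "f = (\<lambda>t. exp (- 2 * L * t) * ((u t - v t) \<bullet> (u t - v t)))"
  have "f T \<le> f 0"
  proof (rule DERIV_nonpos_imp_decreasing_open[OF T])
    show "continuous_on {0..T} f"
      using u v unfolding is_trajectory_def f_def by (auto intro!: continuous_intros)
    fix t assume t: "0 < t" "t < T"
    let ?w = "u t - v t" and ?w' = "W (u t) - W (v t)"
    have du: "(u has_vector_derivative W (u t)) (at t)"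
      and dv: "(v has_vector_derivative W (v t)) (at t)"
      using u v t unfolding is_trajectory_def by auto
    have d: "((\<lambda>t. u t - v t) has_vector_derivative ?w') (at t)"
      by (intro derivative_intros du dv)
    have "((\<lambda>t. (u t - v t) \<bullet> (u t - v t)) has_derivative (\<lambda>h. ?w \<bullet> (h *\<^sub>R ?w') + (h *\<^sub>R ?w') \<bullet> ?w)) (at t)"
      using has_derivative_inner[OF d[unfolded has_vector_derivative_def] d[unfolded has_vector_derivative_def]] .
    then have 1: "((\<lambda>t. (u t - v t) \<bullet> (u t - v t)) has_real_derivative 2 * (?w \<bullet> ?w')) (at t)"
      unfolding has_field_derivative_def
      by (rule has_derivative_eq_rhs) (auto simp: fun_eq_iff inner_commute algebra_simps)
    have 2: "(f has_real_derivative
        exp (- 2 * L * t) * (- 2 * L) * (?w \<bullet> ?w) + 2 * (?w \<bullet> ?w') * exp (- 2 * L * t)) (at t)"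
      unfolding f_def by (rule derivative_eq_intros 1 refl | simp)+
    have "?w \<bullet> ?w' \<le> norm ?w * norm ?w'" by (rule norm_cauchy_schwarz)
    also have "\<dots> \<le> norm ?w * (L * norm ?w)"
      using lipschitz_onD[OF lip, of "u t" "v t"] by (auto simp: dist_norm intro!: mult_left_mono)
    also have "\<dots> = L * (?w \<bullet> ?w)" by (simp add: power2_norm_eq_inner[symmetric] power2_eq_square)
    finally have "exp (- 2 * L * t) * (?w \<bullet> ?w' - L * (?w \<bullet> ?w)) \<le> 0"
      by (intro mult_nonneg_nonpos) auto
    then show "\<exists>y. DERIV f t :> y \<and> y \<le> 0"
      by (intro exI[of _ "exp (- 2 * L * t) * (- 2 * L) * (?w \<bullet> ?w) + 2 * (?w \<bullet> ?w') * exp (- 2 * L * t)"] conjI 2)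
         (simp add: algebra_simps)
  qed
  then have "exp (- 2 * L * T) * (norm (u T - v T))\<^sup>2 \<le> (norm (u 0 - v 0))\<^sup>2"
    unfolding f_def by (simp add: power2_norm_eq_inner)
  then have "exp (2 * L * T) * (exp (- 2 * L * T) * (norm (u T - v T))\<^sup>2) \<le> exp (2 * L * T) * (norm (u 0 - v 0))\<^sup>2"
    by (rule mult_left_mono) auto
  then have "(norm (u T - v T))\<^sup>2 \<le> exp (2 * L * T) * (norm (u 0 - v 0))\<^sup>2"
    by (simp add: mult.assoc[symmetric] exp_add[symmetric])
  also have "\<dots> = (exp (L * T) * norm (u 0 - v 0))\<^sup>2"
    by (simp add: power_mult_distrib power2_eq_square exp_add[symmetric])
  finally show ?thesis by (rule power2_le_imp_le) auto
qed

lemma trajectory_unique: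
  fixes W :: "'a::euclidean_space \<Rightarrow> 'a"
  assumes "L-lipschitz_on UNIV W" "0 \<le> T" "is_trajectory W T u" "is_trajectory W T v" "u 0 = v 0"
  shows "u T = v T"
  using gronwall_trajectories[OF assms(1-4)] assms(5) by simp

section \<open>Existence of trajectories by Picard iteration\<close>

primrec picard :: "('a::euclidean_space \<Rightarrow> 'a) \<Rightarrow> 'a \<Rightarrow> nat \<Rightarrow> real \<Rightarrow> 'a" where
  "picard W x 0 t = x"
| "picard W x (Suc k) t = x + integral {0..t} (\<lambda>s. W (picard W x k s))"

lemma continuous_picard:
  fixes W :: "'a::euclidean_space \<Rightarrow> 'a"
  assumes W: "continuous_on UNIV W"
  shows "continuous_on {0..T} (picard W x k)"
proof (induction k)
  case 0 then show ?case by simp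
next
  case (Suc k)
  have "continuous_on {0..T} (\<lambda>s. W (picard W x k s))"
    by (rule continuous_on_compose2[OF W Suc]) auto
  then have "continuous_on {0..T} (\<lambda>t. integral {0..t} (\<lambda>s. W (picard W x k s)))"
    by (intro indefinite_integral_continuous_1 integrable_continuous_real)
  then show ?case by (auto intro!: continuous_intros)
qed

text \<open>Each integration raises the power of \<open>t\<close> and the factorial by one, so the
  increments are summable on every bounded interval and the solution is global at once, with no
  continuation argument.\<close>

lemma picard_step_bound:
  fixes W :: "'a::euclidean_space \<Rightarrow> 'a"
  assumes lip: "L-lipschitz_on UNIV W" and t: "0 \<le> t"
  shows "norm (picard W x (Suc k) t - picard W x k t) \<le> norm (W x) * L ^ k * t ^ Suc k / fact (Suc k)"
  using t
proof (induction k arbitrary: t)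
  case 0
  have "integral {0..t} (\<lambda>s. W x) = t *\<^sub>R W x" using 0 by simp
  then show ?case using 0 by (simp add: mult.commute)
next
  case (Suc k)
  have W: "continuous_on UNIV W" using lip by (rule lipschitz_on_continuous_on)
  have L: "0 \<le> L" using lip by (rule lipschitz_on_nonneg)
  have c: "continuous_on {0..t} (\<lambda>s. W (picard W x k s))" for k
    by (rule continuous_on_compose2[OF W continuous_picard[OF W]]) auto
  have i: "(\<lambda>s. W (picard W x k s)) integrable_on {0..t}" for k
    using c by (rule integrable_continuous_real)
  have P: "((\<lambda>s. norm (W x) * L ^ Suc k * s ^ Suc k / fact (Suc k)) has_integral
      norm (W x) * L ^ Suc k * t ^ Suc (Suc k) / fact (Suc (Suc k))
      - norm (W x) * L ^ Suc k * 0 ^ Suc (Suc k) / fact (Suc (Suc k))) {0..t}"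
  proof (rule fundamental_theorem_of_calculus[OF Suc.prems])
    fix s :: real assume "s \<in> {0..t}"
    have "((\<lambda>s. norm (W x) * L ^ Suc k * s ^ Suc (Suc k) / fact (Suc (Suc k))) has_real_derivative
       norm (W x) * L ^ Suc k * (real (Suc (Suc k)) * s ^ Suc k) / fact (Suc (Suc k))) (at s within {0..t})"
      by (rule derivative_eq_intros refl | simp)+
    moreover have "norm (W x) * L ^ Suc k * (real (Suc (Suc k)) * s ^ Suc k) / fact (Suc (Suc k))
       = norm (W x) * L ^ Suc k * s ^ Suc k / fact (Suc k)"
    proof -
      have "a * (n * b) / (n * c) = a * b / c" if "n \<noteq> 0" for a b c n :: real
        using that by simp
      from this[of "real (Suc (Suc k))"] show ?thesis unfolding fact_Suc[of "Suc k"] of_nat_mult by simp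
    qed
    ultimately show "((\<lambda>s. norm (W x) * L ^ Suc k * s ^ Suc (Suc k) / fact (Suc (Suc k))) has_vector_derivative
      norm (W x) * L ^ Suc k * s ^ Suc k / fact (Suc k)) (at s within {0..t})"
      by (simp only: has_real_derivative_iff_has_vector_derivative)
  qed
  have "norm (picard W x (Suc (Suc k)) t - picard W x (Suc k) t)
     = norm (integral {0..t} (\<lambda>s. W (picard W x (Suc k) s) - W (picard W x k s)))"
    using i[of k] i[of "Suc k"] by (simp add: Henstock_Kurzweil_Integration.integral_diff)
  also have "\<dots> \<le> integral {0..t} (\<lambda>s. norm (W x) * L ^ Suc k * s ^ Suc k / fact (Suc k))"
  proof (rule integral_norm_bound_integral)
    show "(\<lambda>s. W (picard W x (Suc k) s) - W (picard W x k s)) integrable_on {0..t}"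
      using i[of k] i[of "Suc k"] by (intro integrable_diff)
    show "(\<lambda>s. norm (W x) * L ^ Suc k * s ^ Suc k / fact (Suc k)) integrable_on {0..t}"
      using P by blast
    fix s assume s: "s \<in> {0..t}"
    have "norm (W (picard W x (Suc k) s) - W (picard W x k s))
        \<le> L * norm (picard W x (Suc k) s - picard W x k s)"
      using lipschitz_onD[OF lip, of "picard W x (Suc k) s" "picard W x k s"] by (simp add: dist_norm del: picard.simps)
    also have "\<dots> \<le> L * (norm (W x) * L ^ k * s ^ Suc k / fact (Suc k))"
      using Suc.IH[of s] s L by (intro mult_left_mono) auto
    finally show "norm (W (picard W x (Suc k) s) - W (picard W x k s))
        \<le> norm (W x) * L ^ Suc k * s ^ Suc k / fact (Suc k)"
      by (simp add: mult_ac)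
  qed
  also have "\<dots> = norm (W x) * L ^ Suc k * t ^ Suc (Suc k) / fact (Suc (Suc k))"
    using integral_unique[OF P] by (simp del: fact_Suc)
  finally show ?case .
qed

lemma trajectory_exists:
  fixes W :: "'a::euclidean_space \<Rightarrow> 'a"
  assumes lip: "L-lipschitz_on UNIV W"
  shows "\<exists>u. u 0 = x \<and> (\<forall>T. is_trajectory W T u)"
proof -
  have W: "continuous_on UNIV W" using lip by (rule lipschitz_on_continuous_on)
  have L: "0 \<le> L" using lip by (rule lipschitz_on_nonneg)
  define d where "d = (\<lambda>k t. picard W x (Suc k) t - picard W x k t)"
  have sumd: "(\<Sum>i<n. d i t) = picard W x n t - x" for n t
    unfolding d_def by (subst sum_lessThan_telescope) simp
  have uc: "uniformly_convergent_on {0..T} (\<lambda>n t. \<Sum>i<n. d i t)" for T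
  proof (cases "T \<ge> 0")
    case True
    show ?thesis
    proof (rule Weierstrass_m_test')
      show "summable (\<lambda>k. norm (W x) * T * ((L * T) ^ k / fact k))"
        using summable_exp[of "L * T"] by (intro summable_mult) (simp add: field_simps)
      fix k t assume t: "t \<in> {0..T}"
      have "norm (d k t) \<le> norm (W x) * L ^ k * t ^ Suc k / fact (Suc k)"
        unfolding d_def using picard_step_bound[OF lip, of t x k] t by auto
      also have "\<dots> \<le> norm (W x) * L ^ k * T ^ Suc k / fact k"
        using t L True by (intro frac_le mult_left_mono power_mono mult_nonneg_nonneg) (auto simp: fact_mono)
      finally show "norm (d k t) \<le> norm (W x) * T * ((L * T) ^ k / fact k)"
        by (simp add: power_mult_distrib mult_ac)
    qed
  qed simp
  \<comment> \<open>The limit is taken pointwise and does not mention \<open>T\<close>, so one curve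
    serves all intervals \<open>{0..T}\<close>.\<close>
  define u where "u = (\<lambda>t. x + lim (\<lambda>n. \<Sum>i<n. d i t))"
  have ul: "uniform_limit {0..T} (\<lambda>n. picard W x n) u sequentially" for T
  proof -
    have "uniform_limit {0..T} (\<lambda>n t. \<Sum>i<n. d i t) (\<lambda>t. lim (\<lambda>n. \<Sum>i<n. d i t)) sequentially"
      using uc[of T] by (simp add: uniformly_convergent_uniform_limit_iff)
    then have "uniform_limit {0..T} (\<lambda>n t. x + (\<Sum>i<n. d i t)) (\<lambda>t. x + lim (\<lambda>n. \<Sum>i<n. d i t)) sequentially"
      by (intro uniform_limit_intros)
    then show ?thesis unfolding u_def sumd by simp
  qed
  have cu: "continuous_on {0..T} u" for T
    by (rule uniform_limit_theorem[OF _ ul]) (auto intro!: always_eventually continuous_picard[OF W])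
  have cW: "continuous_on {0..T} (\<lambda>s. W (u s))" for T
    by (rule continuous_on_compose2[OF W cu]) auto
  have eq: "u t = x + integral {0..t} (\<lambda>s. W (u s))" if t: "0 \<le> t" for t
  proof -
    have ulW: "uniform_limit {0..t} (\<lambda>n s. W (picard W x n s)) (\<lambda>s. W (u s)) sequentially"
      using uniform_limit_compose_uniformly_continuous_on[OF ul[of t] lipschitz_on_uniformly_continuous[OF lip]] by auto
    have c: "continuous_on {0..t} (\<lambda>s. W (picard W x n s))" for n
      by (rule continuous_on_compose2[OF W continuous_picard[OF W]]) auto
    obtain I J where IJ: "\<And>n. ((\<lambda>s. W (picard W x n s)) has_integral I n) {0..t}"
      "((\<lambda>s. W (u s)) has_integral J) {0..t}" "(I \<longlongrightarrow> J) sequentially"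
      using uniform_limit_integral[OF ulW c] by auto
    have "(\<lambda>n. picard W x (Suc n) t) = (\<lambda>n. x + I n)"
      using IJ(1) by (auto simp: integral_unique)
    then have 1: "(\<lambda>n. picard W x (Suc n) t) \<longlonglongrightarrow> x + J"
      using IJ(3) by (auto intro!: tendsto_intros)
    have "(\<lambda>n. picard W x n t) \<longlonglongrightarrow> u t"
      using tendsto_uniform_limitI[OF ul[of t], of t] t by auto
    then have "(\<lambda>n. picard W x (Suc n) t) \<longlonglongrightarrow> u t" by (rule LIMSEQ_Suc)
    from LIMSEQ_unique[OF this 1] show ?thesis using IJ(2) by (simp add: integral_unique)
  qed
  have "u 0 = x" using eq[of 0] by simp
  moreover have "is_trajectory W T u" for T
    unfolding is_trajectory_def
  proof (intro conjI allI impI cu)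
    fix t assume t: "0 < t \<and> t < T"
    have "((\<lambda>t. integral {0..t} (\<lambda>s. W (u s))) has_vector_derivative W (u t)) (at t within {0..T})"
      using integral_has_vector_derivative[OF cW[of T], of t] t by auto
    then have "((\<lambda>t. x + integral {0..t} (\<lambda>s. W (u s))) has_vector_derivative 0 + W (u t)) (at t within {0..T})"
      by (intro derivative_intros)
    then have "(u has_vector_derivative W (u t)) (at t within {0..T})"
      using t eq by (intro has_vector_derivative_transform[where f = "\<lambda>t. x + integral {0..t} (\<lambda>s. W (u s))" and g = u]) auto
    moreover have "at t within {0..T} = at t"
      using t by (intro at_within_interior) auto
    ultimately show "(u has_vector_derivative W (u t)) (at t)" by simp
  qed
  ultimately show ?thesis by blast
qed

section \<open>Flow of a globally Lipschitz field (its values at negative times are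
  unspecified)\<close>

definition lflow :: "('a::euclidean_space \<Rightarrow> 'a) \<Rightarrow> real \<Rightarrow> 'a \<Rightarrow> 'a" where
  "lflow W t x = (SOME u. u 0 = x \<and> (\<forall>T. is_trajectory W T u)) t"

context
  fixes W :: "'a::euclidean_space \<Rightarrow> 'a" and L :: real
  assumes lip: "L-lipschitz_on UNIV W"
begin

lemma lflow_trajectory: "is_trajectory W T (\<lambda>t. lflow W t x)" and lflow_0 [simp]: "lflow W 0 x = x"
  using someI_ex[OF trajectory_exists[OF lip, of x]] unfolding lflow_def by auto

lemma lflow_eqI:
  assumes "is_trajectory W t u" "0 \<le> t"
  shows "u t = lflow W t (u 0)"
  by (rule trajectory_unique[OF lip assms(2,1) lflow_trajectory]) simp

lemma lflow_lipschitz: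
  assumes "0 \<le> t"
  shows "dist (lflow W t x) (lflow W t y) \<le> exp (L * t) * dist x y"
  using gronwall_trajectories[OF lip assms lflow_trajectory[of t x] lflow_trajectory[of t y]]
  by (simp add: dist_norm)

lemma continuous_lflow:
  assumes "0 \<le> t"
  shows "continuous_on S (lflow W t)"
proof -
  have "(exp (L * t))-lipschitz_on S (lflow W t)"
    by (rule lipschitz_onI) (use lflow_lipschitz[OF assms] in auto)
  then show ?thesis by (rule lipschitz_on_continuous_on)
qed

lemma lflow_add:
  assumes "0 \<le> s" "0 \<le> t"
  shows "lflow W (s + t) x = lflow W t (lflow W s x)"
  using lflow_eqI[OF is_trajectory_shift[OF lflow_trajectory[of "s + t" x], of s t] assms(2)] assms
  by simp

lemma lflow_has_vector_derivative:
  assumes "0 < t"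
  shows "((\<lambda>t. lflow W t x) has_vector_derivative W (lflow W t x)) (at t)"
  using lflow_trajectory[of "t + 1" x] assms unfolding is_trajectory_def by auto

lemma lflow_bound:
  assumes M: "\<And>x. norm (W x) \<le> M" and t: "0 \<le> t"
  shows "norm (lflow W t x - x) \<le> M * t"
proof (cases "t = 0")
  case False
  have "norm (lflow W t x - lflow W 0 x) \<le> M * t - M * 0"
  proof (rule differentiable_bound_general)
    show "0 < t" using False t by simp
    show "continuous_on {0..t} (\<lambda>t. lflow W t x)"
      using lflow_trajectory unfolding is_trajectory_def by blast
    fix s assume s: "0 < s" "s < t"
    show "((\<lambda>t. lflow W t x) has_vector_derivative W (lflow W s x)) (at s)"
      by (rule lflow_has_vector_derivative[OF s(1)])
    show "((\<lambda>s. M * s) has_vector_derivative M) (at s)"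
      unfolding has_real_derivative_iff_has_vector_derivative[symmetric]
      by (auto intro!: derivative_eq_intros)
    show "norm (W (lflow W s x)) \<le> M" by (rule M)
  qed (auto intro!: continuous_intros)
  then show ?thesis by simp
qed simp

text \<open>Consistency of one Euler step: the derivative of the difference is
  \<open>W (lflow W s x) - W x\<close>, which the Lipschitz condition and \<open>lflow_bound\<close>
  keep below \<open>L * M * t\<close>.\<close>

lemma lflow_euler:
  assumes M: "\<And>x. norm (W x) \<le> M" and t: "0 \<le> t"
  shows "norm (lflow W t x - x - t *\<^sub>R W x) \<le> L * M * t\<^sup>2"
proof (cases "t = 0")
  case False
  have L: "0 \<le> L" using lip by (rule lipschitz_on_nonneg)
  have M0: "0 \<le> M" using M[of 0] norm_ge_zero order_trans by blast
  have "norm ((lflow W t x - t *\<^sub>R W x) - (lflow W 0 x - 0 *\<^sub>R W x)) \<le> (L * M * t) * t - (L * M * t) * 0"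
  proof (rule differentiable_bound_general[where f = "\<lambda>t. lflow W t x - t *\<^sub>R W x"])
    show "0 < t" using False t by simp
    have "continuous_on {0..t} (\<lambda>t. lflow W t x)"
      using lflow_trajectory unfolding is_trajectory_def by blast
    then show "continuous_on {0..t} (\<lambda>t. lflow W t x - t *\<^sub>R W x)"
      by (intro continuous_intros)
    fix s assume s: "0 < s" "s < t"
    have "((\<lambda>t. t *\<^sub>R W x) has_vector_derivative W x) (at s)"
      by (auto intro!: derivative_eq_intros)
    then show "((\<lambda>t. lflow W t x - t *\<^sub>R W x) has_vector_derivative (W (lflow W s x) - W x)) (at s)"
      by (intro derivative_intros lflow_has_vector_derivative[OF s(1)])
    show "((\<lambda>s. L * M * t * s) has_vector_derivative L * M * t) (at s)"
      unfolding has_real_derivative_iff_has_vector_derivative[symmetric]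
      by (auto intro!: derivative_eq_intros)
    have "norm (W (lflow W s x) - W x) \<le> L * norm (lflow W s x - x)"
      using lipschitz_onD[OF lip, of "lflow W s x" x] by (simp add: dist_norm)
    also have "\<dots> \<le> L * (M * s)" using lflow_bound[OF M, of s x] s L by (intro mult_left_mono) auto
    also have "\<dots> \<le> L * (M * t)" using s L M0 by (intro mult_left_mono) auto
    finally show "norm (W (lflow W s x) - W x) \<le> L * M * t" by (simp add: mult_ac)
  qed (auto intro!: continuous_intros)
  then show ?thesis by (simp add: power2_eq_square algebra_simps)
qed simp

end

lemma lipschitz_on_uminus':
  fixes W :: "'a::euclidean_space \<Rightarrow> 'a"
  assumes "L-lipschitz_on S W"
  shows "L-lipschitz_on S (\<lambda>x. - W x)"
  using assms unfolding lipschitz_on_def by (simp add: dist_minus)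

lemma lflow_inverse:
  assumes lip: "L-lipschitz_on UNIV W" and t: "0 \<le> t"
  shows "lflow (\<lambda>x. - W x) t (lflow W t x) = x"
proof -
  have "is_trajectory (\<lambda>x. - W x) t (\<lambda>s. lflow W (t - s) x)"
    by (rule is_trajectory_reverse[OF lflow_trajectory[OF lip]])
  from lflow_eqI[OF lipschitz_on_uminus'[OF lip] this t]
  show ?thesis by (simp add: lflow_0[OF lip])
qed

lemma lflow_inverse':
  assumes lip: "L-lipschitz_on UNIV W" and t: "0 \<le> t"
  shows "lflow W t (lflow (\<lambda>x. - W x) t x) = x"
  using lflow_inverse[OF lipschitz_on_uminus'[OF lip] t] by simp

subsection \<open>Volume preservation\<close>

text \<open>Tonelli's theorem for the hyperplane measure of the definitions. It serves twice: for
  shears along a basis vector and for graphs over a hyperplane.\<close>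

lemma nn_integral_lborel_split:
  fixes f :: "'a::euclidean_space \<Rightarrow> ennreal"
  assumes p: "p \<in> Basis" and f [measurable]: "f \<in> borel_measurable borel"
  shows "(\<integral>\<^sup>+x. f x \<partial>lborel) = (\<integral>\<^sup>+y. (\<integral>\<^sup>+z. f (y + z *\<^sub>R p) \<partial>lborel) \<partial>hyperplane_lborel p)"
proof -
  interpret product_sigma_finite "\<lambda>_::'a. lborel :: real measure" ..
  have ins: "insert p (Basis - {p}) = Basis" using p by auto
  have "(\<integral>\<^sup>+x. f x \<partial>lborel) = (\<integral>\<^sup>+x. f (\<Sum>b\<in>Basis. x b *\<^sub>R b) \<partial>(\<Pi>\<^sub>M b\<in>Basis. lborel))"
    by (subst lborel_eq) (simp add: nn_integral_distr)
  also have "\<dots> = (\<integral>\<^sup>+x. (\<integral>\<^sup>+z. f (\<Sum>b\<in>Basis. (x(p := z)) b *\<^sub>R b) \<partial>lborel) \<partial>(\<Pi>\<^sub>M b\<in>Basis - {p}. lborel))"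
  proof -
    have "(\<lambda>x. f (\<Sum>b\<in>Basis. x b *\<^sub>R b)) \<in> borel_measurable (\<Pi>\<^sub>M b\<in>insert p (Basis - {p}). lborel)"
      unfolding ins by measurable
    from product_nn_integral_insert[OF _ _ this] show ?thesis
      unfolding ins by simp
  qed
  also have "\<dots> = (\<integral>\<^sup>+x. (\<integral>\<^sup>+z. f ((\<Sum>b\<in>Basis - {p}. x b *\<^sub>R b) + z *\<^sub>R p) \<partial>lborel) \<partial>(\<Pi>\<^sub>M b\<in>Basis - {p}. lborel))"
  proof -
    have "(\<Sum>b\<in>Basis. (x(p := z)) b *\<^sub>R b) = (\<Sum>b\<in>Basis - {p}. x b *\<^sub>R b) + z *\<^sub>R p" for x :: "'a \<Rightarrow> real" and z
      using p by (subst sum.remove[OF _ p]) (auto simp: add.commute intro!: sum.cong)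
    then show ?thesis by simp
  qed
  also have "\<dots> = (\<integral>\<^sup>+y. (\<integral>\<^sup>+z. f (y + z *\<^sub>R p) \<partial>lborel) \<partial>hyperplane_lborel p)"
    unfolding hyperplane_lborel_def by (subst nn_integral_distr) auto
  finally show ?thesis .
qed

text \<open>By uniqueness of Lebesgue measure it suffices to treat intervals, and for these it is
  the fundamental theorem of calculus; monotonicity turns preimages of intervals into
  intervals.\<close>

lemma nn_integral_substitution_real:
  fixes g g' :: "real \<Rightarrow> real"
  assumes der: "\<And>z. (g has_real_derivative g' z) (at z)" and cont: "continuous_on UNIV g'"
    and mono: "strict_mono g" and surj: "surj g" and f [measurable]: "f \<in> borel_measurable borel"
  shows "(\<integral>\<^sup>+z. f (g z) * ennreal (g' z) \<partial>lborel) = (\<integral>\<^sup>+z. f z \<partial>lborel)"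
proof -
  have [measurable]: "g' \<in> borel_measurable borel"
    using cont by (rule borel_measurable_continuous_onI)
  have "continuous_on UNIV g"
    using der by (meson DERIV_isCont continuous_at_imp_continuous_on)
  then have [measurable]: "g \<in> borel_measurable borel"
    by (rule borel_measurable_continuous_onI)
  have [measurable]: "g -` S \<in> sets borel" if "S \<in> sets borel" for S
    using that by (rule measurable_sets_borel[rotated]) measurable
  have nonneg: "0 \<le> g' z" for z
    by (rule mono_on_imp_deriv_nonneg[OF strict_mono_mono[OF mono] der]) simp
  have "lborel = distr (density lborel (\<lambda>z. ennreal (g' z))) borel g"
  proof (rule lborel_eqI)
    fix l u :: real assume "\<And>b. b \<in> Basis \<Longrightarrow> l \<bullet> b \<le> u \<bullet> b"
    then have lu: "l \<le> u" by auto
    obtain a where a: "g a = l" using surjD[OF surj, of l] by auto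
    obtain b where b: "g b = u" using surjD[OF surj, of u] by auto
    have "a \<le> b" using lu unfolding a[symmetric] b[symmetric] strict_mono_less_eq[OF mono] .
    have iff: "l < g z \<and> g z < u \<longleftrightarrow> a < z \<and> z < b" for z
      unfolding a[symmetric] b[symmetric] strict_mono_less[OF mono] ..
    have "emeasure (distr (density lborel (\<lambda>z. ennreal (g' z))) borel g) (box l u)
        = (\<integral>\<^sup>+z. ennreal (g' z) * indicator (g -` box l u) z \<partial>lborel)"
      by (simp add: emeasure_distr emeasure_density)
    also have "\<dots> = (\<integral>\<^sup>+z. ennreal (g' z) * indicator {a..b} z \<partial>lborel)"
    proof (rule nn_integral_cong_AE)
      have "AE z in lborel. z \<noteq> a \<and> z \<noteq> b"
        using AE_lborel_singleton[of a] AE_lborel_singleton[of b] by eventually_elim auto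
      then show "AE z in lborel. ennreal (g' z) * indicator (g -` box l u) z
          = ennreal (g' z) * indicator {a..b} z"
      proof eventually_elim
        case (elim z)
        then have "z \<in> g -` box l u \<longleftrightarrow> z \<in> {a..b}" using iff[of z] by auto
        then show ?case by (simp only: indicator_def)
      qed
    qed
    also have "\<dots> = g b - g a"
      using der nonneg \<open>a \<le> b\<close> by (intro nn_integral_FTC_Icc) (auto intro: has_field_derivative_at_within)
    finally show "emeasure (distr (density lborel (\<lambda>z. ennreal (g' z))) borel g) (box l u)
        = ennreal (\<Prod>b\<in>Basis. (u - l) \<bullet> b)" using a b by simp
  qed simp
  then have "(\<integral>\<^sup>+z. f z \<partial>lborel) = (\<integral>\<^sup>+z. f z \<partial>distr (density lborel (\<lambda>z. ennreal (g' z))) borel g)"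
    by (rule arg_cong[where f = "\<lambda>N. integral\<^sup>N N f"])
  also have "\<dots> = (\<integral>\<^sup>+z. f (g z) * ennreal (g' z) \<partial>lborel)"
    by (simp add: nn_integral_distr nn_integral_density mult.commute)
  finally show ?thesis ..
qed

text \<open>A solution is a fixed point of the contraction sending \<open>x\<close> to
  \<open>y - f x\<close>.\<close>

lemma lipschitz_perturbation_bij:
  fixes f :: "'a::euclidean_space \<Rightarrow> 'a"
  assumes lip: "K-lipschitz_on UNIV f" and K: "K < 1"
  shows "\<exists>!x. x + f x = y"
proof -
  have "\<exists>!x. y - f x = x"
  proof (rule banach_fix_type[OF _ K])
    show "0 \<le> K" using lip by (rule lipschitz_on_nonneg)
    show "\<forall>x z. dist (y - f x) (y - f z) \<le> K * dist x z"
      using lipschitz_onD[OF lip] by (auto simp: dist_norm norm_minus_commute)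
  qed
  then show ?thesis by (metis add_diff_cancel_right' diff_add_cancel)
qed

text \<open>On each line parallel to \<open>p\<close> the map is the identity plus a function of
  Lipschitz constant below 1, hence increasing and onto; Tonelli assembles the lines. The Jacobian
  is therefore the one-dimensional \<open>1 + k x\<close>.\<close>

lemma nn_integral_line_substitution:
  fixes a k :: "'a::euclidean_space \<Rightarrow> real"
  assumes p: "p \<in> Basis" and lip: "K-lipschitz_on UNIV a" and K: "K < 1"
    and der: "\<And>x. ((\<lambda>z. a (x + z *\<^sub>R p)) has_real_derivative k x) (at 0)"
    and cont: "continuous_on UNIV k" and f [measurable]: "f \<in> borel_measurable borel"
  shows "(\<integral>\<^sup>+x. f (x + a x *\<^sub>R p) * ennreal (1 + k x) \<partial>lborel) = (\<integral>\<^sup>+x. f x \<partial>lborel)"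
proof -
  have [measurable]: "k \<in> borel_measurable borel"
    using cont by (rule borel_measurable_continuous_onI)
  have [measurable]: "a \<in> borel_measurable borel"
    using lip by (intro borel_measurable_continuous_onI lipschitz_on_continuous_on)
  have n1: "norm p = 1" using p by simp
  have "(\<integral>\<^sup>+x. f (x + a x *\<^sub>R p) * ennreal (1 + k x) \<partial>lborel)
    = (\<integral>\<^sup>+y. (\<integral>\<^sup>+z. f (y + (z + a (y + z *\<^sub>R p)) *\<^sub>R p) * ennreal (1 + k (y + z *\<^sub>R p)) \<partial>lborel)
        \<partial>hyperplane_lborel p)"
    using nn_integral_lborel_split[OF p, of "\<lambda>x. f (x + a x *\<^sub>R p) * ennreal (1 + k x)"]
    by (simp add: scaleR_add_left add.assoc)
  also have "\<dots> = (\<integral>\<^sup>+y. (\<integral>\<^sup>+z. f (y + z *\<^sub>R p) \<partial>lborel) \<partial>hyperplane_lborel p)"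
  proof (rule nn_integral_cong)
    fix y :: 'a
    have l1: "K-lipschitz_on UNIV (\<lambda>z. a (y + z *\<^sub>R p))"
    proof (rule lipschitz_onI)
      show "0 \<le> K" using lip by (rule lipschitz_on_nonneg)
      fix z w :: real
      have "dist (y + z *\<^sub>R p) (y + w *\<^sub>R p) = dist z w"
        using n1 by (simp add: dist_norm scaleR_diff_left[symmetric])
      then show "dist (a (y + z *\<^sub>R p)) (a (y + w *\<^sub>R p)) \<le> K * dist z w"
        using lipschitz_onD[OF lip, of "y + z *\<^sub>R p" "y + w *\<^sub>R p"] by simp
    qed
    show "(\<integral>\<^sup>+z. f (y + (z + a (y + z *\<^sub>R p)) *\<^sub>R p) * ennreal (1 + k (y + z *\<^sub>R p)) \<partial>lborel)
      = (\<integral>\<^sup>+z. f (y + z *\<^sub>R p) \<partial>lborel)"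
    proof (rule nn_integral_substitution_real[where g = "\<lambda>z. z + a (y + z *\<^sub>R p)" and f = "\<lambda>z. f (y + z *\<^sub>R p)"])
      fix z
      have "((\<lambda>w. a (y + z *\<^sub>R p + w *\<^sub>R p)) has_real_derivative k (y + z *\<^sub>R p)) (at 0)"
        by (rule der)
      moreover have "y + z *\<^sub>R p + w *\<^sub>R p = y + (w + z) *\<^sub>R p" for w
        by (simp add: scaleR_add_left add.assoc add.commute)
      ultimately have "((\<lambda>w. a (y + (w + z) *\<^sub>R p)) has_real_derivative k (y + z *\<^sub>R p)) (at 0)"
        by (simp only:)
      then have "((\<lambda>w. a (y + w *\<^sub>R p)) has_real_derivative k (y + z *\<^sub>R p)) (at (0 + z))"
        by (subst DERIV_shift)
      then have "((\<lambda>w. a (y + w *\<^sub>R p)) has_real_derivative k (y + z *\<^sub>R p)) (at z)" by (simp only: add_0)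
      then show "((\<lambda>z. z + a (y + z *\<^sub>R p)) has_real_derivative 1 + k (y + z *\<^sub>R p)) (at z)"
        by (auto intro!: derivative_eq_intros)
    next
      show "continuous_on UNIV (\<lambda>z. 1 + k (y + z *\<^sub>R p))"
        by (intro continuous_intros continuous_on_compose2[OF cont]) auto
    next
      show "strict_mono (\<lambda>z. z + a (y + z *\<^sub>R p))"
      proof (rule strict_monoI)
        fix z w :: real assume zw: "z < w"
        have "\<bar>a (y + z *\<^sub>R p) - a (y + w *\<^sub>R p)\<bar> \<le> K * (w - z)"
          using lipschitz_onD[OF l1, of z w] zw by (simp add: dist_real_def)
        also have "\<dots> < w - z" using K zw by simp
        finally show "z + a (y + z *\<^sub>R p) < w + a (y + w *\<^sub>R p)" by linarith
      qed
    next
      show "surj (\<lambda>z. z + a (y + z *\<^sub>R p))"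
        unfolding surj_def
      proof
        fix w
        obtain z where "z + a (y + z *\<^sub>R p) = w"
          using ex1_implies_ex[OF lipschitz_perturbation_bij[OF l1 K, of w]] by (elim exE)
        then have "w = z + a (y + z *\<^sub>R p)" by (rule sym)
        then show "\<exists>z. w = z + a (y + z *\<^sub>R p)" by (rule exI)
      qed
    qed measurable
  qed
  also have "\<dots> = (\<integral>\<^sup>+x. f x \<partial>lborel)"
    by (rule nn_integral_lborel_split[OF p f, symmetric])
  finally show ?thesis .
qed

section \<open>Divergence-free fields in two coordinate directions and the symplectic Euler
  scheme\<close>

locale div_free_field =
  fixes W :: "'a::euclidean_space \<Rightarrow> 'a" and L M :: real and p q :: 'a and k :: "'a \<Rightarrow> real"
  assumes lip: "L-lipschitz_on UNIV W" and bound: "\<And>x. norm (W x) \<le> M"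
    and p: "p \<in> Basis" and q: "q \<in> Basis"
    and W_pq: "\<And>x. W x = (W x \<bullet> p) *\<^sub>R p + (W x \<bullet> q) *\<^sub>R q"
    and der_p: "\<And>x. ((\<lambda>z. W (x + z *\<^sub>R p) \<bullet> p) has_real_derivative k x) (at 0)"
    and der_q: "\<And>x. ((\<lambda>z. W (x + z *\<^sub>R q) \<bullet> q) has_real_derivative - k x) (at 0)"
    and cont_k: "continuous_on UNIV k"
begin

lemma L_nonneg: "0 \<le> L" using lip by (rule lipschitz_on_nonneg)

lemma M_nonneg: "0 \<le> M" by (rule order_trans[OF norm_ge_zero bound])

text \<open>The sign \<open>\<sigma>\<close> is \<open>-1\<close> for the shear along
  \<open>p\<close> and \<open>1\<close> for the shear along \<open>q\<close>.\<close>

lemma component_lipschitz: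
  assumes "b \<in> Basis" "0 \<le> \<epsilon>" "\<bar>\<sigma>\<bar> = 1"
  shows "(\<epsilon> * L)-lipschitz_on UNIV (\<lambda>x. \<sigma> * \<epsilon> * (W x \<bullet> b))"
proof (rule lipschitz_onI)
  show "0 \<le> \<epsilon> * L" using assms L_nonneg by simp
  fix x y
  have "\<bar>W x \<bullet> b - W y \<bullet> b\<bar> \<le> norm (W x - W y)"
    using Basis_le_norm[OF assms(1), of "W x - W y"] by (simp add: inner_diff_left)
  also have "\<dots> \<le> L * dist x y"
    using lipschitz_onD[OF lip, of x y] by (simp add: dist_norm)
  finally have "\<epsilon> * \<bar>W x \<bullet> b - W y \<bullet> b\<bar> \<le> \<epsilon> * (L * dist x y)"
    using assms by (intro mult_left_mono)
  moreover have "\<bar>\<sigma> * \<epsilon> * (W x \<bullet> b) - \<sigma> * \<epsilon> * (W y \<bullet> b)\<bar> = \<epsilon> * \<bar>W x \<bullet> b - W y \<bullet> b\<bar>"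
  proof -
    have "\<sigma> * \<epsilon> * (W x \<bullet> b) - \<sigma> * \<epsilon> * (W y \<bullet> b) = \<sigma> * (\<epsilon> * (W x \<bullet> b - W y \<bullet> b))"
      by (simp add: algebra_simps)
    then show ?thesis using assms(2,3) by (simp add: abs_mult)
  qed
  ultimately show "dist (\<sigma> * \<epsilon> * (W x \<bullet> b)) (\<sigma> * \<epsilon> * (W y \<bullet> b)) \<le> \<epsilon> * L * dist x y"
    by (simp only: dist_real_def mult.assoc)
qed

text \<open>
  One step of the symplectic Euler scheme, with the midpoint \<open>x\<close> given by \<open>y = x - \<epsilon> (W x \<bullet> p) p\<close>.
  Its two halves are shears along \<open>p\<close> and \<open>q\<close> with the same one-dimensional Jacobian \<open>1 - \<epsilon> k x\<close>
  at \<open>x\<close>, so that each step preserves volume exactly.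
\<close>

definition midpoint :: "real \<Rightarrow> 'a \<Rightarrow> 'a" where
  "midpoint \<epsilon> y = (THE x. x + (- 1 * \<epsilon> * (W x \<bullet> p)) *\<^sub>R p = y)"

definition euler_step :: "real \<Rightarrow> 'a \<Rightarrow> 'a" where
  "euler_step \<epsilon> y = y + \<epsilon> *\<^sub>R W (midpoint \<epsilon> y)"

context
  fixes \<epsilon> :: real
  assumes eps: "0 \<le> \<epsilon>" "\<epsilon> * L < 1"
begin

lemma midpoint_ex1: "\<exists>!x. x + (- 1 * \<epsilon> * (W x \<bullet> p)) *\<^sub>R p = y"
proof (rule lipschitz_perturbation_bij[OF _ eps(2)])
  show "(\<epsilon> * L)-lipschitz_on UNIV (\<lambda>x. (- 1 * \<epsilon> * (W x \<bullet> p)) *\<^sub>R p)"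
    using component_lipschitz[OF p eps(1), of "-1"] p
    unfolding lipschitz_on_def by (auto simp: dist_norm scaleR_diff_left[symmetric])
qed

lemma midpoint: "midpoint \<epsilon> y + (- 1 * \<epsilon> * (W (midpoint \<epsilon> y) \<bullet> p)) *\<^sub>R p = y"
  unfolding midpoint_def by (rule theI'[OF midpoint_ex1])

lemma midpoint_of: "midpoint \<epsilon> (x + (- 1 * \<epsilon> * (W x \<bullet> p)) *\<^sub>R p) = x"
  using midpoint midpoint_ex1 by blast

text \<open>Needed for the measurability of the step: the perturbation has Lipschitz constant
  \<open>\<epsilon> * L < 1\<close> and is absorbed on the left.\<close>

lemma midpoint_lipschitz: "(1 / (1 - \<epsilon> * L))-lipschitz_on UNIV (midpoint \<epsilon>)"
proof (rule lipschitz_onI)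
  show "0 \<le> 1 / (1 - \<epsilon> * L)" using eps by simp
  fix y z
  let ?x = "midpoint \<epsilon> y" and ?w = "midpoint \<epsilon> z"
  let ?a = "\<lambda>x. - 1 * \<epsilon> * (W x \<bullet> p)"
  have "?x - ?w = (y - z) - (?a ?x - ?a ?w) *\<^sub>R p"
    using midpoint[of y] midpoint[of z] by (simp add: algebra_simps)
  then have "norm (?x - ?w) \<le> norm (y - z) + \<bar>?a ?x - ?a ?w\<bar> * norm p"
    by (metis norm_scaleR norm_triangle_ineq4)
  also have "\<dots> \<le> norm (y - z) + \<epsilon> * L * norm (?x - ?w)"
    using lipschitz_onD[OF component_lipschitz[OF p eps(1), of "-1"], of ?x ?w] p
    by (simp add: dist_norm)
  finally show "dist ?x ?w \<le> 1 / (1 - \<epsilon> * L) * dist y z"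
    using eps by (simp add: dist_norm field_simps)
qed

lemma euler_step_measurable [measurable]: "euler_step \<epsilon> \<in> borel_measurable borel"
  unfolding euler_step_def
  by (intro borel_measurable_continuous_onI continuous_intros
      continuous_on_compose2[OF lipschitz_on_continuous_on[OF lip]]
      lipschitz_on_continuous_on[OF midpoint_lipschitz]) auto

lemma euler_step_preserves:
  assumes [measurable]: "f \<in> borel_measurable borel"
  shows "(\<integral>\<^sup>+x. f (euler_step \<epsilon> x) \<partial>lborel) = (\<integral>\<^sup>+x. f x \<partial>lborel)"
proof -
  have cont: "continuous_on UNIV (\<lambda>x. - \<epsilon> * k x)"
    by (intro continuous_intros cont_k)
  have 1: "((\<lambda>z. - 1 * \<epsilon> * (W (x + z *\<^sub>R p) \<bullet> p)) has_real_derivative - \<epsilon> * k x) (at 0)" for x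
    using der_p[of x] by (auto intro!: derivative_eq_intros)
  have 2: "((\<lambda>z. 1 * \<epsilon> * (W (x + z *\<^sub>R q) \<bullet> q)) has_real_derivative - \<epsilon> * k x) (at 0)" for x
    using der_q[of x] by (auto intro!: derivative_eq_intros)
  \<comment> \<open>In terms of the midpoint \<open>x\<close> the step sends the image of one shear
    to the image of the other. The substitution along \<open>p\<close> is then read backwards,
    producing the Jacobian factor, and the one along \<open>q\<close> removes it.\<close>
  have step: "euler_step \<epsilon> (x + (- 1 * \<epsilon> * (W x \<bullet> p)) *\<^sub>R p) = x + (1 * \<epsilon> * (W x \<bullet> q)) *\<^sub>R q" for x
  proof -
    have "euler_step \<epsilon> (x + (- 1 * \<epsilon> * (W x \<bullet> p)) *\<^sub>R p)
        = x + (- 1 * \<epsilon> * (W x \<bullet> p)) *\<^sub>R p + \<epsilon> *\<^sub>R ((W x \<bullet> p) *\<^sub>R p + (W x \<bullet> q) *\<^sub>R q)"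
      unfolding euler_step_def midpoint_of W_pq[symmetric] ..
    then show ?thesis by (simp add: algebra_simps)
  qed
  have "(\<integral>\<^sup>+x. f (euler_step \<epsilon> x) \<partial>lborel)
     = (\<integral>\<^sup>+x. f (euler_step \<epsilon> (x + (- 1 * \<epsilon> * (W x \<bullet> p)) *\<^sub>R p)) * ennreal (1 + - \<epsilon> * k x) \<partial>lborel)"
    by (rule nn_integral_line_substitution[OF p component_lipschitz[OF p eps(1)] eps(2) 1 cont, symmetric]) auto
  also have "\<dots> = (\<integral>\<^sup>+x. f (x + (1 * \<epsilon> * (W x \<bullet> q)) *\<^sub>R q) * ennreal (1 + - \<epsilon> * k x) \<partial>lborel)"
    unfolding step ..
  also have "\<dots> = (\<integral>\<^sup>+x. f x \<partial>lborel)"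
    by (rule nn_integral_line_substitution[OF q component_lipschitz[OF q eps(1)] eps(2) 2 cont]) auto
  finally show ?thesis .
qed

lemma euler_step_iter_measurable [measurable]: "euler_step \<epsilon> ^^ n \<in> borel_measurable borel"
proof (induction n)
  case (Suc n)
  have "euler_step \<epsilon> \<circ> (euler_step \<epsilon> ^^ n) \<in> borel_measurable borel"
    by (rule measurable_comp[OF Suc euler_step_measurable])
  then show ?case by simp
qed (simp add: id_def)

lemma euler_step_iter_preserves:
  assumes f: "f \<in> borel_measurable borel"
  shows "(\<integral>\<^sup>+x. f ((euler_step \<epsilon> ^^ n) x) \<partial>lborel) = (\<integral>\<^sup>+x. f x \<partial>lborel)"
  using f
proof (induction n arbitrary: f)
  case (Suc n)
  have "(\<lambda>x. f (euler_step \<epsilon> x)) \<in> borel_measurable borel"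
    using Suc.prems by measurable
  from Suc.IH[OF this] euler_step_preserves[OF Suc.prems] show ?case by simp
qed simp

text \<open>Two errors of size \<open>L * M * \<epsilon>\<^sup>2\<close> add up: the field is
  evaluated at the midpoint rather than at \<open>x\<close>, and an Euler step replaces the
  flow.\<close>

lemma euler_step_local_error: "norm (euler_step \<epsilon> x - lflow W \<epsilon> x) \<le> 2 * L * M * \<epsilon>\<^sup>2"
proof -
  let ?m = "midpoint \<epsilon> x"
  have "norm (?m - x) = \<epsilon> * \<bar>W ?m \<bullet> p\<bar>"
  proof -
    have "?m - x = (\<epsilon> * (W ?m \<bullet> p)) *\<^sub>R p" using midpoint[of x] by (simp add: algebra_simps)
    then show ?thesis using p eps by (simp add: abs_mult)
  qed
  also have "\<dots> \<le> \<epsilon> * M"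
    using eps p bound[of ?m] Basis_le_norm[OF p, of "W ?m"] by (intro mult_left_mono) auto
  finally have m: "norm (?m - x) \<le> \<epsilon> * M" .
  have "norm (W ?m - W x) \<le> L * norm (?m - x)"
    using lipschitz_onD[OF lip, of ?m x] by (simp add: dist_norm)
  also have "\<dots> \<le> L * (\<epsilon> * M)" using m L_nonneg by (intro mult_left_mono)
  finally have "norm (\<epsilon> *\<^sub>R (W ?m - W x)) \<le> \<epsilon> * (L * (\<epsilon> * M))"
    using eps by (simp add: mult_left_mono)
  moreover have "norm (lflow W \<epsilon> x - x - \<epsilon> *\<^sub>R W x) \<le> L * M * \<epsilon>\<^sup>2"
    by (rule lflow_euler[OF lip bound eps(1)])
  moreover have "euler_step \<epsilon> x - lflow W \<epsilon> x = \<epsilon> *\<^sub>R (W ?m - W x) - (lflow W \<epsilon> x - x - \<epsilon> *\<^sub>R W x)"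
    unfolding euler_step_def by (simp add: algebra_simps)
  ultimately show ?thesis
    using norm_triangle_ineq4[of "\<epsilon> *\<^sub>R (W ?m - W x)" "lflow W \<epsilon> x - x - \<epsilon> *\<^sub>R W x"]
    by (simp add: power2_eq_square algebra_simps)
qed

text \<open>The next exact step enlarges the error committed so far by a factor of at most
  \<open>exp (L * \<epsilon>)\<close>, and one local error is added.\<close>

lemma euler_step_error:
  "norm ((euler_step \<epsilon> ^^ n) x - lflow W (real n * \<epsilon>) x) \<le> 2 * L * M * \<epsilon>\<^sup>2 * real n * exp (L * (real n * \<epsilon>))"
proof (induction n)
  case 0 then show ?case by (simp add: lflow_0[OF lip])
next
  case (Suc n)
  let ?y = "(euler_step \<epsilon> ^^ n) x" and ?z = "lflow W (real n * \<epsilon>) x"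
  let ?C = "2 * L * M * \<epsilon>\<^sup>2"
  have C: "0 \<le> ?C" using L_nonneg M_nonneg by simp
  have split: "lflow W (real (Suc n) * \<epsilon>) x = lflow W \<epsilon> ?z"
    using lflow_add[OF lip, of "real n * \<epsilon>" \<epsilon> x] eps by (simp add: algebra_simps)
  have "norm (lflow W \<epsilon> ?y - lflow W \<epsilon> ?z) \<le> exp (L * \<epsilon>) * norm (?y - ?z)"
    using lflow_lipschitz[OF lip eps(1), of ?y ?z] by (simp add: dist_norm)
  also have "\<dots> \<le> exp (L * \<epsilon>) * (?C * real n * exp (L * (real n * \<epsilon>)))"
    using Suc by (intro mult_left_mono) auto
  also have "\<dots> = ?C * real n * exp (L * (real (Suc n) * \<epsilon>))"
    by (simp add: exp_add[symmetric] algebra_simps)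
  finally have 1: "norm (lflow W \<epsilon> ?y - lflow W \<epsilon> ?z) \<le> ?C * real n * exp (L * (real (Suc n) * \<epsilon>))" .
  have "1 \<le> exp (L * (real (Suc n) * \<epsilon>))"
    using L_nonneg eps by simp
  then have 2: "norm (euler_step \<epsilon> ?y - lflow W \<epsilon> ?y) \<le> ?C * exp (L * (real (Suc n) * \<epsilon>))"
    using euler_step_local_error[of ?y] mult_left_mono[OF _ C, of 1 "exp (L * (real (Suc n) * \<epsilon>))"] by simp
  have "norm (euler_step \<epsilon> ?y - lflow W \<epsilon> ?z)
     \<le> norm (euler_step \<epsilon> ?y - lflow W \<epsilon> ?y) + norm (lflow W \<epsilon> ?y - lflow W \<epsilon> ?z)"
    using dist_triangle[of "euler_step \<epsilon> ?y" "lflow W \<epsilon> ?z" "lflow W \<epsilon> ?y"] by (simp only: dist_norm)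
  also have "\<dots> \<le> ?C * exp (L * (real (Suc n) * \<epsilon>)) + ?C * real n * exp (L * (real (Suc n) * \<epsilon>))"
    using 1 2 by (rule add_mono[rotated])
  also have "\<dots> = ?C * real (Suc n) * exp (L * (real (Suc n) * \<epsilon>))"
    by (simp only: of_nat_Suc) (simp add: algebra_simps)
  finally show ?case unfolding split by simp
qed

end

lemma euler_scheme_converges:
  assumes t: "0 \<le> t"
  shows "(\<lambda>n. (euler_step (t / real (Suc n)) ^^ Suc n) x) \<longlonglongrightarrow> lflow W t x"
proof -
  \<comment> \<open>The condition \<open>\<epsilon> * L < 1\<close> that makes midpoints unique
    holds once the steps are short.\<close>
  have ev: "\<forall>\<^sub>F n in sequentially. t / real (Suc n) * L < 1"
  proof -
    have "(\<lambda>n. t * L * inverse (real (Suc n))) \<longlonglongrightarrow> t * L * 0"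
      by (intro tendsto_intros LIMSEQ_inverse_real_of_nat)
    then have "\<forall>\<^sub>F n in sequentially. t * L * inverse (real (Suc n)) < 1"
      by (rule order_tendstoD) simp
    then show ?thesis by eventually_elim (simp add: field_simps)
  qed
  have "(\<lambda>n. (euler_step (t / real (Suc n)) ^^ Suc n) x - lflow W t x) \<longlonglongrightarrow> 0"
  proof (rule Lim_null_comparison)
    show "\<forall>\<^sub>F n in sequentially. norm ((euler_step (t / real (Suc n)) ^^ Suc n) x - lflow W t x)
      \<le> 2 * L * M * t\<^sup>2 * exp (L * t) * inverse (real (Suc n))"
      using ev
    proof eventually_elim
      case (elim n)
      have "0 \<le> t / real (Suc n)" using t by simp
      from euler_step_error[OF this elim, of "Suc n" x]
      have "norm ((euler_step (t / real (Suc n)) ^^ Suc n) x - lflow W t x)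
         \<le> 2 * L * M * (t / real (Suc n))\<^sup>2 * real (Suc n) * exp (L * t)"
        by (simp del: funpow.simps of_nat_Suc)
      also have "\<dots> = 2 * L * M * t\<^sup>2 * exp (L * t) * inverse (real (Suc n))"
        by (simp del: of_nat_Suc add: power2_eq_square field_simps)
      finally show ?case .
    qed
    have "(\<lambda>n. 2 * L * M * t\<^sup>2 * exp (L * t) * inverse (real (Suc n))) \<longlonglongrightarrow> 2 * L * M * t\<^sup>2 * exp (L * t) * 0"
      by (intro tendsto_intros LIMSEQ_inverse_real_of_nat)
    then show "(\<lambda>n. 2 * L * M * t\<^sup>2 * exp (L * t) * inverse (real (Suc n))) \<longlonglongrightarrow> 0" by simp
  qed
  then show ?thesis by (simp add: LIM_zero_iff)
qed

lemma lflow_measurable [measurable]: "0 \<le> t \<Longrightarrow> lflow W t \<in> borel_measurable borel"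
  by (intro borel_measurable_continuous_onI continuous_lflow[OF lip])

text \<open>Pointwise convergence of the scheme gives, for an open set, lower semicontinuity of the
  indicator only, so Fatou's lemma yields one inequality. The reversed field supplies the
  other.\<close>

lemma emeasure_lflow_open_le:
  assumes t: "0 \<le> t" and S: "open S"
  shows "emeasure lborel (lflow W t -` S) \<le> emeasure lborel S"
proof -
  let ?e = "\<lambda>n. euler_step (t / real (Suc n)) ^^ Suc n"
  have [measurable]: "S \<in> sets borel" using S by simp
  have "\<forall>\<^sub>F n in sequentially. t / real (Suc n) * L < 1"
  proof -
    have "(\<lambda>n. t * L * inverse (real (Suc n))) \<longlonglongrightarrow> t * L * 0"
      by (intro tendsto_intros LIMSEQ_inverse_real_of_nat)
    then have "\<forall>\<^sub>F n in sequentially. t * L * inverse (real (Suc n)) < 1"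
      by (rule order_tendstoD) simp
    then show ?thesis by eventually_elim (simp add: field_simps)
  qed
  \<comment> \<open>The first \<open>N\<close> members are dropped because their steps may be too
    long to preserve volume.\<close>
  then obtain N where N: "\<And>n. n \<ge> N \<Longrightarrow> t / real (Suc n) * L < 1"
    by (auto simp: eventually_sequentially)
  have t': "0 \<le> t / real (Suc n)" for n using t by simp
  have "emeasure lborel (lflow W t -` S) = (\<integral>\<^sup>+x. indicator S (lflow W t x) \<partial>lborel)"
  proof -
    have "lflow W t -` S \<in> sets lborel"
      using measurable_sets_borel[OF lflow_measurable[OF t], of S] by simp
    moreover have "indicator (lflow W t -` S) = (\<lambda>x. indicator S (lflow W t x) :: ennreal)"
      by (auto simp: indicator_def)
    ultimately show ?thesis
      using nn_integral_indicator[of "lflow W t -` S" lborel] by simp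
  qed
  also have "\<dots> \<le> (\<integral>\<^sup>+x. liminf (\<lambda>n. indicator S (?e (n + N) x)) \<partial>lborel)"
  proof (rule nn_integral_mono)
    fix x
    show "(indicator S (lflow W t x) :: ennreal) \<le> liminf (\<lambda>n. indicator S (?e (n + N) x))"
    proof (cases "lflow W t x \<in> S")
      case True
      have "(\<lambda>n. ?e (n + N) x) \<longlonglongrightarrow> lflow W t x"
        using euler_scheme_converges[OF t] by (rule LIMSEQ_ignore_initial_segment)
      then have "\<forall>\<^sub>F n in sequentially. ?e (n + N) x \<in> S"
        using S True by (rule topological_tendstoD)
      then have "\<forall>\<^sub>F n in sequentially. (1::ennreal) \<le> indicator S (?e (n + N) x)"
        by eventually_elim simp
      then show ?thesis using True by (simp add: Liminf_bounded)
    qed simp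
  qed
  also have "\<dots> \<le> liminf (\<lambda>n. \<integral>\<^sup>+x. indicator S (?e (n + N) x) \<partial>lborel)"
  proof (rule nn_integral_liminf)
    fix i
    have "?e (i + N) \<in> borel_measurable borel"
      by (rule euler_step_iter_measurable[OF t' N]) simp
    moreover have "(indicator S :: 'a \<Rightarrow> ennreal) \<in> borel_measurable borel" by simp
    ultimately have "(\<lambda>x. indicator S (?e (i + N) x) :: ennreal) \<in> borel_measurable borel"
      by (rule measurable_compose)
    then show "(\<lambda>x. indicator S (?e (i + N) x) :: ennreal) \<in> borel_measurable lborel"
      by (simp del: funpow.simps)
  qed
  also have "\<dots> = liminf (\<lambda>n. emeasure lborel S)"
    by (subst euler_step_iter_preserves[OF t' N]) auto
  also have "\<dots> = emeasure lborel S" by (simp add: Liminf_const)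
  finally show ?thesis .
qed

end

lemma div_free_field_uminus:
  assumes "div_free_field W L M p q k"
  shows "div_free_field (\<lambda>x. - W x) L M p q (\<lambda>x. - k x)"
proof -
  interpret div_free_field W L M p q k by fact
  show ?thesis
  proof
    show "L-lipschitz_on UNIV (\<lambda>x. - W x)" by (rule lipschitz_on_uminus'[OF lip])
    show "- W x = (- W x \<bullet> p) *\<^sub>R p + (- W x \<bullet> q) *\<^sub>R q" for x
      by (subst W_pq) (simp add: algebra_simps inner_Basis p q)
    show "((\<lambda>z. - W (x + z *\<^sub>R p) \<bullet> p) has_real_derivative - k x) (at 0)" for x
      using DERIV_minus[OF der_p[of x]] by simp
    show "((\<lambda>z. - W (x + z *\<^sub>R q) \<bullet> q) has_real_derivative - (- k x)) (at 0)" for x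
      using DERIV_minus[OF der_q[of x]] by simp
    show "continuous_on UNIV (\<lambda>x. - k x)" by (intro continuous_intros cont_k)
  qed (use bound p q in auto)
qed

text \<open>The inequality for the negated field is applied to the open preimage of
  \<open>S\<close>, whose own preimage under the inverse flow is \<open>S\<close>.\<close>

lemma (in div_free_field) emeasure_lflow_open:
  assumes t: "0 \<le> t" and S: "open S"
  shows "emeasure lborel (lflow W t -` S) = emeasure lborel S"
proof (rule antisym)
  show "emeasure lborel (lflow W t -` S) \<le> emeasure lborel S"
    by (rule emeasure_lflow_open_le[OF t S])
  interpret neg: div_free_field "\<lambda>x. - W x" L M p q "\<lambda>x. - k x"
    by (rule div_free_field_uminus) unfold_locales
  have "open (lflow W t -` S)"
    using continuous_lflow[OF lip t, of UNIV] S by (simp add: open_vimage)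
  from neg.emeasure_lflow_open_le[OF t this]
  have "emeasure lborel (lflow (\<lambda>x. - W x) t -` lflow W t -` S) \<le> emeasure lborel (lflow W t -` S)" .
  moreover have "lflow (\<lambda>x. - W x) t -` lflow W t -` S = S"
    using lflow_inverse'[OF lip t] by auto
  ultimately show "emeasure lborel S \<le> emeasure lborel (lflow W t -` S)" by simp
qed

lemma (in div_free_field) distr_lflow:
  assumes t: "0 \<le> t"
  shows "distr lborel borel (lflow W t) = lborel"
proof (rule lborel_eqI[symmetric])
  fix l u :: 'a assume "\<And>b. b \<in> Basis \<Longrightarrow> l \<bullet> b \<le> u \<bullet> b"
  then show "emeasure (distr lborel borel (lflow W t)) (box l u) = (\<Prod>b\<in>Basis. (u - l) \<bullet> b)"
    using lflow_measurable[OF t] emeasure_lflow_open[OF t open_box, of l u]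
    by (simp add: emeasure_distr emeasure_lborel_box)
qed simp

subsection \<open>Flows confined by a conserved quantity\<close>

text \<open>The cut-off field has to be continuously differentiable, and this is its building block:
  value and slope both vanish at 0.\<close>

definition sqpos :: "real \<Rightarrow> real" where "sqpos v = (max 0 v)\<^sup>2"

lemma sqpos_deriv: "(sqpos has_real_derivative 2 * max 0 v) (at v)"
proof -
  consider "v < 0" | "v > 0" | "v = 0" by linarith
  then show ?thesis
  proof cases
    case 1
    have "((\<lambda>_. 0) has_real_derivative 2 * max 0 v) (at v)" using 1 by auto
    then show ?thesis
      by (rule has_field_derivative_transform_within_open[of _ _ _ "{..<0}"]) (use 1 in \<open>auto simp: sqpos_def\<close>)
  next
    case 2
    have "((\<lambda>v. v\<^sup>2) has_real_derivative 2 * max 0 v) (at v)"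
      using 2 by (auto intro!: derivative_eq_intros)
    then show ?thesis
      by (rule has_field_derivative_transform_within_open[of _ _ _ "{0<..}"]) (use 2 in \<open>auto simp: sqpos_def\<close>)
  next
    case 3
    have "((\<lambda>h. (sqpos (0 + h) - sqpos 0) / h) \<longlongrightarrow> 0) (at 0)"
    proof (rule Lim_null_comparison)
      show "\<forall>\<^sub>F h in at 0. norm ((sqpos (0 + h) - sqpos 0) / h) \<le> \<bar>h\<bar>"
        by (rule always_eventually) (auto simp: sqpos_def max_def power2_eq_square abs_mult)
      show "((\<lambda>h::real. \<bar>h\<bar>) \<longlongrightarrow> 0) (at 0)"
        by (intro tendsto_rabs_zero tendsto_ident_at)
    qed
    then show ?thesis using 3 by (simp add: DERIV_def)
  qed
qed

text \<open>A \<open>C\<^sup>1\<close> transition from \<open>0\<close> on \<open>{..0}\<close> to \<open>1\<close> on \<open>{1..}\<close>.\<close>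

definition cutoff :: "real \<Rightarrow> real" where "cutoff u = 1 - sqpos (1 - sqpos u)"

definition cutoff' :: "real \<Rightarrow> real" where "cutoff' u = 4 * max 0 (1 - sqpos u) * max 0 u"

lemma cutoff_deriv: "(cutoff has_real_derivative cutoff' u) (at u)"
proof -
  have "((\<lambda>u. 1 - sqpos u) has_real_derivative - (2 * max 0 u)) (at u)"
    by (auto intro!: derivative_eq_intros sqpos_deriv)
  then have "((\<lambda>u. sqpos (1 - sqpos u)) has_real_derivative 2 * max 0 (1 - sqpos u) * - (2 * max 0 u)) (at u)"
    by (rule DERIV_chain'[OF _ sqpos_deriv])
  then have "(cutoff has_real_derivative - (2 * max 0 (1 - sqpos u) * - (2 * max 0 u))) (at u)"
    unfolding cutoff_def[abs_def] by (auto intro!: derivative_eq_intros)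
  then show ?thesis by (simp add: cutoff'_def mult_ac)
qed

lemma cutoff_eq_0: "u \<le> 0 \<Longrightarrow> cutoff u = 0" and cutoff'_eq_0: "u \<le> 0 \<Longrightarrow> cutoff' u = 0"
  by (auto simp: cutoff_def cutoff'_def sqpos_def)

lemma cutoff_eq_1: "1 \<le> u \<Longrightarrow> cutoff u = 1"
proof -
  assume "1 \<le> u"
  then have "1 \<le> sqpos u" by (auto simp: sqpos_def max_def one_le_power)
  then show ?thesis by (simp add: cutoff_def sqpos_def)
qed

lemma continuous_cutoff: "continuous_on S cutoff"
  by (meson cutoff_deriv DERIV_isCont continuous_at_imp_continuous_on)

lemma continuous_cutoff': "continuous_on S cutoff'"
  unfolding cutoff'_def[abs_def] sqpos_def by (intro continuous_intros)

text \<open>The derivative is periodic as well, so its bound on the compact set \<open>K\<close>,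
  which meets every orbit of \<open>\<Lambda>\<close>, holds everywhere; the mean value inequality
  turns it into a Lipschitz constant.\<close>

lemma periodic_C1_lipschitz:
  fixes W :: "'a::euclidean_space \<Rightarrow> 'b::euclidean_space"
  assumes der: "\<And>x. (W has_derivative DW x) (at x)"
    and cont: "\<And>b. b \<in> Basis \<Longrightarrow> continuous_on UNIV (\<lambda>x. DW x b)"
    and per: "\<And>x k. k \<in> \<Lambda> \<Longrightarrow> W (x + k) = W x"
    and K: "compact K" "\<And>x. \<exists>k\<in>\<Lambda>. x + k \<in> K"
  obtains L M where "L-lipschitz_on UNIV W" "\<And>x. norm (W x) \<le> M"
proof -
  have DW_per: "DW (x + k) = DW x" if k: "k \<in> \<Lambda>" for x k
  proof -
    have "((\<lambda>y. y + k) has_derivative (\<lambda>h. h)) (at x)"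
      by (auto intro!: derivative_eq_intros)
    from has_derivative_compose[OF this der]
    have "((\<lambda>y. W (y + k)) has_derivative DW (x + k)) (at x)" by simp
    then have "(W has_derivative DW (x + k)) (at x)" by (simp add: per[OF k])
    then show ?thesis by (rule has_derivative_unique[OF _ der])
  qed
  define B where "B = (\<lambda>x. \<Sum>b\<in>Basis. norm (DW x b))"
  have "continuous_on K B"
    unfolding B_def by (intro continuous_intros continuous_on_subset[OF cont]) auto
  then have "bounded (B ` K)"
    using K(1) by (intro compact_imp_bounded compact_continuous_image)
  then obtain C where C: "\<And>x. x \<in> K \<Longrightarrow> \<bar>B x\<bar> \<le> C"
    unfolding bounded_iff by auto
  have B: "B x \<le> C" for x
  proof -
    obtain k where k: "k \<in> \<Lambda>" "x + k \<in> K" using K(2) by blast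
    then have "B x = B (x + k)" by (simp only: B_def DW_per[OF k(1)])
    then show ?thesis using C[OF k(2)] by simp
  qed
  have contW: "continuous_on S W" for S
    using der by (meson has_derivative_continuous continuous_at_imp_continuous_on)
  then have "bounded (W ` K)"
    using K(1) by (intro compact_imp_bounded compact_continuous_image)
  then obtain M where M: "\<And>x. x \<in> K \<Longrightarrow> norm (W x) \<le> M"
    unfolding bounded_iff by auto
  have "norm (W x) \<le> M" for x
  proof -
    obtain k where k: "k \<in> \<Lambda>" "x + k \<in> K" using K(2) by blast
    then show ?thesis using M[OF k(2)] by (simp add: per[OF k(1)])
  qed
  moreover have "C-lipschitz_on UNIV W"
  proof (rule lipschitz_onI)
    show "0 \<le> C" using B[of 0] unfolding B_def by (meson norm_ge_zero order_trans sum_nonneg)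
    fix x y
    have "norm (W x - W y) \<le> C * norm (x - y)"
    proof (rule differentiable_bound[of UNIV W DW])
      fix z
      show "(W has_derivative DW z) (at z within UNIV)" using der by simp
      have "onorm (DW z) \<le> B z"
        unfolding B_def by (rule onorm_componentwise) (rule has_derivative_bounded_linear[OF der])
      then show "onorm (DW z) \<le> C" using B[of z] by linarith
    qed auto
    then show "dist (W x) (W y) \<le> C * dist x y" by (simp add: dist_norm)
  qed
  ultimately show ?thesis using that by blast
qed

lemma constant_along_trajectory:
  fixes f :: "'a::euclidean_space \<Rightarrow> real"
  assumes u: "is_trajectory W T u" and T: "0 \<le> T"
    and S: "\<And>t. 0 \<le> t \<Longrightarrow> t \<le> T \<Longrightarrow> u t \<in> S"
    and der: "\<And>x. x \<in> S \<Longrightarrow> (f has_derivative Df x) (at x)"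
    and zero: "\<And>x. x \<in> S \<Longrightarrow> Df x (W x) = 0"
  shows "f (u T) = f (u 0)"
proof (cases "T = 0")
  case False
  have cu: "continuous_on {0..T} u" using u unfolding is_trajectory_def by blast
  have "continuous_on S f"
    using der by (meson has_derivative_continuous continuous_at_imp_continuous_on)
  from continuous_on_compose2[OF this cu]
  have c: "continuous_on {0..T} (\<lambda>t. f (u t))" using S by (auto simp: image_subset_iff)
  have "((\<lambda>t. f (u t)) has_real_derivative 0) (at t)" if t: "0 < t" "t < T" for t
  proof -
    have Su: "u t \<in> S" using S[of t] t by simp
    have "(u has_derivative (\<lambda>h. h *\<^sub>R W (u t))) (at t)"
      using u t unfolding is_trajectory_def has_vector_derivative_def by auto
    from has_derivative_compose[OF this der[OF Su]]
    have "((\<lambda>t. f (u t)) has_derivative (\<lambda>h. Df (u t) (h *\<^sub>R W (u t)))) (at t)" .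
    moreover have "Df (u t) (h *\<^sub>R W (u t)) = 0" for h
      using has_derivative_bounded_linear[OF der[OF Su]] zero[OF Su]
      by (simp add: linear_simps)
    ultimately show ?thesis by (simp add: has_field_derivative_def lambda_zero[symmetric])
  qed
  then show ?thesis
    using DERIV_isconst2[of 0 T "\<lambda>t. f (u t)" T] c False T by auto
qed simp

lemma scaleR_span_pair:
  fixes v p q :: "'a::real_inner"
  assumes "v = (v \<bullet> p) *\<^sub>R p + (v \<bullet> q) *\<^sub>R q"
  shows "a *\<^sub>R v = ((a *\<^sub>R v) \<bullet> p) *\<^sub>R p + ((a *\<^sub>R v) \<bullet> q) *\<^sub>R q"
proof -
  have "a *\<^sub>R v = a *\<^sub>R ((v \<bullet> p) *\<^sub>R p + (v \<bullet> q) *\<^sub>R q)"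
    by (rule arg_cong[OF assms])
  also have "\<dots> = ((a *\<^sub>R v) \<bullet> p) *\<^sub>R p + ((a *\<^sub>R v) \<bullet> q) *\<^sub>R q"
    by (simp add: scaleR_add_right)
  finally show ?thesis .
qed

text \<open>\<open>proper\<close> asks that the sublevel sets of \<open>B\<close> be closed in the
  whole space, not merely in \<open>\<Omega>\<close>: a trajectory, on which \<open>B\<close> is
  constant, then cannot approach the boundary of \<open>\<Omega>\<close>. \<open>cocompact\<close>
  plays on the cover the part of compactness of the torus.\<close>

locale conserved_flow =
  fixes \<Omega> :: "'a::euclidean_space set" and V :: "'a \<Rightarrow> 'a" and DV :: "'a \<Rightarrow> 'a \<Rightarrow> 'a"
    and B :: "'a \<Rightarrow> real" and DB :: "'a \<Rightarrow> 'a \<Rightarrow> real" and p q :: 'a and \<Lambda> :: "'a set"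
  assumes open_\<Omega>: "open \<Omega>"
    and V_der: "\<And>x. x \<in> \<Omega> \<Longrightarrow> (V has_derivative DV x) (at x)"
    and DV_cont: "\<And>b. b \<in> Basis \<Longrightarrow> continuous_on \<Omega> (\<lambda>x. DV x b)"
    and B_der: "\<And>x. x \<in> \<Omega> \<Longrightarrow> (B has_derivative DB x) (at x)"
    and DB_cont: "\<And>b. b \<in> Basis \<Longrightarrow> continuous_on \<Omega> (\<lambda>x. DB x b)"
    and p: "p \<in> Basis" and q: "q \<in> Basis"
    and V_pq: "\<And>x. x \<in> \<Omega> \<Longrightarrow> V x = (V x \<bullet> p) *\<^sub>R p + (V x \<bullet> q) *\<^sub>R q"
    and div_free: "\<And>x. x \<in> \<Omega> \<Longrightarrow> DV x p \<bullet> p + DV x q \<bullet> q = 0"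
    and conserved: "\<And>x. x \<in> \<Omega> \<Longrightarrow> DB x (V x) = 0"
    and proper: "\<And>c. closed {x \<in> \<Omega>. B x \<le> c}"
    and period_\<Omega>: "\<And>x k. k \<in> \<Lambda> \<Longrightarrow> x + k \<in> \<Omega> \<longleftrightarrow> x \<in> \<Omega>"
    and period_V: "\<And>x k. k \<in> \<Lambda> \<Longrightarrow> V (x + k) = V x"
    and period_B: "\<And>x k. k \<in> \<Lambda> \<Longrightarrow> B (x + k) = B x"
    and cocompact: "\<exists>K. compact K \<and> (\<forall>x. \<exists>k\<in>\<Lambda>. x + k \<in> K)"
begin

text \<open>Equal to \<open>V\<close> where \<open>B x \<le> c\<close> and to 0 where
  \<open>B x \<ge> c + 1\<close>, so that the extension by zero beyond \<open>\<Omega>\<close>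
  creates no singularity.\<close>

definition cutoff_field :: "real \<Rightarrow> 'a \<Rightarrow> 'a" where
  "cutoff_field c x = (if x \<in> \<Omega> then cutoff (c + 1 - B x) *\<^sub>R V x else 0)"

definition cutoff_deriv_field :: "real \<Rightarrow> 'a \<Rightarrow> 'a \<Rightarrow> 'a" where
  "cutoff_deriv_field c x h = (if x \<in> \<Omega>
     then cutoff (c + 1 - B x) *\<^sub>R DV x h + (cutoff' (c + 1 - B x) * - DB x h) *\<^sub>R V x else 0)"

text \<open>This open set and \<open>\<Omega>\<close> cover the space. The extended field vanishes
  on it, so regularity near points outside \<open>\<Omega>\<close> is immediate.\<close>

lemma open_far: "open (- {x \<in> \<Omega>. B x \<le> c + 1})"
  using proper by (simp add: open_Compl)

lemma cutoff_field_far: "x \<in> - {x \<in> \<Omega>. B x \<le> c + 1} \<Longrightarrow> cutoff_field c x = 0"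
  and cutoff_deriv_field_far: "x \<in> - {x \<in> \<Omega>. B x \<le> c + 1} \<Longrightarrow> cutoff_deriv_field c x h = 0"
  by (auto simp: cutoff_field_def cutoff_deriv_field_def cutoff_eq_0 cutoff'_eq_0)

lemma cutoff_field_der: "(cutoff_field c has_derivative cutoff_deriv_field c x) (at x)"
proof (cases "x \<in> \<Omega>")
  case True
  have "((\<lambda>x. c + 1 - B x) has_derivative (\<lambda>h. - DB x h)) (at x)"
    using B_der[OF True] by (auto intro!: derivative_eq_intros)
  from has_derivative_compose[OF this cutoff_deriv[unfolded has_field_derivative_def]]
  have "((\<lambda>x. cutoff (c + 1 - B x)) has_derivative (\<lambda>h. cutoff' (c + 1 - B x) * - DB x h)) (at x)" .
  from has_derivative_scaleR[OF this V_der[OF True]]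
  have "((\<lambda>x. cutoff (c + 1 - B x) *\<^sub>R V x) has_derivative cutoff_deriv_field c x) (at x)"
    using True by (simp add: cutoff_deriv_field_def[abs_def])
  then show ?thesis
    by (rule has_derivative_transform_within_open[OF _ open_\<Omega> True]) (simp add: cutoff_field_def)
next
  case False
  then have x: "x \<in> - {x \<in> \<Omega>. B x \<le> c + 1}" by simp
  have "((\<lambda>_. 0) has_derivative cutoff_deriv_field c x) (at x)"
    using False by (simp add: cutoff_deriv_field_def[abs_def])
  then show ?thesis
    by (rule has_derivative_transform_within_open[OF _ open_far x]) (simp only: cutoff_field_far)
qed

lemma cutoff_deriv_field_cont:
  assumes b: "b \<in> Basis"
  shows "continuous_on UNIV (\<lambda>x. cutoff_deriv_field c x b)"
proof -
  have V: "continuous_on \<Omega> V"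
    using V_der by (meson has_derivative_continuous continuous_at_imp_continuous_on)
  have B: "continuous_on \<Omega> B"
    using B_der by (meson has_derivative_continuous continuous_at_imp_continuous_on)
  have "continuous_on \<Omega> (\<lambda>x. cutoff (c + 1 - B x) *\<^sub>R DV x b + (cutoff' (c + 1 - B x) * - DB x b) *\<^sub>R V x)"
    by (intro continuous_intros V B DV_cont DB_cont b
        continuous_on_compose2[OF continuous_cutoff[of UNIV]] continuous_on_compose2[OF continuous_cutoff'[of UNIV]]) auto
  then have 1: "continuous_on \<Omega> (\<lambda>x. cutoff_deriv_field c x b)"
    by (rule continuous_on_eq) (simp add: cutoff_deriv_field_def)
  have "continuous_on (- {x \<in> \<Omega>. B x \<le> c + 1}) (\<lambda>_. 0 :: 'a)" by simp
  then have 2: "continuous_on (- {x \<in> \<Omega>. B x \<le> c + 1}) (\<lambda>x. cutoff_deriv_field c x b)"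
    by (rule continuous_on_eq) (simp only: cutoff_deriv_field_far)
  have "continuous_on (\<Omega> \<union> - {x \<in> \<Omega>. B x \<le> c + 1}) (\<lambda>x. cutoff_deriv_field c x b)"
    by (rule continuous_on_open_Un[OF open_\<Omega> open_far 1 2])
  moreover have "\<Omega> \<union> - {x \<in> \<Omega>. B x \<le> c + 1} = UNIV" by auto
  ultimately show ?thesis by simp
qed

lemma cutoff_field_period: "k \<in> \<Lambda> \<Longrightarrow> cutoff_field c (x + k) = cutoff_field c x"
  by (simp add: cutoff_field_def period_\<Omega> period_V period_B)

lemma cutoff_field_div_free:
  "\<exists>L M. div_free_field (cutoff_field c) L M p q (\<lambda>x. cutoff_deriv_field c x p \<bullet> p)"
proof -
  obtain K where K: "compact K" "\<And>x. \<exists>k\<in>\<Lambda>. x + k \<in> K" using cocompact by auto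
  obtain L M where LM: "L-lipschitz_on UNIV (cutoff_field c)" "\<And>x. norm (cutoff_field c x) \<le> M"
    using periodic_C1_lipschitz[OF cutoff_field_der cutoff_deriv_field_cont cutoff_field_period K, of c] by auto
  have der: "((\<lambda>z. cutoff_field c (x + z *\<^sub>R b) \<bullet> b) has_real_derivative cutoff_deriv_field c x b \<bullet> b) (at 0)" for x b
  proof -
    have "((\<lambda>z. x + z *\<^sub>R b) has_derivative (\<lambda>h. h *\<^sub>R b)) (at 0)"
      by (auto intro!: derivative_eq_intros)
    from has_derivative_compose[OF this, of "cutoff_field c" "cutoff_deriv_field c x"]
    have "((\<lambda>z. cutoff_field c (x + z *\<^sub>R b)) has_derivative (\<lambda>h. cutoff_deriv_field c x (h *\<^sub>R b))) (at 0)"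
      using cutoff_field_der[of c x] by simp
    from has_derivative_inner_left[OF this, of b]
    have "((\<lambda>z. cutoff_field c (x + z *\<^sub>R b) \<bullet> b) has_derivative (\<lambda>h. cutoff_deriv_field c x (h *\<^sub>R b) \<bullet> b)) (at 0)" .
    moreover have "cutoff_deriv_field c x (h *\<^sub>R b) = h *\<^sub>R cutoff_deriv_field c x b" for h
      using has_derivative_bounded_linear[OF cutoff_field_der[of c x]]
      by (simp add: linear_simps)
    ultimately show ?thesis by (simp add: has_field_derivative_def mult_commute_abs)
  qed
  \<comment> \<open>Differentiating the cut-off factor adds a multiple of \<open>DB x (V x)\<close>,
    which is zero by conservation of \<open>B\<close>; the rest is a multiple of the divergence of
    \<open>V\<close>.\<close>
  have trace: "cutoff_deriv_field c x q \<bullet> q = - (cutoff_deriv_field c x p \<bullet> p)" for x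
  proof (cases "x \<in> \<Omega>")
    case True
    have "DB x (V x) = (V x \<bullet> p) * DB x p + (V x \<bullet> q) * DB x q"
      using has_derivative_bounded_linear[OF B_der[OF True]]
      by (subst V_pq[OF True]) (simp add: linear_simps)
    then have "DB x p * (V x \<bullet> p) + DB x q * (V x \<bullet> q) = 0"
      using conserved[OF True] by (simp add: mult.commute)
    then have c: "cutoff' (c + 1 - B x) * (DB x p * (V x \<bullet> p)) + cutoff' (c + 1 - B x) * (DB x q * (V x \<bullet> q)) = 0"
      by (simp add: distrib_left[symmetric])
    have d: "cutoff (c + 1 - B x) * (DV x p \<bullet> p) + cutoff (c + 1 - B x) * (DV x q \<bullet> q) = 0"
      using div_free[OF True] by (simp add: distrib_left[symmetric])
    show ?thesis
      using True c d by (simp add: cutoff_deriv_field_def inner_add_left inner_diff_left mult.assoc)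
  qed (simp add: cutoff_deriv_field_def)
  have "div_free_field (cutoff_field c) L M p q (\<lambda>x. cutoff_deriv_field c x p \<bullet> p)"
  proof
    show "cutoff_field c x = (cutoff_field c x \<bullet> p) *\<^sub>R p + (cutoff_field c x \<bullet> q) *\<^sub>R q" for x
    proof (cases "x \<in> \<Omega>")
      case True
      show ?thesis
        using scaleR_span_pair[OF V_pq[OF True], of "cutoff (c + 1 - B x)"] True
        by (simp only: cutoff_field_def if_True)
    qed (simp add: cutoff_field_def)
    show "((\<lambda>z. cutoff_field c (x + z *\<^sub>R q) \<bullet> q) has_real_derivative - (cutoff_deriv_field c x p \<bullet> p)) (at 0)" for x
      using der[of x q] unfolding trace .
    show "continuous_on UNIV (\<lambda>x. cutoff_deriv_field c x p \<bullet> p)"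
      by (intro continuous_intros cutoff_deriv_field_cont p)
  qed (use LM p q der in auto)
  then show ?thesis by blast
qed

lemma cutoff_field_lipschitz: obtains L where "L-lipschitz_on UNIV (cutoff_field c)"
  using cutoff_field_div_free[of c] unfolding div_free_field_def by blast

lemma lflow_cutoff_outside:
  assumes "x \<notin> \<Omega>" "0 \<le> t"
  shows "lflow (cutoff_field c) t x = x" "lflow (\<lambda>x. - cutoff_field c x) t x = x"
proof -
  obtain L where lip: "L-lipschitz_on UNIV (cutoff_field c)" by (rule cutoff_field_lipschitz)
  have "is_trajectory (cutoff_field c) t (\<lambda>_. x)" "is_trajectory (\<lambda>x. - cutoff_field c x) t (\<lambda>_. x)"
    using assms by (auto simp: is_trajectory_def cutoff_field_def)
  then show "lflow (cutoff_field c) t x = x" "lflow (\<lambda>x. - cutoff_field c x) t x = x"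
    using lflow_eqI[OF lip, of t "\<lambda>_. x"] lflow_eqI[OF lipschitz_on_uminus'[OF lip], of t "\<lambda>_. x"] assms by auto
qed

text \<open>Points outside \<open>\<Omega>\<close> are stationary for the negated field too, so an
  orbit that had left \<open>\<Omega>\<close> could not return to its starting point backwards in
  time.\<close>

lemma lflow_cutoff_inside:
  assumes x: "x \<in> \<Omega>" and t: "0 \<le> t"
  shows "lflow (cutoff_field c) t x \<in> \<Omega>"
proof (rule ccontr)
  obtain L where lip: "L-lipschitz_on UNIV (cutoff_field c)" by (rule cutoff_field_lipschitz)
  assume n: "lflow (cutoff_field c) t x \<notin> \<Omega>"
  from lflow_cutoff_outside(2)[OF this t, of c] lflow_inverse[OF lip t, of x] x n
  show False by simp
qed

lemma lflow_cutoff_conserved: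
  fixes f :: "'a \<Rightarrow> real"
  assumes x: "x \<in> \<Omega>" and t: "0 \<le> t"
    and der: "\<And>x. x \<in> \<Omega> \<Longrightarrow> (f has_derivative Df x) (at x)"
    and zero: "\<And>x. x \<in> \<Omega> \<Longrightarrow> Df x (V x) = 0"
  shows "f (lflow (cutoff_field c) t x) = f x"
proof -
  obtain L where lip: "L-lipschitz_on UNIV (cutoff_field c)" by (rule cutoff_field_lipschitz)
  have "f (lflow (cutoff_field c) t x) = f (lflow (cutoff_field c) 0 x)"
  proof (rule constant_along_trajectory[OF lflow_trajectory[OF lip] t, where S = \<Omega> and Df = Df])
    fix y assume y: "y \<in> \<Omega>"
    show "Df y (cutoff_field c y) = 0"
      using has_derivative_bounded_linear[OF der[OF y]] zero[OF y] y
      by (simp add: linear_simps cutoff_field_def)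
  qed (use x der lflow_cutoff_inside in auto)
  then show ?thesis by (simp add: lflow_0[OF lip])
qed

text \<open>The level of the cut-off is the value of \<open>B\<close> at the starting point; since
  \<open>B\<close> is constant along the orbit, the cut-off is never active there.\<close>

definition cflow :: "real \<Rightarrow> 'a \<Rightarrow> 'a" where
  "cflow t x = lflow (cutoff_field (B x)) t x"

lemma cflow_unique:
  assumes u: "is_trajectory V T u" and T: "0 \<le> T"
    and inside: "\<And>t. 0 \<le> t \<Longrightarrow> t \<le> T \<Longrightarrow> u t \<in> \<Omega>" and c: "B (u 0) \<le> c"
  shows "u T = lflow (cutoff_field c) T (u 0)"
proof -
  obtain L where lip: "L-lipschitz_on UNIV (cutoff_field c)" by (rule cutoff_field_lipschitz)
  have "is_trajectory (cutoff_field c) T u"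
  proof (rule is_trajectory_cong[OF u])
    fix t assume t: "0 < t" "t < T"
    have "B (u t) = B (u 0)"
      by (rule constant_along_trajectory[OF is_trajectory_subinterval[OF u], where S = \<Omega> and Df = DB])
         (use inside t B_der conserved in auto)
    then have "B (u t) \<le> c" using c by simp
    then show "cutoff_field c (u t) = V (u t)"
      using inside[of t] t by (simp add: cutoff_field_def cutoff_eq_1)
  qed
  from lflow_eqI[OF lip this T] show ?thesis .
qed

lemma lflow_cutoff_trajectory:
  assumes x: "x \<in> \<Omega>" "B x \<le> c"
  shows "is_trajectory V T (\<lambda>t. lflow (cutoff_field c) t x)"
proof -
  obtain L where lip: "L-lipschitz_on UNIV (cutoff_field c)" by (rule cutoff_field_lipschitz)
  show ?thesis
  proof (rule is_trajectory_cong[OF lflow_trajectory[OF lip]])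
    fix t :: real assume t: "0 < t"
    have "B (lflow (cutoff_field c) t x) = B x"
      by (rule lflow_cutoff_conserved[OF x(1) _ B_der conserved]) (use t in auto)
    then show "V (lflow (cutoff_field c) t x) = cutoff_field c (lflow (cutoff_field c) t x)"
      using x t lflow_cutoff_inside[of x t c] by (auto simp: cutoff_field_def cutoff_eq_1)
  qed
qed

text \<open>On a whole sublevel set a single cut-off field does the work. Continuity and volume
  preservation of \<open>cflow\<close> are inherited from its Lipschitz flow.\<close>

lemma cflow_eq:
  assumes x: "x \<in> \<Omega>" "B x \<le> c" and t: "0 \<le> t"
  shows "cflow t x = lflow (cutoff_field c) t x"
proof -
  obtain L where lip: "L-lipschitz_on UNIV (cutoff_field c)" by (rule cutoff_field_lipschitz)
  show ?thesis
    unfolding cflow_def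
    using cflow_unique[OF lflow_cutoff_trajectory[OF x] t, of "B x"] lflow_cutoff_inside[OF x(1), of _ c]
    by (simp add: lflow_0[OF lip])
qed

lemma cflow_trajectory: "x \<in> \<Omega> \<Longrightarrow> is_trajectory V T (\<lambda>t. cflow t x)"
  unfolding cflow_def by (rule lflow_cutoff_trajectory) auto

lemma cflow_eqI:
  assumes "is_trajectory V T u" "0 \<le> T" "\<And>t. 0 \<le> t \<Longrightarrow> t \<le> T \<Longrightarrow> u t \<in> \<Omega>"
  shows "u T = cflow T (u 0)"
  unfolding cflow_def by (rule cflow_unique[OF assms]) auto

lemma cflow_in: "x \<in> \<Omega> \<Longrightarrow> 0 \<le> t \<Longrightarrow> cflow t x \<in> \<Omega>"
  unfolding cflow_def by (rule lflow_cutoff_inside)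

lemma cflow_0 [simp]: "cflow 0 x = x"
proof -
  obtain L where lip: "L-lipschitz_on UNIV (cutoff_field (B x))" by (rule cutoff_field_lipschitz)
  show ?thesis unfolding cflow_def by (rule lflow_0[OF lip])
qed

lemma cflow_conserved:
  fixes f :: "'a \<Rightarrow> real"
  assumes "x \<in> \<Omega>" "0 \<le> t" "\<And>x. x \<in> \<Omega> \<Longrightarrow> (f has_derivative Df x) (at x)"
    "\<And>x. x \<in> \<Omega> \<Longrightarrow> Df x (V x) = 0"
  shows "f (cflow t x) = f x"
  unfolding cflow_def by (rule lflow_cutoff_conserved[OF assms])

lemma B_cflow: "x \<in> \<Omega> \<Longrightarrow> 0 \<le> t \<Longrightarrow> B (cflow t x) = B x"
  by (rule cflow_conserved[OF _ _ B_der conserved])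

lemma cflow_period:
  assumes x: "x \<in> \<Omega>" and k: "k \<in> \<Lambda>" and t: "0 \<le> t"
  shows "cflow t (x + k) = cflow t x + k"
proof -
  have "is_trajectory V t (\<lambda>s. cflow s x + k)"
    using cflow_trajectory[OF x, of t]
    unfolding is_trajectory_def has_vector_derivative_def
    by (auto intro!: continuous_intros derivative_eq_intros simp: period_V[OF k])
  from cflow_eqI[OF this t] show ?thesis
    using x cflow_in period_\<Omega>[OF k] by auto
qed

lemma continuous_cflow:
  assumes t: "0 \<le> t"
  shows "continuous_on \<Omega> (cflow t)"
proof -
  have B: "continuous_on \<Omega> B"
    using B_der by (meson has_derivative_continuous continuous_at_imp_continuous_on)
  have op: "open {x \<in> \<Omega>. B x < c}" for c
  proof -
    have "{x \<in> \<Omega>. B x < c} = \<Omega> \<inter> B -` {..<c}" by auto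
    then show ?thesis using continuous_open_preimage[OF B open_\<Omega> open_lessThan[of c]] by (simp only:)
  qed
  have "continuous_on (\<Union>c. {x \<in> \<Omega>. B x < c}) (cflow t)"
  proof (rule continuous_on_open_UN[OF op])
    fix c
    obtain L where lip: "L-lipschitz_on UNIV (cutoff_field c)" by (rule cutoff_field_lipschitz)
    show "continuous_on {x \<in> \<Omega>. B x < c} (cflow t)"
      by (rule continuous_on_eq[OF continuous_lflow[OF lip t]]) (simp add: cflow_eq[of _ c] t less_imp_le)
  qed
  moreover have "(\<Union>c. {x \<in> \<Omega>. B x < c}) = \<Omega>"
  proof -
    have "\<exists>c. B x < c" for x by (rule gt_ex)
    then show ?thesis by blast
  qed
  ultimately show ?thesis by simp
qed

text \<open>\<open>\<Omega>\<close> is exhausted by the sublevel sets \<open>X n\<close>. Each is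
  invariant, and on it \<open>cflow\<close> is the flow of one cut-off field, which preserves
  Lebesgue measure on the whole space; monotone limits finish the argument.\<close>

lemma emeasure_cflow:
  assumes t: "0 \<le> t" and A: "A \<in> sets borel"
  shows "emeasure lborel {x \<in> \<Omega>. cflow t x \<in> A} = emeasure lborel (A \<inter> \<Omega>)"
proof -
  define X where "X = (\<lambda>n::nat. {x \<in> \<Omega>. B x \<le> real n})"
  have X [measurable]: "X n \<in> sets borel" for n
    unfolding X_def using proper by simp
  \<comment> \<open>Points outside \<open>\<Omega>\<close> are fixed and \<open>B\<close> is
    conserved inside, so whatever the cut-off flow carries into \<open>X n\<close> started in
    \<open>X n\<close>.\<close>
  have step: "X n \<inter> {x \<in> \<Omega>. cflow t x \<in> A} = lflow (cutoff_field n) t -` (A \<inter> X n)" for n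
  proof (intro set_eqI iffI)
    fix x assume x: "x \<in> X n \<inter> {x \<in> \<Omega>. cflow t x \<in> A}"
    then have "cflow t x = lflow (cutoff_field n) t x"
      by (intro cflow_eq t) (auto simp: X_def)
    moreover have "cflow t x \<in> X n"
      using x t B_cflow[of x t] cflow_in[of x t] by (auto simp: X_def)
    ultimately show "x \<in> lflow (cutoff_field n) t -` (A \<inter> X n)" using x by auto
  next
    fix x assume x: "x \<in> lflow (cutoff_field n) t -` (A \<inter> X n)"
    have in\<Omega>: "x \<in> \<Omega>"
    proof (rule ccontr)
      assume "x \<notin> \<Omega>"
      then show False
        using lflow_cutoff_outside(1)[of x t n] t x by (auto simp: X_def)
    qed
    have "B (lflow (cutoff_field n) t x) = B x"
      by (rule lflow_cutoff_conserved[OF in\<Omega> t B_der conserved])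
    then have "x \<in> X n" using x in\<Omega> by (auto simp: X_def)
    then show "x \<in> X n \<inter> {x \<in> \<Omega>. cflow t x \<in> A}"
      using x in\<Omega> cflow_eq[of x n t] t by (auto simp: X_def)
  qed
  have eq: "emeasure lborel (X n \<inter> {x \<in> \<Omega>. cflow t x \<in> A}) = emeasure lborel (A \<inter> X n)"
    and meas: "X n \<inter> {x \<in> \<Omega>. cflow t x \<in> A} \<in> sets borel" for n
  proof -
    obtain L M where "div_free_field (cutoff_field n) L M p q (\<lambda>x. cutoff_deriv_field n x p \<bullet> p)"
      using cutoff_field_div_free by blast
    then interpret div_free_field "cutoff_field n" L M p q "\<lambda>x. cutoff_deriv_field n x p \<bullet> p" .
    have "emeasure lborel (A \<inter> X n) = emeasure (distr lborel borel (lflow (cutoff_field n) t)) (A \<inter> X n)"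
      by (simp add: distr_lflow[OF t])
    also have "\<dots> = emeasure lborel (lflow (cutoff_field n) t -` (A \<inter> X n))"
      using A X by (subst emeasure_distr) (auto simp: lflow_measurable[OF t])
    finally show "emeasure lborel (X n \<inter> {x \<in> \<Omega>. cflow t x \<in> A}) = emeasure lborel (A \<inter> X n)"
      unfolding step by simp
    show "X n \<inter> {x \<in> \<Omega>. cflow t x \<in> A} \<in> sets borel"
      unfolding step using A X by (intro measurable_sets_borel[OF lflow_measurable[OF t]]) auto
  qed
  have inc: "incseq X" unfolding X_def by (auto simp: incseq_def)
  have UN: "(\<Union>n. X n) = \<Omega>" unfolding X_def using real_arch_simple by auto
  have 1: "(\<lambda>n. emeasure lborel (X n \<inter> {x \<in> \<Omega>. cflow t x \<in> A})) \<longlonglongrightarrow> emeasure lborel (\<Union>n. X n \<inter> {x \<in> \<Omega>. cflow t x \<in> A})"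
    by (rule Lim_emeasure_incseq) (use meas inc in \<open>auto simp: incseq_def\<close>)
  have 2: "(\<Union>n. X n \<inter> {x \<in> \<Omega>. cflow t x \<in> A}) = {x \<in> \<Omega>. cflow t x \<in> A}"
    using UN by blast
  have 3: "(\<lambda>n. emeasure lborel (A \<inter> X n)) \<longlonglongrightarrow> emeasure lborel (\<Union>n. A \<inter> X n)"
    by (rule Lim_emeasure_incseq) (use A X inc in \<open>auto simp: incseq_def\<close>)
  have 4: "(\<Union>n. A \<inter> X n) = A \<inter> \<Omega>" using UN by blast
  show ?thesis using LIMSEQ_unique[OF 1[unfolded eq] 3] unfolding 2 4 .
qed

end

lemma conserved_flow_uminus:
  assumes "conserved_flow \<Omega> V DV B DB p q \<Lambda>"
  shows "conserved_flow \<Omega> (\<lambda>x. - V x) (\<lambda>x h. - DV x h) B DB p q \<Lambda>"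
proof -
  interpret conserved_flow \<Omega> V DV B DB p q \<Lambda> by fact
  show ?thesis
  proof
    fix x assume x: "x \<in> \<Omega>"
    show "((\<lambda>x. - V x) has_derivative (\<lambda>h. - DV x h)) (at x)"
      using V_der[OF x] by (rule has_derivative_minus)
    show "- V x = (- V x \<bullet> p) *\<^sub>R p + (- V x \<bullet> q) *\<^sub>R q"
      using scaleR_span_pair[OF V_pq[OF x], of "-1"] by (simp only: scaleR_minus1_left)
    show "- DV x p \<bullet> p + - DV x q \<bullet> q = 0" using div_free[OF x] by simp
    show "DB x (- V x) = 0"
      using has_derivative_bounded_linear[OF B_der[OF x]] conserved[OF x] by (simp add: linear_simps)
  next
    fix b :: 'a assume "b \<in> Basis"
    then show "continuous_on \<Omega> (\<lambda>x. - DV x b)"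
      by (intro continuous_intros DV_cont)
  next
    fix x k assume "k \<in> \<Lambda>"
    then show "- V (x + k) = - V x" by (simp only: period_V)
  qed (fact open_\<Omega> B_der DB_cont p q proper period_\<Omega> period_B cocompact)+
qed

lemma (in conserved_flow) cflow_inverse:
  assumes x: "x \<in> \<Omega>" and t: "0 \<le> t"
  shows "conserved_flow.cflow \<Omega> (\<lambda>x. - V x) B t (cflow t x) = x"
proof -
  interpret neg: conserved_flow \<Omega> "\<lambda>x. - V x" "\<lambda>x h. - DV x h" B DB p q \<Lambda>
    by (rule conserved_flow_uminus) unfold_locales
  have "is_trajectory (\<lambda>x. - V x) t (\<lambda>s. cflow (t - s) x)"
    by (rule is_trajectory_reverse[OF cflow_trajectory[OF x]])
  from neg.cflow_eqI[OF this t] show ?thesis using x t cflow_in by auto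
qed

lemma (in conserved_flow) cflow_inverse':
  assumes x: "x \<in> \<Omega>" and t: "0 \<le> t"
  shows "cflow t (conserved_flow.cflow \<Omega> (\<lambda>x. - V x) B t x) = x"
proof -
  interpret neg: conserved_flow \<Omega> "\<lambda>x. - V x" "\<lambda>x h. - DV x h" B DB p q \<Lambda>
    by (rule conserved_flow_uminus) unfold_locales
  show ?thesis using neg.cflow_inverse[OF x t] by simp
qed

subsection \<open>Thin shells around a level set\<close>

text \<open>Neither measure is assumed sigma-finite. A countable subcover, made disjoint, splits
  every Borel set into pieces on which the measures agree.\<close>

lemma measure_eqI_open_cover:
  fixes M N :: "'a::second_countable_topology measure"
  assumes sets [measurable_cong, simp]: "sets M = sets borel" "sets N = sets borel"
    and op: "\<And>W. W \<in> \<C> \<Longrightarrow> open W"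
    and eq: "\<And>W A. W \<in> \<C> \<Longrightarrow> A \<in> sets borel \<Longrightarrow> A \<subseteq> W \<Longrightarrow> emeasure M A = emeasure N A"
    and null: "emeasure M (- \<Union>\<C>) = 0" "emeasure N (- \<Union>\<C>) = 0"
  shows "M = N"
proof (cases "\<C> = {}")
  case True
  have "emeasure M A = emeasure N A" if A: "A \<in> sets borel" for A
  proof -
    have "emeasure M A \<le> emeasure M UNIV" "emeasure N A \<le> emeasure N UNIV"
      by (auto intro!: emeasure_mono)
    then show ?thesis using null True by simp
  qed
  then show ?thesis by (intro measure_eqI) auto
next
  case False
  obtain \<D> where \<D>: "\<D> \<subseteq> \<C>" "countable \<D>" "\<Union>\<D> = \<Union>\<C>"
    using Lindelof[of \<C>] op by metis
  \<comment> \<open>One arbitrary member is added because \<open>from_nat_into\<close> enumerates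
    non-empty sets only.\<close>
  define W where "W = from_nat_into (insert (SOME W. W \<in> \<C>) \<D>)"
  have rW: "range W = insert (SOME W. W \<in> \<C>) \<D>"
    unfolding W_def using \<D>(2) by (intro range_from_nat_into) auto
  have some: "(SOME W. W \<in> \<C>) \<in> \<C>" using False by (simp add: some_in_eq)
  have "range W \<subseteq> \<C>" unfolding rW using some \<D>(1) by simp
  then have WC: "W n \<in> \<C>" for n by (rule range_subsetD)
  have UW: "(\<Union>n. W n) = \<Union>\<C>"
  proof
    show "(\<Union>n. W n) \<subseteq> \<Union>\<C>" using WC by (intro UN_least Union_upper)
    have "\<Union>\<D> \<subseteq> (\<Union>n. W n)" unfolding rW by (intro Union_mono) (rule subset_insertI)
    then show "\<Union>\<C> \<subseteq> (\<Union>n. W n)" unfolding \<D>(3) .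
  qed
  have W_meas [measurable]: "W n \<in> sets borel" for n using op[OF WC] by simp
  have d_meas [measurable]: "disjointed W n \<in> sets borel" for n
  proof -
    have "range W \<subseteq> sets borel" using W_meas by (intro image_subsetI)
    from sets.range_disjointed_sets[OF this] show ?thesis by (rule range_subsetD)
  qed
  have dsub: "disjointed W n \<subseteq> W n" for n by (rule disjointed_subset)
  show ?thesis
  proof (rule measure_eqI)
    fix A assume "A \<in> sets M"
    then have A [measurable]: "A \<in> sets borel" by simp
    have split: "emeasure P A = (\<Sum>n. emeasure P (A \<inter> disjointed W n))"
      if P [measurable_cong, simp]: "sets P = sets borel" and n: "emeasure P (- \<Union>\<C>) = 0" for P :: "'a measure"
    proof -
      have "\<Union>\<C> \<in> sets borel" using op by (intro borel_open open_Union) auto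
      then have [measurable]: "- \<Union>\<C> \<in> sets borel" by auto
      have "emeasure P (A - \<Union>\<C>) \<le> emeasure P (- \<Union>\<C>)"
        by (intro emeasure_mono) auto
      then have z: "emeasure P (A - \<Union>\<C>) = 0" using n by simp
      have "emeasure P A = emeasure P ((A \<inter> \<Union>\<C>) \<union> (A - \<Union>\<C>))"
        by (rule arg_cong[where f = "emeasure P"]) auto
      also have "\<dots> = emeasure P (A \<inter> \<Union>\<C>) + emeasure P (A - \<Union>\<C>)"
        using \<open>\<Union>\<C> \<in> sets borel\<close> by (intro plus_emeasure[symmetric]) auto
      also have "\<dots> = emeasure P (\<Union>n. A \<inter> disjointed W n)"
        unfolding z using UN_disjointed_eq[of W] UW by (auto intro!: arg_cong[where f = "emeasure P"])
      also have "\<dots> = (\<Sum>n. emeasure P (A \<inter> disjointed W n))"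
        using disjoint_family_disjointed[of W]
        by (intro suminf_emeasure[symmetric]) (auto simp: disjoint_family_on_def)
      finally show ?thesis .
    qed
    have "emeasure M (A \<inter> disjointed W n) = emeasure N (A \<inter> disjointed W n)" for n
      using dsub[of n] by (intro eq[OF WC]) auto
    then show "emeasure M A = emeasure N A"
      unfolding split[OF sets(1) null(1)] split[OF sets(2) null(2)] by simp
  qed simp
qed

text \<open>The shell has half-width \<open>\<eta> = 1 / real (Suc n)\<close> in the values of
  \<open>\<phi>\<close>, so the factor in front is \<open>1 / (2 * \<eta>)\<close>. Near
  \<open>c\<close> the shell is almost an interval of half-length \<open>\<eta> / \<phi>' c\<close>,
  which explains the limit. The bound \<open>\<kappa>\<close> excludes other zeros and keeps the
  shell close to \<open>c\<close>.\<close>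

lemma thin_shell_1d:
  fixes \<phi> \<phi>' \<psi> :: "real \<Rightarrow> real"
  assumes c: "a < c" "c < b" "\<phi> c = 0"
    and der: "\<And>z. a < z \<Longrightarrow> z < b \<Longrightarrow> (\<phi> has_real_derivative \<phi>' z) (at z)"
    and \<kappa>: "0 < \<kappa>" "\<And>z. a < z \<Longrightarrow> z < b \<Longrightarrow> \<kappa> \<le> \<phi>' z"
    and cont': "isCont \<phi>' c" and cont: "isCont \<psi> c"
    and pos: "\<And>z. 0 \<le> \<psi> z" and \<psi> [measurable]: "\<psi> \<in> borel_measurable borel"
  shows "(\<lambda>n. ennreal (real (Suc n) / 2) *
      (\<integral>\<^sup>+z. ennreal (\<psi> z) * indicator {z. a < z \<and> z < b \<and> \<bar>\<phi> z\<bar> < 1 / real (Suc n)} z \<partial>lborel))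
    \<longlonglongrightarrow> ennreal (\<psi> c / \<phi>' c)" (is "?J \<longlonglongrightarrow> _")
proof -
  define d where "d = \<phi>' c"
  have d: "\<kappa> \<le> d" "0 < d" using \<kappa>(2)[of c] c \<kappa>(1) by (auto simp: d_def)
  have mvt: "\<exists>\<zeta>. a < \<zeta> \<and> \<zeta> < b \<and> \<bar>\<zeta> - c\<bar> \<le> \<bar>z - c\<bar> \<and> \<bar>\<phi> z\<bar> = \<phi>' \<zeta> * \<bar>z - c\<bar>" if z: "a < z" "z < b" for z
  proof -
    consider "z = c" | "c < z" | "z < c" by linarith
    then show ?thesis
    proof cases
      case 1 then show ?thesis using c by auto
    next
      case 2
      have "\<exists>\<zeta>. c < \<zeta> \<and> \<zeta> < z \<and> \<phi> z - \<phi> c = (z - c) * \<phi>' \<zeta>"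
        by (rule MVT2[OF 2]) (use c z der in auto)
      then obtain \<zeta> where h: "c < \<zeta>" "\<zeta> < z" "\<phi> z = (z - c) * \<phi>' \<zeta>" using c by auto
      moreover have "0 \<le> \<phi>' \<zeta>" using \<kappa>(2)[of \<zeta>] \<kappa>(1) h c z by auto
      ultimately show ?thesis using c z by (intro exI[of _ \<zeta>]) (auto simp: abs_mult)
    next
      case 3
      have "\<exists>\<zeta>. z < \<zeta> \<and> \<zeta> < c \<and> \<phi> c - \<phi> z = (c - z) * \<phi>' \<zeta>"
        by (rule MVT2[OF 3]) (use c z der in auto)
      then obtain \<zeta> where h: "z < \<zeta>" "\<zeta> < c" "- \<phi> z = (c - z) * \<phi>' \<zeta>" using c by auto
      moreover have "0 \<le> \<phi>' \<zeta>" using \<kappa>(2)[of \<zeta>] \<kappa>(1) h c z by auto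
      moreover have "\<bar>\<phi> z\<bar> = \<bar>- \<phi> z\<bar>" by simp
      ultimately show ?thesis using c z by (intro exI[of _ \<zeta>]) (auto simp: abs_mult)
    qed
  qed
  \<comment> \<open>The shell is squeezed between intervals of half-length
    \<open>\<eta> / (d + \<epsilon>)\<close> and \<open>\<eta> / (d - \<epsilon>)\<close>, and on
    the shell \<open>\<psi>\<close> differs from \<open>\<psi> c\<close> by at most
    \<open>\<epsilon>\<close>.\<close>
  have bounds: "\<forall>\<^sub>F n in sequentially. ennreal ((\<psi> c - \<epsilon>) / (d + \<epsilon>)) \<le> ?J n \<and> ?J n \<le> ennreal ((\<psi> c + \<epsilon>) / (d - \<epsilon>))"
    if \<epsilon>: "0 < \<epsilon>" "\<epsilon> < d" for \<epsilon>
  proof -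
    obtain \<delta>1 where \<delta>1: "\<delta>1 > 0" "\<And>z. \<bar>z - c\<bar> < \<delta>1 \<Longrightarrow> \<bar>\<phi>' z - d\<bar> < \<epsilon>"
      using cont' \<epsilon>(1) unfolding continuous_at_eps_delta d_def by (auto simp: dist_real_def)
    obtain \<delta>2 where \<delta>2: "\<delta>2 > 0" "\<And>z. \<bar>z - c\<bar> < \<delta>2 \<Longrightarrow> \<bar>\<psi> z - \<psi> c\<bar> < \<epsilon>"
      using cont \<epsilon>(1) unfolding continuous_at_eps_delta by (auto simp: dist_real_def)
    \<comment> \<open>Besides continuity this secures that the interval of radius
      \<open>\<delta>\<close> stays between \<open>a\<close> and \<open>b\<close>. For large
      \<open>n\<close> one has \<open>\<eta> < \<kappa> * \<delta>\<close>, and since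
      \<open>\<kappa> * \<bar>z - c\<bar> \<le> \<bar>\<phi> z\<bar>\<close> the whole shell lies
      within \<open>\<delta>\<close> of \<open>c\<close>.\<close>
    define \<delta> where "\<delta> = Min {\<delta>1, \<delta>2, c - a, b - c}"
    have \<delta>: "0 < \<delta>" "\<delta> \<le> \<delta>1" "\<delta> \<le> \<delta>2" "\<delta> \<le> c - a" "\<delta> \<le> b - c"
      using \<delta>1 \<delta>2 c by (auto simp: \<delta>_def)
    have "\<forall>\<^sub>F n in sequentially. inverse (real (Suc n)) < \<kappa> * \<delta>"
      using \<kappa>(1) \<delta>(1) by (intro order_tendstoD(2)[OF LIMSEQ_inverse_real_of_nat]) auto
    then show ?thesis
    proof eventually_elim
      case (elim n)
      define \<eta> where "\<eta> = 1 / real (Suc n)"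
      have \<eta>: "0 < \<eta>" "\<eta> < \<kappa> * \<delta>" using elim by (auto simp: \<eta>_def inverse_eq_divide)
      let ?S = "{z. a < z \<and> z < b \<and> \<bar>\<phi> z\<bar> < \<eta>}"
      let ?I = "\<lambda>r. {c - r<..<c + r}"
      have in1: "\<bar>z - c\<bar> < \<delta>" if zS: "z \<in> ?S" for z
      proof -
        obtain \<zeta> where "a < \<zeta>" "\<zeta> < b" "\<bar>\<phi> z\<bar> = \<phi>' \<zeta> * \<bar>z - c\<bar>" using mvt[of z] zS by auto
        then have "\<kappa> * \<bar>z - c\<bar> \<le> \<bar>\<phi> z\<bar>" using \<kappa>(2)[of \<zeta>] by (simp add: mult_right_mono)
        also have "\<dots> < \<kappa> * \<delta>" using zS \<eta> by auto
        finally show ?thesis using \<kappa>(1) by simp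
      qed
      have near: "\<bar>\<phi>' \<zeta> - d\<bar> < \<epsilon>" "\<bar>\<psi> \<zeta> - \<psi> c\<bar> < \<epsilon>" if "\<bar>\<zeta> - c\<bar> < \<delta>" for \<zeta>
        using \<delta>1(2)[of \<zeta>] \<delta>2(2)[of \<zeta>] \<delta> that by auto
      have upper_sub: "?S \<subseteq> ?I (\<eta> / (d - \<epsilon>))"
      proof
        fix z assume z: "z \<in> ?S"
        then obtain \<zeta> where h: "\<bar>\<zeta> - c\<bar> \<le> \<bar>z - c\<bar>" "\<bar>\<phi> z\<bar> = \<phi>' \<zeta> * \<bar>z - c\<bar>" using mvt[of z] by auto
        have "d - \<epsilon> \<le> \<phi>' \<zeta>" using near(1)[of \<zeta>] h in1[OF z] by auto
        then have "(d - \<epsilon>) * \<bar>z - c\<bar> \<le> \<bar>\<phi> z\<bar>" using h by (simp add: mult_right_mono)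
        also have "\<dots> < \<eta>" using z by simp
        finally have "\<bar>z - c\<bar> < \<eta> / (d - \<epsilon>)" using \<epsilon> by (simp add: field_simps)
        then show "z \<in> ?I (\<eta> / (d - \<epsilon>))" by auto
      qed
      have lower_sub: "?I (\<eta> / (d + \<epsilon>)) \<subseteq> ?S"
      proof
        fix z assume "z \<in> ?I (\<eta> / (d + \<epsilon>))"
        then have z: "\<bar>z - c\<bar> < \<eta> / (d + \<epsilon>)" by auto
        also have "\<dots> \<le> \<eta> / \<kappa>" using d \<epsilon> \<eta> \<kappa>(1) by (intro divide_left_mono) auto
        also have "\<dots> < \<delta>" using \<eta> \<kappa>(1) by (simp add: field_simps)
        finally have z': "\<bar>z - c\<bar> < \<delta>" .
        then have ab: "a < z" "z < b" using \<delta> by auto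
        then obtain \<zeta> where h: "\<bar>\<zeta> - c\<bar> \<le> \<bar>z - c\<bar>" "\<bar>\<phi> z\<bar> = \<phi>' \<zeta> * \<bar>z - c\<bar>" using mvt[of z] by auto
        have "\<phi>' \<zeta> \<le> d + \<epsilon>" using near(1)[of \<zeta>] h z' by auto
        then have "\<bar>\<phi> z\<bar> \<le> (d + \<epsilon>) * \<bar>z - c\<bar>" using h by (simp add: mult_right_mono)
        also have "\<dots> < \<eta>" using z d \<epsilon> by (simp add: field_simps)
        finally show "z \<in> ?S" using ab by auto
      qed
      have len: "emeasure lborel (?I r) = ennreal (2 * r)" if "0 \<le> r" for r
        using that by simp
      have scale: "ennreal (1 / (2 * \<eta>)) * (ennreal x * ennreal (2 * (\<eta> / y))) = ennreal (x / y)"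
        if "0 \<le> x" "0 < y" for x y
      proof -
        have "ennreal (1 / (2 * \<eta>) * (x * (2 * (\<eta> / y)))) = ennreal (1 / (2 * \<eta>)) * (ennreal x * ennreal (2 * (\<eta> / y)))"
        proof -
          have n: "0 \<le> 1 / (2 * \<eta>)" "0 \<le> x * (2 * (\<eta> / y))" "0 \<le> 2 * (\<eta> / y)"
            using that \<eta> by auto
          show ?thesis by (simp only: ennreal_mult[OF n(1,2)] ennreal_mult[OF that(1) n(3)])
        qed
        moreover have "1 / (2 * \<eta>) * (x * (2 * (\<eta> / y))) = x / y" using \<eta> that by (simp add: field_simps)
        ultimately show ?thesis by (simp only:)
      qed
      have "?J n \<le> ennreal (1 / (2 * \<eta>)) * (\<integral>\<^sup>+z. ennreal (\<psi> c + \<epsilon>) * indicator (?I (\<eta> / (d - \<epsilon>))) z \<partial>lborel)"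
      proof (rule mult_mono)
        show "ennreal (real (Suc n) / 2) \<le> ennreal (1 / (2 * \<eta>))" by (simp add: \<eta>_def)
        show "(\<integral>\<^sup>+z. ennreal (\<psi> z) * indicator {z. a < z \<and> z < b \<and> \<bar>\<phi> z\<bar> < 1 / real (Suc n)} z \<partial>lborel)
           \<le> (\<integral>\<^sup>+z. ennreal (\<psi> c + \<epsilon>) * indicator (?I (\<eta> / (d - \<epsilon>))) z \<partial>lborel)"
        proof (rule nn_integral_mono)
          fix z
          show "ennreal (\<psi> z) * indicator {z. a < z \<and> z < b \<and> \<bar>\<phi> z\<bar> < 1 / real (Suc n)} z
            \<le> ennreal (\<psi> c + \<epsilon>) * indicator (?I (\<eta> / (d - \<epsilon>))) z"
          proof (cases "z \<in> ?S")
            case True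
            have "\<psi> z \<le> \<psi> c + \<epsilon>" using near(2)[OF in1[OF True]] by linarith
            moreover have "z \<in> ?I (\<eta> / (d - \<epsilon>))" using upper_sub True by blast
            ultimately show ?thesis using True by (simp add: \<eta>_def ennreal_leI)
          qed (simp add: \<eta>_def)
        qed
      qed auto
      also have "\<dots> = ennreal (1 / (2 * \<eta>)) * (ennreal (\<psi> c + \<epsilon>) * ennreal (2 * (\<eta> / (d - \<epsilon>))))"
        using \<epsilon> \<eta> len[of "\<eta> / (d - \<epsilon>)"] by (subst nn_integral_cmult_indicator) auto
      also have "\<dots> = ennreal ((\<psi> c + \<epsilon>) / (d - \<epsilon>))"
        using \<epsilon> pos[of c] by (intro scale) auto
      finally have upper: "?J n \<le> ennreal ((\<psi> c + \<epsilon>) / (d - \<epsilon>))" .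
      \<comment> \<open>\<open>ennreal\<close> sends negative numbers to 0, so the lower bound can
        be rewritten with a non-negative numerator, as \<open>scale\<close> requires.\<close>
      have "ennreal ((\<psi> c - \<epsilon>) / (d + \<epsilon>)) = ennreal (max 0 (\<psi> c - \<epsilon>) / (d + \<epsilon>))"
        using d \<epsilon> by (auto simp: max_def ennreal_neg divide_nonpos_pos)
      also have "\<dots> = ennreal (1 / (2 * \<eta>)) * (ennreal (max 0 (\<psi> c - \<epsilon>)) * ennreal (2 * (\<eta> / (d + \<epsilon>))))"
        using \<epsilon> d by (intro scale[symmetric]) auto
      also have "\<dots> = ennreal (1 / (2 * \<eta>)) * (\<integral>\<^sup>+z. ennreal (max 0 (\<psi> c - \<epsilon>)) * indicator (?I (\<eta> / (d + \<epsilon>))) z \<partial>lborel)"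
        using \<epsilon> \<eta> d len[of "\<eta> / (d + \<epsilon>)"] by (subst nn_integral_cmult_indicator) auto
      also have "\<dots> \<le> ?J n"
      proof (rule mult_mono)
        show "ennreal (1 / (2 * \<eta>)) \<le> ennreal (real (Suc n) / 2)" by (simp add: \<eta>_def)
        show "(\<integral>\<^sup>+z. ennreal (max 0 (\<psi> c - \<epsilon>)) * indicator (?I (\<eta> / (d + \<epsilon>))) z \<partial>lborel)
          \<le> (\<integral>\<^sup>+z. ennreal (\<psi> z) * indicator {z. a < z \<and> z < b \<and> \<bar>\<phi> z\<bar> < 1 / real (Suc n)} z \<partial>lborel)"
        proof (rule nn_integral_mono)
          fix z
          show "ennreal (max 0 (\<psi> c - \<epsilon>)) * indicator (?I (\<eta> / (d + \<epsilon>))) z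
            \<le> ennreal (\<psi> z) * indicator {z. a < z \<and> z < b \<and> \<bar>\<phi> z\<bar> < 1 / real (Suc n)} z"
          proof (cases "z \<in> ?I (\<eta> / (d + \<epsilon>))")
            case True
            then have z: "z \<in> ?S" using lower_sub by blast
            have "max 0 (\<psi> c - \<epsilon>) \<le> \<psi> z" using near(2)[OF in1[OF z]] pos[of z] by auto
            then show ?thesis using True z by (simp add: \<eta>_def ennreal_leI)
          qed simp
        qed
      qed auto
      finally show ?case using upper by blast
    qed
  qed
  have ev: "\<forall>\<^sub>F \<epsilon> in at_right 0. 0 < \<epsilon> \<and> \<epsilon> < d"
    using eventually_at_right_real[OF d(2)] by eventually_elim auto
  have lim_lo: "((\<lambda>\<epsilon>. ennreal ((\<psi> c - \<epsilon>) / (d + \<epsilon>))) \<longlongrightarrow> ennreal ((\<psi> c - 0) / (d + 0))) (at_right 0)"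
    using d(2) by (intro tendsto_intros) auto
  have lim_hi: "((\<lambda>\<epsilon>. ennreal ((\<psi> c + \<epsilon>) / (d - \<epsilon>))) \<longlongrightarrow> ennreal ((\<psi> c + 0) / (d - 0))) (at_right 0)"
    using d(2) by (intro tendsto_intros) auto
  show ?thesis
    unfolding d_def[symmetric]
  proof (rule order_tendstoI)
    fix l assume "l < ennreal (\<psi> c / d)"
    then have "\<forall>\<^sub>F \<epsilon> in at_right 0. l < ennreal ((\<psi> c - \<epsilon>) / (d + \<epsilon>))"
      using order_tendstoD(1)[OF lim_lo] by simp
    then have "\<forall>\<^sub>F \<epsilon> in at_right 0. (0 < \<epsilon> \<and> \<epsilon> < d) \<and> l < ennreal ((\<psi> c - \<epsilon>) / (d + \<epsilon>))"
      using ev by eventually_elim auto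
    then have "\<exists>\<epsilon>. (0 < \<epsilon> \<and> \<epsilon> < d) \<and> l < ennreal ((\<psi> c - \<epsilon>) / (d + \<epsilon>))"
      by (rule eventually_happens'[rotated]) simp
    then obtain \<epsilon> where "0 < \<epsilon>" "\<epsilon> < d" "l < ennreal ((\<psi> c - \<epsilon>) / (d + \<epsilon>))" by blast
    note el = this(3)
    from bounds[OF \<open>0 < \<epsilon>\<close> \<open>\<epsilon> < d\<close>] show "\<forall>\<^sub>F n in sequentially. l < ?J n"
      by (rule eventually_mono) (rule less_le_trans[OF el], blast)
  next
    fix l assume "ennreal (\<psi> c / d) < l"
    then have "\<forall>\<^sub>F \<epsilon> in at_right 0. ennreal ((\<psi> c + \<epsilon>) / (d - \<epsilon>)) < l"
      using order_tendstoD(2)[OF lim_hi] by simp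
    then have "\<forall>\<^sub>F \<epsilon> in at_right 0. (0 < \<epsilon> \<and> \<epsilon> < d) \<and> ennreal ((\<psi> c + \<epsilon>) / (d - \<epsilon>)) < l"
      using ev by eventually_elim auto
    then have "\<exists>\<epsilon>. (0 < \<epsilon> \<and> \<epsilon> < d) \<and> ennreal ((\<psi> c + \<epsilon>) / (d - \<epsilon>)) < l"
      by (rule eventually_happens'[rotated]) simp
    then obtain \<epsilon> where "0 < \<epsilon>" "\<epsilon> < d" "ennreal ((\<psi> c + \<epsilon>) / (d - \<epsilon>)) < l" by blast
    note el = this(3)
    from bounds[OF \<open>0 < \<epsilon>\<close> \<open>\<epsilon> < d\<close>] show "\<forall>\<^sub>F n in sequentially. ?J n < l"
      by (rule eventually_mono) (rule le_less_trans[OF _ el], blast)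
  qed
qed

section \<open>Regular level sets and the measure delta(H - E)\<close>

locale level_set =
  fixes \<Omega> :: "'a::euclidean_space set" and H :: "'a \<Rightarrow> real" and g :: "'a \<Rightarrow> 'a" and E :: real
    and \<sigma> :: "'a measure"
  assumes open_\<Omega>: "open \<Omega>"
    and H_der: "\<And>x. x \<in> \<Omega> \<Longrightarrow> (H has_derivative (\<lambda>h. g x \<bullet> h)) (at x)"
    and g_cont: "continuous_on \<Omega> g"
    and regular: "\<And>x. x \<in> \<Omega> \<Longrightarrow> H x = E \<Longrightarrow> g x \<noteq> 0"
    and surface: "surface_measure_on {x \<in> \<Omega>. H x = E} \<sigma>"
begin

lemma sets_\<sigma> [measurable_cong, simp]: "sets \<sigma> = sets borel"
  using surface unfolding surface_measure_on_def by (elim conjE)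

lemma H_cont: "continuous_on \<Omega> H"
  using H_der by (meson has_derivative_continuous continuous_at_imp_continuous_on)

lemma \<Omega>_borel [measurable]: "\<Omega> \<in> sets borel" using open_\<Omega> by simp

text \<open>With the energy for \<open>H\<close> this is the lift of the unnormalised microcanonical
  measure to the cover, written formally as \<open>\<delta>(H - E) dx\<close>.\<close>

definition \<mu> :: "'a measure" where
  "\<mu> = density \<sigma> (\<lambda>x. indicator \<Omega> x * ennreal (1 / norm (g x)))"

lemma sets_\<mu> [measurable_cong, simp]: "sets \<mu> = sets borel" by (simp add: \<mu>_def)

lemma borel_on_\<Omega>:
  fixes f :: "'a \<Rightarrow> 'b::{real_normed_vector, second_countable_topology}"
  assumes "continuous_on \<Omega> f"
  shows "(\<lambda>x. if x \<in> \<Omega> then f x else 0) \<in> borel_measurable borel"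
  using assms by (intro borel_measurable_continuous_on_if) auto

lemma weight_measurable [measurable]: "(\<lambda>x. indicator \<Omega> x * ennreal (1 / norm (g x))) \<in> borel_measurable borel"
proof -
  have [measurable]: "(\<lambda>x. if x \<in> \<Omega> then g x else 0) \<in> borel_measurable borel"
    by (rule borel_on_\<Omega>[OF g_cont])
  have "(\<lambda>x. indicator \<Omega> x * ennreal (1 / norm (if x \<in> \<Omega> then g x else 0))) \<in> borel_measurable borel"
    by measurable
  moreover have "(\<lambda>x. indicator \<Omega> x * ennreal (1 / norm (if x \<in> \<Omega> then g x else 0))) =
     (\<lambda>x. indicator \<Omega> x * ennreal (1 / norm (g x)))"
    by (auto simp: fun_eq_iff indicator_def)
  ultimately show ?thesis by simp
qed

definition shell :: "nat \<Rightarrow> 'a set" where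
  "shell n = {x \<in> \<Omega>. \<bar>H x - E\<bar> < 1 / real (Suc n)}"

lemma shell_borel [measurable]: "shell n \<in> sets borel"
proof -
  have "open (\<Omega> \<inter> (\<lambda>x. \<bar>H x - E\<bar>) -` {..< 1 / real (Suc n)})"
    by (intro continuous_open_preimage continuous_intros H_cont open_\<Omega> open_lessThan)
  moreover have "\<Omega> \<inter> (\<lambda>x. \<bar>H x - E\<bar>) -` {..< 1 / real (Suc n)} = shell n"
    by (auto simp: shell_def)
  ultimately show ?thesis by simp
qed

lemma level_borel [measurable]: "{x \<in> \<Omega>. H x = E} \<in> sets borel"
proof -
  have [measurable]: "(\<lambda>x. if x \<in> \<Omega> then H x else 0) \<in> borel_measurable borel"
    by (rule borel_on_\<Omega>[OF H_cont])
  have "\<Omega> \<inter> {x. (if x \<in> \<Omega> then H x else 0) = E} \<in> sets borel" by measurable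
  moreover have "\<Omega> \<inter> {x. (if x \<in> \<Omega> then H x else 0) = E} = {x \<in> \<Omega>. H x = E}" by auto
  ultimately show ?thesis by simp
qed

lemma \<mu>_null: "emeasure \<mu> (- {x \<in> \<Omega>. H x = E}) = 0"
proof -
  have [measurable]: "- {x \<in> \<Omega>. H x = E} \<in> sets borel" using level_borel by (rule borel_comp)
  have "emeasure \<sigma> (- {x \<in> \<Omega>. H x = E}) = 0"
    using surface unfolding surface_measure_on_def by (elim conjE)
  then have "- {x \<in> \<Omega>. H x = E} \<in> null_sets \<sigma>" by (intro null_setsI) auto
  then have "AE x in \<sigma>. x \<notin> - {x \<in> \<Omega>. H x = E}" by (rule AE_not_in)
  then have "(\<integral>\<^sup>+x. (indicator \<Omega> x * ennreal (1 / norm (g x))) * indicator (- {x \<in> \<Omega>. H x = E}) x \<partial>\<sigma>) = (\<integral>\<^sup>+x. 0 \<partial>\<sigma>)"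
    by (intro nn_integral_cong_AE) (auto simp: indicator_def)
  then show ?thesis
    unfolding \<mu>_def by (subst emeasure_density) auto
qed

end

text \<open>
  A box \<open>Q\<close> around a point of the level set, on which the derivative of \<open>s H\<close> in the direction \<open>b\<close>
  is bounded below and which is crossed by the level set as a graph over the hyperplane orthogonal to \<open>b\<close>.
\<close>

locale level_set_chart = level_set \<Omega> H g E \<sigma>
  for \<Omega> :: "'a::euclidean_space set" and H g E \<sigma> +
  fixes b y0 :: 'a and z0 s \<kappa> r \<rho> :: real
  assumes b: "b \<in> Basis" and s: "\<bar>s\<bar> = 1" and pos: "0 < \<kappa>" "0 < r" "0 < \<rho>" and y0: "y0 \<bullet> b = 0"
    and box_\<Omega>: "\<And>y z. y \<bullet> b = 0 \<Longrightarrow> norm (y - y0) < \<rho> \<Longrightarrow> \<bar>z - z0\<bar> < r \<Longrightarrow> y + z *\<^sub>R b \<in> \<Omega>"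
    and steep: "\<And>y z. y \<bullet> b = 0 \<Longrightarrow> norm (y - y0) < \<rho> \<Longrightarrow> \<bar>z - z0\<bar> < r \<Longrightarrow>
      \<kappa> \<le> s * (g (y + z *\<^sub>R b) \<bullet> b)"
    and root: "\<And>y. y \<bullet> b = 0 \<Longrightarrow> norm (y - y0) < \<rho> \<Longrightarrow> \<exists>z. \<bar>z - z0\<bar> < r \<and> H (y + z *\<^sub>R b) = E"
begin

lemma bb [simp]: "b \<bullet> b = 1" using b by simp

definition base :: "'a set" where "base = {y. y \<bullet> b = 0 \<and> norm (y - y0) < \<rho>}"

definition Q :: "'a set" where
  "Q = {x. norm (x - (x \<bullet> b) *\<^sub>R b - y0) < \<rho> \<and> \<bar>x \<bullet> b - z0\<bar> < r}"

lemma open_Q: "open Q"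
  unfolding Q_def by (intro open_Collect_conj open_Collect_less continuous_intros)

lemma Q_borel [measurable]: "Q \<in> sets borel" using open_Q by simp

lemma in_Q: "y \<bullet> b = 0 \<Longrightarrow> y + z *\<^sub>R b \<in> Q \<longleftrightarrow> y \<in> base \<and> \<bar>z - z0\<bar> < r"
  by (auto simp: Q_def base_def inner_add_left)

lemma Q_decomp:
  assumes "x \<in> Q"
  shows "x - (x \<bullet> b) *\<^sub>R b \<in> base" "\<bar>x \<bullet> b - z0\<bar> < r"
  using assms by (auto simp: Q_def base_def inner_diff_left)

lemma Q_\<Omega>: "x \<in> Q \<Longrightarrow> x \<in> \<Omega>"
  using box_\<Omega>[of "x - (x \<bullet> b) *\<^sub>R b" "x \<bullet> b"] Q_decomp[of x] by (auto simp: base_def)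

lemma Q_steep: "x \<in> Q \<Longrightarrow> \<kappa> \<le> s * (g x \<bullet> b)"
  using steep[of "x - (x \<bullet> b) *\<^sub>R b" "x \<bullet> b"] Q_decomp[of x] by (auto simp: base_def)

lemma Q_nonzero: "x \<in> Q \<Longrightarrow> g x \<bullet> b \<noteq> 0"
  using Q_steep[of x] pos(1) by auto

lemma Q_abs: "x \<in> Q \<Longrightarrow> \<bar>g x \<bullet> b\<bar> = s * (g x \<bullet> b)"
  using Q_steep[of x] pos(1) s by (auto simp: abs_if split: if_splits)

lemma bounded_Q: "bounded Q"
proof (rule boundedI)
  fix x assume x: "x \<in> Q"
  have "x = (x - (x \<bullet> b) *\<^sub>R b - y0) + y0 + (x \<bullet> b) *\<^sub>R b" by simp
  then have "norm x \<le> norm (x - (x \<bullet> b) *\<^sub>R b - y0) + norm y0 + norm ((x \<bullet> b) *\<^sub>R b)"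
    by (metis norm_triangle_le norm_triangle_ineq add_right_mono)
  also have "\<dots> \<le> \<rho> + norm y0 + (\<bar>z0\<bar> + r)"
    using x b by (auto simp: Q_def)
  finally show "norm x \<le> \<rho> + norm y0 + (\<bar>z0\<bar> + r)" .
qed

lemma line_der:
  assumes "y + z *\<^sub>R b \<in> \<Omega>"
  shows "((\<lambda>z. H (y + z *\<^sub>R b)) has_real_derivative g (y + z *\<^sub>R b) \<bullet> b) (at z)"
proof -
  have "((\<lambda>z. y + z *\<^sub>R b) has_derivative (\<lambda>h. h *\<^sub>R b)) (at z)"
    by (auto intro!: derivative_eq_intros)
  from has_derivative_compose[OF this H_der[OF assms]]
  show ?thesis by (simp add: has_field_derivative_def mult_commute_abs)
qed

lemma line_inj:
  assumes y: "y \<in> base" and z: "\<bar>z - z0\<bar> < r" "\<bar>w - z0\<bar> < r" and eq: "H (y + z *\<^sub>R b) = H (y + w *\<^sub>R b)"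
  shows "z = w"
proof -
  have False if zw: "z < w" "\<bar>z - z0\<bar> < r" "\<bar>w - z0\<bar> < r" "H (y + z *\<^sub>R b) = H (y + w *\<^sub>R b)" for z w
  proof -
    have inQ: "y + \<zeta> *\<^sub>R b \<in> Q" if "z \<le> \<zeta>" "\<zeta> \<le> w" for \<zeta>
      using in_Q[of y \<zeta>] y that zw by (auto simp: base_def)
    have "\<exists>\<zeta>. z < \<zeta> \<and> \<zeta> < w \<and> H (y + w *\<^sub>R b) - H (y + z *\<^sub>R b) = (w - z) * (g (y + \<zeta> *\<^sub>R b) \<bullet> b)"
      by (rule MVT2[OF zw(1)]) (use inQ Q_\<Omega> line_der in auto)
    then obtain \<zeta> where \<zeta>: "z < \<zeta>" "\<zeta> < w" "(w - z) * (g (y + \<zeta> *\<^sub>R b) \<bullet> b) = 0" using zw by auto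
    then show False using Q_nonzero[OF inQ[of \<zeta>]] zw by auto
  qed
  from this[of z w] this[of w z] z eq show ?thesis by (cases z w rule: linorder_cases) auto
qed

definition height :: "'a \<Rightarrow> real" where
  "height y = (THE z. \<bar>z - z0\<bar> < r \<and> H (y + z *\<^sub>R b) = E)"

lemma height:
  assumes "y \<in> base"
  shows "\<bar>height y - z0\<bar> < r" "H (y + height y *\<^sub>R b) = E"
proof -
  have "\<exists>!z. \<bar>z - z0\<bar> < r \<and> H (y + z *\<^sub>R b) = E"
    using root[of y] assms line_inj[OF assms] by (auto simp: base_def)
  from theI'[OF this] show "\<bar>height y - z0\<bar> < r" "H (y + height y *\<^sub>R b) = E"
    unfolding height_def by auto
qed

lemma height_eqI:
  assumes "y \<in> base" "\<bar>z - z0\<bar> < r" "H (y + z *\<^sub>R b) = E"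
  shows "height y = z"
  using line_inj[OF assms(1) height(1)[OF assms(1)] assms(2)] height(2)[OF assms(1)] assms(3) by simp

lemma graph_in_Q: "y \<in> base \<Longrightarrow> y + height y *\<^sub>R b \<in> Q"
  using in_Q[of y "height y"] height by (auto simp: base_def)

lemma graph_eq: "(\<lambda>y. y + height y *\<^sub>R b) ` base = {x \<in> Q. H x = E}"
proof (intro set_eqI iffI)
  fix x assume "x \<in> {x \<in> Q. H x = E}"
  then have x: "x \<in> Q" "H x = E" by auto
  let ?y = "x - (x \<bullet> b) *\<^sub>R b"
  have "height ?y = x \<bullet> b"
    by (rule height_eqI) (use Q_decomp[OF x(1)] x in auto)
  then have "x = ?y + height ?y *\<^sub>R b" by simp
  then show "x \<in> (\<lambda>y. y + height y *\<^sub>R b) ` base" using Q_decomp(1)[OF x(1)] by blast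
qed (use graph_in_Q height in auto)

text \<open>The gradient of the implicit function \<open>height\<close>, found by differentiating
  \<open>H (y + height y *\<^sub>R b) = E\<close> along the hyperplane.\<close>

definition slope :: "'a \<Rightarrow> 'a" where
  "slope x = - (1 / (g x \<bullet> b)) *\<^sub>R (g x - (g x \<bullet> b) *\<^sub>R b)"

text \<open>
  The implicit function theorem, applied to the map that replaces the \<open>b\<close>-coordinate of a point by its
  value of \<open>H\<close>.
\<close>

lemma height_derivative:
  assumes y: "y \<in> base"
  shows "(height has_derivative (\<lambda>h. slope (y + height y *\<^sub>R b) \<bullet> h)) (at y within {y. y \<bullet> b = 0})"
proof -
  define T where "T = (\<lambda>x. x + (H x - x \<bullet> b) *\<^sub>R b)"
  define S where "S = inv_into Q T"
  let ?x = "y + height y *\<^sub>R b"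
  have yb: "y \<bullet> b = 0" using y by (simp add: base_def)
  have xQ: "?x \<in> Q" by (rule graph_in_Q[OF y])
  have inj: "inj_on T Q"
  proof (rule inj_onI)
    fix u v assume uv: "u \<in> Q" "v \<in> Q" "T u = T v"
    have Tb: "T w \<bullet> b = H w" "T w - (T w \<bullet> b) *\<^sub>R b = w - (w \<bullet> b) *\<^sub>R b" for w
      by (auto simp: T_def inner_add_left algebra_simps)
    have eq: "u - (u \<bullet> b) *\<^sub>R b = v - (v \<bullet> b) *\<^sub>R b" "H u = H v"
      using Tb[of u] Tb[of v] uv(3) by auto
    have "u \<bullet> b = v \<bullet> b"
    proof (rule line_inj[OF Q_decomp(1)[OF uv(1)] Q_decomp(2)[OF uv(1)] Q_decomp(2)[OF uv(2)]])
      have "H (u - (u \<bullet> b) *\<^sub>R b + (v \<bullet> b) *\<^sub>R b) = H (v - (v \<bullet> b) *\<^sub>R b + (v \<bullet> b) *\<^sub>R b)"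
        unfolding eq(1) ..
      then show "H (u - (u \<bullet> b) *\<^sub>R b + (u \<bullet> b) *\<^sub>R b) = H (u - (u \<bullet> b) *\<^sub>R b + (v \<bullet> b) *\<^sub>R b)"
        using eq(2) by simp
    qed
    then show "u = v" using eq(1) by simp
  qed
  let ?T' = "\<lambda>h. h + (g ?x \<bullet> h - h \<bullet> b) *\<^sub>R b"
  let ?w = "\<lambda>k. (k \<bullet> b - g ?x \<bullet> (k - (k \<bullet> b) *\<^sub>R b)) / (g ?x \<bullet> b)"
  let ?S' = "\<lambda>k. (k - (k \<bullet> b) *\<^sub>R b) + ?w k *\<^sub>R b"
  have "(S has_derivative ?S') (at (T ?x))"
  proof (rule has_derivative_inverse_strong[OF open_Q xQ])
    have "continuous_on Q H" using H_cont Q_\<Omega> by (meson continuous_on_subset subsetI)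
    then show "continuous_on Q T" unfolding T_def by (intro continuous_intros)
    show "S (T x) = x" if "x \<in> Q" for x
      unfolding S_def using inj that by simp
    show "(T has_derivative ?T') (at ?x)"
      unfolding T_def using H_der[OF Q_\<Omega>[OF xQ]] by (auto intro!: derivative_eq_intros)
    show "?T' \<circ> ?S' = id"
    proof
      fix k
      have nz: "g ?x \<bullet> b \<noteq> 0" by (rule Q_nonzero[OF xQ])
      have Sb: "?S' k \<bullet> b = ?w k" by (simp add: inner_add_left inner_diff_left)
      have "g ?x \<bullet> ?S' k = g ?x \<bullet> (k - (k \<bullet> b) *\<^sub>R b) + ?w k * (g ?x \<bullet> b)"
        by (simp only: inner_add_right inner_scaleR_right)
      also have "\<dots> = k \<bullet> b" using nz by simp
      finally have gS: "g ?x \<bullet> ?S' k = k \<bullet> b" .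
      show "(?T' \<circ> ?S') k = id k"
        unfolding o_def gS Sb by (simp add: algebra_simps)
    qed
  qed
  moreover have "T ?x = y - (y \<bullet> b) *\<^sub>R b + E *\<^sub>R b"
    using height(2)[OF y] yb by (simp add: T_def inner_add_left algebra_simps)
  ultimately have dS: "(S has_derivative ?S') (at (y - (y \<bullet> b) *\<^sub>R b + E *\<^sub>R b))" by simp
  \<comment> \<open>Over \<open>y\<close> in the hyperplane the inverse map at level
    \<open>E\<close> returns the point of the graph. Projecting \<open>y\<close> first makes the
    derivative annihilate \<open>b\<close>, in agreement with \<open>slope\<close>.\<close>
  have "((\<lambda>y. y - (y \<bullet> b) *\<^sub>R b + E *\<^sub>R b) has_derivative (\<lambda>h. h - (h \<bullet> b) *\<^sub>R b)) (at y)"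
    by (auto intro!: derivative_eq_intros)
  from has_derivative_inner_left[OF has_derivative_compose[OF this dS], of b]
  have "((\<lambda>y. S (y - (y \<bullet> b) *\<^sub>R b + E *\<^sub>R b) \<bullet> b) has_derivative
      (\<lambda>h. ?S' (h - (h \<bullet> b) *\<^sub>R b) \<bullet> b)) (at y)" .
  moreover have "?S' (h - (h \<bullet> b) *\<^sub>R b) \<bullet> b = slope ?x \<bullet> h" for h
  proof -
    define k where "k = h - (h \<bullet> b) *\<^sub>R b"
    have kb: "k \<bullet> b = 0" by (simp add: k_def inner_diff_left)
    have "?S' k \<bullet> b = - ((g ?x \<bullet> k) / (g ?x \<bullet> b))"
      using kb by (simp add: inner_add_left inner_diff_left)
    also have "g ?x \<bullet> k = (g ?x - (g ?x \<bullet> b) *\<^sub>R b) \<bullet> h"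
      by (simp add: k_def inner_diff_left inner_diff_right inner_commute[of b h] mult.commute)
    also have "- (((g ?x - (g ?x \<bullet> b) *\<^sub>R b) \<bullet> h) / (g ?x \<bullet> b)) = slope ?x \<bullet> h"
      by (simp add: slope_def)
    finally show ?thesis by (simp only: k_def)
  qed
  ultimately have "((\<lambda>y. S (y - (y \<bullet> b) *\<^sub>R b + E *\<^sub>R b) \<bullet> b) has_derivative (\<lambda>h. slope ?x \<bullet> h)) (at y)"
    by simp
  then have d: "((\<lambda>y. S (y - (y \<bullet> b) *\<^sub>R b + E *\<^sub>R b) \<bullet> b) has_derivative (\<lambda>h. slope ?x \<bullet> h)) (at y within {y. y \<bullet> b = 0})"
    by (rule has_derivative_at_withinI)
  have "0 < \<rho> - norm (y - y0)" using y by (simp add: base_def)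
  then show ?thesis
  proof (rule has_derivative_transform_within[OF d])
    show "y \<in> {y. y \<bullet> b = 0}" using yb by simp
    fix v assume v: "v \<in> {y. y \<bullet> b = 0}" "dist v y < \<rho> - norm (y - y0)"
    have "norm (v - y0) \<le> dist v y + norm (y - y0)"
      using dist_triangle[of v y0 y] by (simp add: dist_norm)
    then have vb: "v \<in> base" using v by (simp add: base_def)
    have "T (v + height v *\<^sub>R b) = v - (v \<bullet> b) *\<^sub>R b + E *\<^sub>R b"
      using height(2)[OF vb] v by (simp add: T_def inner_add_left algebra_simps)
    then have "S (v - (v \<bullet> b) *\<^sub>R b + E *\<^sub>R b) = v + height v *\<^sub>R b"
      unfolding S_def using inv_into_f_f[OF inj graph_in_Q[OF vb]] by simp
    then show "S (v - (v \<bullet> b) *\<^sub>R b + E *\<^sub>R b) \<bullet> b = height v"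
      using v by (simp add: inner_add_left)
  qed
qed

lemma height_cont: "continuous_on base height"
  unfolding continuous_on_eq_continuous_within
proof
  fix y assume y: "y \<in> base"
  have "continuous (at y within {y. y \<bullet> b = 0}) height"
    by (rule has_derivative_continuous[OF height_derivative[OF y]])
  then show "continuous (at y within base) height"
    by (rule continuous_within_subset) (auto simp: base_def)
qed

lemma slope_cont: "continuous_on base (\<lambda>y. slope (y + height y *\<^sub>R b))"
proof -
  have "continuous_on base (\<lambda>y. g (y + height y *\<^sub>R b))"
    by (rule continuous_on_compose2[OF g_cont])
      (use graph_in_Q Q_\<Omega> in \<open>auto intro!: continuous_intros height_cont\<close>)
  then show ?thesis
    unfolding slope_def using Q_nonzero[OF graph_in_Q] by (intro continuous_intros) auto
qed

lemma height_C1: "C1_on_hyperplane b base height (\<lambda>y. slope (y + height y *\<^sub>R b))"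
  unfolding C1_on_hyperplane_def
proof (intro conjI ballI slope_cont height_derivative)
  have "base = {y. y \<bullet> b = 0} \<inter> ball y0 \<rho>"
    by (auto simp: base_def dist_norm norm_minus_commute)
  then show "openin (top_of_set {y. y \<bullet> b = 0}) base" by (auto intro: openin_open_Int)
  show "slope (y + height y *\<^sub>R b) \<bullet> b = 0" for y by (simp add: slope_def inner_diff_left)
qed

text \<open>Pythagoras, since the component of \<open>g x\<close> along \<open>b\<close> is
  \<open>g x \<bullet> b\<close>. In this form the factor \<open>norm (g x)\<close> of the area
  element cancels against the density of \<open>\<mu>\<close>.\<close>

lemma area_element:
  assumes "x \<in> Q"
  shows "sqrt (1 + (norm (slope x))\<^sup>2) = norm (g x) / \<bar>g x \<bullet> b\<bar>"
proof -
  have nz: "g x \<bullet> b \<noteq> 0" by (rule Q_nonzero[OF assms])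
  have "(norm (g x - (g x \<bullet> b) *\<^sub>R b))\<^sup>2 = (norm (g x))\<^sup>2 - (g x \<bullet> b)\<^sup>2"
    unfolding power2_norm_eq_inner
    by (simp add: inner_diff_left inner_diff_right power2_eq_square inner_commute[of b "g x"])
  moreover have "(norm (slope x))\<^sup>2 = (norm (g x - (g x \<bullet> b) *\<^sub>R b))\<^sup>2 / (g x \<bullet> b)\<^sup>2"
    by (simp add: slope_def power_mult_distrib power_divide)
  ultimately have "1 + (norm (slope x))\<^sup>2 = 1 + ((norm (g x))\<^sup>2 - (g x \<bullet> b)\<^sup>2) / (g x \<bullet> b)\<^sup>2"
    by (simp only:)
  also have "\<dots> = (norm (g x))\<^sup>2 / (g x \<bullet> b)\<^sup>2"
    using nz by (simp add: diff_divide_distrib)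
  also have "\<dots> = (norm (g x) / \<bar>g x \<bullet> b\<bar>)\<^sup>2" by (simp add: power_divide)
  finally have "1 + (norm (slope x))\<^sup>2 = (norm (g x) / \<bar>g x \<bullet> b\<bar>)\<^sup>2" .
  then show ?thesis by (simp add: real_sqrt_unique)
qed

lemma base_borel [measurable]: "base \<in> sets borel"
proof -
  have "base = {y. y \<bullet> b = 0} \<inter> {y. norm (y - y0) < \<rho>}" by (auto simp: base_def)
  then show ?thesis by simp
qed

lemma sets_hyperplane [measurable_cong, simp]: "sets (hyperplane_lborel b) = sets borel"
  by (simp add: hyperplane_lborel_def)

definition graph_map :: "'a \<Rightarrow> 'a" where
  "graph_map y = (if y \<in> base then y + height y *\<^sub>R b else 0)"

lemma graph_map_borel [measurable]: "graph_map \<in> borel_measurable borel"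
  unfolding graph_map_def
  by (intro borel_measurable_continuous_on_if continuous_intros height_cont) auto

lemma slope_graph_borel: "(\<lambda>y. if y \<in> base then slope (y + height y *\<^sub>R b) else 0) \<in> borel_measurable borel"
  by (intro borel_measurable_continuous_on_if continuous_intros slope_cont) auto

text \<open>\<open>surface_measure_on\<close> speaks of measures of subsets of the graph. To
  integrate, it is first restated as an equality between \<open>\<sigma>\<close> cut down to the
  graph and an image measure.\<close>

lemma \<sigma>_graph:
  assumes F [measurable]: "F \<in> borel_measurable borel" and zero: "\<And>x. x \<notin> Q \<Longrightarrow> F x = 0"
  shows "(\<integral>\<^sup>+x. F x \<partial>\<sigma>) = (\<integral>\<^sup>+y. indicator base y * ennreal (norm (g (graph_map y)) / \<bar>g (graph_map y) \<bullet> b\<bar>)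
      * F (graph_map y) \<partial>hyperplane_lborel b)"
proof -
  let ?G = "{x \<in> Q. H x = E}"
  let ?w = "\<lambda>y. indicator base y * ennreal (sqrt (1 + (norm (if y \<in> base then slope (y + height y *\<^sub>R b) else 0))\<^sup>2))"
  have G_eq: "?G = Q \<inter> {x \<in> \<Omega>. H x = E}" using Q_\<Omega> by auto
  then have G_meas [measurable]: "?G \<in> sets borel" by simp
  have [measurable]: "(\<lambda>y. if y \<in> base then slope (y + height y *\<^sub>R b) else 0) \<in> borel_measurable borel"
    by (rule slope_graph_borel)
  have w [measurable]: "?w \<in> borel_measurable borel" by measurable
  have "density \<sigma> (indicator ?G) = distr (density (hyperplane_lborel b) ?w) borel graph_map"
  proof (rule measure_eqI)
    fix A assume "A \<in> sets (density \<sigma> (indicator ?G))"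
    then have A [measurable]: "A \<in> sets borel" by simp
    have "emeasure (density \<sigma> (indicator ?G)) A = emeasure \<sigma> (?G \<inter> A)"
    proof -
      have "emeasure (density \<sigma> (indicator ?G)) A = (\<integral>\<^sup>+x. indicator ?G x * indicator A x \<partial>\<sigma>)"
        by (simp only: emeasure_density borel_measurable_indicator sets_\<sigma> G_meas A)
      also have "\<dots> = (\<integral>\<^sup>+x. indicator (?G \<inter> A) x \<partial>\<sigma>)"
        by (simp only: indicator_inter_arith)
      also have "\<dots> = emeasure \<sigma> (?G \<inter> A)" by (rule nn_integral_indicator) (simp add: sets.Int[OF G_meas A])
      finally show ?thesis .
    qed
    also have "\<dots> = (\<integral>\<^sup>+y\<in>base. ennreal (sqrt (1 + (norm (slope (y + height y *\<^sub>R b)))\<^sup>2)) *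
        indicator (?G \<inter> A) (y + height y *\<^sub>R b) \<partial>hyperplane_lborel b)"
    proof -
      have sub: "(\<lambda>y. y + height y *\<^sub>R b) ` base \<subseteq> {x \<in> \<Omega>. H x = E}"
        unfolding graph_eq using Q_\<Omega> by auto
      have "?G \<inter> A \<in> sets borel" by measurable
      moreover have "?G \<inter> A \<subseteq> (\<lambda>y. y + height y *\<^sub>R b) ` base" unfolding graph_eq by auto
      ultimately show ?thesis
        using surface b height_C1 sub unfolding surface_measure_on_def by blast
    qed
    also have "\<dots> = (\<integral>\<^sup>+y. ?w y * indicator (graph_map -` A) y \<partial>hyperplane_lborel b)"
    proof (rule nn_integral_cong)
      fix y
      show "ennreal (sqrt (1 + (norm (slope (y + height y *\<^sub>R b)))\<^sup>2)) *
          indicator (?G \<inter> A) (y + height y *\<^sub>R b) * indicator base y = ?w y * indicator (graph_map -` A) y"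
        using graph_eq by (auto simp: indicator_def graph_map_def)
    qed
    also have "\<dots> = emeasure (distr (density (hyperplane_lborel b) ?w) borel graph_map) A"
    proof -
      have "graph_map -` A \<in> sets borel" by (rule measurable_sets_borel[OF graph_map_borel A])
      then show ?thesis
        by (subst emeasure_distr) (auto simp: emeasure_density space_density hyperplane_lborel_def)
    qed
    finally show "emeasure (density \<sigma> (indicator ?G)) A = emeasure (distr (density (hyperplane_lborel b) ?w) borel graph_map) A" .
  qed simp
  then have eq: "(\<integral>\<^sup>+x. F x \<partial>density \<sigma> (indicator ?G)) = (\<integral>\<^sup>+x. F x \<partial>distr (density (hyperplane_lborel b) ?w) borel graph_map)"
    by (rule arg_cong[where f = "\<lambda>N. integral\<^sup>N N F"])
  have "emeasure \<sigma> (- {x \<in> \<Omega>. H x = E}) = 0"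
    using surface unfolding surface_measure_on_def by (elim conjE)
  then have "- {x \<in> \<Omega>. H x = E} \<in> null_sets \<sigma>"
    using borel_comp[OF level_borel] by (intro null_setsI) auto
  then have "AE x in \<sigma>. x \<notin> - {x \<in> \<Omega>. H x = E}" by (rule AE_not_in)
  then have "(\<integral>\<^sup>+x. F x \<partial>\<sigma>) = (\<integral>\<^sup>+x. indicator ?G x * F x \<partial>\<sigma>)"
    by (intro nn_integral_cong_AE) (auto simp: indicator_def zero)
  also have "\<dots> = (\<integral>\<^sup>+x. F x \<partial>density \<sigma> (indicator ?G))"
    by (subst nn_integral_density) auto
  also have "\<dots> = (\<integral>\<^sup>+y. ?w y * F (graph_map y) \<partial>hyperplane_lborel b)"
    unfolding eq by (subst nn_integral_distr) (auto simp: nn_integral_density)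
  also have "\<dots> = (\<integral>\<^sup>+y. indicator base y * ennreal (norm (g (graph_map y)) / \<bar>g (graph_map y) \<bullet> b\<bar>)
      * F (graph_map y) \<partial>hyperplane_lborel b)"
    by (rule nn_integral_cong) (auto simp: indicator_def graph_map_def area_element[OF graph_in_Q])
  finally show ?thesis .
qed

text \<open>After the cancellation of \<open>norm (g x)\<close> the weight is
  \<open>1 / \<bar>g x \<bullet> b\<bar>\<close>, the same that a thin shell leaves on a line
  parallel to \<open>b\<close>.\<close>

lemma \<mu>_graph:
  assumes F [measurable]: "F \<in> borel_measurable borel" and zero: "\<And>x. x \<notin> Q \<Longrightarrow> F x = 0"
  shows "(\<integral>\<^sup>+x. F x \<partial>\<mu>) = (\<integral>\<^sup>+y. indicator base y * (ennreal (1 / \<bar>g (graph_map y) \<bullet> b\<bar>) * F (graph_map y))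
      \<partial>hyperplane_lborel b)"
proof -
  have "(\<integral>\<^sup>+x. F x \<partial>\<mu>) = (\<integral>\<^sup>+x. indicator \<Omega> x * ennreal (1 / norm (g x)) * F x \<partial>\<sigma>)"
    unfolding \<mu>_def by (subst nn_integral_density) auto
  also have "\<dots> = (\<integral>\<^sup>+y. indicator base y * ennreal (norm (g (graph_map y)) / \<bar>g (graph_map y) \<bullet> b\<bar>)
      * (indicator \<Omega> (graph_map y) * ennreal (1 / norm (g (graph_map y))) * F (graph_map y)) \<partial>hyperplane_lborel b)"
    by (rule \<sigma>_graph) (use zero in auto)
  also have "\<dots> = (\<integral>\<^sup>+y. indicator base y * (ennreal (1 / \<bar>g (graph_map y) \<bullet> b\<bar>) * F (graph_map y)) \<partial>hyperplane_lborel b)"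
  proof (rule nn_integral_cong)
    fix y
    show "indicator base y * ennreal (norm (g (graph_map y)) / \<bar>g (graph_map y) \<bullet> b\<bar>)
      * (indicator \<Omega> (graph_map y) * ennreal (1 / norm (g (graph_map y))) * F (graph_map y))
      = indicator base y * (ennreal (1 / \<bar>g (graph_map y) \<bullet> b\<bar>) * F (graph_map y))"
    proof (cases "y \<in> base")
      case True
      have x: "graph_map y \<in> Q" using graph_in_Q[OF True] True by (simp add: graph_map_def)
      have n: "norm (g (graph_map y)) \<noteq> 0" using Q_nonzero[OF x] by auto
      have "ennreal (norm (g (graph_map y)) / \<bar>g (graph_map y) \<bullet> b\<bar>) * ennreal (1 / norm (g (graph_map y)))
          = ennreal (norm (g (graph_map y)) / \<bar>g (graph_map y) \<bullet> b\<bar> * (1 / norm (g (graph_map y))))"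
        by (rule ennreal_mult[symmetric]) auto
      also have "norm (g (graph_map y)) / \<bar>g (graph_map y) \<bullet> b\<bar> * (1 / norm (g (graph_map y))) = 1 / \<bar>g (graph_map y) \<bullet> b\<bar>"
        using n by simp
      finally show ?thesis using True Q_\<Omega>[OF x] by (simp add: mult.assoc[symmetric])
    qed simp
  qed
  finally show ?thesis .
qed

text \<open>\<open>Q\<close> is the product of \<open>base\<close> with an interval of length
  \<open>2 * r\<close>, and it has finite volume because it is bounded.\<close>

lemma emeasure_base_finite: "emeasure (hyperplane_lborel b) base < \<infinity>"
proof -
  let ?B = "{x. norm (x - (x \<bullet> b) *\<^sub>R b - y0) < \<rho> \<and> \<bar>x \<bullet> b - z0\<bar> < r}"
  have "ennreal (2 * r) * emeasure (hyperplane_lborel b) base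
      = (\<integral>\<^sup>+y. ennreal (2 * r) * indicator base y \<partial>hyperplane_lborel b)"
    by (simp add: nn_integral_cmult_indicator)
  also have "\<dots> \<le> (\<integral>\<^sup>+y. (\<integral>\<^sup>+z. indicator Q (y + z *\<^sub>R b) \<partial>lborel) \<partial>hyperplane_lborel b)"
  proof (rule nn_integral_mono)
    fix y
    show "ennreal (2 * r) * indicator base y \<le> (\<integral>\<^sup>+z. indicator Q (y + z *\<^sub>R b) \<partial>lborel)"
    proof (cases "y \<in> base")
      case True
      then have "y \<bullet> b = 0" by (simp add: base_def)
      have "(\<integral>\<^sup>+z. indicator Q (y + z *\<^sub>R b) \<partial>lborel) = (\<integral>\<^sup>+z. indicator {z0 - r<..<z0 + r} z \<partial>lborel)"
      proof (rule nn_integral_cong)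
        fix z
        have "y + z *\<^sub>R b \<in> Q \<longleftrightarrow> z \<in> {z0 - r<..<z0 + r}"
          using in_Q[OF \<open>y \<bullet> b = 0\<close>, of z] True by auto
        then show "(indicator Q (y + z *\<^sub>R b) :: ennreal) = indicator {z0 - r<..<z0 + r} z"
          by (simp only: indicator_def)
      qed
      also have "\<dots> = ennreal (2 * r)" using pos by simp
      finally show ?thesis using True by (simp only: indicator_simps mult_1_right order_refl)
    qed simp
  qed
  also have "\<dots> = emeasure lborel Q"
    by (subst nn_integral_lborel_split[OF b, symmetric]) auto
  also have "\<dots> < \<infinity>" by (rule emeasure_bounded_finite[OF bounded_Q])
  finally show ?thesis using pos by (auto simp: ennreal_mult_less_top)
qed

text \<open>The density \<open>1 / \<bar>g x \<bullet> b\<bar>\<close> is at most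
  \<open>1 / \<kappa>\<close>. Finiteness is what later allows passing from open sets to Borel
  sets.\<close>

lemma \<mu>_Q_finite: "emeasure \<mu> Q < \<infinity>"
proof -
  have "emeasure \<mu> Q = (\<integral>\<^sup>+x. indicator Q x \<partial>\<mu>)" by simp
  also have "\<dots> = (\<integral>\<^sup>+y. indicator base y * (ennreal (1 / \<bar>g (graph_map y) \<bullet> b\<bar>) * indicator Q (graph_map y)) \<partial>hyperplane_lborel b)"
    by (rule \<mu>_graph) auto
  also have "\<dots> \<le> (\<integral>\<^sup>+y. ennreal (1 / \<kappa>) * indicator base y \<partial>hyperplane_lborel b)"
  proof (rule nn_integral_mono)
    fix y
    show "indicator base y * (ennreal (1 / \<bar>g (graph_map y) \<bullet> b\<bar>) * indicator Q (graph_map y)) \<le> ennreal (1 / \<kappa>) * indicator base y"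
    proof (cases "y \<in> base")
      case True
      have x: "graph_map y \<in> Q" using graph_in_Q[OF True] True by (simp add: graph_map_def)
      have "1 / \<bar>g (graph_map y) \<bullet> b\<bar> \<le> 1 / \<kappa>"
        using Q_steep[OF x] Q_abs[OF x] pos(1) by (intro divide_left_mono) auto
      then show ?thesis using True x by (simp add: ennreal_leI)
    qed simp
  qed
  also have "\<dots> = ennreal (1 / \<kappa>) * emeasure (hyperplane_lborel b) base"
    by (simp add: nn_integral_cmult_indicator)
  also have "\<dots> < \<infinity>" using emeasure_base_finite by (simp add: ennreal_mult_less_top)
  finally show ?thesis .
qed

text \<open>\<open>hyperplane_lborel\<close> lives on the whole space, so membership in the
  hyperplane is available almost everywhere only.\<close>

lemma AE_hyperplane: "AE y in hyperplane_lborel b. y \<bullet> b = 0"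
proof -
  have "(\<Sum>c\<in>Basis - {b}. f c *\<^sub>R c) \<bullet> b = 0" for f
    using b by (simp add: inner_sum_left inner_not_same_Basis)
  then show ?thesis
    unfolding hyperplane_lborel_def by (subst AE_distr_iff) auto
qed

text \<open>A local co-area formula: slice the shell by lines parallel to \<open>b\<close>, use the
  one-dimensional limit on each, and dominate by \<open>1 / \<kappa>\<close> on
  \<open>base\<close>.\<close>

lemma shell_limit:
  fixes f :: "'a \<Rightarrow> real"
  assumes cont: "continuous_on Q f" and f01: "\<And>x. 0 \<le> f x" "\<And>x. f x \<le> 1"
    and zero: "\<And>x. x \<notin> Q \<Longrightarrow> f x = 0"
  shows "(\<lambda>n. ennreal (real (Suc n) / 2) * (\<integral>\<^sup>+x. ennreal (f x) * indicator (shell n) x \<partial>lborel))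
    \<longlonglongrightarrow> (\<integral>\<^sup>+x. ennreal (f x) \<partial>\<mu>)"
proof -
  have "(\<lambda>x. if x \<in> Q then f x else 0) \<in> borel_measurable borel"
    using cont by (intro borel_measurable_continuous_on_if) auto
  moreover have "(\<lambda>x. if x \<in> Q then f x else 0) = f" using zero by auto
  ultimately have f_meas [measurable]: "f \<in> borel_measurable borel" by simp
  define J where "J = (\<lambda>n y. ennreal (real (Suc n) / 2) *
      (\<integral>\<^sup>+z. ennreal (f (y + z *\<^sub>R b)) * indicator (shell n) (y + z *\<^sub>R b) \<partial>lborel))"
  define J' where "J' = (\<lambda>y. indicator base y * (ennreal (1 / \<bar>g (graph_map y) \<bullet> b\<bar>) * ennreal (f (graph_map y))))"
  have J_meas [measurable]: "J n \<in> borel_measurable borel" for n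
    unfolding J_def by measurable
  have [measurable]: "(\<lambda>x. if x \<in> \<Omega> then g x else 0) \<in> borel_measurable borel"
    by (rule borel_on_\<Omega>[OF g_cont])
  have "(\<lambda>y. indicator base y * (ennreal (1 / \<bar>(if graph_map y \<in> \<Omega> then g (graph_map y) else 0) \<bullet> b\<bar>) * ennreal (f (graph_map y)))) \<in> borel_measurable borel"
    by measurable
  moreover have "(\<lambda>y. indicator base y * (ennreal (1 / \<bar>(if graph_map y \<in> \<Omega> then g (graph_map y) else 0) \<bullet> b\<bar>) * ennreal (f (graph_map y)))) = J'"
    using Q_\<Omega>[OF graph_in_Q] by (auto simp: J'_def graph_map_def indicator_def)
  ultimately have J'_meas [measurable]: "J' \<in> borel_measurable borel" by simp
  have J_int: "(\<integral>\<^sup>+y. J n y \<partial>hyperplane_lborel b) = ennreal (real (Suc n) / 2) * (\<integral>\<^sup>+x. ennreal (f x) * indicator (shell n) x \<partial>lborel)" for n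
    unfolding J_def by (subst nn_integral_lborel_split[OF b]) (auto simp: nn_integral_cmult)
  \<comment> \<open>The sign \<open>s\<close> makes \<open>s * (H - E)\<close> increasing along the
    line, as \<open>thin_shell_1d\<close> expects.\<close>
  have line: "J n y = ennreal (real (Suc n) / 2) *
      (\<integral>\<^sup>+z. ennreal (f (y + z *\<^sub>R b)) * indicator {z. z0 - r < z \<and> z < z0 + r \<and> \<bar>s * (H (y + z *\<^sub>R b) - E)\<bar> < 1 / real (Suc n)} z \<partial>lborel)"
    if y: "y \<in> base" for n y
  proof -
    have "ennreal (f (y + z *\<^sub>R b)) * indicator (shell n) (y + z *\<^sub>R b)
      = ennreal (f (y + z *\<^sub>R b)) * indicator {z. z0 - r < z \<and> z < z0 + r \<and> \<bar>s * (H (y + z *\<^sub>R b) - E)\<bar> < 1 / real (Suc n)} z" for z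
    proof (cases "y + z *\<^sub>R b \<in> Q")
      case True
      then have "\<bar>z - z0\<bar> < r" using in_Q[of y z] y by (auto simp: base_def)
      then have "z0 - r < z" "z < z0 + r" by auto
      moreover have "\<bar>s * (H (y + z *\<^sub>R b) - E)\<bar> = \<bar>H (y + z *\<^sub>R b) - E\<bar>" using s by (simp add: abs_mult)
      ultimately show ?thesis using Q_\<Omega>[OF True] by (simp add: indicator_def shell_def)
    qed (simp add: zero)
    then show ?thesis unfolding J_def by simp
  qed
  have line_out: "J n y = 0" if "y \<bullet> b = 0" "y \<notin> base" for n y
    using in_Q[OF that(1)] that(2) by (simp add: J_def zero)
  have seg: "y + z *\<^sub>R b \<in> Q" if "y \<in> base" "z0 - r < z" "z < z0 + r" for y z
    using in_Q[of y z] that by (auto simp: base_def)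
  have der: "((\<lambda>z. s * (H (y + z *\<^sub>R b) - E)) has_real_derivative s * (g (y + z *\<^sub>R b) \<bullet> b)) (at z)"
    if "y \<in> base" "z0 - r < z" "z < z0 + r" for y z
    using line_der[OF Q_\<Omega>[OF seg[OF that]]] by (auto intro!: derivative_eq_intros)
  have lim: "(\<lambda>n. J n y) \<longlonglongrightarrow> J' y" if yb: "y \<bullet> b = 0" for y
  proof (cases "y \<in> base")
    case False
    then show ?thesis using line_out[OF yb] by (simp add: J'_def)
  next
    case True
    let ?c = "height y"
    have c: "z0 - r < ?c" "?c < z0 + r" using height(1)[OF True] by auto
    have Qc: "y + ?c *\<^sub>R b \<in> Q" by (rule graph_in_Q[OF True])
    have cont_line: "isCont (\<lambda>z. F (y + z *\<^sub>R b)) ?c" if "isCont F (y + ?c *\<^sub>R b)" for F :: "'a \<Rightarrow> 'c::topological_space"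
      by (rule isCont_o2[where f = "\<lambda>z. y + z *\<^sub>R b" and g = F]) (use that in \<open>auto intro!: continuous_intros\<close>)
    have "(\<lambda>n. J n y) \<longlonglongrightarrow> ennreal (f (y + ?c *\<^sub>R b) / (s * (g (y + ?c *\<^sub>R b) \<bullet> b)))"
      unfolding line[OF True]
    proof (rule thin_shell_1d[OF c _ der[OF True] pos(1)])
      show "s * (H (y + ?c *\<^sub>R b) - E) = 0" using height(2)[OF True] by simp
      show "\<kappa> \<le> s * (g (y + z *\<^sub>R b) \<bullet> b)" if "z0 - r < z" "z < z0 + r" for z
        by (rule Q_steep[OF seg[OF True that]])
      have "isCont g (y + ?c *\<^sub>R b)"
        using g_cont Q_\<Omega>[OF Qc] open_\<Omega> by (simp add: continuous_on_eq_continuous_at)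
      from cont_line[OF this]
      show "isCont (\<lambda>z. s * (g (y + z *\<^sub>R b) \<bullet> b)) ?c" by (intro continuous_intros)
      have "isCont f (y + ?c *\<^sub>R b)"
        using cont Qc open_Q by (simp add: continuous_on_eq_continuous_at)
      from cont_line[OF this] show "isCont (\<lambda>z. f (y + z *\<^sub>R b)) ?c" .
    qed (use f01 in auto)
    moreover have "ennreal (f (y + ?c *\<^sub>R b) / (s * (g (y + ?c *\<^sub>R b) \<bullet> b))) = J' y"
      using True Q_abs[OF Qc] f01(1)[of "y + ?c *\<^sub>R b"] by (simp add: J'_def graph_map_def ennreal_mult[symmetric])
    ultimately show ?thesis by simp
  qed
  \<comment> \<open>Since \<open>s * (H - E)\<close> grows at rate at least \<open>\<kappa>\<close>,
    the shell meets the line in a set of length at most \<open>2 * \<eta> / \<kappa>\<close>, and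
    \<open>f\<close> is at most 1.\<close>
  have bound: "J n y \<le> ennreal (1 / \<kappa>) * indicator base y" if yb: "y \<bullet> b = 0" for n y
  proof (cases "y \<in> base")
    case False
    then show ?thesis using line_out[OF yb] by simp
  next
    case True
    let ?S = "{z. z0 - r < z \<and> z < z0 + r \<and> \<bar>s * (H (y + z *\<^sub>R b) - E)\<bar> < 1 / real (Suc n)}"
    let ?\<phi> = "\<lambda>z. s * (H (y + z *\<^sub>R b) - E)"
    let ?c = "height y"
    define \<eta> where "\<eta> = 1 / real (Suc n)"
    have \<eta>: "0 < \<eta>" by (simp add: \<eta>_def)
    have c: "z0 - r < ?c" "?c < z0 + r" using height(1)[OF True] by auto
    have c0: "?\<phi> ?c = 0" using height(2)[OF True] by simp
    have incr: "\<kappa> * (w - z) \<le> ?\<phi> w - ?\<phi> z" if zw: "z0 - r < z" "w < z0 + r" "z < w" for z w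
    proof -
      have "\<exists>\<zeta>. z < \<zeta> \<and> \<zeta> < w \<and> ?\<phi> w - ?\<phi> z = (w - z) * (s * (g (y + \<zeta> *\<^sub>R b) \<bullet> b))"
        by (rule MVT2[OF zw(3)]) (use der[OF True] zw in auto)
      then obtain \<zeta> where \<zeta>: "z < \<zeta>" "\<zeta> < w" "?\<phi> w - ?\<phi> z = (w - z) * (s * (g (y + \<zeta> *\<^sub>R b) \<bullet> b))" by blast
      have "\<kappa> \<le> s * (g (y + \<zeta> *\<^sub>R b) \<bullet> b)" using Q_steep[OF seg[OF True]] \<zeta> zw by auto
      then have "(w - z) * \<kappa> \<le> (w - z) * (s * (g (y + \<zeta> *\<^sub>R b) \<bullet> b))"
        using zw by (intro mult_left_mono) auto
      then show ?thesis using \<zeta>(3) by (simp add: mult.commute)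
    qed
    have sub: "?S \<subseteq> {?c - \<eta> / \<kappa>..?c + \<eta> / \<kappa>}"
    proof
      fix z assume z: "z \<in> ?S"
      have "\<kappa> * \<bar>z - ?c\<bar> \<le> \<bar>?\<phi> z\<bar>"
        using incr[of ?c z] incr[of z ?c] z c c0 by (cases z ?c rule: linorder_cases) auto
      also have "\<dots> < \<eta>" using z by (simp add: \<eta>_def)
      finally have "\<bar>z - ?c\<bar> < \<eta> / \<kappa>" using pos(1) by (simp add: field_simps)
      then show "z \<in> {?c - \<eta> / \<kappa>..?c + \<eta> / \<kappa>}" by auto
    qed
    have "J n y \<le> ennreal (1 / (2 * \<eta>)) * (\<integral>\<^sup>+z. indicator {?c - \<eta> / \<kappa>..?c + \<eta> / \<kappa>} z \<partial>lborel)"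
      unfolding line[OF True]
    proof (rule mult_mono)
      show "(\<integral>\<^sup>+z. ennreal (f (y + z *\<^sub>R b)) * indicator ?S z \<partial>lborel) \<le> (\<integral>\<^sup>+z. indicator {?c - \<eta> / \<kappa>..?c + \<eta> / \<kappa>} z \<partial>lborel)"
      proof (rule nn_integral_mono)
        fix z
        show "ennreal (f (y + z *\<^sub>R b)) * indicator ?S z \<le> indicator {?c - \<eta> / \<kappa>..?c + \<eta> / \<kappa>} z"
        proof (cases "z \<in> ?S")
          case True
          then have "z \<in> {?c - \<eta> / \<kappa>..?c + \<eta> / \<kappa>}" using sub by blast
          then show ?thesis using True f01 by simp
        qed simp
      qed
    qed (auto simp: \<eta>_def)
    also have "\<dots> = ennreal (1 / (2 * \<eta>)) * ennreal (2 * (\<eta> / \<kappa>))"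
      using \<eta> pos(1) by simp
    also have "\<dots> = ennreal (1 / (2 * \<eta>) * (2 * (\<eta> / \<kappa>)))"
      using \<eta> pos(1) by (intro ennreal_mult[symmetric]) auto
    also have "1 / (2 * \<eta>) * (2 * (\<eta> / \<kappa>)) = 1 / \<kappa>" using \<eta> by simp
    finally show ?thesis using True by simp
  qed
  have "(\<lambda>n. \<integral>\<^sup>+y. J n y \<partial>hyperplane_lborel b) \<longlonglongrightarrow> (\<integral>\<^sup>+y. J' y \<partial>hyperplane_lborel b)"
  proof (rule nn_integral_dominated_convergence[where w = "\<lambda>y. ennreal (1 / \<kappa>) * indicator base y"])
    show "AE y in hyperplane_lborel b. J n y \<le> ennreal (1 / \<kappa>) * indicator base y" for n
      using AE_hyperplane by eventually_elim (rule bound)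
    show "AE y in hyperplane_lborel b. (\<lambda>n. J n y) \<longlonglongrightarrow> J' y"
      using AE_hyperplane by eventually_elim (rule lim)
    show "(\<integral>\<^sup>+y. ennreal (1 / \<kappa>) * indicator base y \<partial>hyperplane_lborel b) < \<infinity>"
      using emeasure_base_finite by (simp add: nn_integral_cmult_indicator ennreal_mult_less_top)
  qed auto
  moreover have "(\<integral>\<^sup>+y. J' y \<partial>hyperplane_lborel b) = (\<integral>\<^sup>+x. ennreal (f x) \<partial>\<mu>)"
    unfolding J'_def by (rule \<mu>_graph[symmetric]) (auto simp: zero)
  ultimately show ?thesis unfolding J_int by simp
qed

end

text \<open>Take a basis vector along which the gradient at \<open>p\<close> is non-zero. Along it
  \<open>s * (H - E)\<close> increases, so it is negative at \<open>z0 - r\<close> and positive at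
  \<open>z0 + r\<close>; by continuity this persists over nearby \<open>y\<close>, and the
  intermediate value theorem gives the crossing.\<close>

lemma (in level_set) chart_exists:
  assumes p: "p \<in> \<Omega>" "H p = E"
  obtains b y0 z0 s \<kappa> r \<rho> where "level_set_chart \<Omega> H g E \<sigma> b y0 z0 s \<kappa> r \<rho>"
    and "norm (p - (p \<bullet> b) *\<^sub>R b - y0) < \<rho>" "\<bar>p \<bullet> b - z0\<bar> < r"
proof -
  obtain b where b: "b \<in> Basis" "g p \<bullet> b \<noteq> 0"
    using regular[OF p] euclidean_all_zero_iff[of "g p"] by auto
  have bb: "b \<bullet> b = 1" using b by simp
  define s where "s = sgn (g p \<bullet> b)"
  define \<kappa> where "\<kappa> = \<bar>g p \<bullet> b\<bar> / 2"
  have s: "\<bar>s\<bar> = 1" using b by (simp add: s_def abs_sgn_eq)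
  have \<kappa>: "0 < \<kappa>" using b by (simp add: \<kappa>_def)
  have "s * (g p \<bullet> b) = 2 * \<kappa>" by (simp add: s_def \<kappa>_def sgn_if)
  then have sp: "\<kappa> < s * (g p \<bullet> b)" using \<kappa> by simp
  have "open (\<Omega> \<inter> (\<lambda>x. s * (g x \<bullet> b)) -` {\<kappa><..})"
    by (intro continuous_open_preimage continuous_intros g_cont open_\<Omega> open_greaterThan)
  moreover have "p \<in> \<Omega> \<inter> (\<lambda>x. s * (g x \<bullet> b)) -` {\<kappa><..}" using p sp by simp
  ultimately obtain \<delta> where \<delta>: "0 < \<delta>" "ball p \<delta> \<subseteq> \<Omega> \<inter> (\<lambda>x. s * (g x \<bullet> b)) -` {\<kappa><..}"
    unfolding open_contains_ball by blast
  define z0 where "z0 = p \<bullet> b"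
  define y0 where "y0 = p - z0 *\<^sub>R b"
  \<comment> \<open>Small enough for the closed segment of radius \<open>r\<close> over a base point
    within \<open>\<delta> / 2\<close> to stay in the ball of radius
    \<open>\<delta>\<close>.\<close>
  define r where "r = \<delta> / 4"
  have r: "0 < r" using \<delta> by (simp add: r_def)
  have y0b: "y0 \<bullet> b = 0" by (simp add: y0_def z0_def inner_diff_left bb)
  have near: "y + z *\<^sub>R b \<in> \<Omega>" "\<kappa> < s * (g (y + z *\<^sub>R b) \<bullet> b)"
    if "norm (y - y0) < \<delta> / 2" "\<bar>z - z0\<bar> \<le> r" for y z
  proof -
    have eq: "y + z *\<^sub>R b - p = (y - y0) + (z - z0) *\<^sub>R b" by (simp add: y0_def algebra_simps)
    have "norm (y + z *\<^sub>R b - p) \<le> norm (y - y0) + norm ((z - z0) *\<^sub>R b)"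
      unfolding eq by (rule norm_triangle_ineq)
    also have "\<dots> < \<delta> / 2 + \<delta> / 2"
      using that b(1) \<delta>(1) by (intro add_strict_mono) (auto simp: r_def)
    finally have "y + z *\<^sub>R b \<in> ball p \<delta>" by (simp add: dist_norm norm_minus_commute)
    then show "y + z *\<^sub>R b \<in> \<Omega>" "\<kappa> < s * (g (y + z *\<^sub>R b) \<bullet> b)" using \<delta>(2) by auto
  qed
  have der: "((\<lambda>z. s * (H (y + z *\<^sub>R b) - E)) has_real_derivative s * (g (y + z *\<^sub>R b) \<bullet> b)) (at z)"
    if "y + z *\<^sub>R b \<in> \<Omega>" for y z
  proof -
    have "((\<lambda>z. y + z *\<^sub>R b) has_derivative (\<lambda>h. h *\<^sub>R b)) (at z)"
      by (auto intro!: derivative_eq_intros)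
    from has_derivative_compose[OF this H_der[OF that]]
    have "((\<lambda>z. H (y + z *\<^sub>R b)) has_real_derivative g (y + z *\<^sub>R b) \<bullet> b) (at z)"
      by (simp add: has_field_derivative_def mult_commute_abs)
    then show ?thesis by (auto intro!: derivative_eq_intros)
  qed
  have y0n: "norm (y0 - y0) < \<delta> / 2" using \<delta> by simp
  have c0: "s * (H (y0 + z0 *\<^sub>R b) - E) = 0" using p(2) by (simp add: y0_def)
  have up: "0 < s * (H (y0 + (z0 + r) *\<^sub>R b) - E)"
  proof -
    have "\<exists>\<zeta>. z0 < \<zeta> \<and> \<zeta> < z0 + r \<and> s * (H (y0 + (z0 + r) *\<^sub>R b) - E) - s * (H (y0 + z0 *\<^sub>R b) - E)
        = (z0 + r - z0) * (s * (g (y0 + \<zeta> *\<^sub>R b) \<bullet> b))"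
      by (rule MVT2) (use r in \<open>auto intro!: der near(1)[OF y0n]\<close>)
    then obtain \<zeta> where \<zeta>: "z0 < \<zeta>" "\<zeta> < z0 + r" "s * (H (y0 + (z0 + r) *\<^sub>R b) - E) = r * (s * (g (y0 + \<zeta> *\<^sub>R b) \<bullet> b))"
      using c0 by auto
    have "0 < s * (g (y0 + \<zeta> *\<^sub>R b) \<bullet> b)" using near(2)[OF y0n, of \<zeta>] \<zeta> \<kappa> by auto
    then show ?thesis unfolding \<zeta>(3) using r by simp
  qed
  have down: "s * (H (y0 + (z0 - r) *\<^sub>R b) - E) < 0"
  proof -
    have "\<exists>\<zeta>. z0 - r < \<zeta> \<and> \<zeta> < z0 \<and> s * (H (y0 + z0 *\<^sub>R b) - E) - s * (H (y0 + (z0 - r) *\<^sub>R b) - E)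
        = (z0 - (z0 - r)) * (s * (g (y0 + \<zeta> *\<^sub>R b) \<bullet> b))"
      by (rule MVT2) (use r in \<open>auto intro!: der near(1)[OF y0n]\<close>)
    then obtain \<zeta> where \<zeta>: "z0 - r < \<zeta>" "\<zeta> < z0" "- (s * (H (y0 + (z0 - r) *\<^sub>R b) - E)) = r * (s * (g (y0 + \<zeta> *\<^sub>R b) \<bullet> b))"
      using c0 by auto
    have "0 < s * (g (y0 + \<zeta> *\<^sub>R b) \<bullet> b)" using near(2)[OF y0n, of \<zeta>] \<zeta> \<kappa> by auto
    then have "0 < - (s * (H (y0 + (z0 - r) *\<^sub>R b) - E))" unfolding \<zeta>(3) using r by simp
    then show ?thesis by simp
  qed
  have "open (\<Omega> \<inter> (\<lambda>x. s * (H x - E)) -` {0<..})"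
    by (intro continuous_open_preimage continuous_intros H_cont open_\<Omega> open_greaterThan)
  moreover have "y0 + (z0 + r) *\<^sub>R b \<in> \<Omega> \<inter> (\<lambda>x. s * (H x - E)) -` {0<..}"
    using up near(1)[OF y0n, of "z0 + r"] r by auto
  ultimately obtain \<rho>1 where \<rho>1: "0 < \<rho>1" "ball (y0 + (z0 + r) *\<^sub>R b) \<rho>1 \<subseteq> \<Omega> \<inter> (\<lambda>x. s * (H x - E)) -` {0<..}"
    unfolding open_contains_ball by blast
  have "open (\<Omega> \<inter> (\<lambda>x. s * (H x - E)) -` {..<0})"
    by (intro continuous_open_preimage continuous_intros H_cont open_\<Omega> open_lessThan)
  moreover have "y0 + (z0 - r) *\<^sub>R b \<in> \<Omega> \<inter> (\<lambda>x. s * (H x - E)) -` {..<0}"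
    using down near(1)[OF y0n, of "z0 - r"] r by auto
  ultimately obtain \<rho>2 where \<rho>2: "0 < \<rho>2" "ball (y0 + (z0 - r) *\<^sub>R b) \<rho>2 \<subseteq> \<Omega> \<inter> (\<lambda>x. s * (H x - E)) -` {..<0}"
    unfolding open_contains_ball by blast
  define \<rho> where "\<rho> = Min {\<rho>1, \<rho>2, \<delta> / 2}"
  have \<rho>: "0 < \<rho>" "\<rho> \<le> \<rho>1" "\<rho> \<le> \<rho>2" "\<rho> \<le> \<delta> / 2"
    using \<rho>1 \<rho>2 \<delta> by (auto simp: \<rho>_def)
  have root: "\<exists>z. \<bar>z - z0\<bar> < r \<and> H (y + z *\<^sub>R b) = E" if y: "norm (y - y0) < \<rho>" for y
  proof -
    have "y + (z0 + r) *\<^sub>R b \<in> ball (y0 + (z0 + r) *\<^sub>R b) \<rho>1"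
      using y \<rho> by (simp add: dist_norm norm_minus_commute)
    from subsetD[OF \<rho>1(2) this] have u: "0 < s * (H (y + (z0 + r) *\<^sub>R b) - E)" by simp
    have "y + (z0 - r) *\<^sub>R b \<in> ball (y0 + (z0 - r) *\<^sub>R b) \<rho>2"
      using y \<rho> by (simp add: dist_norm norm_minus_commute)
    from subsetD[OF \<rho>2(2) this] have d: "s * (H (y + (z0 - r) *\<^sub>R b) - E) < 0" by simp
    have "\<exists>z\<ge>z0 - r. z \<le> z0 + r \<and> s * (H (y + z *\<^sub>R b) - E) = 0"
    proof (rule IVT')
      show "continuous_on {z0 - r..z0 + r} (\<lambda>z. s * (H (y + z *\<^sub>R b) - E))"
      proof (rule continuous_at_imp_continuous_on, rule ballI, rule DERIV_isCont, rule der)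
        fix z assume "z \<in> {z0 - r..z0 + r}"
        then show "y + z *\<^sub>R b \<in> \<Omega>" using near(1)[of y z] y \<rho> by auto
      qed
    qed (use u d r in auto)
    then obtain z where z: "z0 - r \<le> z" "z \<le> z0 + r" "s * (H (y + z *\<^sub>R b) - E) = 0" by blast
    have "z \<noteq> z0 - r" "z \<noteq> z0 + r" using z(3) u d by auto
    moreover have "H (y + z *\<^sub>R b) = E" using z(3) s by auto
    ultimately show ?thesis using z by (intro exI[of _ z]) auto
  qed
  have "level_set_chart \<Omega> H g E \<sigma> b y0 z0 s \<kappa> r \<rho>"
  proof
    fix y z assume y: "y \<bullet> b = 0" "norm (y - y0) < \<rho>" and z: "\<bar>z - z0\<bar> < r"
    show "y + z *\<^sub>R b \<in> \<Omega>" using near(1)[of y z] y z \<rho> by auto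
    show "\<kappa> \<le> s * (g (y + z *\<^sub>R b) \<bullet> b)" using near(2)[of y z] y z \<rho> by auto
  qed (use b s \<kappa> r \<rho> y0b root in auto)
  moreover have "norm (p - (p \<bullet> b) *\<^sub>R b - y0) < \<rho>" "\<bar>p \<bullet> b - z0\<bar> < r"
    using \<rho> r by (auto simp: y0_def z0_def)
  ultimately show ?thesis using that by blast
qed

section \<open>Continuous approximations of open sets\<close>

definition bump :: "'a::metric_space set \<Rightarrow> nat \<Rightarrow> 'a \<Rightarrow> real" where
  "bump S k x = min 1 (real k * infdist x (- S))"

lemma bump_range: "0 \<le> bump S k x" "bump S k x \<le> 1"
  by (auto simp: bump_def infdist_nonneg)

lemma bump_outside: "x \<notin> S \<Longrightarrow> bump S k x = 0"
  by (simp add: bump_def)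

lemma continuous_bump: "continuous_on A (bump S k)"
  unfolding bump_def by (intro continuous_intros)

text \<open>Monotone convergence. The complement of \<open>S\<close> must be non-empty because
  \<open>infdist\<close> to the empty set is 0 by convention.\<close>

lemma bump_lim:
  fixes N :: "'a::euclidean_space measure"
  assumes S: "open S" "- S \<noteq> {}" and sets [measurable_cong]: "sets N = sets borel"
  shows "(\<lambda>k. \<integral>\<^sup>+x. ennreal (bump S k x) \<partial>N) \<longlonglongrightarrow> emeasure N S"
proof -
  have [measurable]: "bump S k \<in> borel_measurable borel" for k
    by (intro borel_measurable_continuous_onI continuous_bump)
  have "(\<lambda>k. \<integral>\<^sup>+x. ennreal (bump S k x) \<partial>N) \<longlonglongrightarrow> (\<integral>\<^sup>+x. indicator S x \<partial>N)"
  proof (rule nn_integral_LIMSEQ)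
    show "incseq (\<lambda>k x. ennreal (bump S k x))"
      unfolding incseq_def le_fun_def bump_def
      by (intro allI impI ennreal_leI min.mono mult_right_mono) (auto simp: infdist_nonneg)
    fix x
    show "(\<lambda>k. ennreal (bump S k x)) \<longlonglongrightarrow> indicator S x"
    proof (cases "x \<in> S")
      case False
      then show ?thesis by (simp add: bump_outside)
    next
      case True
      then have "infdist x (- S) \<noteq> 0"
        using S in_closed_iff_infdist_zero[of "- S" x] by auto
      then have d: "0 < infdist x (- S)" using infdist_nonneg[of x "- S"] by simp
      obtain k0 where k0: "1 / infdist x (- S) \<le> real k0" using real_arch_simple by blast
      have "\<forall>\<^sub>F k in sequentially. ennreal (bump S k x) = 1"
        using eventually_ge_at_top[of k0]
      proof eventually_elim
        case (elim k)
        have "1 \<le> real k0 * infdist x (- S)" using k0 d by (simp add: field_simps)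
        also have "\<dots> \<le> real k * infdist x (- S)" using elim d by (intro mult_right_mono) auto
        finally show ?case by (simp add: bump_def)
      qed
      then show ?thesis using True by (simp add: tendsto_eventually)
    qed
  qed measurable
  moreover have "S \<in> sets N" using S(1) by (simp add: sets)
  ultimately show ?thesis by simp
qed

text \<open>Open sets form an intersection-stable generator; the finite mass of \<open>W\<close>
  makes the measures cut down to \<open>W\<close> finite.\<close>

lemma emeasure_eq_on_open_subsets:
  fixes M N :: "'a::euclidean_space measure"
  assumes sets [measurable_cong, simp]: "sets M = sets borel" "sets N = sets borel"
    and W: "open W" and fin: "emeasure M W < \<infinity>"
    and eq: "\<And>S. open S \<Longrightarrow> S \<subseteq> W \<Longrightarrow> emeasure M S = emeasure N S"
    and A: "A \<in> sets borel" "A \<subseteq> W"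
  shows "emeasure M A = emeasure N A"
proof -
  have [measurable]: "W \<in> sets borel" using W by simp
  have d: "emeasure (density P (indicator W)) S = emeasure P (W \<inter> S)"
    if "sets P = sets borel" "S \<in> sets borel" for P :: "'a measure" and S
  proof -
    have "emeasure (density P (indicator W)) S = (\<integral>\<^sup>+x. indicator W x * indicator S x \<partial>P)"
      using that by (subst emeasure_density) (auto simp: measurable_cong_sets[OF that(1) refl])
    also have "\<dots> = (\<integral>\<^sup>+x. indicator (W \<inter> S) x \<partial>P)" by (simp only: indicator_inter_arith)
    also have "\<dots> = emeasure P (W \<inter> S)" using that by (intro nn_integral_indicator) auto
    finally show ?thesis .
  qed
  have "density M (indicator W) = density N (indicator W)"
  proof (rule measure_eqI_generator_eq[where E = "{S. open S}" and \<Omega> = UNIV and A = "\<lambda>_. UNIV"])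
    show "Int_stable {S :: 'a set. open S}" by (auto simp: Int_stable_def)
    show "emeasure (density M (indicator W)) S = emeasure (density N (indicator W)) S" if "S \<in> {S. open S}" for S
      using that W eq[of "W \<inter> S"] by (simp add: d open_Int)
    show "sets (density M (indicator W)) = sigma_sets UNIV {S. open S}"
      "sets (density N (indicator W)) = sigma_sets UNIV {S. open S}"
      by (simp_all add: borel_def)
    show "emeasure (density M (indicator W)) UNIV \<noteq> \<infinity>" for i :: nat
      using fin by (simp add: d)
  qed auto
  from arg_cong[OF this, of "\<lambda>P. emeasure P A"] show ?thesis
    using A by (simp add: d Int_absorb1)
qed

text \<open>
  A map preserving Lebesgue measure and \<open>H\<close> preserves the volume of thin shells, hence also the limit
  measure \<open>\<mu>\<close>, first for test functions supported in a chart.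
\<close>

lemma (in level_set) distr_\<mu>:
  assumes F_borel [measurable]: "F \<in> borel_measurable borel" and vol: "distr lborel borel F = lborel"
    and F_in: "\<And>x. x \<in> \<Omega> \<Longrightarrow> F x \<in> \<Omega>" and F'_in: "\<And>x. x \<in> \<Omega> \<Longrightarrow> F' x \<in> \<Omega>"
    and F'F: "\<And>x. F' (F x) = x" and FF': "\<And>x. F (F' x) = x"
    and F_cont: "continuous_on \<Omega> F" and F'_cont: "continuous_on \<Omega> F'"
    and HF: "\<And>x. x \<in> \<Omega> \<Longrightarrow> H (F x) = H x"
  shows "distr \<mu> borel F = \<mu>"
proof -
  let ?N = "distr \<mu> borel F"
  have F_out: "F x \<notin> \<Omega>" if "x \<notin> \<Omega>" for x using F'_in[of "F x"] that F'F by auto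
  have local: "\<exists>W. open W \<and> p \<in> W \<and> (\<forall>A\<in>sets borel. A \<subseteq> W \<longrightarrow> emeasure \<mu> A = emeasure ?N A)"
    if p: "p \<in> \<Omega>" "H p = E" for p
  proof -
    obtain b y0 z0 s \<kappa> r \<rho> where ch: "level_set_chart \<Omega> H g E \<sigma> b y0 z0 s \<kappa> r \<rho>"
      and pQ: "norm (p - (p \<bullet> b) *\<^sub>R b - y0) < \<rho>" "\<bar>p \<bullet> b - z0\<bar> < r"
      by (rule chart_exists[OF p])
    interpret P: level_set_chart \<Omega> H g E \<sigma> b y0 z0 s \<kappa> r \<rho> by (rule ch)
    have q: "F' p \<in> \<Omega>" "H (F' p) = E" using F'_in[OF p(1)] HF[of "F' p"] FF' p by auto
    obtain b' y0' z0' s' \<kappa>' r' \<rho>' where ch': "level_set_chart \<Omega> H g E \<sigma> b' y0' z0' s' \<kappa>' r' \<rho>'"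
      and qQ: "norm (F' p - (F' p \<bullet> b') *\<^sub>R b' - y0') < \<rho>'" "\<bar>F' p \<bullet> b' - z0'\<bar> < r'"
      by (rule chart_exists[OF q])
    interpret R: level_set_chart \<Omega> H g E \<sigma> b' y0' z0' s' \<kappa>' r' \<rho>' by (rule ch')
    \<comment> \<open>A test function supported in \<open>W\<close> lives in the chart at
      \<open>p\<close>, and its composition with \<open>F\<close> in the chart at
      \<open>F' p\<close>, so the shell limit applies to both.\<close>
    define W where "W = P.Q \<inter> (\<Omega> \<inter> F' -` R.Q)"
    have W: "open W"
      unfolding W_def by (intro open_Int P.open_Q continuous_open_preimage F'_cont open_\<Omega> R.open_Q)
    have pW: "p \<in> W" using pQ qQ p by (auto simp: W_def P.Q_def R.Q_def)
    have open_eq: "emeasure \<mu> S = emeasure ?N S" if S: "open S" "S \<subseteq> W" for S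
    proof -
      have "bounded S" using S(2) P.bounded_Q by (auto simp: W_def intro: bounded_subset)
      then have ne: "- S \<noteq> {}" using not_bounded_UNIV[where 'a = 'a] by (metis Compl_eq_Diff_UNIV Diff_eq_empty_iff top.extremum_uniqueI)
      have bump_eq: "(\<integral>\<^sup>+x. ennreal (bump S k x) \<partial>\<mu>) = (\<integral>\<^sup>+x. ennreal (bump S k x) \<partial>?N)" for k
      proof -
        let ?f = "bump S k"
        have [measurable]: "?f \<in> borel_measurable borel"
          by (intro borel_measurable_continuous_onI continuous_bump)
        have "(\<lambda>n. ennreal (real (Suc n) / 2) * (\<integral>\<^sup>+x. ennreal (?f x) * indicator (shell n) x \<partial>lborel))
          \<longlonglongrightarrow> (\<integral>\<^sup>+x. ennreal (?f x) \<partial>\<mu>)"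
        proof (rule P.shell_limit)
          show "?f x = 0" if "x \<notin> P.Q" for x
            by (rule bump_outside) (use S(2) that in \<open>auto simp: W_def\<close>)
        qed (auto simp: continuous_bump bump_range)
        moreover have "(\<lambda>n. ennreal (real (Suc n) / 2) * (\<integral>\<^sup>+x. ennreal (?f (F x)) * indicator (shell n) x \<partial>lborel))
          \<longlonglongrightarrow> (\<integral>\<^sup>+x. ennreal (?f (F x)) \<partial>\<mu>)"
        proof (rule R.shell_limit)
          show "continuous_on R.Q (\<lambda>x. ?f (F x))"
            by (rule continuous_on_compose2[OF continuous_bump[of UNIV] continuous_on_subset[OF F_cont]])
              (use R.Q_\<Omega> in auto)
          show "?f (F x) = 0" if "x \<notin> R.Q" for x
          proof (rule bump_outside)
            show "F x \<notin> S" using S(2) that F'F[of x] by (auto simp: W_def)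
          qed
        qed (auto simp: bump_range)
        moreover have "(\<integral>\<^sup>+x. ennreal (?f (F x)) * indicator (shell n) x \<partial>lborel)
            = (\<integral>\<^sup>+x. ennreal (?f x) * indicator (shell n) x \<partial>lborel)" for n
        proof -
          \<comment> \<open>\<open>F\<close> maps shells onto themselves, and points off
            \<open>\<Omega>\<close> stay off \<open>\<Omega>\<close>; with volume preservation the
            two sequences coincide term by term.\<close>
          have ind: "indicator (shell n) (F x) = (indicator (shell n) x :: ennreal)" for x
          proof (cases "x \<in> \<Omega>")
            case True
            then show ?thesis using HF F_in by (simp add: indicator_def shell_def)
          next
            case False
            then show ?thesis using F_out by (simp add: indicator_def shell_def)
          qed
          have "(\<integral>\<^sup>+x. ennreal (?f x) * indicator (shell n) x \<partial>lborel)
              = (\<integral>\<^sup>+x. ennreal (?f x) * indicator (shell n) x \<partial>distr lborel borel F)"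
            unfolding vol ..
          also have "\<dots> = (\<integral>\<^sup>+x. ennreal (?f (F x)) * indicator (shell n) (F x) \<partial>lborel)"
            by (subst nn_integral_distr) auto
          finally show ?thesis unfolding ind ..
        qed
        ultimately have "(\<integral>\<^sup>+x. ennreal (?f x) \<partial>\<mu>) = (\<integral>\<^sup>+x. ennreal (?f (F x)) \<partial>\<mu>)"
          using LIMSEQ_unique by simp
        also have "\<dots> = (\<integral>\<^sup>+x. ennreal (?f x) \<partial>?N)" by (subst nn_integral_distr) auto
        finally show ?thesis .
      qed
      have "(\<lambda>k. \<integral>\<^sup>+x. ennreal (bump S k x) \<partial>?N) \<longlonglongrightarrow> emeasure \<mu> S"
        using bump_lim[OF S(1) ne sets_\<mu>] unfolding bump_eq .
      from LIMSEQ_unique[OF this bump_lim[OF S(1) ne sets_distr]] show ?thesis .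
    qed
    have "emeasure \<mu> W \<le> emeasure \<mu> P.Q" by (rule emeasure_mono) (auto simp: W_def)
    then have "emeasure \<mu> W < \<infinity>" using P.\<mu>_Q_finite by (rule le_less_trans)
    from emeasure_eq_on_open_subsets[OF sets_\<mu> sets_distr W this open_eq]
    show ?thesis using W pW by blast
  qed
  define \<C> where "\<C> = {W. open W \<and> (\<forall>A\<in>sets borel. A \<subseteq> W \<longrightarrow> emeasure \<mu> A = emeasure ?N A)}"
  have cover: "- \<Union>\<C> \<subseteq> - {x \<in> \<Omega>. H x = E}"
    using local by (fastforce simp: \<C>_def)
  have Mc [measurable]: "- {x \<in> \<Omega>. H x = E} \<in> sets borel" using level_borel by (rule borel_comp)
  have "\<mu> = ?N"
  proof (rule measure_eqI_open_cover[where \<C> = \<C>])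
    have "emeasure \<mu> (- \<Union>\<C>) \<le> emeasure \<mu> (- {x \<in> \<Omega>. H x = E})"
      by (rule emeasure_mono[OF cover]) (simp add: Mc)
    then show "emeasure \<mu> (- \<Union>\<C>) = 0" using \<mu>_null by simp
    have "emeasure ?N (- \<Union>\<C>) \<le> emeasure ?N (- {x \<in> \<Omega>. H x = E})"
      by (rule emeasure_mono[OF cover]) (simp add: Mc)
    also have "\<dots> = emeasure \<mu> (F -` (- {x \<in> \<Omega>. H x = E}))"
    proof -
      have "space \<mu> = UNIV" using sets_eq_imp_space_eq[OF sets_\<mu>] by simp
      then show ?thesis by (subst emeasure_distr) (auto simp: Mc)
    qed
    also have "\<dots> \<le> emeasure \<mu> (- {x \<in> \<Omega>. H x = E})"
      by (rule emeasure_mono) (use F_in HF Mc in auto)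
    finally show "emeasure ?N (- \<Union>\<C>) = 0" using \<mu>_null by simp
  qed (auto simp: \<C>_def)
  then show ?thesis ..
qed

subsection \<open>Maps on a fundamental domain\<close>

locale fundamental_domain =
  fixes \<Lambda> D :: "'a::euclidean_space set" and wr :: "'a \<Rightarrow> 'a"
  assumes countable_\<Lambda>: "countable \<Lambda>"
    and \<Lambda>_add: "\<And>k l. k \<in> \<Lambda> \<Longrightarrow> l \<in> \<Lambda> \<Longrightarrow> k + l \<in> \<Lambda>"
    and \<Lambda>_minus: "\<And>k. k \<in> \<Lambda> \<Longrightarrow> - k \<in> \<Lambda>"
    and D_borel [measurable]: "D \<in> sets borel"
    and wr_in: "\<And>x. wr x \<in> D" and wr_equiv: "\<And>x. wr x - x \<in> \<Lambda>"
    and unique: "\<And>x y. x \<in> D \<Longrightarrow> y \<in> D \<Longrightarrow> x - y \<in> \<Lambda> \<Longrightarrow> x = y"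
begin

text \<open>Cut the domain according to the lattice vector \<open>k\<close> that brings
  \<open>F x\<close> back to \<open>D\<close>. The pieces \<open>C k\<close> are carried by
  \<open>F\<close> and the translation by \<open>k\<close> onto the pieces \<open>E k\<close> of
  \<open>A \<inter> D \<inter> \<Omega>\<close>, and both motions preserve
  \<open>\<nu>\<close>.\<close>

lemma emeasure_wrapped_map:
  fixes \<nu> :: "'a measure"
  assumes sets [simp, measurable_cong]: "sets \<nu> = sets borel" and \<Omega> [measurable]: "\<Omega> \<in> sets borel"
    and F: "\<And>x. x \<in> \<Omega> \<Longrightarrow> F x \<in> \<Omega>" "\<And>x. x \<in> \<Omega> \<Longrightarrow> F' x \<in> \<Omega>"
    and F'F: "\<And>x. x \<in> \<Omega> \<Longrightarrow> F' (F x) = x" and FF': "\<And>x. x \<in> \<Omega> \<Longrightarrow> F (F' x) = x"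
    and period_\<Omega>: "\<And>x k. k \<in> \<Lambda> \<Longrightarrow> x + k \<in> \<Omega> \<longleftrightarrow> x \<in> \<Omega>"
    and period: "\<And>x k. x \<in> \<Omega> \<Longrightarrow> k \<in> \<Lambda> \<Longrightarrow> F' (x + k) = F' x + k"
    and meas: "\<And>C. C \<in> sets borel \<Longrightarrow> {x \<in> \<Omega>. F x \<in> C} \<in> sets borel"
    and meas': "\<And>C. C \<in> sets borel \<Longrightarrow> {x \<in> \<Omega>. F' x \<in> C} \<in> sets borel"
    and inv': "\<And>C. C \<in> sets borel \<Longrightarrow> emeasure \<nu> {x \<in> \<Omega>. F' x \<in> C} = emeasure \<nu> (C \<inter> \<Omega>)"
    and transl: "\<And>C k. C \<in> sets borel \<Longrightarrow> k \<in> \<Lambda> \<Longrightarrow> emeasure \<nu> {x. x + k \<in> C} = emeasure \<nu> C"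
    and A [measurable]: "A \<in> sets borel"
  shows "emeasure \<nu> {x \<in> D \<inter> \<Omega>. wr (F x) \<in> A} = emeasure \<nu> (A \<inter> D \<inter> \<Omega>)"
proof -
  define C where "C = (\<lambda>k. {x \<in> D \<inter> \<Omega>. F x + k \<in> A \<inter> D})"
  define E where "E = (\<lambda>k. {a \<in> A \<inter> D \<inter> \<Omega>. F' a - k \<in> D})"
  have C_meas: "C k \<in> sets borel" for k
  proof -
    have "(\<lambda>x. x + k) -` (A \<inter> D) \<in> sets borel"
      by (rule measurable_sets_borel[of _ borel]) measurable
    then have "D \<inter> {x \<in> \<Omega>. F x \<in> (\<lambda>x. x + k) -` (A \<inter> D)} \<in> sets borel"
      using meas by measurable
    moreover have "C k = D \<inter> {x \<in> \<Omega>. F x \<in> (\<lambda>x. x + k) -` (A \<inter> D)}"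
      unfolding C_def by auto
    ultimately show ?thesis by simp
  qed
  have E_meas: "E k \<in> sets borel" for k
  proof -
    have "(\<lambda>x. x - k) -` D \<in> sets borel"
      by (rule measurable_sets_borel[of _ borel]) measurable
    then have "A \<inter> D \<inter> {x \<in> \<Omega>. F' x \<in> (\<lambda>x. x - k) -` D} \<in> sets borel"
      using meas' by measurable
    moreover have "E k = A \<inter> D \<inter> {x \<in> \<Omega>. F' x \<in> (\<lambda>x. x - k) -` D}"
      unfolding E_def by auto
    ultimately show ?thesis by simp
  qed
  have diff: "k - l \<in> \<Lambda>" if "k \<in> \<Lambda>" "l \<in> \<Lambda>" for k l
    using \<Lambda>_add[OF that(1) \<Lambda>_minus[OF that(2)]] by simp
  have "emeasure \<nu> {x \<in> D \<inter> \<Omega>. wr (F x) \<in> A} = emeasure \<nu> (\<Union>k\<in>\<Lambda>. C k)"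
  proof (rule arg_cong[where f = "emeasure \<nu>"], intro set_eqI iffI)
    fix x assume x: "x \<in> {x \<in> D \<inter> \<Omega>. wr (F x) \<in> A}"
    have "wr (F x) - F x \<in> \<Lambda>" by (rule wr_equiv)
    moreover have "x \<in> C (wr (F x) - F x)" using x wr_in by (auto simp: C_def)
    ultimately show "x \<in> (\<Union>k\<in>\<Lambda>. C k)" by blast
  next
    fix x assume "x \<in> (\<Union>k\<in>\<Lambda>. C k)"
    then obtain k where k: "k \<in> \<Lambda>" "x \<in> D" "x \<in> \<Omega>" "F x + k \<in> A" "F x + k \<in> D"
      by (auto simp: C_def)
    have "wr (F x) = F x + k"
    proof (rule unique[OF wr_in k(5)])
      show "wr (F x) - (F x + k) \<in> \<Lambda>"
        using diff[OF wr_equiv[of "F x"] k(1)] by (simp add: diff_diff_add)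
    qed
    then show "x \<in> {x \<in> D \<inter> \<Omega>. wr (F x) \<in> A}" using k by simp
  qed
  also have "\<dots> = (\<integral>\<^sup>+k. emeasure \<nu> (C k) \<partial>count_space \<Lambda>)"
  proof (rule emeasure_UN_countable[OF _ countable_\<Lambda>])
    show "C k \<in> sets \<nu>" for k using C_meas by simp
    show "disjoint_family_on C \<Lambda>"
      unfolding disjoint_family_on_def
    proof (intro ballI impI)
      fix k l assume kl: "k \<in> \<Lambda>" "l \<in> \<Lambda>" "k \<noteq> l"
      have False if "F x + k \<in> D" "F x + l \<in> D" for x
        using unique[OF that] diff[OF kl(1,2)] kl(3) by simp
      then show "C k \<inter> C l = {}" by (auto simp: C_def)
    qed
  qed
  also have "\<dots> = (\<integral>\<^sup>+k. emeasure \<nu> (E k) \<partial>count_space \<Lambda>)"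
  proof (rule nn_integral_cong)
    fix k assume "k \<in> space (count_space \<Lambda>)"
    then have k: "k \<in> \<Lambda>" by simp
    \<comment> \<open>In other words \<open>E k\<close> is the image of \<open>C k\<close> under
      \<open>F\<close> followed by translation by \<open>k\<close>.\<close>
    have "{x. x + - k \<in> {x \<in> \<Omega>. F' x \<in> C k}} = E k"
    proof (intro set_eqI iffI)
      fix a assume "a \<in> {x. x + - k \<in> {x \<in> \<Omega>. F' x \<in> C k}}"
      then have a: "a + - k \<in> \<Omega>" "F' (a + - k) \<in> C k" by auto
      then have a\<Omega>: "a \<in> \<Omega>" using period_\<Omega>[OF \<Lambda>_minus[OF k]] by simp
      have "F' (a + - k) = F' a - k" using period[OF a\<Omega> \<Lambda>_minus[OF k]] by simp
      moreover have "F (F' (a + - k)) = a + - k" by (rule FF'[OF a(1)])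
      ultimately show "a \<in> E k" using a a\<Omega> by (auto simp: C_def E_def)
    next
      fix a assume "a \<in> E k"
      then have a: "a \<in> A" "a \<in> D" "a \<in> \<Omega>" "F' a - k \<in> D" by (auto simp: E_def)
      have 1: "a + - k \<in> \<Omega>" using period_\<Omega>[OF \<Lambda>_minus[OF k]] a by simp
      have 2: "F' (a + - k) = F' a - k" using period[OF a(3) \<Lambda>_minus[OF k]] by simp
      have 3: "F (F' (a + - k)) = a + - k" by (rule FF'[OF 1])
      have 4: "F' (a + - k) \<in> \<Omega>" by (rule F(2)[OF 1])
      have "F' (a + - k) \<in> C k" unfolding C_def using 3 4 2 a by simp
      then show "a \<in> {x. x + - k \<in> {x \<in> \<Omega>. F' x \<in> C k}}" using 1 by simp
    qed
    with transl[OF meas'[OF C_meas[of k]] \<Lambda>_minus[OF k]]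
    have "emeasure \<nu> (E k) = emeasure \<nu> {x \<in> \<Omega>. F' x \<in> C k}"
      by (simp only:)
    also have "\<dots> = emeasure \<nu> (C k \<inter> \<Omega>)" by (rule inv'[OF C_meas])
    also have "C k \<inter> \<Omega> = C k" by (auto simp: C_def)
    finally show "emeasure \<nu> (C k) = emeasure \<nu> (E k)" by simp
  qed
  also have "\<dots> = emeasure \<nu> (\<Union>k\<in>\<Lambda>. E k)"
  proof (rule emeasure_UN_countable[OF _ countable_\<Lambda>, symmetric])
    show "E k \<in> sets \<nu>" for k using E_meas by simp
    show "disjoint_family_on E \<Lambda>"
      unfolding disjoint_family_on_def
    proof (intro ballI impI)
      fix k l assume kl: "k \<in> \<Lambda>" "l \<in> \<Lambda>" "k \<noteq> l"
      have False if "F' x - k \<in> D" "F' x - l \<in> D" for x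
        using unique[OF that] diff[OF kl(2,1)] kl(3) by simp
      then show "E k \<inter> E l = {}" by (auto simp: E_def)
    qed
  qed
  also have "(\<Union>k\<in>\<Lambda>. E k) = A \<inter> D \<inter> \<Omega>"
  proof (intro set_eqI iffI)
    fix a assume a: "a \<in> A \<inter> D \<inter> \<Omega>"
    have "- (wr (F' a) - F' a) \<in> \<Lambda>" by (intro \<Lambda>_minus wr_equiv)
    moreover have "a \<in> E (- (wr (F' a) - F' a))" using a wr_in by (auto simp: E_def)
    ultimately show "a \<in> (\<Union>k\<in>\<Lambda>. E k)" by blast
  qed (auto simp: E_def)
  finally show ?thesis .
qed

text \<open>The case of a translation, with \<open>\<Omega> = UNIV\<close>. It makes integrals of
  periodic functions over \<open>D\<close> invariant under shifts of the argument.\<close>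

lemma distr_wrapped_translation:
  assumes [measurable]: "wr \<in> borel_measurable borel"
  shows "distr (restrict_space lborel D) (restrict_space lborel D) (\<lambda>x. wr (x + a)) = restrict_space lborel D"
proof (rule measure_eqI)
  fix A assume "A \<in> sets (distr (restrict_space lborel D) (restrict_space lborel D) (\<lambda>x. wr (x + a)))"
  then have A: "A \<subseteq> D" and [measurable]: "A \<in> sets borel"
    by (auto simp: sets_restrict_space)
  have tr: "emeasure lborel {x. x + k \<in> C} = emeasure lborel C" if C: "C \<in> sets borel" for k and C :: "'a set"
  proof -
    have "emeasure lborel C = emeasure (distr lborel borel ((+) k)) C"
      by (simp add: lborel_distr_plus)
    also have "\<dots> = emeasure lborel ((+) k -` C)"
      using C by (subst emeasure_distr) auto
    also have "(+) k -` C = {x. x + k \<in> C}" by (auto simp: add.commute)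
    finally show ?thesis ..
  qed
  have mtr: "{x. x + k \<in> C} \<in> sets borel" if C: "C \<in> sets borel" for k and C :: "'a set"
    using measurable_sets_borel[of "\<lambda>x. x + k" borel C] C by (simp add: vimage_def)
  have "emeasure (distr (restrict_space lborel D) (restrict_space lborel D) (\<lambda>x. wr (x + a))) A
      = emeasure (restrict_space lborel D) ((\<lambda>x. wr (x + a)) -` A \<inter> D)"
    using A by (subst emeasure_distr)
      (auto simp: space_restrict_space sets_restrict_space wr_in intro!: measurable_restrict_space3)
  also have "\<dots> = emeasure lborel {x \<in> D \<inter> UNIV. wr (x + a) \<in> A}"
    by (subst emeasure_restrict_space) (auto intro!: arg_cong[where f = "emeasure lborel"])
  also have "\<dots> = emeasure lborel (A \<inter> D \<inter> UNIV)"
    by (rule emeasure_wrapped_map[where F' = "\<lambda>x. x - a"])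
       (use tr[of _ "- a"] mtr[of _ "- a"] tr mtr in auto)
  also have "\<dots> = emeasure (restrict_space lborel D) A"
    using A by (subst emeasure_restrict_space) (auto simp: Int_absorb2)
  finally show "emeasure (distr (restrict_space lborel D) (restrict_space lborel D) (\<lambda>x. wr (x + a))) A
     = emeasure (restrict_space lborel D) A" .
qed simp

end

subsection \<open>Test functions on the torus\<close>

lemma countable_lattice2: "countable lattice2"
  unfolding lattice2_def by (rule countable_vector) (simp add: Ints_def)

lemma lattice2_add: "k \<in> lattice2 \<Longrightarrow> l \<in> lattice2 \<Longrightarrow> k + l \<in> lattice2"
  and lattice2_minus: "k \<in> lattice2 \<Longrightarrow> - k \<in> lattice2"
  and lattice2_0: "0 \<in> lattice2"
  by (auto simp: lattice2_def)

lemma lattice2_diff: "k \<in> lattice2 \<Longrightarrow> l \<in> lattice2 \<Longrightarrow> k - l \<in> lattice2"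
  by (auto simp: lattice2_def)

lemma lattice2_minus_iff [simp]: "- k \<in> lattice2 \<longleftrightarrow> k \<in> lattice2"
  using lattice2_minus[of k] lattice2_minus[of "- k"] by auto

lemma torus_borel [measurable]: "torus \<in> sets borel"
proof -
  have [measurable]: "(\<lambda>x::real^2. x $ k) \<in> borel_measurable borel" for k
    by (intro borel_measurable_continuous_onI continuous_intros)
  have "torus = {x. 0 \<le> x $ 1 \<and> x $ 1 < 1 \<and> 0 \<le> x $ 2 \<and> x $ 2 < 1}"
    unfolding torus_def by (auto simp: forall_2)
  also have "\<dots> \<in> sets borel" by measurable
  finally show ?thesis .
qed

lemma wrap_in: "wrap x \<in> torus"
  by (simp add: wrap_def torus_def frac_lt_1)

lemma wrap_diff: "wrap x - x \<in> lattice2"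
  by (auto simp: wrap_def lattice2_def frac_def)

lemma torus_unique:
  assumes "x \<in> torus" "y \<in> torus" "x - y \<in> lattice2"
  shows "x = y"
proof -
  have "x $ k = y $ k" for k
  proof -
    have "0 \<le> x $ k" "x $ k < 1" "0 \<le> y $ k" "y $ k < 1" "x $ k - y $ k \<in> \<int>"
      using assms by (auto simp: torus_def lattice2_def)
    then obtain n where n: "x $ k - y $ k = of_int n" by (auto elim: Ints_cases)
    have "real_of_int n < 1" "- 1 < real_of_int n"
      using n \<open>0 \<le> x $ k\<close> \<open>x $ k < 1\<close> \<open>0 \<le> y $ k\<close> \<open>y $ k < 1\<close> by linarith+
    then have "n = 0" by linarith
    then show ?thesis using n by simp
  qed
  then show ?thesis by (simp add: vec_eq_iff)
qed

interpretation torus: fundamental_domain lattice2 torus wrap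
  by unfold_locales
     (auto intro: countable_lattice2 lattice2_add lattice2_minus wrap_in wrap_diff torus_unique torus_borel)

lemma wrap_measurable [measurable]: "wrap \<in> borel_measurable borel"
proof (rule borel_measurableI)
  have [measurable]: "(\<lambda>x::real^2. x $ k) \<in> borel_measurable borel" for k
    by (intro borel_measurable_continuous_onI continuous_intros)
  have "(\<lambda>x. \<Sum>k\<in>UNIV. axis k (frac (x $ k))) \<in> borel_measurable (borel :: (real^2) measure)"
  proof (intro borel_measurable_sum)
    fix k :: 2
    have [measurable]: "(\<lambda>x::real^2. frac (x $ k)) \<in> borel_measurable borel"
      unfolding frac_def by measurable
    have "axis k (frac (x $ k)) = frac (x $ k) *\<^sub>R axis k (1::real)" for x :: "real^2"
      by (simp add: vec_eq_iff axis_def)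
    then show "(\<lambda>x::real^2. axis k (frac (x $ k))) \<in> borel_measurable borel" by simp
  qed
  moreover have "(\<lambda>x. \<Sum>k\<in>UNIV. axis k (frac (x $ k))) = wrap"
    by (auto simp: wrap_def vec_eq_iff axis_def fun_eq_iff sum.delta)
  ultimately have m: "wrap \<in> borel_measurable borel" by simp
  show "wrap -` S \<inter> space borel \<in> sets borel" if "open S" for S
    using measurable_sets[OF m, of S] that by simp
qed

section \<open>Integration of periodic functions over the torus\<close>

abbreviation torus_measure :: "(real^2) measure" where
  "torus_measure \<equiv> restrict_space lborel torus"

lemma bounded_torus: "bounded torus"
proof -
  have "torus \<subseteq> cbox 0 1"
    by (auto simp: torus_def mem_box_cart less_imp_le)
  then show ?thesis using bounded_cbox bounded_subset by blast
qed

interpretation torus_measure: finite_measure torus_measure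
proof
  have "emeasure lborel torus < \<infinity>" by (rule emeasure_bounded_finite[OF bounded_torus])
  then show "emeasure torus_measure (space torus_measure) \<noteq> \<infinity>"
    by (simp add: emeasure_restrict_space space_restrict_space)
qed

lemma torus_integral_eq:
  fixes f :: "real^2 \<Rightarrow> real"
  shows "(LINT x:torus|lborel. f x) = integral\<^sup>L torus_measure f"
  unfolding set_lebesgue_integral_def by (rule integral_restrict_space[symmetric]) simp

lemma torus_measurable: "f \<in> borel_measurable borel \<Longrightarrow> f \<in> borel_measurable torus_measure"
  by (intro measurable_restrict_space1) simp

lemma torus_integrable_bounded:
  fixes f :: "real^2 \<Rightarrow> real"
  assumes "f \<in> borel_measurable borel" "\<And>x. \<bar>f x\<bar> \<le> C"
  shows "integrable torus_measure f"
  using assms by (intro torus_measure.integrable_const_bound[where B = C] torus_measurable) auto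

lemma torus_integral_shift:
  fixes f :: "real^2 \<Rightarrow> real"
  assumes per: "\<And>x k. k \<in> lattice2 \<Longrightarrow> f (x + k) = f x" and f: "f \<in> borel_measurable borel"
  shows "integral\<^sup>L torus_measure (\<lambda>x. f (x + a)) = integral\<^sup>L torus_measure f"
proof -
  have "f (x + a) = f (wrap (x + a))" for x
    using per[OF wrap_diff[of "x + a"], of "x + a"] by simp
  then have "integral\<^sup>L torus_measure (\<lambda>x. f (x + a)) = integral\<^sup>L torus_measure (\<lambda>x. f (wrap (x + a)))"
    by simp
  also have "\<dots> = integral\<^sup>L (distr torus_measure torus_measure (\<lambda>x. wrap (x + a))) f"
    by (rule integral_distr[symmetric])
       (auto intro!: measurable_restrict_space3 torus_measurable f simp: wrap_in)
  also have "\<dots> = integral\<^sup>L torus_measure f"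
    unfolding torus.distr_wrapped_translation[OF wrap_measurable] ..
  finally show ?thesis .
qed

text \<open>A class of explicit smooth functions that is closed under taking derivatives.\<close>

inductive nice :: "('a::euclidean_space \<Rightarrow> real) \<Rightarrow> bool" where
  const: "nice (\<lambda>x. c)"
| cos: "nice (\<lambda>x. cos (a \<bullet> x + t))"
| add: "nice f \<Longrightarrow> nice g \<Longrightarrow> nice (\<lambda>x. f x + g x)"
| mult: "nice f \<Longrightarrow> nice g \<Longrightarrow> nice (\<lambda>x. f x * g x)"
| inverse: "nice f \<Longrightarrow> (\<And>x. 0 < f x) \<Longrightarrow> nice (\<lambda>x. 1 / f x)"
| ln: "nice f \<Longrightarrow> (\<And>x. 0 < f x) \<Longrightarrow> nice (\<lambda>x. ln (f x))"

lemma nice_derivative: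
  "nice f \<Longrightarrow> \<exists>f'. (\<forall>x. (f has_derivative f' x) (at x)) \<and> (\<forall>b. nice (\<lambda>x. f' x b))"
proof (induction rule: nice.induct)
  case (const c)
  show ?case by (intro exI[of _ "\<lambda>x h. 0"]) (auto intro: nice.intros)
next
  case (cos a t)
  \<comment> \<open>The free phase \<open>t\<close> makes the class contain sines: differentiation
    shifts the phase by a quarter period.\<close>
  have "nice (\<lambda>x. cos (a \<bullet> x + (t + pi / 2)) * (a \<bullet> b))" for b
    by (intro nice.intros)
  moreover have "((\<lambda>x. cos (a \<bullet> x + t)) has_derivative (\<lambda>h. cos (a \<bullet> x + (t + pi / 2)) * (a \<bullet> h))) (at x)" for x
  proof -
    have "cos (a \<bullet> x + (t + pi / 2)) = - sin (a \<bullet> x + t)"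
      by (simp add: add.assoc[symmetric] cos_add)
    then show ?thesis
      by (auto intro!: derivative_eq_intros simp: fun_eq_iff)
  qed
  ultimately show ?case
    by (intro exI[of _ "\<lambda>x h. cos (a \<bullet> x + (t + pi / 2)) * (a \<bullet> h)"]) auto
next
  case (add f g)
  then obtain f' g' where h: "\<And>x. (f has_derivative f' x) (at x)" "\<And>b. nice (\<lambda>x. f' x b)"
    "\<And>x. (g has_derivative g' x) (at x)" "\<And>b. nice (\<lambda>x. g' x b)" by blast
  show ?case
    by (intro exI[of _ "\<lambda>x h. f' x h + g' x h"] conjI allI has_derivative_add nice.intros h)
next
  case (mult f g)
  then obtain f' g' where h: "\<And>x. (f has_derivative f' x) (at x)" "\<And>b. nice (\<lambda>x. f' x b)"
    "\<And>x. (g has_derivative g' x) (at x)" "\<And>b. nice (\<lambda>x. g' x b)" by blast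
  show ?case
    by (intro exI[of _ "\<lambda>x h. f x * g' x h + f' x h * g x"] conjI allI has_derivative_mult nice.intros h mult.hyps)
next
  case (inverse f)
  then obtain f' where h: "\<And>x. (f has_derivative f' x) (at x)" "\<And>b. nice (\<lambda>x. f' x b)" by blast
  have nz: "f x \<noteq> 0" for x using inverse(2)[of x] by simp
  have "((\<lambda>x. 1 / f x) has_derivative (\<lambda>h. (-1) * (f' x h * (1 / f x * (1 / f x))))) (at x)" for x
    using h(1)[of x] nz[of x] by (auto intro!: derivative_eq_intros simp: fun_eq_iff power2_eq_square)
  moreover have "nice (\<lambda>x. (-1) * (f' x b * (1 / f x * (1 / f x))))" for b
    by (intro nice.intros h inverse.hyps)
  ultimately show ?case
    by (intro exI[of _ "\<lambda>x h. (-1) * (f' x h * (1 / f x * (1 / f x)))"]) auto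
next
  case (ln f)
  then obtain f' where h: "\<And>x. (f has_derivative f' x) (at x)" "\<And>b. nice (\<lambda>x. f' x b)" by blast
  have "((\<lambda>x. ln (f x)) has_derivative (\<lambda>h. f' x h * (1 / f x))) (at x)" for x
    using h(1)[of x] ln(2)[of x] by (auto intro!: derivative_eq_intros simp: fun_eq_iff divide_inverse)
  moreover have "nice (\<lambda>x. f' x b * (1 / f x))" for b
    by (intro nice.intros h ln.hyps)
  ultimately show ?case
    by (intro exI[of _ "\<lambda>x h. f' x h * (1 / f x)"]) auto
qed

lemma nice_differentiable: "nice f \<Longrightarrow> f differentiable (at x)"
  using nice_derivative[of f] unfolding differentiable_def by blast

lemma nice_has_derivative: "nice f \<Longrightarrow> (f has_derivative frechet_derivative f (at x)) (at x)"
  using nice_differentiable frechet_derivative_works by blast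

lemma nice_frechet: "nice f \<Longrightarrow> nice (\<lambda>x. frechet_derivative f (at x) b)"
proof -
  assume "nice f"
  then obtain f' where f': "\<And>x. (f has_derivative f' x) (at x)" "\<And>b. nice (\<lambda>x. f' x b)"
    using nice_derivative by blast
  have "frechet_derivative f (at x) = f' x" for x
    using frechet_derivative_at[OF f'(1)] by simp
  then show ?thesis using f'(2) by simp
qed

lemma nice_continuous: "nice f \<Longrightarrow> continuous_on S f"
  by (meson nice_has_derivative has_derivative_continuous continuous_at_imp_continuous_on)

lemma nice_measurable: "nice f \<Longrightarrow> f \<in> borel_measurable borel"
  by (intro borel_measurable_continuous_onI nice_continuous)

lemma nice_smooth: "nice f \<Longrightarrow> smooth_on UNIV f"
proof -
  have "nice f \<Longrightarrow> Ck_on k UNIV f" for k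
  proof (induction k arbitrary: f)
    case 0 then show ?case by (simp add: nice_continuous)
  next
    case (Suc k) then show ?case by (auto simp: nice_differentiable intro: nice_frechet)
  qed
  then show "nice f \<Longrightarrow> smooth_on UNIV f" by (simp add: smooth_on_def)
qed

lemma frechet_derivative_periodic:
  assumes "\<And>x. f (x + k) = f x"
  shows "frechet_derivative f (at (x + k)) = frechet_derivative f (at x)"
proof -
  have "(f has_derivative D) (at (x + k)) \<longleftrightarrow> (f has_derivative D) (at x)" for D
  proof
    assume d: "(f has_derivative D) (at (x + k))"
    have "((\<lambda>y. y + k) has_derivative (\<lambda>h. h)) (at x)" by (auto intro!: derivative_eq_intros)
    from has_derivative_compose[OF this d] show "(f has_derivative D) (at x)" by (simp add: assms)
  next
    assume "(f has_derivative D) (at x)"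
    then have d: "(f has_derivative D) (at (x + k + - k))" by simp
    have "((\<lambda>y. y + - k) has_derivative (\<lambda>h. h)) (at (x + k))" by (auto intro!: derivative_eq_intros)
    from has_derivative_compose[OF this d]
    have "((\<lambda>y. f (y + - k)) has_derivative D) (at (x + k))" .
    moreover have "f (y + - k) = f y" for y using assms[of "y + - k"] by simp
    ultimately show "(f has_derivative D) (at (x + k))" by simp
  qed
  then show ?thesis unfolding frechet_derivative_def by simp
qed

lemma periodic2_shift: "periodic2 f \<Longrightarrow> k \<in> lattice2 \<Longrightarrow> f (x + k) = f x"
  by (simp add: periodic2_def)

lemma periodic2_wrap: "periodic2 f \<Longrightarrow> f (wrap x) = f x"
  using periodic2_shift[of f "wrap x - x" x] wrap_diff[of x] by simp

lemma periodic2_frechet: "periodic2 f \<Longrightarrow> periodic2 (\<lambda>x. frechet_derivative f (at x) b)"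
  unfolding periodic2_def using frechet_derivative_periodic[of f] by metis

lemma periodic_bounded:
  assumes "periodic2 f" "continuous_on UNIV f"
  obtains C where "\<And>x. \<bar>f x\<bar> \<le> C"
proof -
  have "compact (f ` cbox 0 1)"
    using assms(2) by (intro compact_continuous_image compact_cbox) (auto intro: continuous_on_subset)
  then obtain C where C: "\<And>x. x \<in> cbox 0 1 \<Longrightarrow> \<bar>f x\<bar> \<le> C"
    using compact_imp_bounded[of "f ` cbox 0 1"] unfolding bounded_iff by auto
  have "\<bar>f x\<bar> \<le> C" for x
  proof -
    have "wrap x \<in> cbox 0 1" using wrap_in[of x] by (auto simp: torus_def mem_box_cart less_imp_le)
    from C[OF this] show ?thesis by (simp add: periodic2_wrap[OF assms(1)])
  qed
  then show ?thesis using that by blast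
qed

text \<open>Difference quotients integrate to 0 by translation invariance; the mean value theorem
  bounds them by a bound of the derivative, so dominated convergence applies.\<close>

lemma integral_derivative_periodic:
  assumes f: "nice f" and per: "periodic2 f"
  shows "integral\<^sup>L torus_measure (\<lambda>x. frechet_derivative f (at x) b) = 0"
proof -
  let ?D = "\<lambda>x. frechet_derivative f (at x)"
  let ?q = "\<lambda>n x. real (Suc n) * (f (x + (1 / real (Suc n)) *\<^sub>R b) - f x)"
  have cf: "continuous_on UNIV f" by (rule nice_continuous[OF f])
  obtain C where C: "\<And>x. \<bar>f x\<bar> \<le> C" using periodic_bounded[OF per cf] by blast
  obtain C' where C': "\<And>x. \<bar>?D x b\<bar> \<le> C'"
    using periodic_bounded[OF periodic2_frechet[OF per] nice_continuous[OF nice_frechet[OF f]]] by blast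
  have [measurable]: "f \<in> borel_measurable borel" by (rule nice_measurable[OF f])
  have line: "((\<lambda>t. f (x + t *\<^sub>R b)) has_real_derivative ?D (x + t *\<^sub>R b) b) (at t)" for x t
  proof -
    have "((\<lambda>t. x + t *\<^sub>R b) has_derivative (\<lambda>h. h *\<^sub>R b)) (at t)"
      by (auto intro!: derivative_eq_intros)
    from has_derivative_compose[OF this nice_has_derivative[OF f]]
    have "((\<lambda>t. f (x + t *\<^sub>R b)) has_derivative (\<lambda>h. ?D (x + t *\<^sub>R b) (h *\<^sub>R b))) (at t)" .
    moreover have "?D (x + t *\<^sub>R b) (h *\<^sub>R b) = ?D (x + t *\<^sub>R b) b * h" for h
      using has_derivative_bounded_linear[OF nice_has_derivative[OF f]] by (simp add: linear_simps)
    ultimately show ?thesis by (simp add: has_field_derivative_def)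
  qed
  have int0: "integral\<^sup>L torus_measure (?q n) = 0" for n
  proof -
    have "integrable torus_measure (\<lambda>x. f (x + (1 / real (Suc n)) *\<^sub>R b))"
      by (rule torus_integrable_bounded[where C = C]) (use C in auto)
    moreover have "integrable torus_measure f" by (rule torus_integrable_bounded[where C = C]) (use C in auto)
    ultimately have "integral\<^sup>L torus_measure (?q n) = real (Suc n) *
        (integral\<^sup>L torus_measure (\<lambda>x. f (x + (1 / real (Suc n)) *\<^sub>R b)) - integral\<^sup>L torus_measure f)"
      by (simp add: Bochner_Integration.integral_diff)
    then show ?thesis
      using torus_integral_shift[of f "(1 / real (Suc n)) *\<^sub>R b"] periodic2_shift[OF per] by simp
  qed
  have "(\<lambda>n. integral\<^sup>L torus_measure (?q n)) \<longlonglongrightarrow> integral\<^sup>L torus_measure (\<lambda>x. ?D x b)"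
  proof (rule integral_dominated_convergence[where w = "\<lambda>_. C'"])
    show "(\<lambda>x. ?D x b) \<in> borel_measurable torus_measure"
      by (intro torus_measurable nice_measurable nice_frechet f)
    show "?q n \<in> borel_measurable torus_measure" for n by (rule torus_measurable) measurable
    show "AE x in torus_measure. (\<lambda>n. ?q n x) \<longlonglongrightarrow> ?D x b"
    proof (rule AE_I2)
      fix x
      have "((\<lambda>h. (f (x + (0 + h) *\<^sub>R b) - f (x + 0 *\<^sub>R b)) / h) \<longlongrightarrow> ?D (x + 0 *\<^sub>R b) b) (at 0)"
        using line[of x 0] unfolding DERIV_def by simp
      moreover have "filterlim (\<lambda>n. 1 / real (Suc n)) (at 0) sequentially"
        unfolding filterlim_at using LIMSEQ_inverse_real_of_nat by (auto simp: inverse_eq_divide)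
      ultimately have "(\<lambda>n. (f (x + (0 + 1 / real (Suc n)) *\<^sub>R b) - f (x + 0 *\<^sub>R b)) / (1 / real (Suc n)))
          \<longlonglongrightarrow> ?D (x + 0 *\<^sub>R b) b"
        by (rule filterlim_compose)
      then show "(\<lambda>n. ?q n x) \<longlonglongrightarrow> ?D x b" by (simp add: mult.commute del: of_nat_Suc)
    qed
    show "AE x in torus_measure. norm (?q n x) \<le> C'" for n
    proof (rule AE_I2)
      fix x
      have "\<exists>\<zeta>. 0 < \<zeta> \<and> \<zeta> < 1 / real (Suc n) \<and> f (x + (1 / real (Suc n)) *\<^sub>R b) - f (x + 0 *\<^sub>R b)
          = (1 / real (Suc n) - 0) * ?D (x + \<zeta> *\<^sub>R b) b"
        by (rule MVT2) (use line in auto)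
      then obtain \<zeta> where "f (x + (1 / real (Suc n)) *\<^sub>R b) - f x = (1 / real (Suc n)) * ?D (x + \<zeta> *\<^sub>R b) b" by auto
      then have "?q n x = ?D (x + \<zeta> *\<^sub>R b) b" by (simp del: of_nat_Suc)
      then show "norm (?q n x) \<le> C'" using C' by simp
    qed
  qed simp
  then show ?thesis unfolding int0 by (simp add: LIMSEQ_const_iff)
qed

lemma sum_Basis_real2:
  fixes F :: "real^2 \<Rightarrow> 'a::comm_monoid_add"
  shows "(\<Sum>b\<in>Basis. F b) = F (axis 1 1) + F (axis 2 1)"
proof -
  have B: "(Basis :: (real^2) set) = {axis 1 1, axis 2 1}"
    by (auto simp: Basis_vec_def UNIV_2)
  show ?thesis unfolding B by (simp add: axis_eq_axis)
qed

lemma laplacian_eqI: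
  fixes f :: "real^2 \<Rightarrow> real"
  assumes "\<And>x. (f has_derivative f' x) (at x)"
    and "\<And>x b. ((\<lambda>y. f' y b) has_derivative f'' x b) (at x)"
  shows "laplacian f x = f'' x (axis 1 1) (axis 1 1) + f'' x (axis 2 1) (axis 2 1)"
proof -
  have "frechet_derivative f (at y) = f' y" for y
    using frechet_derivative_at[OF assms(1)] by simp
  moreover have "frechet_derivative (\<lambda>y. f' y b) (at x) = f'' x b" for b
    using frechet_derivative_at[OF assms(2)] by simp
  ultimately show ?thesis by (simp add: laplacian_def sum_Basis_real2)
qed

lemma integral_laplacian_periodic:
  fixes f :: "real^2 \<Rightarrow> real"
  assumes f: "nice f" and per: "periodic2 f"
  shows "integral\<^sup>L torus_measure (laplacian f) = 0"
proof -
  let ?D = "\<lambda>b x. frechet_derivative (\<lambda>y. frechet_derivative f (at y) b) (at x) b"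
  have n: "nice (\<lambda>y. frechet_derivative f (at y) b)" "periodic2 (\<lambda>y. frechet_derivative f (at y) b)" for b
    by (intro nice_frechet f periodic2_frechet per)+
  have int: "integrable torus_measure (?D b)" for b
  proof -
    obtain C where "\<And>x. \<bar>?D b x\<bar> \<le> C"
      using periodic_bounded[OF periodic2_frechet[OF n(2)] nice_continuous[OF nice_frechet[OF n(1)]]] by blast
    then show ?thesis by (intro torus_integrable_bounded nice_measurable nice_frechet n)
  qed
  have "laplacian f = (\<lambda>x. ?D (axis 1 1) x + ?D (axis 2 1) x)"
    by (auto simp: fun_eq_iff laplacian_def sum_Basis_real2)
  then show ?thesis
    using int integral_derivative_periodic[OF n] by simp
qed

subsection \<open>The Green function at the origin\<close>

text \<open>\<open>sin\<^sup>2 (\<pi> x\<^sub>1) + sin\<^sup>2 (\<pi> x\<^sub>2)\<close>, a smooth substitute for the squared distance to the lattice.\<close>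

definition sdist :: "real^2 \<Rightarrow> real" where
  "sdist x = 1 - (cos (2 * pi * x $ 1) + cos (2 * pi * x $ 2)) / 2"

lemma cos_periodic_int: "n \<in> \<int> \<Longrightarrow> cos (2 * pi * (t + n)) = cos (2 * pi * t)"
proof -
  assume "n \<in> \<int>"
  then obtain k :: int where "n = of_int k" by (auto elim: Ints_cases)
  then show ?thesis
    using cos.plus_of_int[of "2 * pi * t" k] by (simp add: distrib_left mult_ac)
qed

lemma sdist_periodic: "k \<in> lattice2 \<Longrightarrow> sdist (x + k) = sdist x"
  by (simp add: sdist_def lattice2_def cos_periodic_int)

lemma sdist_minus [simp]: "sdist (- x) = sdist x"
  by (simp add: sdist_def)

lemma sdist_range: "0 \<le> sdist x" "sdist x \<le> 2"
proof -
  have "cos (2 * pi * x $ 1) \<le> 1" "cos (2 * pi * x $ 2) \<le> 1"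
    "- 1 \<le> cos (2 * pi * x $ 1)" "- 1 \<le> cos (2 * pi * x $ 2)" by simp_all
  note c = this
  have "0 \<le> 1 - (a + b) / 2 \<and> 1 - (a + b) / 2 \<le> 2" if "a \<le> 1" "b \<le> 1" "- 1 \<le> a" "- 1 \<le> b" for a b :: real
    using that by simp
  from this[OF c] show "0 \<le> sdist x" "sdist x \<le> 2" unfolding sdist_def by blast+
qed

lemma sdist_eq_0_iff: "sdist x = 0 \<longleftrightarrow> x \<in> lattice2"
proof
  assume z: "sdist x = 0"
  have "a = 1 \<and> b = 1" if "1 - (a + b) / 2 = 0" "a \<le> 1" "b \<le> 1" for a b :: real
    using that by (simp add: field_simps)
  from this[OF z[unfolded sdist_def] cos_le_one cos_le_one]
  have c: "cos (2 * pi * x $ 1) = 1" "cos (2 * pi * x $ 2) = 1" by blast+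
  have "x $ k \<in> \<int>" if ck: "cos (2 * pi * x $ k) = 1" for k
  proof -
    obtain n :: int where "2 * pi * x $ k = of_int n * 2 * pi" using ck cos_one_2pi_int by auto
    then have "x $ k = of_int n" by simp
    then show ?thesis by simp
  qed
  then show "x \<in> lattice2" using c by (simp add: lattice2_def forall_2)
next
  assume "x \<in> lattice2"
  from sdist_periodic[OF this, of 0] show "sdist x = 0" by (simp add: sdist_def)
qed

lemma sdist_pos: "x \<notin> lattice2 \<Longrightarrow> 0 < sdist x"
  using sdist_eq_0_iff[of x] sdist_range(1)[of x] by linarith

lemma continuous_sdist: "continuous_on A sdist"
  unfolding sdist_def by (intro continuous_intros) auto

lemma sdist_measurable [measurable]: "sdist \<in> borel_measurable borel"
  by (intro borel_measurable_continuous_onI continuous_sdist)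

lemma nice_sdist: "nice (\<lambda>x. sdist (x + y))"
proof -
  have "sdist (x + y) = 1 + (- 1 / 2) * (cos (((2 * pi) *\<^sub>R axis 1 1) \<bullet> x + 2 * pi * y $ 1)
      + cos (((2 * pi) *\<^sub>R axis 2 1) \<bullet> x + 2 * pi * y $ 2))" for x
    by (simp add: sdist_def inner_axis' algebra_simps)
  moreover have "nice (\<lambda>x::real^2. 1 + (- 1 / 2) * (cos (((2 * pi) *\<^sub>R axis 1 1) \<bullet> x + 2 * pi * y $ 1)
      + cos (((2 * pi) *\<^sub>R axis 2 1) \<bullet> x + 2 * pi * y $ 2)))"
    by (intro nice.intros)
  ultimately show ?thesis by simp
qed

text \<open>By compactness \<open>sdist\<close> has a positive minimum on the unit square outside
  the balls around lattice points, and periodicity does the rest. Smallness of \<open>sdist\<close>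
  can thus replace smallness of the distance to the lattice.\<close>

lemma sdist_small_near_lattice:
  assumes "0 < r"
  obtains \<delta> where "0 < \<delta>" "\<And>x. sdist x < \<delta> \<Longrightarrow> \<exists>k\<in>lattice2. norm (x - k) < r"
proof -
  define K where "K = cbox 0 1 - (\<Union>k\<in>lattice2. ball k r)"
  have "compact K"
    unfolding K_def by (intro compact_diff compact_cbox open_UN ballI open_ball)
  show ?thesis
  proof (cases "K = {}")
    case True
    have "\<exists>k\<in>lattice2. norm (x - k) < r" for x
    proof -
      have "wrap x \<in> cbox 0 1" using wrap_in[of x] by (auto simp: torus_def mem_box_cart less_imp_le)
      then obtain k where k: "k \<in> lattice2" "norm (wrap x - k) < r"
        using True by (auto simp: K_def dist_norm norm_minus_commute)
      have "k - (wrap x - x) \<in> lattice2" by (intro lattice2_diff k wrap_diff)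
      moreover have "norm (x - (k - (wrap x - x))) < r" using k(2) by simp
      ultimately show ?thesis by blast
    qed
    then show ?thesis using that[of 1] by simp
  next
    case False
    obtain z where z: "z \<in> K" "\<And>x. x \<in> K \<Longrightarrow> sdist z \<le> sdist x"
      using continuous_attains_inf[OF \<open>compact K\<close> False continuous_sdist] by blast
    have "z \<notin> lattice2" using z(1) assms by (auto simp: K_def)
    then have "0 < sdist z" by (rule sdist_pos)
    moreover have "\<exists>k\<in>lattice2. norm (x - k) < r" if "sdist x < sdist z" for x
    proof -
      have "sdist (wrap x) = sdist x" using sdist_periodic[OF wrap_diff[of x], of x] by simp
      then have "wrap x \<notin> K" using z(2)[of "wrap x"] that by auto
      moreover have "wrap x \<in> cbox 0 1" using wrap_in[of x] by (auto simp: torus_def mem_box_cart less_imp_le)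
      ultimately obtain k where k: "k \<in> lattice2" "norm (wrap x - k) < r"
        by (auto simp: K_def dist_norm norm_minus_commute)
      have "k - (wrap x - x) \<in> lattice2" by (intro lattice2_diff k wrap_diff)
      moreover have "norm (x - (k - (wrap x - x))) < r" using k(2) by simp
      ultimately show ?thesis by blast
    qed
    ultimately show ?thesis using that by blast
  qed
qed

text \<open>
  The Laplacian of \<open>ln (sdist + e)\<close> is an approximate multiple of the Dirac mass, up to a term that is
  bounded uniformly in \<open>e\<close>.
\<close>

definition log_kernel :: "real \<Rightarrow> real^2 \<Rightarrow> real" where
  "log_kernel e z = 4 * pi\<^sup>2 * (e * (1 - sdist z)
      - 2 * ((1 - cos (2 * pi * z $ 1)) / 2) * ((1 - cos (2 * pi * z $ 2)) / 2)) / (sdist z + e)\<^sup>2"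

lemma laplacian_log_sdist:
  assumes e: "0 < e"
  shows "laplacian (\<lambda>x. ln (sdist (x + y) + e)) x = log_kernel e (x + y)"
proof -
  define c where "c = (\<lambda>(i::2) x. cos (2 * pi * ((x + y) $ i)))"
  define s where "s = (\<lambda>(i::2) x. sin (2 * pi * ((x + y) $ i)))"
  define w where "w = (\<lambda>x. sdist (x + y) + e)"
  have w_eq: "w = (\<lambda>x. 1 - (c 1 x + c 2 x) / 2 + e)"
    by (simp add: w_def sdist_def c_def)
  have w: "0 < w x" for x using sdist_range(1)[of "x + y"] e by (simp add: w_def)
  have arg: "((\<lambda>x. 2 * pi * ((x + y) $ i)) has_derivative (\<lambda>h. 2 * pi * h $ i)) (at x)" for i x
    by (auto intro!: derivative_eq_intros bounded_linear_imp_has_derivative bounded_linear_vec_nth)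
  have dcos: "(c i has_derivative (\<lambda>h. - s i x * (2 * pi * h $ i))) (at x)" for i x
    using has_derivative_compose[OF arg DERIV_cos[unfolded has_field_derivative_def]]
    unfolding c_def s_def .
  have dsin: "(s i has_derivative (\<lambda>h. c i x * (2 * pi * h $ i))) (at x)" for i x
    using has_derivative_compose[OF arg DERIV_sin[unfolded has_field_derivative_def]]
    unfolding c_def s_def .
  define w' where "w' = (\<lambda>x (h::real^2). pi * (s 1 x * h $ 1 + s 2 x * h $ 2))"
  have dw: "(w has_derivative w' x) (at x)" for x
    unfolding w_eq w'_def
    by (auto intro!: derivative_eq_intros dcos simp: fun_eq_iff field_simps)
  have d1: "((\<lambda>x. ln (w x)) has_derivative (\<lambda>h. w' x h / w x)) (at x)" for x
    using has_derivative_compose[OF dw DERIV_ln[OF w, unfolded has_field_derivative_def]]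
    by (simp add: divide_inverse mult.commute)
  define w'' where "w'' = (\<lambda>x (b::real^2) (h::real^2). pi * (c 1 x * (2 * pi * h $ 1) * b $ 1 + c 2 x * (2 * pi * h $ 2) * b $ 2))"
  have dw': "((\<lambda>x. w' x b) has_derivative w'' x b) (at x)" for x and b :: "real^2"
    unfolding w'_def w''_def
    by (auto intro!: derivative_eq_intros dsin simp: fun_eq_iff algebra_simps)
  have d2: "((\<lambda>x. w' x b / w x) has_derivative (\<lambda>h. (w'' x b h * w x - w' x b * w' x h) / (w x * w x))) (at x)" for x b
    by (rule has_derivative_divide'[OF dw' dw]) (use w[of x] in simp)
  have sq: "(s i x)\<^sup>2 = 1 - (c i x)\<^sup>2" for i by (simp add: s_def c_def sin_squared_eq)
  have s_eq: "sdist (x + y) = 1 - (c 1 x + c 2 x) / 2" by (simp add: sdist_def c_def)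
  have "laplacian (\<lambda>x. ln (w x)) x = (2 * pi\<^sup>2 * c 1 x * w x - pi\<^sup>2 * (s 1 x)\<^sup>2) / (w x * w x)
       + (2 * pi\<^sup>2 * c 2 x * w x - pi\<^sup>2 * (s 2 x)\<^sup>2) / (w x * w x)"
    by (subst laplacian_eqI[OF d1 d2]) (simp add: w'_def w''_def axis_def power2_eq_square algebra_simps)
  also have "\<dots> = (2 * pi\<^sup>2 * (c 1 x + c 2 x) * w x - pi\<^sup>2 * (2 - (c 1 x)\<^sup>2 - (c 2 x)\<^sup>2)) / (w x)\<^sup>2"
    unfolding sq by (simp add: add_divide_distrib[symmetric] power2_eq_square algebra_simps)
  also have "2 * pi\<^sup>2 * (c 1 x + c 2 x) * w x - pi\<^sup>2 * (2 - (c 1 x)\<^sup>2 - (c 2 x)\<^sup>2)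
     = 4 * pi\<^sup>2 * (e * (1 - sdist (x + y)) - 2 * ((1 - c 1 x) / 2) * ((1 - c 2 x) / 2))"
    unfolding w_eq s_eq by (simp add: power2_eq_square field_simps)
  finally show ?thesis unfolding log_kernel_def w_def c_def .
qed

lemma nice_log_sdist: "0 < e \<Longrightarrow> nice (\<lambda>x. ln (sdist (x + y) + e))"
  using sdist_range(1) by (intro nice.intros nice_sdist) (simp add: add_nonneg_pos)

lemma log_sdist_periodic: "periodic2 (\<lambda>x. ln (sdist (x + y) + e))"
  unfolding periodic2_def
proof (intro allI ballI)
  fix x k :: "real^2" assume "k \<in> lattice2"
  then have "sdist ((x + y) + k) = sdist (x + y)" by (rule sdist_periodic)
  then show "ln (sdist (x + k + y) + e) = ln (sdist (x + y) + e)" by (simp add: ac_simps)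
qed

text \<open>With \<open>a\<close>, \<open>b\<close> the two squared sines and
  \<open>s = a + b\<close>, the term \<open>2 * a * b / w\<^sup>2\<close> is at most 1/2 and
  \<open>e * s / w\<^sup>2\<close> at most 1/4, both by the inequality of means. Up to bounded
  errors \<open>log_kernel\<close> is controlled by the bump
  \<open>4 * pi\<^sup>2 * (e / w\<^sup>2)\<close>, and conversely.\<close>

lemma log_kernel_bounds:
  assumes e: "0 < e"
  shows "\<bar>log_kernel e z\<bar> \<le> 2 * pi\<^sup>2 + 4 * pi\<^sup>2 * (e / (sdist z + e)\<^sup>2)"
    and "4 * pi\<^sup>2 * (e / (sdist z + e)\<^sup>2) \<le> log_kernel e z + 3 * pi\<^sup>2"
proof -
  define a where "a = (1 - cos (2 * pi * z $ 1)) / 2"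
  define b where "b = (1 - cos (2 * pi * z $ 2)) / 2"
  define s where "s = sdist z"
  define w where "w = s + e"
  have ab: "0 \<le> a" "0 \<le> b" "s = a + b" by (simp_all add: a_def b_def s_def sdist_def field_simps)
  have s: "0 \<le> s" "s \<le> 2" unfolding s_def by (rule sdist_range)+
  have w: "0 < w" "s \<le> w" using s e by (auto simp: w_def)
  have k: "log_kernel e z = 4 * pi\<^sup>2 * (e * (1 - s) / w\<^sup>2 - 2 * a * b / w\<^sup>2)"
    by (simp add: log_kernel_def a_def b_def s_def w_def diff_divide_distrib right_diff_distrib)
  have "4 * (a * b) \<le> (a + b)\<^sup>2" using zero_le_power2[of "a - b"] by (simp add: power2_eq_square algebra_simps)
  also have "\<dots> \<le> w\<^sup>2" using ab w s by (intro power_mono) auto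
  finally have ab2: "2 * a * b / w\<^sup>2 \<le> 1 / 2" using w by (simp add: field_simps)
  have ab0: "0 \<le> 2 * a * b / w\<^sup>2" using ab by simp
  have "\<bar>e * (1 - s) / w\<^sup>2\<bar> = e / w\<^sup>2 * \<bar>1 - s\<bar>" using e by (simp add: abs_mult)
  also have "\<dots> \<le> e / w\<^sup>2 * 1" using s e by (intro mult_left_mono) auto
  finally have e1: "\<bar>e * (1 - s) / w\<^sup>2\<bar> \<le> e / w\<^sup>2" by simp
  have "\<bar>e * (1 - s) / w\<^sup>2 - 2 * a * b / w\<^sup>2\<bar> \<le> e / w\<^sup>2 + 1 / 2"
    using e1 ab2 ab0 by linarith
  then have "\<bar>log_kernel e z\<bar> \<le> 4 * pi\<^sup>2 * (e / w\<^sup>2 + 1 / 2)"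
    unfolding k abs_mult by (intro mult_mono) auto
  then show "\<bar>log_kernel e z\<bar> \<le> 2 * pi\<^sup>2 + 4 * pi\<^sup>2 * (e / (sdist z + e)\<^sup>2)"
    by (simp add: w_def s_def algebra_simps)
  have "4 * (e * s) \<le> w\<^sup>2" using zero_le_power2[of "s - e"] by (simp add: w_def power2_eq_square algebra_simps)
  then have es: "e * s / w\<^sup>2 \<le> 1 / 4" using w by (simp add: field_simps)
  have "e / w\<^sup>2 = e * (1 - s) / w\<^sup>2 + e * s / w\<^sup>2"
    by (simp add: add_divide_distrib[symmetric] algebra_simps)
  also have "\<dots> \<le> (e * (1 - s) / w\<^sup>2 - 2 * a * b / w\<^sup>2) + 3 / 4"
    using es ab2 by linarith
  finally have "4 * pi\<^sup>2 * (e / w\<^sup>2) \<le> 4 * pi\<^sup>2 * ((e * (1 - s) / w\<^sup>2 - 2 * a * b / w\<^sup>2) + 3 / 4)"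
    by (intro mult_left_mono) auto
  then show "4 * pi\<^sup>2 * (e / (sdist z + e)\<^sup>2) \<le> log_kernel e z + 3 * pi\<^sup>2"
    unfolding k by (simp add: w_def s_def algebra_simps)
qed

lemma log_kernel_measurable [measurable]: "log_kernel e \<in> borel_measurable borel"
proof -
  have [measurable]: "(\<lambda>x::real^2. x $ k) \<in> borel_measurable borel" for k
    by (intro borel_measurable_continuous_onI continuous_intros)
  show ?thesis unfolding log_kernel_def by measurable
qed

lemma emeasure_torus_le_1: "measure torus_measure torus \<le> 1"
proof -
  have "torus \<subseteq> cbox 0 1" by (auto simp: torus_def mem_box_cart less_imp_le)
  then have "emeasure lborel torus \<le> emeasure lborel (cbox (0::real^2) 1)" by (intro emeasure_mono) auto
  also have "\<dots> = 1"
    by (subst emeasure_lborel_cbox) (auto simp: Basis_vec_def UNIV_2 inner_axis axis_eq_axis)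
  finally have "emeasure torus_measure torus \<le> 1" by (simp add: emeasure_restrict_space)
  then show ?thesis
    unfolding measure_def by (metis enn2real_leI ennreal_1 zero_le_one)
qed

text \<open>The kernel is the Laplacian of a periodic function and has integral 0;
  \<open>log_kernel_bounds\<close> then bounds the mass of the bump uniformly in
  \<open>e\<close>.\<close>

lemma integral_e_over_w:
  assumes e: "0 < e"
  shows "integrable torus_measure (\<lambda>x. 4 * pi\<^sup>2 * (e / (sdist (x + y) + e)\<^sup>2))"
    and "integral\<^sup>L torus_measure (\<lambda>x. 4 * pi\<^sup>2 * (e / (sdist (x + y) + e)\<^sup>2)) \<le> 3 * pi\<^sup>2"
proof -
  have le: "\<bar>4 * pi\<^sup>2 * (e / (sdist z + e)\<^sup>2)\<bar> \<le> 4 * pi\<^sup>2 * (e / e\<^sup>2)" for z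
  proof -
    have "e\<^sup>2 \<le> (sdist z + e)\<^sup>2" using sdist_range(1)[of z] e by (intro power_mono) auto
    then have "e / (sdist z + e)\<^sup>2 \<le> e / e\<^sup>2"
      using e sdist_range(1)[of z] by (intro divide_left_mono mult_pos_pos zero_less_power) auto
    then have "4 * pi\<^sup>2 * (e / (sdist z + e)\<^sup>2) \<le> 4 * pi\<^sup>2 * (e / e\<^sup>2)" by (intro mult_left_mono) auto
    moreover have "0 \<le> 4 * pi\<^sup>2 * (e / (sdist z + e)\<^sup>2)" using e by simp
    ultimately show ?thesis by linarith
  qed
  show int: "integrable torus_measure (\<lambda>x. 4 * pi\<^sup>2 * (e / (sdist (x + y) + e)\<^sup>2))"
    by (rule torus_integrable_bounded[OF _ le]) measurable
  have int': "integrable torus_measure (\<lambda>x. log_kernel e (x + y))"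
  proof (rule torus_integrable_bounded)
    show "\<bar>log_kernel e (x + y)\<bar> \<le> 2 * pi\<^sup>2 + 4 * pi\<^sup>2 * (e / e\<^sup>2)" for x
      using log_kernel_bounds(1)[OF e, of "x + y"] le[of "x + y"] by linarith
  qed measurable
  have "integral\<^sup>L torus_measure (\<lambda>x. 4 * pi\<^sup>2 * (e / (sdist (x + y) + e)\<^sup>2))
      \<le> integral\<^sup>L torus_measure (\<lambda>x. log_kernel e (x + y) + 3 * pi\<^sup>2)"
    by (intro integral_mono int Bochner_Integration.integrable_add int' torus_measure.integrable_const log_kernel_bounds(2)[OF e])
  also have "\<dots> = integral\<^sup>L torus_measure (\<lambda>x. log_kernel e (x + y)) + 3 * pi\<^sup>2 * measure torus_measure (space torus_measure)"
    using int' by (simp add: Bochner_Integration.integral_add)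
  also have "integral\<^sup>L torus_measure (\<lambda>x. log_kernel e (x + y)) = 0"
  proof -
    have "laplacian (\<lambda>x. ln (sdist (x + y) + e)) = (\<lambda>x. log_kernel e (x + y))"
      by (rule ext) (rule laplacian_log_sdist[OF e])
    then show ?thesis
      using integral_laplacian_periodic[OF nice_log_sdist[OF e] log_sdist_periodic, of y] by (simp only:)
  qed
  also have "0 + 3 * pi\<^sup>2 * measure torus_measure (space torus_measure) \<le> 3 * pi\<^sup>2"
    using emeasure_torus_le_1 by (simp add: space_restrict_space mult_left_le)
  finally show "integral\<^sup>L torus_measure (\<lambda>x. 4 * pi\<^sup>2 * (e / (sdist (x + y) + e)\<^sup>2)) \<le> 3 * pi\<^sup>2" .
qed

locale green =
  fixes G :: "real^2 \<Rightarrow> real"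
  assumes green: "green_function G"
begin

lemma G_periodic: "k \<in> lattice2 \<Longrightarrow> G (x + k) = G x"
  using green unfolding green_function_def periodic2_def by blast

lemma G_smooth: "smooth_on (- lattice2) G"
  using green unfolding green_function_def by blast

lemma G_integrable: "integrable torus_measure G"
  using green unfolding green_function_def set_integrable_def
  by (simp add: integrable_restrict_space)

lemma G_test:
  assumes "nice \<phi>" "periodic2 \<phi>"
  shows "integral\<^sup>L torus_measure (\<lambda>x. G x * (- laplacian \<phi> x)) = \<phi> 0 - integral\<^sup>L torus_measure \<phi>"
  using green nice_smooth[OF assms(1)] assms(2) unfolding green_function_def torus_integral_eq by blast

lemma G_continuous: "continuous_on (- lattice2) G"
  using G_smooth unfolding smooth_on_def by (metis Ck_on.simps(1))

lemma closed_lattice2: "closed lattice2"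
proof -
  have "lattice2 = sdist -` {0}" using sdist_eq_0_iff by auto
  moreover have "closed (sdist -` {0})"
    by (intro closed_vimage continuous_sdist closed_singleton)
  ultimately show ?thesis by simp
qed

text \<open>Continuity at \<open>y\<close> measured by \<open>sdist\<close>, so that it holds around
  all translates of \<open>y\<close> at once.\<close>

lemma G_close:
  assumes y: "y \<notin> lattice2" and \<epsilon>: "0 < \<epsilon>"
  obtains \<delta> where "0 < \<delta>" "\<And>x. sdist (x - y) < \<delta> \<Longrightarrow> \<bar>G x - G y\<bar> < \<epsilon>"
proof -
  have "isCont G y"
    using G_continuous y closed_lattice2 by (simp add: continuous_on_eq_continuous_at open_Compl)
  then obtain r where r: "0 < r" "\<And>x. norm (x - y) < r \<Longrightarrow> \<bar>G x - G y\<bar> < \<epsilon>"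
    using \<epsilon> unfolding continuous_at_eps_delta by (auto simp: dist_norm)
  obtain \<delta> where \<delta>: "0 < \<delta>" "\<And>x. sdist x < \<delta> \<Longrightarrow> \<exists>k\<in>lattice2. norm (x - k) < r"
    by (rule sdist_small_near_lattice[OF r(1)]) blast
  have "\<bar>G x - G y\<bar> < \<epsilon>" if sx: "sdist (x - y) < \<delta>" for x
  proof -
    obtain k where k: "k \<in> lattice2" "norm (x - y - k) < r" using \<delta>(2)[OF sx] by blast
    have "G (x + - k) = G x" by (rule G_periodic[OF lattice2_minus[OF k(1)]])
    moreover have "\<bar>G (x + - k) - G y\<bar> < \<epsilon>" by (rule r(2)) (use k(2) in \<open>simp add: algebra_simps\<close>)
    ultimately show ?thesis by simp
  qed
  then show ?thesis using that \<delta>(1) by blast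
qed

definition G_norm :: real where "G_norm = integral\<^sup>L torus_measure (\<lambda>x. \<bar>G x\<bar>)"

lemma G_integrable_mult:
  assumes "f \<in> borel_measurable borel" "\<And>x. \<bar>f x\<bar> \<le> C"
  shows "integrable torus_measure (\<lambda>x. G x * f x)"
proof (rule Bochner_Integration.integrable_bound)
  show "integrable torus_measure (\<lambda>x. C * G x)" by (intro integrable_mult_right G_integrable)
  have "G \<in> borel_measurable torus_measure" using G_integrable by (rule borel_measurable_integrable)
  then show "(\<lambda>x. G x * f x) \<in> borel_measurable torus_measure"
    using torus_measurable[OF assms(1)] by measurable
  have "\<bar>G x * f x\<bar> \<le> \<bar>C * G x\<bar>" for x
  proof -
    have "\<bar>f x\<bar> \<le> \<bar>C\<bar>" using assms(2)[of x] by linarith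
    then have "\<bar>G x\<bar> * \<bar>f x\<bar> \<le> \<bar>G x\<bar> * \<bar>C\<bar>" by (intro mult_left_mono) auto
    then show ?thesis by (simp add: abs_mult mult.commute)
  qed
  then show "AE x in torus_measure. norm (G x * f x) \<le> norm (C * G x)" by simp
qed

text \<open>Where \<open>sdist (x - y) < \<delta>\<close> the factor \<open>\<bar>G x\<bar>\<close>
  is at most \<open>\<bar>G y\<bar> + 1\<close>, and the bump has mass at most
  \<open>3 * pi\<^sup>2\<close>. Elsewhere the bump is at most \<open>4 * pi\<^sup>2\<close>, and
  the bounded part of the kernel adds \<open>2 * pi\<^sup>2\<close>; both are paid for by the
  integral of \<open>\<bar>G\<bar>\<close>.\<close>

lemma log_kernel_integral_bound:
  assumes y: "y \<notin> lattice2"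
  obtains \<delta> where "0 < \<delta>" "\<And>e. 0 < e \<Longrightarrow> e \<le> \<delta> \<Longrightarrow>
    \<bar>integral\<^sup>L torus_measure (\<lambda>x. G x * log_kernel e (x - y))\<bar> \<le> (\<bar>G y\<bar> + 1) * (3 * pi\<^sup>2) + 6 * pi\<^sup>2 * G_norm + 4 * pi\<^sup>2 * G_norm"
proof -
  obtain \<delta> where \<delta>: "0 < \<delta>" "\<And>x. sdist (x - y) < \<delta> \<Longrightarrow> \<bar>G x - G y\<bar> < 1"
    by (rule G_close[OF y zero_less_one]) blast
  \<comment> \<open>If \<open>sdist (x - y) \<ge> \<delta>\<close> then
    \<open>e \<le> \<delta>'\<close> implies \<open>e \<le> (sdist (x - y) + e)\<^sup>2\<close>,
    which is the bound on the bump away from \<open>y\<close>.\<close>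
  define \<delta>' where "\<delta>' = min 1 \<delta> ^ 2"
  have \<delta>': "0 < \<delta>'" using \<delta>(1) by (simp add: \<delta>'_def)
  have N0: "0 \<le> G_norm" unfolding G_norm_def by (intro integral_nonneg_AE) auto
  have "\<bar>integral\<^sup>L torus_measure (\<lambda>x. G x * log_kernel e (x - y))\<bar> \<le> (\<bar>G y\<bar> + 1) * (3 * pi\<^sup>2) + 6 * pi\<^sup>2 * G_norm + 4 * pi\<^sup>2 * G_norm"
    if e: "0 < e" "e \<le> \<delta>'" for e
  proof -
    define w where "w = (\<lambda>x. 4 * pi\<^sup>2 * (e / (sdist (x + - y) + e)\<^sup>2))"
    have iG: "integrable torus_measure (\<lambda>x. \<bar>G x\<bar>)" using G_integrable by simp
    have iw: "integrable torus_measure w" and w_int: "integral\<^sup>L torus_measure w \<le> 3 * pi\<^sup>2"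
      unfolding w_def by (rule integral_e_over_w[OF e(1)])+
    have w0: "0 \<le> w x" for x using e by (simp add: w_def)
    have pt: "\<bar>G x * log_kernel e (x - y)\<bar> \<le> (\<bar>G y\<bar> + 1) * w x + 6 * pi\<^sup>2 * \<bar>G x\<bar>" for x
    proof -
      have "\<bar>log_kernel e (x - y)\<bar> \<le> 2 * pi\<^sup>2 + w x"
        using log_kernel_bounds(1)[OF e(1), of "x - y"] by (simp add: w_def)
      then have 1: "\<bar>G x * log_kernel e (x - y)\<bar> \<le> \<bar>G x\<bar> * (2 * pi\<^sup>2 + w x)"
        unfolding abs_mult by (rule mult_left_mono) simp
      have 2: "\<bar>G x\<bar> * w x \<le> (\<bar>G y\<bar> + 1) * w x + 4 * pi\<^sup>2 * \<bar>G x\<bar>"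
      proof (cases "sdist (x - y) < \<delta>")
        case True
        then have "\<bar>G x\<bar> \<le> \<bar>G y\<bar> + 1" using \<delta>(2)[of x] by linarith
        then have "\<bar>G x\<bar> * w x \<le> (\<bar>G y\<bar> + 1) * w x" using w0 by (rule mult_right_mono)
        then show ?thesis by (simp add: add_increasing2)
      next
        case False
        have "min 1 \<delta> ^ 2 \<le> (sdist (x + - y) + e)\<^sup>2"
          using False e \<delta>(1) by (intro power_mono) auto
        then have "e \<le> (sdist (x + - y) + e)\<^sup>2" using e(2) by (simp add: \<delta>'_def)
        moreover have "0 < (sdist (x + - y) + e)\<^sup>2" using e sdist_range(1)[of "x + - y"] by (intro zero_less_power) linarith
        ultimately have "e / (sdist (x + - y) + e)\<^sup>2 \<le> 1" by (simp only: divide_le_eq_1_pos)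
        then have "w x \<le> 4 * pi\<^sup>2 * 1" unfolding w_def by (rule mult_left_mono) simp
        then have "\<bar>G x\<bar> * w x \<le> \<bar>G x\<bar> * (4 * pi\<^sup>2 * 1)" by (rule mult_left_mono) simp
        moreover have "0 \<le> (\<bar>G y\<bar> + 1) * w x" using w0[of x] by simp
        ultimately show ?thesis by (simp add: mult_ac)
      qed
      have "\<bar>G x\<bar> * (2 * pi\<^sup>2 + w x) = 2 * pi\<^sup>2 * \<bar>G x\<bar> + \<bar>G x\<bar> * w x" by (simp add: algebra_simps)
      then show ?thesis using 1 2 by linarith
    qed
    have int_rhs: "integrable torus_measure (\<lambda>x. (\<bar>G y\<bar> + 1) * w x + 6 * pi\<^sup>2 * \<bar>G x\<bar>)"
      by (intro Bochner_Integration.integrable_add integrable_mult_right iw iG)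
    have "\<bar>integral\<^sup>L torus_measure (\<lambda>x. G x * log_kernel e (x - y))\<bar> \<le> integral\<^sup>L torus_measure (\<lambda>x. \<bar>G x * log_kernel e (x - y)\<bar>)"
      by (rule integral_abs_bound)
    also have "\<dots> \<le> integral\<^sup>L torus_measure (\<lambda>x. (\<bar>G y\<bar> + 1) * w x + 6 * pi\<^sup>2 * \<bar>G x\<bar>)"
      by (rule integral_mono'[OF int_rhs pt]) (use w0 in simp)
    also have "\<dots> = (\<bar>G y\<bar> + 1) * integral\<^sup>L torus_measure w + 6 * pi\<^sup>2 * G_norm"
    proof -
      have "integrable torus_measure (\<lambda>x. (\<bar>G y\<bar> + 1) * w x)" by (rule integrable_mult_right[OF iw])
      moreover have "integrable torus_measure (\<lambda>x. 6 * pi\<^sup>2 * \<bar>G x\<bar>)" by (rule integrable_mult_right[OF iG])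
      ultimately show ?thesis
        unfolding G_norm_def by (subst Bochner_Integration.integral_add) (simp_all only: integral_mult_right_zero)
    qed
    also have "\<dots> \<le> (\<bar>G y\<bar> + 1) * (3 * pi\<^sup>2) + 6 * pi\<^sup>2 * G_norm"
      using w_int by (intro add_right_mono mult_left_mono) auto
    finally have "\<bar>integral\<^sup>L torus_measure (\<lambda>x. G x * log_kernel e (x - y))\<bar> \<le> (\<bar>G y\<bar> + 1) * (3 * pi\<^sup>2) + 6 * pi\<^sup>2 * G_norm" .
    moreover have "0 \<le> 4 * pi\<^sup>2 * G_norm" using N0 by simp
    ultimately show ?thesis by linarith
  qed
  then show ?thesis using that \<delta>' by blast
qed

text \<open>The defining identity of \<open>G\<close> for minus the regularised logarithm centred at
  \<open>y\<close>. The last integral does not depend on \<open>y\<close>.\<close>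

lemma log_kernel_integral:
  assumes e: "0 < e"
  shows "integral\<^sup>L torus_measure (\<lambda>x. G x * log_kernel e (x - y))
    = - ln (sdist y + e) + integral\<^sup>L torus_measure (\<lambda>x. ln (sdist x + e))"
proof -
  let ?f = "\<lambda>x. ln (sdist (x + - y) + e)"
  have n: "nice (\<lambda>x. (- 1) * ?f x)" by (intro nice.mult nice.const nice_log_sdist e)
  have p: "periodic2 (\<lambda>x. (- 1) * ?f x)" using log_sdist_periodic[of "- y" e] unfolding periodic2_def by simp
  have lap: "laplacian (\<lambda>x. (- 1) * ?f x) x = - laplacian ?f x" for x
  proof -
    have nf: "nice ?f" by (rule nice_log_sdist[OF e])
    have d1: "((\<lambda>x. (- 1) * ?f x) has_derivative (\<lambda>h. - frechet_derivative ?f (at x) h)) (at x)" for x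
      using has_derivative_minus[OF nice_has_derivative[OF nf, of x]] by simp
    have d2: "((\<lambda>x. - frechet_derivative ?f (at x) b) has_derivative
        (\<lambda>h. - frechet_derivative (\<lambda>x. frechet_derivative ?f (at x) b) (at x) h)) (at x)" for x b
      using has_derivative_minus[OF nice_has_derivative[OF nice_frechet[OF nf, of b], of x]] .
    show ?thesis
      by (subst laplacian_eqI[OF d1 d2]) (simp add: laplacian_def sum_Basis_real2)
  qed
  have "integral\<^sup>L torus_measure (\<lambda>x. G x * log_kernel e (x - y))
      = integral\<^sup>L torus_measure (\<lambda>x. G x * (- laplacian (\<lambda>x. (- 1) * ?f x) x))"
    unfolding lap laplacian_log_sdist[OF e] by simp
  also have "\<dots> = (- 1) * ?f 0 - integral\<^sup>L torus_measure (\<lambda>x. (- 1) * ?f x)"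
    by (rule G_test[OF n p])
  also have "integral\<^sup>L torus_measure (\<lambda>x. (- 1) * ?f x) = - integral\<^sup>L torus_measure ?f"
    by (simp only: integral_mult_right_zero)
  also have "integral\<^sup>L torus_measure ?f = integral\<^sup>L torus_measure (\<lambda>x. ln (sdist x + e))"
    by (rule torus_integral_shift[where f = "\<lambda>x. ln (sdist x + e)"]) (auto simp: sdist_periodic)
  finally show ?thesis by simp
qed

text \<open>Comparing \<open>y\<close> with a fixed point \<open>y0\<close> cancels the integral in
  \<open>log_kernel_integral\<close> that does not depend on \<open>y\<close>. The left side is then
  of the order of \<open>- ln (sdist y)\<close>, the right side of the order of
  \<open>\<bar>G y\<bar> + 1\<close>.\<close>

lemma G_blowup:
  obtains \<delta> where "0 < \<delta>" "\<And>y. y \<notin> lattice2 \<Longrightarrow> sdist y < \<delta> \<Longrightarrow> C < \<bar>G y\<bar>"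
proof -
  have "((\<chi> i. 1 / 2) :: real^2) \<notin> lattice2"
  proof
    assume "((\<chi> i. 1 / 2) :: real^2) \<in> lattice2"
    then have "(1 / 2 :: real) \<in> \<int>" by (simp add: lattice2_def)
    then obtain n :: int where "1 / 2 = real_of_int n" by (auto elim: Ints_cases)
    then have "1 = 2 * n" by linarith
    then show False by presburger
  qed
  then obtain y0 :: "real^2" where y0: "y0 \<notin> lattice2" by blast
  define A where "A = (\<bar>G y0\<bar> + 1) * (3 * pi\<^sup>2) + 2 * (6 * pi\<^sup>2 * G_norm + 4 * pi\<^sup>2 * G_norm) - ln (sdist y0)"
  have main: "- ln (2 * sdist y) \<le> A + (\<bar>G y\<bar> + 1) * (3 * pi\<^sup>2)" if y: "y \<notin> lattice2" for y
  proof -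
    obtain \<delta>1 where \<delta>1: "0 < \<delta>1" "\<And>e. 0 < e \<Longrightarrow> e \<le> \<delta>1 \<Longrightarrow>
      \<bar>integral\<^sup>L torus_measure (\<lambda>x. G x * log_kernel e (x - y))\<bar> \<le> (\<bar>G y\<bar> + 1) * (3 * pi\<^sup>2) + 6 * pi\<^sup>2 * G_norm + 4 * pi\<^sup>2 * G_norm"
      by (rule log_kernel_integral_bound[OF y]) blast
    obtain \<delta>2 where \<delta>2: "0 < \<delta>2" "\<And>e. 0 < e \<Longrightarrow> e \<le> \<delta>2 \<Longrightarrow>
      \<bar>integral\<^sup>L torus_measure (\<lambda>x. G x * log_kernel e (x - y0))\<bar> \<le> (\<bar>G y0\<bar> + 1) * (3 * pi\<^sup>2) + 6 * pi\<^sup>2 * G_norm + 4 * pi\<^sup>2 * G_norm"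
      by (rule log_kernel_integral_bound[OF y0]) blast
    \<comment> \<open>\<open>e \<le> sdist y\<close> gives
      \<open>ln (sdist y + e) \<le> ln (2 * sdist y)\<close>, so no limit in \<open>e\<close> has to
      be taken.\<close>
    define e where "e = Min {\<delta>1, \<delta>2, sdist y}"
    have e: "0 < e" "e \<le> \<delta>1" "e \<le> \<delta>2" "e \<le> sdist y"
      using \<delta>1 \<delta>2 sdist_pos[OF y] by (auto simp: e_def)
    have "- ln (sdist y + e) + ln (sdist y0 + e)
        = integral\<^sup>L torus_measure (\<lambda>x. G x * log_kernel e (x - y)) - integral\<^sup>L torus_measure (\<lambda>x. G x * log_kernel e (x - y0))"
      unfolding log_kernel_integral[OF e(1)] by simp
    also have "\<dots> \<le> A + ln (sdist y0) + (\<bar>G y\<bar> + 1) * (3 * pi\<^sup>2)"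
      using \<delta>1(2)[OF e(1,2)] \<delta>2(2)[OF e(1,3)] unfolding A_def by argo
    finally have 1: "- ln (sdist y + e) + ln (sdist y0 + e) \<le> A + ln (sdist y0) + (\<bar>G y\<bar> + 1) * (3 * pi\<^sup>2)" .
    have "ln (sdist y + e) \<le> ln (2 * sdist y)" using e sdist_pos[OF y] by (subst ln_le_cancel_iff) auto
    moreover have "ln (sdist y0) \<le> ln (sdist y0 + e)" using e sdist_pos[OF y0] by (subst ln_le_cancel_iff) auto
    ultimately show ?thesis using 1 by linarith
  qed
  \<comment> \<open>Chosen so that \<open>- ln (2 * \<delta>)\<close> equals the bound of
    \<open>main\<close> with \<open>\<bar>C\<bar>\<close> in place of
    \<open>\<bar>G y\<bar>\<close>.\<close>
  define \<delta> where "\<delta> = exp (- (A + (\<bar>C\<bar> + 1) * (3 * pi\<^sup>2))) / 2"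
  have "C < \<bar>G y\<bar>" if y: "y \<notin> lattice2" "sdist y < \<delta>" for y
  proof (rule ccontr)
    assume "\<not> C < \<bar>G y\<bar>"
    then have "(\<bar>G y\<bar> + 1) * (3 * pi\<^sup>2) \<le> (\<bar>C\<bar> + 1) * (3 * pi\<^sup>2)" by (intro mult_right_mono) auto
    moreover have "ln (2 * sdist y) < ln (2 * \<delta>)" using y sdist_pos[OF y(1)] by (subst ln_less_cancel_iff) auto
    moreover have "ln (2 * \<delta>) = - (A + (\<bar>C\<bar> + 1) * (3 * pi\<^sup>2))" by (simp add: \<delta>_def)
    ultimately show False using main[OF y(1)] by linarith
  qed
  then show ?thesis using that[of \<delta>] by (simp add: \<delta>_def)
qed

end

subsection \<open>Symmetry of the Green function\<close>

lemma inner_lattice2: "k \<in> lattice2 \<Longrightarrow> l \<in> lattice2 \<Longrightarrow> k \<bullet> l \<in> \<int>"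
  by (auto simp: lattice2_def inner_vec_def intro!: Ints_sum Ints_mult)

lemma cos_lattice_periodic:
  assumes k: "k \<in> lattice2" and l: "l \<in> lattice2"
  shows "cos (2 * pi * (k \<bullet> (x + l))) = cos (2 * pi * (k \<bullet> x))"
  unfolding inner_add_right by (rule cos_periodic_int[OF inner_lattice2[OF k l]])

lemma laplacian_cos:
  fixes k y :: "real^2"
  shows "laplacian (\<lambda>x. cos (2 * pi * (k \<bullet> (x + y)))) x = - (4 * pi\<^sup>2 * ((k $ 1)\<^sup>2 + (k $ 2)\<^sup>2)) * cos (2 * pi * (k \<bullet> (x + y)))"
proof -
  let ?u = "\<lambda>x. 2 * pi * (k \<bullet> (x + y))"
  have arg: "(?u has_derivative (\<lambda>h. 2 * pi * (k \<bullet> h))) (at x)" for x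
    by (auto intro!: derivative_eq_intros)
  have d1: "((\<lambda>x. cos (?u x)) has_derivative (\<lambda>h. - sin (?u x) * (2 * pi * (k \<bullet> h)))) (at x)" for x
    by (rule has_derivative_compose[OF arg DERIV_cos[unfolded has_field_derivative_def]])
  have ds: "((\<lambda>x. sin (?u x)) has_derivative (\<lambda>h. cos (?u x) * (2 * pi * (k \<bullet> h)))) (at x)" for x
    by (rule has_derivative_compose[OF arg DERIV_sin[unfolded has_field_derivative_def]])
  have d2: "((\<lambda>x. - sin (?u x) * (2 * pi * (k \<bullet> b))) has_derivative
      (\<lambda>h. - (cos (?u x) * (2 * pi * (k \<bullet> h))) * (2 * pi * (k \<bullet> b)))) (at x)" for x b
    by (intro has_derivative_mult_left has_derivative_minus ds)
  show ?thesis
    by (subst laplacian_eqI[OF d1 d2]) (simp add: inner_axis power2_eq_square algebra_simps)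
qed

text \<open>Without phases all members are even functions.\<close>

inductive trig_poly :: "(real^2 \<Rightarrow> real) \<Rightarrow> bool" where
  cos: "k \<in> lattice2 \<Longrightarrow> trig_poly (\<lambda>x. cos (2 * pi * (k \<bullet> x)))"
| add: "trig_poly f \<Longrightarrow> trig_poly g \<Longrightarrow> trig_poly (\<lambda>x. f x + g x)"
| scale: "trig_poly f \<Longrightarrow> trig_poly (\<lambda>x. c * f x)"

lemma trig_poly_mult_cos:
  assumes l: "l \<in> lattice2"
  shows "trig_poly f \<Longrightarrow> trig_poly (\<lambda>x. f x * cos (2 * pi * (l \<bullet> x)))"
proof (induction rule: trig_poly.induct)
  case (cos k)
  have "cos (2 * pi * (k \<bullet> x)) * cos (2 * pi * (l \<bullet> x))
      = 1 / 2 * cos (2 * pi * ((k - l) \<bullet> x)) + 1 / 2 * cos (2 * pi * ((k + l) \<bullet> x))" for x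
    by (simp add: cos_times_cos inner_add_left inner_diff_left algebra_simps add_divide_distrib)
  moreover have "trig_poly (\<lambda>x. 1 / 2 * cos (2 * pi * ((k - l) \<bullet> x)) + 1 / 2 * cos (2 * pi * ((k + l) \<bullet> x)))"
    by (intro trig_poly.intros lattice2_diff lattice2_add cos l)
  ultimately show ?case by simp
next
  case (add f g)
  then show ?case using trig_poly.add by (simp add: distrib_right)
next
  case (scale f c)
  then show ?case using trig_poly.scale by (simp add: mult.assoc)
qed

text \<open>\<open>1 - sdist x / 2\<close> takes values in \<open>{0..1}\<close> and equals 1
  exactly on the lattice, so its powers concentrate there, in the manner of a Fejer kernel.\<close>

lemma trig_poly_kernel: "trig_poly (\<lambda>x. (1 - sdist x / 2) ^ n)"
proof (induction n)
  case 0
  have "trig_poly (\<lambda>x. cos (2 * pi * ((0 :: real^2) \<bullet> x)))" by (rule trig_poly.cos[OF lattice2_0])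
  then show ?case by simp
next
  case (Suc n)
  have ax: "axis i 1 \<in> lattice2" for i by (auto simp: lattice2_def axis_def)
  let ?T = "\<lambda>x. (1 - sdist x / 2) ^ n"
  have "(1 - sdist x / 2) ^ Suc n = 1 / 2 * ?T x + (1 / 4 * (?T x * cos (2 * pi * (axis 1 1 \<bullet> x)))
       + 1 / 4 * (?T x * cos (2 * pi * (axis 2 1 \<bullet> x))))" for x
  proof -
    have alg: "T * (1 / 2 + (1 / 4 * a + 1 / 4 * b)) = 1 / 2 * T + (1 / 4 * (T * a) + 1 / 4 * (T * b))" for T a b :: real
      by (simp add: algebra_simps)
    have eq: "(1 - sdist x / 2) = 1 / 2 + (1 / 4 * cos (2 * pi * (axis 1 1 \<bullet> x)) + 1 / 4 * cos (2 * pi * (axis 2 1 \<bullet> x)))"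
      by (simp add: sdist_def inner_axis' field_simps)
    have "(1 - sdist x / 2) ^ Suc n = ?T x * (1 - sdist x / 2)" by simp
    also have "\<dots> = ?T x * (1 / 2 + (1 / 4 * cos (2 * pi * (axis 1 1 \<bullet> x)) + 1 / 4 * cos (2 * pi * (axis 2 1 \<bullet> x))))"
      by (rule arg_cong[OF eq])
    finally show ?thesis unfolding alg .
  qed
  moreover have "trig_poly (\<lambda>x. 1 / 2 * ?T x + (1 / 4 * (?T x * cos (2 * pi * (axis 1 1 \<bullet> x)))
       + 1 / 4 * (?T x * cos (2 * pi * (axis 2 1 \<bullet> x)))))"
    by (intro trig_poly.add trig_poly.scale trig_poly_mult_cos Suc ax)
  ultimately show ?case by simp
qed

lemma trig_poly_bounded: "trig_poly f \<Longrightarrow> f \<in> borel_measurable borel \<and> (\<exists>C. \<forall>x. \<bar>f x\<bar> \<le> C)"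
proof (induction rule: trig_poly.induct)
  case (cos k)
  have "\<exists>C. \<forall>x. \<bar>cos (2 * pi * (k \<bullet> x))\<bar> \<le> C" by (intro exI[of _ 1]) simp
  moreover have "(\<lambda>x. cos (2 * pi * (k \<bullet> x))) \<in> borel_measurable borel"
    by (intro borel_measurable_continuous_onI continuous_intros)
  ultimately show ?case by blast
next
  case (add f g)
  then obtain C D where "\<And>x. \<bar>f x\<bar> \<le> C" "\<And>x. \<bar>g x\<bar> \<le> D" by auto
  then have "\<bar>f x + g x\<bar> \<le> C + D" for x by (meson abs_triangle_ineq add_mono order_trans)
  then show ?case using add by auto
next
  case (scale f c)
  then obtain C where "\<And>x. \<bar>f x\<bar> \<le> C" by auto
  then have "\<bar>c * f x\<bar> \<le> \<bar>c\<bar> * C" for x by (simp add: abs_mult mult_left_mono)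
  then show ?case using scale by auto
qed

lemma sdist_sublevel_pos:
  assumes "0 < \<delta>"
  shows "0 < measure torus_measure {x \<in> torus. sdist x < \<delta>}"
proof -
  let ?U = "box 0 1 \<inter> sdist -` {..<\<delta>} :: (real^2) set"
  have sub: "?U \<subseteq> torus" by (auto simp: torus_def mem_box_cart less_imp_le)
  have op: "open ?U"
    by (intro open_Int open_box open_vimage open_lessThan continuous_sdist)
  have "isCont sdist 0" using continuous_sdist[of UNIV] by (simp add: continuous_on_eq_continuous_at)
  then obtain r where r: "0 < r" "\<And>x. norm x < r \<Longrightarrow> \<bar>sdist x - sdist 0\<bar> < \<delta>"
    using assms unfolding continuous_at_eps_delta by (auto simp: dist_norm)
  define t where "t = min (1 / 2) (r / 3)"
  \<comment> \<open>The origin is a corner of the fundamental square, so a nearby point on the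
    diagonal is used to find an open subset of positive measure.\<close>
  define x where "x = ((\<chi> i. t) :: real^2)"
  have t: "0 < t" "t < 1" "2 * t < r" using r by (auto simp: t_def min_def)
  have "norm x \<le> 2 * t"
    using norm_le_l1_cart[of x] t by (simp add: x_def sum_2)
  then have "\<bar>sdist x - sdist 0\<bar> < \<delta>" using r t by auto
  moreover have "sdist 0 = 0" by (simp add: sdist_eq_0_iff lattice2_0)
  ultimately have "x \<in> ?U" using t by (auto simp: x_def mem_box_cart)
  then have "\<not> negligible ?U" using open_not_negligible[OF op] by blast
  then have "emeasure lborel ?U \<noteq> 0"
    using op negligible_iff_null_sets[of ?U] by (auto simp: null_sets_def null_sets_completion_iff)
  moreover have "emeasure lborel ?U = emeasure torus_measure ?U"
    using op sub by (subst emeasure_restrict_space) auto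
  moreover have "emeasure torus_measure ?U \<le> emeasure torus_measure {x \<in> torus. sdist x < \<delta>}"
  proof (rule emeasure_mono)
    have "{x \<in> torus. sdist x < \<delta>} = torus \<inter> sdist -` {..<\<delta>}" by auto
    moreover have "sdist -` {..<\<delta>} \<in> sets borel"
      by (intro borel_open open_vimage open_lessThan continuous_sdist)
    ultimately show "{x \<in> torus. sdist x < \<delta>} \<in> sets torus_measure"
      by (auto simp: sets_restrict_space)
  qed (use sub in auto)
  ultimately have "emeasure torus_measure {x \<in> torus. sdist x < \<delta>} \<noteq> 0" by auto
  then show ?thesis
    by (simp add: torus_measure.emeasure_eq_measure zero_less_measure_iff)
qed

context green
begin

text \<open>A plane wave is an eigenfunction of the Laplacian, so testing \<open>G\<close> with its
  translate by \<open>z\<close> gives a multiple of the integral in question and a right side that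
  is even in \<open>z\<close>. The frequency 0, with eigenvalue 0, is trivial.\<close>

lemma G_cos_even:
  assumes k: "k \<in> lattice2"
  shows "integral\<^sup>L torus_measure (\<lambda>x. G x * cos (2 * pi * (k \<bullet> (x + - y))))
    = integral\<^sup>L torus_measure (\<lambda>x. G x * cos (2 * pi * (k \<bullet> (x + y))))"
proof (cases "k = 0")
  case False
  define c where "c = 4 * pi\<^sup>2 * ((k $ 1)\<^sup>2 + (k $ 2)\<^sup>2)"
  have "(k $ 1)\<^sup>2 + (k $ 2)\<^sup>2 \<noteq> 0"
    using False by (auto simp: vec_eq_iff forall_2 sum_power2_eq_zero_iff)
  then have c: "c \<noteq> 0" by (simp add: c_def)
  have test: "c * integral\<^sup>L torus_measure (\<lambda>x. G x * cos (2 * pi * (k \<bullet> (x + z))))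
      = cos (2 * pi * (k \<bullet> z)) - integral\<^sup>L torus_measure (\<lambda>x. cos (2 * pi * (k \<bullet> x)))" for z
  proof -
    let ?\<phi> = "\<lambda>x. cos (2 * pi * (k \<bullet> (x + z)))"
    have "nice (\<lambda>x. cos (((2 * pi) *\<^sub>R k) \<bullet> x + 2 * pi * (k \<bullet> z)))" by (rule nice.cos)
    then have n: "nice ?\<phi>" by (simp add: inner_add_right algebra_simps)
    have p: "periodic2 ?\<phi>"
      unfolding periodic2_def
    proof (intro allI ballI)
      fix x l :: "real^2" assume l: "l \<in> lattice2"
      show "?\<phi> (x + l) = ?\<phi> x"
        using cos_lattice_periodic[OF k l, of "x + z"] by (simp add: ac_simps)
    qed
    have "c * integral\<^sup>L torus_measure (\<lambda>x. G x * ?\<phi> x) = integral\<^sup>L torus_measure (\<lambda>x. c * (G x * ?\<phi> x))"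
      by simp
    also have "(\<lambda>x. c * (G x * ?\<phi> x)) = (\<lambda>x. G x * (- laplacian ?\<phi> x))"
      unfolding laplacian_cos c_def[symmetric] by (simp add: mult_ac)
    also have "integral\<^sup>L torus_measure (\<lambda>x. G x * (- laplacian ?\<phi> x)) = ?\<phi> 0 - integral\<^sup>L torus_measure ?\<phi>"
      by (rule G_test[OF n p])
    also have "integral\<^sup>L torus_measure ?\<phi> = integral\<^sup>L torus_measure (\<lambda>x. cos (2 * pi * (k \<bullet> x)))"
      by (rule torus_integral_shift[where f = "\<lambda>x. cos (2 * pi * (k \<bullet> x))"])
         (auto simp: cos_lattice_periodic[OF k] intro!: borel_measurable_continuous_onI continuous_intros)
    finally show ?thesis by simp
  qed
  have "cos (2 * pi * (k \<bullet> - y)) = cos (2 * pi * (k \<bullet> y))" by simp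
  then have "c * integral\<^sup>L torus_measure (\<lambda>x. G x * cos (2 * pi * (k \<bullet> (x + - y))))
     = c * integral\<^sup>L torus_measure (\<lambda>x. G x * cos (2 * pi * (k \<bullet> (x + y))))"
    unfolding test by (simp only:)
  then show ?thesis using c by (simp only: mult_cancel_left) blast
qed simp

lemma G_trig_even:
  "trig_poly f \<Longrightarrow> integral\<^sup>L torus_measure (\<lambda>x. G x * f (x + - y)) = integral\<^sup>L torus_measure (\<lambda>x. G x * f (x + y))"
proof (induction rule: trig_poly.induct)
  case (cos k)
  then show ?case by (rule G_cos_even)
next
  case (add f g)
  have int: "integrable torus_measure (\<lambda>x. G x * h (x + z))" if h: "trig_poly h" for h z
  proof -
    obtain C where m: "h \<in> borel_measurable borel" and C: "\<And>x. \<bar>h x\<bar> \<le> C"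
      using trig_poly_bounded[OF h] by blast
    have "(\<lambda>x. h (x + z)) \<in> borel_measurable borel" using m by measurable
    then show ?thesis using C by (rule G_integrable_mult)
  qed
  show ?case
    unfolding distrib_left
    by (simp only: Bochner_Integration.integral_add[OF int[OF add.hyps(1)] int[OF add.hyps(2)]] add.IH)
next
  case (scale f c)
  have "integral\<^sup>L torus_measure (\<lambda>x. G x * (c * f (x + z))) = c * integral\<^sup>L torus_measure (\<lambda>x. G x * f (x + z))" for z
    by (simp only: mult.left_commute[of _ c] integral_mult_right_zero)
  then show ?case using scale.IH by (simp only:)
qed

text \<open>The convolutions of \<open>G\<close> with the peak kernel at \<open>y\<close> and at
  \<open>- y\<close> agree. Divided by the mass \<open>M n\<close> they would approximate
  \<open>G y\<close> and \<open>G (- y)\<close>, so a gap between these is incompatible with the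
  concentration of the kernel.\<close>

lemma G_even:
  assumes y: "y \<notin> lattice2"
  shows "G (- y) = G y"
proof (rule ccontr)
  assume ne: "G (- y) \<noteq> G y"
  \<comment> \<open>A quarter of the gap: the two approximation errors \<open>d * M n\<close>
    consume half of it and \<open>2 * d * M n\<close> remains.\<close>
  define d where "d = \<bar>G y - G (- y)\<bar> / 4"
  have d: "0 < d" using ne by (simp add: d_def)
  have y': "- y \<notin> lattice2" using y by simp
  obtain \<delta>1 where \<delta>1: "0 < \<delta>1" "\<And>x. sdist (x - y) < \<delta>1 \<Longrightarrow> \<bar>G x - G y\<bar> < d"
    by (rule G_close[OF y d]) blast
  obtain \<delta>2 where \<delta>2: "0 < \<delta>2" "\<And>x. sdist (x - - y) < \<delta>2 \<Longrightarrow> \<bar>G x - G (- y)\<bar> < d"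
    by (rule G_close[OF y' d]) blast
  define \<delta> where "\<delta> = Min {1, \<delta>1, \<delta>2}"
  have \<delta>: "0 < \<delta>" "\<delta> \<le> 1" "\<delta> \<le> \<delta>1" "\<delta> \<le> \<delta>2" using \<delta>1 \<delta>2 by (auto simp: \<delta>_def)
  define T where "T = (\<lambda>n x. (1 - sdist x / 2) ^ n)"
  have T0: "0 \<le> T n x" and T1: "T n x \<le> 1" for n x
    using sdist_range[of x] by (auto simp: T_def intro!: zero_le_power power_le_one)
  have T_meas [measurable]: "T n \<in> borel_measurable borel" for n unfolding T_def by measurable
  have T_int: "integrable torus_measure (\<lambda>x. T n (x + z))" for n z
    by (rule torus_integrable_bounded[where C = 1]) (use T0 T1 in \<open>auto simp: abs_le_iff intro: order_trans[of _ 0]\<close>)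
  have GT_int: "integrable torus_measure (\<lambda>x. G x * T n (x + z))" for n z
    by (rule G_integrable_mult[where C = 1]) (use T0 T1 in \<open>auto simp: abs_le_iff intro: order_trans[of _ 0]\<close>)
  define M where "M = (\<lambda>n. integral\<^sup>L torus_measure (T n))"
  have M_shift: "integral\<^sup>L torus_measure (\<lambda>x. T n (x + z)) = M n" for n z
    unfolding M_def by (rule torus_integral_shift) (auto simp: T_def sdist_periodic)
  define q where "q = 1 - \<delta> / 2"
  have q: "0 < q" "q < 1" using \<delta> by (auto simp: q_def)
  \<comment> \<open>Where \<open>sdist\<close> is at least \<open>\<delta>\<close> the kernel is at
    most \<open>q ^ n\<close>; the remaining error is at most \<open>d\<close> per unit of
    mass.\<close>
  have est: "\<bar>integral\<^sup>L torus_measure (\<lambda>x. G x * T n (x + z)) - g * M n\<bar> \<le> d * M n + (G_norm + \<bar>g\<bar>) * q ^ n"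
    if close: "\<And>x. sdist (x + z) < \<delta> \<Longrightarrow> \<bar>G x - g\<bar> \<le> d" for n z g
  proof -
    have iA: "integrable torus_measure (\<lambda>x. (\<bar>G x\<bar> + \<bar>g\<bar>) * q ^ n)" using G_integrable by simp
    have iR: "integrable torus_measure (\<lambda>x. d * T n (x + z) + (\<bar>G x\<bar> + \<bar>g\<bar>) * q ^ n)"
      by (intro Bochner_Integration.integrable_add integrable_mult_right T_int iA)
    have iL: "integrable torus_measure (\<lambda>x. G x * T n (x + z) - g * T n (x + z))"
      by (intro Bochner_Integration.integrable_diff integrable_mult_right T_int GT_int)
    have pt: "\<bar>G x * T n (x + z) - g * T n (x + z)\<bar> \<le> d * T n (x + z) + (\<bar>G x\<bar> + \<bar>g\<bar>) * q ^ n" for x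
    proof -
      have eq: "\<bar>G x * T n (x + z) - g * T n (x + z)\<bar> = \<bar>G x - g\<bar> * T n (x + z)"
        using T0[of n "x + z"] by (simp add: left_diff_distrib[symmetric] abs_mult)
      have n1: "0 \<le> (\<bar>G x\<bar> + \<bar>g\<bar>) * q ^ n" and n2: "0 \<le> d * T n (x + z)" using q d T0 by auto
      show ?thesis
      proof (cases "sdist (x + z) < \<delta>")
        case True
        have "\<bar>G x - g\<bar> * T n (x + z) \<le> d * T n (x + z)"
          using close[OF True] T0 by (rule mult_right_mono)
        then show ?thesis using eq n1 by linarith
      next
        case False
        have "T n (x + z) \<le> q ^ n"
          unfolding T_def using False sdist_range[of "x + z"] by (intro power_mono) (auto simp: q_def)
        moreover have "\<bar>G x - g\<bar> \<le> \<bar>G x\<bar> + \<bar>g\<bar>" by (rule abs_triangle_ineq4)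
        ultimately have "\<bar>G x - g\<bar> * T n (x + z) \<le> (\<bar>G x\<bar> + \<bar>g\<bar>) * q ^ n"
          using T0 by (intro mult_mono) auto
        then show ?thesis using eq n2 by linarith
      qed
    qed
    have "integral\<^sup>L torus_measure (\<lambda>x. G x * T n (x + z)) - g * M n
       = integral\<^sup>L torus_measure (\<lambda>x. G x * T n (x + z) - g * T n (x + z))"
      by (subst Bochner_Integration.integral_diff) (auto simp: GT_int T_int M_shift)
    then have "\<bar>integral\<^sup>L torus_measure (\<lambda>x. G x * T n (x + z)) - g * M n\<bar>
       \<le> integral\<^sup>L torus_measure (\<lambda>x. \<bar>G x * T n (x + z) - g * T n (x + z)\<bar>)"
      by (simp only: integral_abs_bound)
    also have "\<dots> \<le> integral\<^sup>L torus_measure (\<lambda>x. d * T n (x + z) + (\<bar>G x\<bar> + \<bar>g\<bar>) * q ^ n)"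
      by (rule integral_mono[OF _ iR pt]) (use iL in simp)
    also have "\<dots> = d * M n + (G_norm + \<bar>g\<bar> * measure torus_measure torus) * q ^ n"
    proof -
      have "integral\<^sup>L torus_measure (\<lambda>x. d * T n (x + z) + (\<bar>G x\<bar> + \<bar>g\<bar>) * q ^ n)
         = integral\<^sup>L torus_measure (\<lambda>x. d * T n (x + z)) + integral\<^sup>L torus_measure (\<lambda>x. (\<bar>G x\<bar> + \<bar>g\<bar>) * q ^ n)"
        by (intro Bochner_Integration.integral_add integrable_mult_right T_int iA)
      moreover have "integral\<^sup>L torus_measure (\<lambda>x. \<bar>G x\<bar> + \<bar>g\<bar>) = G_norm + \<bar>g\<bar> * measure torus_measure torus"
        using G_integrable by (simp add: G_norm_def space_restrict_space)
      ultimately show ?thesis by (simp add: M_shift)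
    qed
    also have "\<dots> \<le> d * M n + (G_norm + \<bar>g\<bar>) * q ^ n"
      using q emeasure_torus_le_1 by (intro add_left_mono mult_right_mono) (auto simp: mult_left_le)
    finally show ?thesis .
  qed
  define C where "C = (G_norm + \<bar>G y\<bar>) + (G_norm + \<bar>G (- y)\<bar>)"
  have le1: "2 * d * M n \<le> C * q ^ n" for n
  proof -
    define I where "I = integral\<^sup>L torus_measure (\<lambda>x. G x * T n (x + y))"
    have I': "integral\<^sup>L torus_measure (\<lambda>x. G x * T n (x + - y)) = I"
      unfolding I_def T_def by (rule G_trig_even[OF trig_poly_kernel])
    have a: "\<bar>I - G y * M n\<bar> \<le> d * M n + (G_norm + \<bar>G y\<bar>) * q ^ n"
      unfolding I'[symmetric] by (rule est) (use \<delta>1 \<delta> in \<open>auto intro!: less_imp_le\<close>)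
    have b: "\<bar>I - G (- y) * M n\<bar> \<le> d * M n + (G_norm + \<bar>G (- y)\<bar>) * q ^ n"
      unfolding I_def by (rule est) (use \<delta>2 \<delta> in \<open>auto intro!: less_imp_le\<close>)
    have M0: "0 \<le> M n" unfolding M_def by (intro integral_nonneg_AE) (auto simp: T0)
    have "4 * d * M n = \<bar>(I - G (- y) * M n) - (I - G y * M n)\<bar>"
      using M0 by (simp add: d_def left_diff_distrib[symmetric] abs_mult)
    also have "\<dots> \<le> \<bar>I - G (- y) * M n\<bar> + \<bar>I - G y * M n\<bar>" by (rule abs_triangle_ineq4)
    finally have "4 * d * M n \<le> 2 * (d * M n) + C * q ^ n"
      using a b by (simp add: C_def distrib_right)
    then show ?thesis by simp
  qed
  define m0 where "m0 = measure torus_measure {x \<in> torus. sdist x < \<delta> / 2}"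
  have m0: "0 < m0" unfolding m0_def by (rule sdist_sublevel_pos) (use \<delta> in simp)
  \<comment> \<open>On \<open>sdist x < \<delta> / 2\<close> the kernel is at least
    \<open>p ^ n\<close>, and that set has positive measure. As \<open>q < p\<close>, the mass
    decays more slowly than the tails.\<close>
  define p where "p = 1 - \<delta> / 4"
  have p: "0 < p" "q < p" using \<delta> by (auto simp: p_def q_def)
  have ge: "m0 * p ^ n \<le> M n" for n
  proof -
    define A where "A = {x \<in> torus. sdist x < \<delta> / 2}"
    have A: "A \<in> sets torus_measure"
    proof -
      have "A = torus \<inter> sdist -` {..<\<delta> / 2}" by (auto simp: A_def)
      moreover have "sdist -` {..<\<delta> / 2} \<in> sets borel"
        by (intro borel_open open_vimage open_lessThan continuous_sdist)
      ultimately show ?thesis by (auto simp: sets_restrict_space)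
    qed
    have AT: "A \<inter> space torus_measure = A" by (auto simp: A_def space_restrict_space)
    have m: "m0 = measure torus_measure (A \<inter> space torus_measure)"
      unfolding AT unfolding m0_def A_def ..
    have "m0 = integral\<^sup>L torus_measure (indicator A)"
      unfolding m by (rule Bochner_Integration.integral_indicator[symmetric])
    then have "m0 * p ^ n = integral\<^sup>L torus_measure (\<lambda>x. indicator A x * p ^ n)"
      by (simp only: integral_mult_left_zero)
    also have "\<dots> \<le> M n"
      unfolding M_def
    proof (rule integral_mono)
      show "integrable torus_measure (\<lambda>x. indicator A x * p ^ n)"
        using A by (intro integrable_mult_left integrable_real_indicator) (auto simp: less_top[symmetric])
      show "integrable torus_measure (T n)" using T_int[of n 0] by simp
      fix x
      show "indicator A x * p ^ n \<le> T n x"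
      proof (cases "x \<in> A")
        case True
        then have "p ^ n \<le> T n x" unfolding T_def using p by (intro power_mono) (auto simp: p_def A_def)
        then show ?thesis using True by simp
      qed (simp add: T0)
    qed
    finally show ?thesis .
  qed
  have "(\<lambda>n. C * (q / p) ^ n) \<longlonglongrightarrow> C * 0"
    using p q by (intro tendsto_intros LIMSEQ_power_zero) auto
  then have "(\<lambda>n. C * (q / p) ^ n) \<longlonglongrightarrow> 0" by simp
  moreover have "2 * d * m0 \<le> C * (q / p) ^ n" for n
  proof -
    have "2 * d * (m0 * p ^ n) \<le> 2 * d * M n" using ge d by (intro mult_left_mono) auto
    then have "2 * d * m0 * p ^ n \<le> C * q ^ n" using le1[of n] by (simp add: mult.assoc)
    then show ?thesis using p by (simp add: power_divide pos_le_divide_eq)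
  qed
  ultimately have "2 * d * m0 \<le> 0" by (intro LIMSEQ_le_const) auto
  then show False using mult_pos_pos[OF d m0] by simp
qed

end

subsection \<open>Second derivatives\<close>

text \<open>Schwarz's theorem, from the second difference quotient.\<close>

lemma mixed_derivatives_symmetric:
  fixes f :: "'a::real_inner \<Rightarrow> real"
  assumes S: "open S" "x \<in> S"
    and f: "\<And>z. z \<in> S \<Longrightarrow> (f has_derivative f' z) (at z)"
    and fp: "\<And>z. z \<in> S \<Longrightarrow> ((\<lambda>z. f' z p) has_derivative fp z) (at z)"
    and fq: "\<And>z. z \<in> S \<Longrightarrow> ((\<lambda>z. f' z q) has_derivative fq z) (at z)"
    and cont: "isCont (\<lambda>z. fp z q) x" "isCont (\<lambda>z. fq z p) x"
  shows "fp x q = fq x p"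
proof -
  have line: "((\<lambda>u. g (a + u *\<^sub>R b)) has_real_derivative g' (a + u *\<^sub>R b) b) (at u)"
    if "(g has_derivative g' (a + u *\<^sub>R b)) (at (a + u *\<^sub>R b))" for g :: "'a \<Rightarrow> real" and g' a b u
  proof -
    have "((\<lambda>u. a + u *\<^sub>R b) has_derivative (\<lambda>h. h *\<^sub>R b)) (at u)"
      by (auto intro!: derivative_eq_intros)
    from has_derivative_compose[OF this that]
    have "((\<lambda>u. g (a + u *\<^sub>R b)) has_derivative (\<lambda>h. g' (a + u *\<^sub>R b) (h *\<^sub>R b))) (at u)" .
    moreover have "g' (a + u *\<^sub>R b) (h *\<^sub>R b) = g' (a + u *\<^sub>R b) b * h" for h
      using has_derivative_bounded_linear[OF that] by (simp add: linear_simps)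
    ultimately show ?thesis by (simp add: has_field_derivative_def)
  qed
  \<comment> \<open>The mean value theorem in direction \<open>p\<close> and then in direction
    \<open>q\<close>. The second difference is symmetric in the two, so exchanging them evaluates
    both mixed derivatives near \<open>x\<close>.\<close>
  have second: "\<exists>z. norm (z - x) \<le> t * (norm p + norm q) \<and>
      f (x + t *\<^sub>R p + t *\<^sub>R q) - f (x + t *\<^sub>R p) - f (x + t *\<^sub>R q) + f x = t * (t * gp z q)"
    if t: "0 < t" "\<And>z. norm (z - x) \<le> t * (norm p + norm q) \<Longrightarrow> z \<in> S"
      and gp: "\<And>z. z \<in> S \<Longrightarrow> ((\<lambda>z. f' z p) has_derivative gp z) (at z)" for t p q gp
  proof -
    have inS: "norm (x + u *\<^sub>R p + v *\<^sub>R q - x) \<le> t * (norm p + norm q)" if "0 \<le> u" "u \<le> t" "0 \<le> v" "v \<le> t" for u v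
    proof -
      have "norm (u *\<^sub>R p + v *\<^sub>R q) \<le> u * norm p + v * norm q"
        using norm_triangle_ineq[of "u *\<^sub>R p" "v *\<^sub>R q"] that by simp
      also have "\<dots> \<le> t * norm p + t * norm q"
        using that by (intro add_mono mult_right_mono) auto
      finally show ?thesis by (simp add: distrib_left add.assoc)
    qed
    have "\<exists>u. 0 < u \<and> u < t \<and> (f (x + t *\<^sub>R q + t *\<^sub>R p) - f (x + t *\<^sub>R p)) - (f (x + t *\<^sub>R q + 0 *\<^sub>R p) - f (x + 0 *\<^sub>R p))
        = (t - 0) * (f' (x + t *\<^sub>R q + u *\<^sub>R p) p - f' (x + u *\<^sub>R p) p)"
    proof (rule MVT2[OF t(1)])
      fix u assume u: "0 \<le> u" "u \<le> t"
      have "x + t *\<^sub>R q + u *\<^sub>R p \<in> S" "x + u *\<^sub>R p \<in> S"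
        using t(2)[OF inS[of u t]] t(2)[OF inS[of u 0]] u t(1) by (auto simp: algebra_simps)
      then show "((\<lambda>u. f (x + t *\<^sub>R q + u *\<^sub>R p) - f (x + u *\<^sub>R p)) has_real_derivative
          f' (x + t *\<^sub>R q + u *\<^sub>R p) p - f' (x + u *\<^sub>R p) p) (at u)"
        by (intro DERIV_diff line f)
    qed
    then obtain u where u: "0 < u" "u < t"
      "(f (x + t *\<^sub>R q + t *\<^sub>R p) - f (x + t *\<^sub>R p)) - (f (x + t *\<^sub>R q) - f x)
        = t * (f' (x + t *\<^sub>R q + u *\<^sub>R p) p - f' (x + u *\<^sub>R p) p)" by auto
    have "\<exists>v. 0 < v \<and> v < t \<and> f' (x + u *\<^sub>R p + t *\<^sub>R q) p - f' (x + u *\<^sub>R p + 0 *\<^sub>R q) p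
        = (t - 0) * gp (x + u *\<^sub>R p + v *\<^sub>R q) q"
    proof (rule MVT2[OF t(1)])
      fix v assume v: "0 \<le> v" "v \<le> t"
      have "x + u *\<^sub>R p + v *\<^sub>R q \<in> S"
        by (rule t(2)[OF inS]) (use u v in auto)
      then show "((\<lambda>v. f' (x + u *\<^sub>R p + v *\<^sub>R q) p) has_real_derivative gp (x + u *\<^sub>R p + v *\<^sub>R q) q) (at v)"
        by (intro line[of "\<lambda>z. f' z p"] gp)
    qed
    then obtain v where v: "0 < v" "v < t"
      "f' (x + u *\<^sub>R p + t *\<^sub>R q) p - f' (x + u *\<^sub>R p) p = t * gp (x + u *\<^sub>R p + v *\<^sub>R q) q" by auto
    have "norm (x + u *\<^sub>R p + v *\<^sub>R q - x) \<le> t * (norm p + norm q)" by (rule inS) (use u v in auto)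
    moreover have "f (x + t *\<^sub>R p + t *\<^sub>R q) - f (x + t *\<^sub>R p) - f (x + t *\<^sub>R q) + f x = t * (t * gp (x + u *\<^sub>R p + v *\<^sub>R q) q)"
      using u(3) v(3) by (simp add: algebra_simps)
    ultimately show ?thesis by blast
  qed
  have bound: "\<bar>fp x q - fq x p\<bar> \<le> \<epsilon>" if \<epsilon>: "0 < \<epsilon>" for \<epsilon>
  proof -
    obtain r0 where r0: "0 < r0" "ball x r0 \<subseteq> S" using S open_contains_ball by blast
    obtain r1 where r1: "0 < r1" "\<And>z. norm (z - x) < r1 \<Longrightarrow> \<bar>fp z q - fp x q\<bar> < \<epsilon> / 2"
      using cont(1) half_gt_zero[OF \<epsilon>] unfolding continuous_at_eps_delta dist_norm real_norm_def by blast
    obtain r2 where r2: "0 < r2" "\<And>z. norm (z - x) < r2 \<Longrightarrow> \<bar>fq z p - fq x p\<bar> < \<epsilon> / 2"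
      using cont(2) half_gt_zero[OF \<epsilon>] unfolding continuous_at_eps_delta dist_norm real_norm_def by blast
    define r where "r = Min {r0, r1, r2}"
    have r: "0 < r" "r \<le> r0" "r \<le> r1" "r \<le> r2" using r0 r1 r2 by (auto simp: r_def)
    define N where "N = norm p + norm q + 1"
    have N: "0 < N" by (simp add: N_def add_nonneg_pos)
    define t where "t = r / N"
    have t: "0 < t" using r N by (simp add: t_def)
    have tr: "t * (norm p + norm q) < r"
    proof -
      have "t * (norm p + norm q) < t * N" using t by (simp add: N_def)
      then show ?thesis using N by (simp add: t_def)
    qed
    have inS: "z \<in> S" if "norm (z - x) \<le> t * (norm p + norm q)" for z
    proof -
      have "norm (z - x) < r0" using that tr r by linarith
      then show ?thesis using r0(2) by (auto simp: dist_norm norm_minus_commute)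
    qed
    obtain z1 where z1: "norm (z1 - x) \<le> t * (norm p + norm q)"
      "f (x + t *\<^sub>R p + t *\<^sub>R q) - f (x + t *\<^sub>R p) - f (x + t *\<^sub>R q) + f x = t * (t * fp z1 q)"
      using second[OF t inS fp] by blast
    obtain z2 where z2: "norm (z2 - x) \<le> t * (norm q + norm p)"
      "f (x + t *\<^sub>R q + t *\<^sub>R p) - f (x + t *\<^sub>R q) - f (x + t *\<^sub>R p) + f x = t * (t * fq z2 p)"
      using second[where p = q and q = p and gp = fq, OF t _ fq] inS unfolding add.commute[of "norm q"] by blast
    have comm: "x + t *\<^sub>R q + t *\<^sub>R p = x + t *\<^sub>R p + t *\<^sub>R q" by (simp add: ac_simps)
    have "t * (t * fp z1 q) = t * (t * fq z2 p)" using z1(2) z2(2) unfolding comm by linarith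
    note teq = this
    have tn: "t \<noteq> 0" using t by simp
    from teq have "fp z1 q = fq z2 p"
      by (rule mult_left_cancel[OF tn, THEN iffD1, OF mult_left_cancel[OF tn, THEN iffD1]])
    moreover have "\<bar>fp z1 q - fp x q\<bar> < \<epsilon> / 2" using r1(2)[of z1] z1(1) tr r by linarith
    moreover have "\<bar>fq z2 p - fq x p\<bar> < \<epsilon> / 2"
      using r2(2)[of z2] z2(1) tr r unfolding add.commute[of "norm q"] by linarith
    ultimately show ?thesis by linarith
  qed
  show ?thesis
  proof (rule ccontr)
    assume "fp x q \<noteq> fq x p"
    then have "0 < \<bar>fp x q - fq x p\<bar>" by (simp only: zero_less_abs_iff right_minus_eq not_False_eq_True)
    moreover have "\<not> d \<le> d / 2" if "0 < d" for d :: real using that by simp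
    ultimately show False using bound[OF half_gt_zero] by blast
  qed
qed

subsection \<open>Vortices moved one at a time\<close>

abbreviation e1 :: "real^2" where "e1 \<equiv> axis 1 1"
abbreviation e2 :: "real^2" where "e2 \<equiv> axis 2 1"

lemma e_Basis: "e1 \<in> Basis" "e2 \<in> Basis" by (auto simp: Basis_vec_def)

lemma linear_real2:
  fixes f :: "real^2 \<Rightarrow> real"
  assumes "bounded_linear f"
  shows "f w = w $ 1 * f e1 + w $ 2 * f e2"
proof -
  have "w = w $ 1 *\<^sub>R e1 + w $ 2 *\<^sub>R e2"
    by (simp add: vec_eq_iff forall_2 axis_def)
  then have "f w = f (w $ 1 *\<^sub>R e1 + w $ 2 *\<^sub>R e2)" by simp
  also have "\<dots> = w $ 1 * f e1 + w $ 2 * f e2"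
    using assms by (simp add: linear_simps)
  finally show ?thesis .
qed

section \<open>Derivatives of the Green function and the Biot-Savart kernel\<close>

context green
begin

abbreviation DG :: "real^2 \<Rightarrow> real^2 \<Rightarrow> real" where "DG z \<equiv> frechet_derivative G (at z)"

abbreviation D2G :: "real^2 \<Rightarrow> real^2 \<Rightarrow> real^2 \<Rightarrow> real" where
  "D2G b z \<equiv> frechet_derivative (\<lambda>z. DG z b) (at z)"

lemma G_C2: "Ck_on 2 (- lattice2) G"
  using G_smooth by (simp add: smooth_on_def)

lemma G_der: "z \<notin> lattice2 \<Longrightarrow> (G has_derivative DG z) (at z)"
  using G_C2 by (simp add: numeral_2_eq_2 frechet_derivative_works)

lemma DG_der: "z \<notin> lattice2 \<Longrightarrow> b \<in> Basis \<Longrightarrow> ((\<lambda>z. DG z b) has_derivative D2G b z) (at z)"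
  using G_C2 by (simp add: numeral_2_eq_2 frechet_derivative_works)

lemma D2G_cont_Basis: "b \<in> Basis \<Longrightarrow> c \<in> Basis \<Longrightarrow> continuous_on (- lattice2) (\<lambda>z. D2G b z c)"
  using G_C2 by (simp add: numeral_2_eq_2)

lemma DG_cont: "continuous_on (- lattice2) (\<lambda>z. DG z w)"
proof -
  have b: "continuous_on (- lattice2) (\<lambda>z. DG z b)" if "b \<in> Basis" for b
    using DG_der[OF _ that] by (meson ComplD has_derivative_continuous continuous_at_imp_continuous_on)
  have "continuous_on (- lattice2) (\<lambda>z. w $ 1 * DG z e1 + w $ 2 * DG z e2)"
    by (intro continuous_intros b e_Basis)
  moreover have "w $ 1 * DG z e1 + w $ 2 * DG z e2 = DG z w" if "z \<in> - lattice2" for z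
    by (rule linear_real2[OF has_derivative_bounded_linear[OF G_der], symmetric]) (use that in blast)
  ultimately show ?thesis by (rule continuous_on_eq)
qed

lemma D2G_cont:
  assumes b: "b \<in> Basis"
  shows "continuous_on (- lattice2) (\<lambda>z. D2G b z w)"
proof -
  have "continuous_on (- lattice2) (\<lambda>z. w $ 1 * D2G b z e1 + w $ 2 * D2G b z e2)"
    by (intro continuous_intros D2G_cont_Basis b e_Basis)
  moreover have "w $ 1 * D2G b z e1 + w $ 2 * D2G b z e2 = D2G b z w" if "z \<in> - lattice2" for z
    by (rule linear_real2[OF has_derivative_bounded_linear[OF DG_der[OF _ b]], symmetric]) (use that in blast)
  ultimately show ?thesis by (rule continuous_on_eq)
qed

lemma D2G_sym:
  assumes z: "z \<notin> lattice2"
  shows "D2G e1 z e2 = D2G e2 z e1"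
proof (rule mixed_derivatives_symmetric[where S = "- lattice2" and f = G and f' = DG])
  show "open (- lattice2)" using closed_lattice2 by (simp add: open_Compl)
  then show "isCont (\<lambda>z. D2G e1 z e2) z" "isCont (\<lambda>z. D2G e2 z e1) z"
    using z D2G_cont[OF e_Basis(1), of e2] D2G_cont[OF e_Basis(2), of e1]
    by (auto simp: continuous_on_eq_continuous_at)
qed (use z G_der DG_der e_Basis in auto)

lemma biot_savart_eq: "biot_savart G z = DG z e2 *\<^sub>R e1 - DG z e1 *\<^sub>R e2"
proof -
  have g: "grad G z = DG z e1 *\<^sub>R e1 + DG z e2 *\<^sub>R e2"
    unfolding grad_def by (rule sum_Basis_real2)
  show ?thesis
    unfolding biot_savart_def perp_def g
    by (simp add: vec_eq_iff forall_2 axis_def vector_def)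
qed

lemma DG_periodic: "k \<in> lattice2 \<Longrightarrow> DG (z + k) = DG z"
  by (rule frechet_derivative_periodic) (rule G_periodic)

end

section \<open>Configurations on the universal cover\<close>

definition latticeN :: "(real^2^'n) set" where "latticeN = {k. \<forall>i. k $ i \<in> lattice2}"

lemma vec_nth_component_der: "((\<lambda>x. x $ i - x $ j) has_derivative (\<lambda>h. h $ i - h $ j)) (at x)"
  for x :: "real^2^'n"
  by (intro has_derivative_diff bounded_linear_imp_has_derivative bounded_linear_vec_nth)

lemma continuous_difference: "continuous_on S (\<lambda>x::real^2^'n. x $ i - x $ j)"
  by (intro continuous_intros)

abbreviation conf :: "(real^2^'n) set" where "conf \<equiv> lifted_conf_space"

lemma conf_diff: "x \<in> conf \<Longrightarrow> i \<noteq> j \<Longrightarrow> x $ i - x $ j \<notin> lattice2"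
  by (simp add: lifted_conf_space_def)

lemma conf_period:
  assumes "k \<in> latticeN"
  shows "x + k \<in> conf \<longleftrightarrow> x \<in> conf"
proof -
  have "(x + k) $ i - (x + k) $ j \<in> lattice2 \<longleftrightarrow> x $ i - x $ j \<in> lattice2" for i j
  proof -
    have k: "k $ i - k $ j \<in> lattice2" using assms by (auto simp: latticeN_def intro: lattice2_diff)
    have eq: "(x + k) $ i - (x + k) $ j = (x $ i - x $ j) + (k $ i - k $ j)" by simp
    show ?thesis
      unfolding eq
      using lattice2_add[OF _ k, of "x $ i - x $ j"] lattice2_diff[OF _ k, of "x $ i - x $ j + (k $ i - k $ j)"]
      unfolding add_diff_cancel_right' by blast
  qed
  then show ?thesis by (simp only: lifted_conf_space_def mem_Collect_eq)
qed

locale vortices = green G for G +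
  fixes \<xi> :: "'n::finite \<Rightarrow> real"
  assumes \<xi>: "\<And>i. \<xi> i \<noteq> 0"
begin

lemma open_conf: "open (conf :: (real^2^'n) set)"
proof -
  have "(conf :: (real^2^'n) set) = (\<Inter>(i, j)\<in>{(i, j). i \<noteq> j}. (\<lambda>x. x $ i - x $ j) -` (- lattice2))"
    by (auto simp: lifted_conf_space_def)
  moreover have "open ((\<lambda>x::real^2^'n. x $ i - x $ j) -` (- lattice2))" for i j
    using closed_lattice2 by (intro open_vimage continuous_difference) (simp add: open_Compl)
  moreover have "open (\<Inter>(i, j)\<in>{(i, j). i \<noteq> j}. (\<lambda>x::real^2^'n. x $ i - x $ j) -` (- lattice2))"
    by (rule open_INT) (use calculation(2) in auto)
  ultimately show ?thesis by (simp only:)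
qed

definition ham :: "'n \<Rightarrow> real^2^'n \<Rightarrow> real" where
  "ham i x = (\<Sum>j\<in>UNIV - {i}. \<xi> j * G (x $ i - x $ j))"

definition dham :: "'n \<Rightarrow> real^2 \<Rightarrow> real^2^'n \<Rightarrow> real" where
  "dham i b x = (\<Sum>j\<in>UNIV - {i}. \<xi> j * DG (x $ i - x $ j) b)"

definition d2ham :: "'n \<Rightarrow> real^2 \<Rightarrow> real^2^'n \<Rightarrow> real^2^'n \<Rightarrow> real" where
  "d2ham i b x h = (\<Sum>j\<in>UNIV - {i}. \<xi> j * D2G b (x $ i - x $ j) (h $ i - h $ j))"

lemma ham_der:
  assumes "x \<in> conf"
  shows "(ham i has_derivative (\<lambda>h. \<Sum>j\<in>UNIV - {i}. \<xi> j * DG (x $ i - x $ j) (h $ i - h $ j))) (at x)"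
  unfolding ham_def
proof (intro has_derivative_sum has_derivative_mult_right)
  fix j assume "j \<in> UNIV - {i}"
  then have "x $ i - x $ j \<notin> lattice2" using conf_diff[OF assms] by auto
  from has_derivative_compose[OF vec_nth_component_der G_der[OF this]]
  show "((\<lambda>x. G (x $ i - x $ j)) has_derivative (\<lambda>h. DG (x $ i - x $ j) (h $ i - h $ j))) (at x)" .
qed

lemma dham_der:
  assumes "x \<in> conf" "b \<in> Basis"
  shows "(dham i b has_derivative d2ham i b x) (at x)"
  unfolding dham_def d2ham_def
proof (intro has_derivative_sum has_derivative_mult_right)
  fix j assume "j \<in> UNIV - {i}"
  then have "x $ i - x $ j \<notin> lattice2" using conf_diff[OF assms(1)] by auto
  from has_derivative_compose[OF vec_nth_component_der DG_der[OF this assms(2)]]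
  show "((\<lambda>x. DG (x $ i - x $ j) b) has_derivative (\<lambda>h. D2G b (x $ i - x $ j) (h $ i - h $ j))) (at x)" .
qed

lemma cont_diff:
  assumes "continuous_on (- lattice2) f" "i \<noteq> j"
  shows "continuous_on conf (\<lambda>x::real^2^'n. f (x $ i - x $ j))"
  by (rule continuous_on_compose2[OF assms(1) continuous_difference]) (use assms(2) conf_diff in auto)

lemma d2ham_cont:
  assumes "b \<in> Basis"
  shows "continuous_on conf (\<lambda>x. d2ham i b x h)"
  unfolding d2ham_def
  by (intro continuous_on_sum continuous_on_mult_left cont_diff[of "\<lambda>z. D2G b z (h $ i - h $ _)"] D2G_cont assms) auto

abbreviation px :: "'n \<Rightarrow> real^2^'n" where "px i \<equiv> axis i e1"
abbreviation qx :: "'n \<Rightarrow> real^2^'n" where "qx i \<equiv> axis i e2"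

lemma pq_Basis: "px i \<in> Basis" "qx i \<in> Basis"
  using e_Basis by (auto simp: Basis_vec_def)

lemma pq_inner: "px i \<bullet> px i = 1" "qx i \<bullet> qx i = 1" "px i \<bullet> qx i = 0" "qx i \<bullet> px i = 0"
  by (simp_all add: inner_axis_axis)

text \<open>The rotated gradient of \<open>ham i\<close> in the coordinates of the
  \<open>i\<close>-th vortex: a planar Hamiltonian field. Conservation of \<open>ham i\<close> and
  vanishing divergence both come from this shape.\<close>

lemma slot_field_eq: "slot_field G \<xi> i x = dham i e2 x *\<^sub>R px i - dham i e1 x *\<^sub>R qx i"
proof -
  have "velocity G \<xi> i x = dham i e2 x *\<^sub>R e1 - dham i e1 x *\<^sub>R e2"
    unfolding velocity_def dham_def biot_savart_eq
    by (simp add: scaleR_diff_right sum_subtractf scaleR_sum_left)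
  then show ?thesis
    by (simp add: slot_field_def vec_eq_iff axis_def)
qed

lemma slot_field_der:
  assumes "x \<in> conf"
  shows "(slot_field G \<xi> i has_derivative (\<lambda>h. d2ham i e2 x h *\<^sub>R px i - d2ham i e1 x h *\<^sub>R qx i)) (at x)"
  unfolding slot_field_eq[abs_def]
  by (intro has_derivative_diff has_derivative_scaleR_left dham_der assms e_Basis)

lemma slot_field_conserves_ham:
  assumes x: "x \<in> conf"
  shows "(\<Sum>j\<in>UNIV - {i}. \<xi> j * DG (x $ i - x $ j) (slot_field G \<xi> i x $ i - slot_field G \<xi> i x $ j)) = 0"
proof -
  have "slot_field G \<xi> i x $ i - slot_field G \<xi> i x $ j = dham i e2 x *\<^sub>R e1 - dham i e1 x *\<^sub>R e2"
    if "j \<noteq> i" for j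
    using that unfolding slot_field_eq by (simp add: axis_def)
  moreover have "DG (x $ i - x $ j) (dham i e2 x *\<^sub>R e1 - dham i e1 x *\<^sub>R e2)
     = dham i e2 x * DG (x $ i - x $ j) e1 - dham i e1 x * DG (x $ i - x $ j) e2" if "j \<noteq> i" for j
    using has_derivative_bounded_linear[OF G_der[OF conf_diff[OF x, of i j]]] that
    by (simp add: linear_simps)
  ultimately have "(\<Sum>j\<in>UNIV - {i}. \<xi> j * DG (x $ i - x $ j) (slot_field G \<xi> i x $ i - slot_field G \<xi> i x $ j))
    = (\<Sum>j\<in>UNIV - {i}. dham i e2 x * (\<xi> j * DG (x $ i - x $ j) e1) - dham i e1 x * (\<xi> j * DG (x $ i - x $ j) e2))"
    by (intro sum.cong) (auto simp: right_diff_distrib mult.left_commute)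
  also have "\<dots> = dham i e2 x * dham i e1 x - dham i e1 x * dham i e2 x"
    by (simp only: sum_subtractf sum_distrib_left[symmetric] dham_def)
  finally show ?thesis by simp
qed

text \<open>
  A conserved quantity that blows up at every collision: the others are at rest, and the \<open>i\<close>-th vortex
  conserves \<open>ham i\<close>.
\<close>

definition pairs :: "'n \<Rightarrow> ('n \<times> 'n) set" where
  "pairs i = {(j, k). j \<noteq> i \<and> k \<noteq> i \<and> j \<noteq> k}"

definition barrier :: "'n \<Rightarrow> real^2^'n \<Rightarrow> real" where
  "barrier i x = (ham i x)\<^sup>2 + (\<Sum>(j, k)\<in>pairs i. 1 / sdist (x $ j - x $ k))"

abbreviation Dsdist :: "real^2 \<Rightarrow> real^2 \<Rightarrow> real" where "Dsdist z \<equiv> frechet_derivative sdist (at z)"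

lemma nice_sdist': "nice sdist" using nice_sdist[of 0] by simp

definition dbarrier :: "'n \<Rightarrow> real^2^'n \<Rightarrow> real^2^'n \<Rightarrow> real" where
  "dbarrier i x h = 2 * ham i x * (\<Sum>j\<in>UNIV - {i}. \<xi> j * DG (x $ i - x $ j) (h $ i - h $ j))
     + (\<Sum>(j, k)\<in>pairs i. - (1 / (sdist (x $ j - x $ k))\<^sup>2) * Dsdist (x $ j - x $ k) (h $ j - h $ k))"

lemma barrier_der:
  assumes x: "x \<in> conf"
  shows "(barrier i has_derivative dbarrier i x) (at x)"
proof -
  have 1: "((\<lambda>x. (ham i x)\<^sup>2) has_derivative
     (\<lambda>h. 2 * ham i x * (\<Sum>j\<in>UNIV - {i}. \<xi> j * DG (x $ i - x $ j) (h $ i - h $ j)))) (at x)"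
    using has_derivative_power[OF ham_der[OF x, of i], of 2] by (simp add: mult_ac)
  have 2: "((\<lambda>x. \<Sum>(j, k)\<in>pairs i. 1 / sdist (x $ j - x $ k)) has_derivative
     (\<lambda>h. \<Sum>(j, k)\<in>pairs i. - (1 / (sdist (x $ j - x $ k))\<^sup>2) * Dsdist (x $ j - x $ k) (h $ j - h $ k))) (at x)"
    unfolding case_prod_beta
  proof (intro has_derivative_sum)
    fix p assume "p \<in> pairs i"
    then have "x $ fst p - x $ snd p \<notin> lattice2" using conf_diff[OF x] by (auto simp: pairs_def)
    then have "sdist (x $ fst p - x $ snd p) \<noteq> 0" by (simp add: sdist_eq_0_iff)
    from DERIV_inverse[OF this]
    have inv: "((\<lambda>u. 1 / u) has_derivative (*) (- (1 / (sdist (x $ fst p - x $ snd p))\<^sup>2))) (at (sdist (x $ fst p - x $ snd p)))"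
      by (simp add: has_field_derivative_def inverse_eq_divide power_one_over numeral_2_eq_2)
    show "((\<lambda>x. 1 / sdist (x $ fst p - x $ snd p)) has_derivative
       (\<lambda>h. - (1 / (sdist (x $ fst p - x $ snd p))\<^sup>2) * Dsdist (x $ fst p - x $ snd p) (h $ fst p - h $ snd p))) (at x)"
      by (rule has_derivative_compose[OF has_derivative_compose[OF vec_nth_component_der nice_has_derivative[OF nice_sdist']] inv])
  qed
  show ?thesis
    unfolding barrier_def[abs_def] dbarrier_def[abs_def] by (rule has_derivative_add[OF 1 2])
qed

lemma dbarrier_cont: "continuous_on conf (\<lambda>x. dbarrier i x h)"
proof -
  have ham: "continuous_on conf (ham i)"
    using ham_der by (meson has_derivative_continuous continuous_at_imp_continuous_on)
  have nz: "sdist (x $ j - x $ k) \<noteq> 0" if "x \<in> conf" "j \<noteq> k" for x :: "real^2^'n" and j k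
    using conf_diff[OF that] by (simp add: sdist_eq_0_iff)
  have 1: "continuous_on conf (\<lambda>x. \<Sum>j\<in>UNIV - {i}. \<xi> j * DG (x $ i - x $ j) (h $ i - h $ j))"
    by (intro continuous_on_sum continuous_on_mult_left cont_diff[of "\<lambda>z. DG z (h $ i - h $ _)"] DG_cont) auto
  have 2: "continuous_on conf (\<lambda>x. \<Sum>(j, k)\<in>pairs i. - (1 / (sdist (x $ j - x $ k))\<^sup>2) * Dsdist (x $ j - x $ k) (h $ j - h $ k))"
    unfolding case_prod_beta
  proof (rule continuous_on_sum)
    fix p assume p: "p \<in> pairs i"
    have s: "continuous_on conf (\<lambda>x::real^2^'n. sdist (x $ fst p - x $ snd p))"
      by (rule continuous_on_compose2[OF continuous_sdist[of UNIV] continuous_difference]) auto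
    have d: "continuous_on conf (\<lambda>x::real^2^'n. Dsdist (x $ fst p - x $ snd p) (h $ fst p - h $ snd p))"
      by (rule continuous_on_compose2[OF nice_continuous[OF nice_frechet[OF nice_sdist'], of UNIV] continuous_difference]) auto
    show "continuous_on conf (\<lambda>x. - (1 / (sdist (x $ fst p - x $ snd p))\<^sup>2) * Dsdist (x $ fst p - x $ snd p) (h $ fst p - h $ snd p))"
      using nz p by (intro continuous_on_mult continuous_on_minus continuous_on_divide continuous_on_power continuous_on_const s d) (auto simp: pairs_def)
  qed
  show ?thesis
    unfolding dbarrier_def by (intro continuous_intros ham 1 2)
qed

text \<open>The second sum of \<open>barrier\<close> keeps the resting vortices apart in the limit,
  so vortex \<open>i\<close> can merge with only one of them. All other terms of
  \<open>ham i\<close> converge, hence the single singular one would stay bounded, against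
  \<open>G_blowup\<close>. Two singular terms of opposite signs could cancel.\<close>

lemma barrier_proper: "closed {x \<in> conf. barrier i x \<le> c}"
  unfolding closed_sequential_limits
proof (intro allI impI, elim conjE)
  fix x :: "nat \<Rightarrow> real^2^'n" and l
  assume x: "\<forall>n. x n \<in> {x \<in> conf. barrier i x \<le> c}" and lim: "x \<longlonglongrightarrow> l"
  have xc: "x n \<in> conf" "barrier i (x n) \<le> c" for n using x by auto
  have term0: "0 \<le> 1 / sdist (y $ fst p - y $ snd p)" for y :: "real^2^'n" and p using sdist_range(1) by simp
  have sum0: "0 \<le> (\<Sum>(j, k)\<in>pairs i. 1 / sdist (y $ j - y $ k))" for y :: "real^2^'n"
    unfolding case_prod_beta by (intro sum_nonneg term0)
  have limd: "(\<lambda>n. x n $ j - x n $ k) \<longlonglongrightarrow> l $ j - l $ k" for j k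
    by (intro tendsto_intros lim)
  have lims: "(\<lambda>n. sdist (x n $ j - x n $ k)) \<longlonglongrightarrow> sdist (l $ j - l $ k)" for j k
  proof -
    have "isCont sdist (l $ j - l $ k)" using continuous_sdist[of UNIV] by (simp add: continuous_on_eq_continuous_at)
    from isCont_tendsto_compose[OF this limd] show ?thesis .
  qed
  have rest: "l $ j - l $ k \<notin> lattice2" if jk: "j \<noteq> i" "k \<noteq> i" "j \<noteq> k" for j k
  proof -
    \<comment> \<open>Multiplied out, because this form passes to the limit even if
      \<open>sdist\<close> tends to 0.\<close>
    have "1 \<le> c * sdist (x n $ j - x n $ k)" for n
    proof -
      have s: "0 < sdist (x n $ j - x n $ k)" using conf_diff[OF xc(1) jk(3)] by (rule sdist_pos)
      have "1 / sdist (x n $ fst (j, k) - x n $ snd (j, k)) \<le> (\<Sum>p\<in>pairs i. 1 / sdist (x n $ fst p - x n $ snd p))"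
        by (rule member_le_sum) (use jk term0 in \<open>auto simp: pairs_def\<close>)
      also have "\<dots> \<le> barrier i (x n)" by (simp add: barrier_def case_prod_beta)
      also have "\<dots> \<le> c" by (rule xc)
      finally show ?thesis using s by (simp add: field_simps)
    qed
    then have "1 \<le> c * sdist (l $ j - l $ k)"
      by (intro LIMSEQ_le_const[OF tendsto_mult[OF tendsto_const lims]]) auto
    then have "sdist (l $ j - l $ k) \<noteq> 0" by auto
    then show ?thesis by (simp add: sdist_eq_0_iff)
  qed
  have self: "l $ i - l $ j \<notin> lattice2" if j: "j \<noteq> i" for j
  proof
    assume lat: "l $ i - l $ j \<in> lattice2"
    let ?R = "\<lambda>y. \<Sum>k\<in>UNIV - {i} - {j}. \<xi> k * G (y $ i - y $ k)"
    \<comment> \<open>Otherwise the resting vortices \<open>j\<close> and \<open>k\<close> would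
      coincide on the torus.\<close>
    have "l $ i - l $ k \<notin> lattice2" if k: "k \<in> UNIV - {i} - {j}" for k
    proof
      assume "l $ i - l $ k \<in> lattice2"
      from lattice2_diff[OF lat this] have "l $ k - l $ j \<in> lattice2" by simp
      then show False using rest[of k j] k j by auto
    qed
    then have "isCont G (l $ i - l $ k)" if "k \<in> UNIV - {i} - {j}" for k
      using G_der that has_derivative_continuous by blast
    then have "(\<lambda>n. ?R (x n)) \<longlonglongrightarrow> ?R l"
      by (intro tendsto_sum tendsto_mult tendsto_const isCont_tendsto_compose[OF _ limd])
    then have "Bseq (\<lambda>n. ?R (x n))" by (intro convergent_imp_Bseq convergentI)
    then obtain R where R: "\<And>n. \<bar>?R (x n)\<bar> \<le> R" unfolding Bseq_def by auto
    have ham_bound: "\<bar>ham i (x n)\<bar> \<le> c + 1" for n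
    proof -
      have "(ham i (x n))\<^sup>2 \<le> barrier i (x n)" using sum0 by (simp add: barrier_def)
      moreover have "\<bar>u\<bar> \<le> u\<^sup>2 + 1" for u :: real
      proof -
        have "0 \<le> (\<bar>u\<bar> - 1)\<^sup>2" by simp
        then show ?thesis by (simp add: power2_diff)
      qed
      ultimately show ?thesis using xc(2)[of n] by (meson add_right_mono order_trans)
    qed
    have G_bound: "\<bar>G (x n $ i - x n $ j)\<bar> \<le> (c + 1 + R) / \<bar>\<xi> j\<bar>" for n
    proof -
      have "ham i (x n) = \<xi> j * G (x n $ i - x n $ j) + ?R (x n)"
        unfolding ham_def by (rule sum.remove) (use j in auto)
      then have "\<bar>\<xi> j * G (x n $ i - x n $ j)\<bar> \<le> c + 1 + R" using ham_bound[of n] R[of n] by linarith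
      then show ?thesis using \<xi>[of j] by (simp add: abs_mult field_simps)
    qed
    obtain \<delta> where \<delta>: "0 < \<delta>" "\<And>y. y \<notin> lattice2 \<Longrightarrow> sdist y < \<delta> \<Longrightarrow> (c + 1 + R) / \<bar>\<xi> j\<bar> < \<bar>G y\<bar>"
      using G_blowup[of "(c + 1 + R) / \<bar>\<xi> j\<bar>"] by blast
    have "sdist (l $ i - l $ j) = 0" using lat by (simp add: sdist_eq_0_iff)
    then have "\<forall>\<^sub>F n in sequentially. sdist (x n $ i - x n $ j) < \<delta>"
      using order_tendstoD(2)[OF lims, of i j \<delta>] \<delta>(1) by simp
    then obtain n where "sdist (x n $ i - x n $ j) < \<delta>" by (auto simp: eventually_sequentially)
    with \<delta>(2)[OF conf_diff[OF xc(1)], of i j n] j G_bound[of n] show False by auto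
  qed
  have lc: "l \<in> conf"
    unfolding lifted_conf_space_def mem_Collect_eq
  proof (intro allI impI)
    fix a b :: 'n assume ab: "a \<noteq> b"
    consider "a = i" | "b = i" | "a \<noteq> i" "b \<noteq> i" by blast
    then show "l $ a - l $ b \<notin> lattice2"
    proof cases
      case 1 then show ?thesis using self[of b] ab by auto
    next
      case 2
      then have "l $ b - l $ a \<notin> lattice2" using self[of a] ab by blast
      then show ?thesis using lattice2_minus[of "l $ a - l $ b"] by (simp only: minus_diff_eq) blast
    next
      case 3 then show ?thesis using rest ab by auto
    qed
  qed
  have "isCont (barrier i) l" by (rule has_derivative_continuous[OF barrier_der[OF lc]])
  from isCont_tendsto_compose[OF this lim] have "(\<lambda>n. barrier i (x n)) \<longlonglongrightarrow> barrier i l" .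
  then have "barrier i l \<le> c" by (rule LIMSEQ_le_const2) (use xc in auto)
  then show "l \<in> {x \<in> conf. barrier i x \<le> c}" using lc by simp
qed

lemma diff_shift:
  fixes x k :: "real^2^'n"
  assumes "k \<in> latticeN"
  shows "(x + k) $ i - (x + k) $ j = (x $ i - x $ j) + (k $ i - k $ j)" "k $ i - k $ j \<in> lattice2"
  using assms by (auto simp: latticeN_def intro: lattice2_diff)

lemma slot_field_period: "k \<in> latticeN \<Longrightarrow> slot_field G \<xi> i (x + k) = slot_field G \<xi> i x"
  unfolding slot_field_eq dham_def by (simp only: diff_shift(1) DG_periodic[OF diff_shift(2)])

lemma barrier_period: "k \<in> latticeN \<Longrightarrow> barrier i (x + k) = barrier i x"
  unfolding barrier_def ham_def by (simp only: diff_shift(1) G_periodic[OF diff_shift(2)] sdist_periodic[OF diff_shift(2)])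

end

section \<open>Configurations reduced to the torus\<close>

lemma wrapN_in: "wrapN x \<in> torusN" by (simp add: wrapN_def torusN_def wrap_in)

lemma wrapN_diff: "wrapN x - x \<in> latticeN" by (simp add: wrapN_def latticeN_def wrap_diff)

lemma bounded_torusN: "bounded (torusN :: (real^2^'n) set)"
proof -
  obtain C where C: "\<And>y. y \<in> torus \<Longrightarrow> norm y \<le> C" using bounded_torus unfolding bounded_iff by blast
  show ?thesis
  proof (rule boundedI)
    fix x :: "real^2^'n" assume "x \<in> torusN"
    then have "norm (x $ i) \<le> C" for i using C by (simp add: torusN_def)
    then have "(\<Sum>i\<in>UNIV. norm (x $ i)) \<le> (\<Sum>i\<in>(UNIV::'n set). C)" by (intro sum_mono)
    moreover have "norm x \<le> (\<Sum>i\<in>UNIV. norm (x $ i))"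
      unfolding norm_vec_def by (rule L2_set_le_sum) simp
    ultimately show "norm x \<le> (\<Sum>i\<in>(UNIV::'n set). C)" by linarith
  qed
qed

lemma (in vortices) slot_conserved_flow:
  "conserved_flow conf (slot_field G \<xi> i) (\<lambda>x h. d2ham i e2 x h *\<^sub>R px i - d2ham i e1 x h *\<^sub>R qx i)
     (barrier i) (dbarrier i) (px i) (qx i) latticeN"
proof
  show "\<exists>K. compact K \<and> (\<forall>x. \<exists>k\<in>latticeN. x + k \<in> (K :: (real^2^'n) set))"
  proof (intro exI conjI allI)
    show "compact (closure (torusN :: (real^2^'n) set))" using bounded_torusN by simp
    fix x :: "real^2^'n"
    have "x + (wrapN x - x) \<in> closure torusN" using wrapN_in[of x] closure_subset by auto
    then show "\<exists>k\<in>latticeN. x + k \<in> closure torusN" using wrapN_diff by blast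
  qed
next
  fix x :: "real^2^'n" assume x: "x \<in> conf"
  show "slot_field G \<xi> i x = (slot_field G \<xi> i x \<bullet> px i) *\<^sub>R px i + (slot_field G \<xi> i x \<bullet> qx i) *\<^sub>R qx i"
    unfolding slot_field_eq by (simp add: inner_diff_left pq_inner)
  \<comment> \<open>Symmetry of the second derivatives of \<open>G\<close> is the vanishing of the
    divergence.\<close>
  have "d2ham i e2 x (px i) = d2ham i e1 x (qx i)"
    unfolding d2ham_def
  proof (rule sum.cong[OF refl])
    fix j assume "j \<in> UNIV - {i}"
    then show "\<xi> j * D2G e2 (x $ i - x $ j) (px i $ i - px i $ j) = \<xi> j * D2G e1 (x $ i - x $ j) (qx i $ i - qx i $ j)"
      using D2G_sym[OF conf_diff[OF x, of i j]] by (simp add: axis_def)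
  qed
  then show "(d2ham i e2 x (px i) *\<^sub>R px i - d2ham i e1 x (px i) *\<^sub>R qx i) \<bullet> px i
      + (d2ham i e2 x (qx i) *\<^sub>R px i - d2ham i e1 x (qx i) *\<^sub>R qx i) \<bullet> qx i = 0"
    by (simp add: inner_diff_left pq_inner)
  \<comment> \<open>Every pair in \<open>pairs i\<close> is at rest, so only the \<open>ham\<close>
    part of the barrier could change.\<close>
  have "slot_field G \<xi> i x $ j = 0" if "j \<noteq> i" for j
    using that by (simp add: slot_field_def)
  then have "(\<Sum>(j, k)\<in>pairs i. - (1 / (sdist (x $ j - x $ k))\<^sup>2)
      * Dsdist (x $ j - x $ k) (slot_field G \<xi> i x $ j - slot_field G \<xi> i x $ k)) = 0"
    using has_derivative_bounded_linear[OF nice_has_derivative[OF nice_sdist']]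
    by (intro sum.neutral) (auto simp: pairs_def linear_simps)
  then show "dbarrier i x (slot_field G \<xi> i x) = 0"
    unfolding dbarrier_def slot_field_conserves_ham[OF x] by simp
qed (use pq_Basis e_Basis in \<open>auto intro!: open_conf slot_field_der continuous_intros d2ham_cont barrier_der dbarrier_cont
    barrier_proper slot_field_period barrier_period simp: conf_period\<close>)

lemma torusN_borel [measurable]: "(torusN :: (real^2^'n) set) \<in> sets borel"
proof -
  have "(\<lambda>x::real^2^'n. x $ i) -` torus \<in> sets borel" for i
    by (rule measurable_sets_borel[OF _ torus_borel]) (intro borel_measurable_continuous_onI continuous_intros)
  then have "(\<Inter>i. (\<lambda>x::real^2^'n. x $ i) -` torus) \<in> sets borel"
    by (intro sets.finite_INT) auto
  moreover have "(\<Inter>i. (\<lambda>x::real^2^'n. x $ i) -` torus) = torusN" by (auto simp: torusN_def)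
  ultimately show ?thesis by simp
qed

lemma latticeN_add: "k \<in> latticeN \<Longrightarrow> l \<in> latticeN \<Longrightarrow> k + l \<in> latticeN"
  and latticeN_minus: "k \<in> latticeN \<Longrightarrow> - k \<in> latticeN"
  by (auto simp: latticeN_def lattice2_add)

interpretation torusN: fundamental_domain "latticeN :: (real^2^'n) set" torusN wrapN
proof
  show "countable (latticeN :: (real^2^'n) set)"
    unfolding latticeN_def by (rule countable_vector) (simp add: countable_lattice2)
  show "x = y" if "x \<in> torusN" "y \<in> torusN" "x - y \<in> latticeN" for x y :: "real^2^'n"
    using that torus_unique by (auto simp: torusN_def latticeN_def vec_eq_iff[where 'b = 'n])
qed (auto simp: latticeN_add latticeN_minus wrapN_in wrapN_diff)

lemma wrapN_shift:
  assumes "k \<in> latticeN"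
  shows "wrapN (x + k) = wrapN x"
proof (rule torusN.unique)
  have "wrapN (x + k) - (x + k) + k - (wrapN x - x) \<in> latticeN"
    using latticeN_add[OF latticeN_add[OF wrapN_diff[of "x + k"] assms] latticeN_minus[OF wrapN_diff[of x]]] by simp
  then show "wrapN (x + k) - wrapN x \<in> latticeN" by simp
qed (auto simp: wrapN_in)

lemma wrapN_id: "x \<in> torusN \<Longrightarrow> wrapN x = x"
  by (rule torusN.unique) (auto simp: wrapN_in wrapN_diff)

lemma conf_space_eq: "conf_space = torusN \<inter> conf"
proof -
  have *: "x $ i = x $ j \<longleftrightarrow> x $ i - x $ j \<in> lattice2" if "x \<in> torusN" for x :: "real^2^'n" and i j
    using that torus_unique lattice2_0 by (auto simp: torusN_def)
  show ?thesis
    unfolding conf_space_def lifted_conf_space_def Int_def by (intro Collect_cong) (simp cong: conj_cong add: *)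
qed

lemma wrapN_conf_space: "wrapN x \<in> conf_space \<longleftrightarrow> x \<in> conf"
  using conf_period[OF wrapN_diff[of x], of x] wrapN_in[of x] by (auto simp: conf_space_eq)

lemma wrapN_measurable [measurable]: "wrapN \<in> borel_measurable (borel :: (real^2^'n) measure)"
proof -
  have comp: "(\<lambda>x::real^2^'n. wrap (x $ i)) \<in> borel_measurable borel" for i
    by (rule measurable_compose[OF _ wrap_measurable]) (intro borel_measurable_continuous_onI continuous_intros)
  have lin: "continuous_on UNIV (\<lambda>v::real^2. axis i v :: real^2^'n)" for i
  proof -
    have "bounded_linear (\<lambda>v::real^2. axis i v :: real^2^'n)"
      by (intro linear_conv_bounded_linear[THEN iffD1] linearI) (auto simp: vec_eq_iff axis_def)
    then show ?thesis by (rule linear_continuous_on)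
  qed
  have "(\<lambda>x::real^2^'n. \<Sum>i\<in>UNIV. axis i (wrap (x $ i))) \<in> borel_measurable borel"
    by (intro borel_measurable_sum measurable_compose[OF comp] borel_measurable_continuous_onI lin)
  moreover have "(\<lambda>x. \<Sum>i\<in>UNIV. axis i (wrap (x $ i))) = (wrapN :: real^2^'n \<Rightarrow> _)"
    by (auto simp: fun_eq_iff vec_eq_iff wrapN_def axis_def sum.delta if_distrib[of "\<lambda>v. v $ _"] cong: if_cong)
  ultimately show ?thesis by simp
qed

section \<open>Measures with invariant densities\<close>

lemma preserves_measure_cong:
  assumes "preserves_measure f \<mu>" "\<And>x. x \<in> conf_space \<Longrightarrow> g x = f x"
  shows "preserves_measure g \<mu>"
proof -
  have eq: "g x = f x" if "x \<in> space (restrict_space \<mu> conf_space)" for x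
    using that assms(2) by (auto simp: space_restrict_space)
  show ?thesis
    using assms(1) measurable_cong[of "restrict_space \<mu> conf_space" g f \<mu>, OF eq]
      distr_cong[of "restrict_space \<mu> conf_space" "restrict_space \<mu> conf_space" \<mu> \<mu> g f, OF refl refl eq]
    unfolding preserves_measure_def by simp
qed

text \<open>Used for the Gibbs weight, a function of the energy, and for the constant that
  normalises the microcanonical measure.\<close>

lemma preserves_measure_density:
  assumes pres: "preserves_measure f \<mu>" and w [measurable]: "w \<in> borel_measurable \<mu>"
    and conf: "conf_space \<inter> space \<mu> \<in> sets \<mu>"
    and inv: "\<And>x. x \<in> conf_space \<inter> space \<mu> \<Longrightarrow> w (f x) = w x"
  shows "preserves_measure f (density \<mu> w)"
proof -
  let ?r = "restrict_space \<mu> conf_space"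
  have f [measurable]: "f \<in> measurable ?r \<mu>" and d: "distr ?r \<mu> f = \<mu>"
    using pres unfolding preserves_measure_def by auto
  have sets_eq: "sets (restrict_space (density \<mu> w) conf_space) = sets ?r"
    by (simp add: sets_restrict_space)
  have f': "f \<in> measurable (restrict_space (density \<mu> w) conf_space) (density \<mu> w)"
    using f by (simp add: measurable_cong_sets[OF sets_eq])
  have conf': "conf_space \<inter> space \<mu> \<in> sets \<mu>" by (rule conf)
  have "distr (restrict_space (density \<mu> w) conf_space) (density \<mu> w) f = density \<mu> w"
  proof (rule measure_eqI)
    fix A assume "A \<in> sets (distr (restrict_space (density \<mu> w) conf_space) (density \<mu> w) f)"
    then have A [measurable]: "A \<in> sets \<mu>" by simp
    let ?B = "f -` A \<inter> space ?r"
    have Br: "?B \<in> sets ?r" by (rule measurable_sets[OF f A])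
    then have B [measurable]: "?B \<in> sets \<mu>"
      using conf by (auto simp: sets_restrict_space_iff)
    have "emeasure (density \<mu> w) A = (\<integral>\<^sup>+x. w x * indicator A x \<partial>\<mu>)"
      by (simp add: emeasure_density)
    also have "\<dots> = (\<integral>\<^sup>+x. w x * indicator A x \<partial>distr ?r \<mu> f)" by (simp only: d)
    also have "\<dots> = (\<integral>\<^sup>+x. w (f x) * indicator A (f x) \<partial>?r)"
      by (rule nn_integral_distr[OF f]) measurable
    also have "\<dots> = (\<integral>\<^sup>+x. w (f x) * indicator A (f x) * indicator conf_space x \<partial>\<mu>)"
      by (rule nn_integral_restrict_space[OF conf])
    also have "\<dots> = (\<integral>\<^sup>+x. w x * indicator ?B x \<partial>\<mu>)"
      by (rule nn_integral_cong) (auto simp: indicator_def inv space_restrict_space)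
    also have "\<dots> = emeasure (density \<mu> w) ?B" by (simp add: emeasure_density)
    also have "\<dots> = emeasure (restrict_space (density \<mu> w) conf_space) ?B"
      using conf by (subst emeasure_restrict_space) (auto simp: space_restrict_space)
    also have "\<dots> = emeasure (distr (restrict_space (density \<mu> w) conf_space) (density \<mu> w) f) A"
      using A by (subst emeasure_distr[OF f']) (auto simp: space_restrict_space)
    finally show "emeasure (distr (restrict_space (density \<mu> w) conf_space) (density \<mu> w) f) A = emeasure (density \<mu> w) A" ..
  qed simp
  then show ?thesis using f' by (simp add: preserves_measure_def)
qed

lemma density_restrict_space:
  assumes A: "A \<inter> space M \<in> sets M" and w [measurable]: "w \<in> borel_measurable M"
  shows "density (restrict_space M A) w = restrict_space (density M w) A"
proof (rule measure_eqI)
  fix X assume "X \<in> sets (density (restrict_space M A) w)"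
  then have X: "X \<in> sets (restrict_space M A)" by simp
  then have XA: "X \<subseteq> A" and [measurable]: "X \<in> sets M"
    using A by (auto simp: sets_restrict_space_iff)
  have "emeasure (density (restrict_space M A) w) X = (\<integral>\<^sup>+x. w x * indicator X x \<partial>restrict_space M A)"
    using X by (intro emeasure_density measurable_restrict_space1) auto
  also have "\<dots> = (\<integral>\<^sup>+x. w x * indicator X x * indicator A x \<partial>M)"
    by (rule nn_integral_restrict_space[OF A])
  also have "\<dots> = (\<integral>\<^sup>+x. w x * indicator X x \<partial>M)"
    using XA by (intro nn_integral_cong) (auto simp: indicator_def)
  also have "\<dots> = emeasure (density M w) X" by (simp add: emeasure_density)
  also have "\<dots> = emeasure (restrict_space (density M w) A) X"
    using XA A by (subst emeasure_restrict_space) auto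
  finally show "emeasure (density (restrict_space M A) w) X = emeasure (restrict_space (density M w) A) X" .
qed (simp add: sets_restrict_space)

lemma has_derivative_grad:
  assumes "(f has_derivative f') (at x)"
  shows "(f has_derivative (\<lambda>h. grad f x \<bullet> h)) (at x)"
proof -
  have eq: "frechet_derivative f (at x) = f'" using frechet_derivative_at[OF assms] by simp
  have lin: "bounded_linear f'" by (rule has_derivative_bounded_linear[OF assms])
  have "grad f x \<bullet> h = f' h" for h
  proof -
    have "f' h = f' (\<Sum>b\<in>Basis. (h \<bullet> b) *\<^sub>R b)" by (simp add: euclidean_representation)
    also have "\<dots> = (\<Sum>b\<in>Basis. (h \<bullet> b) * f' b)"
      using lin by (simp add: linear_sum[OF bounded_linear.linear] linear_simps)
    also have "\<dots> = grad f x \<bullet> h"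
      by (simp add: grad_def eq inner_sum_left inner_commute[of h] mult.commute)
    finally show ?thesis ..
  qed
  then show ?thesis using assms by simp
qed

section \<open>Conservation of energy and invariance of the three measures\<close>

context vortices
begin

text \<open>The part of the energy that stays constant while only vortex \<open>i\<close>
  moves.\<close>

definition rest :: "'n \<Rightarrow> real^2^'n \<Rightarrow> real" where
  "rest i x = (\<Sum>a\<in>UNIV - {i}. \<Sum>b\<in>UNIV - {a} - {i}. \<xi> a * \<xi> b * G (x $ a - x $ b))"

text \<open>\<open>energy\<close> counts ordered pairs, so each pair containing \<open>i\<close>
  appears twice; evenness of \<open>G\<close> merges the two terms into
  \<open>2 * \<xi> i * ham i x\<close>.\<close>

lemma energy_eq:
  assumes x: "x \<in> conf"
  shows "energy G \<xi> x = 2 * \<xi> i * ham i x + rest i x"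
proof -
  have "energy G \<xi> x = (\<Sum>j\<in>UNIV - {i}. \<xi> i * \<xi> j * G (x $ i - x $ j))
      + (\<Sum>a\<in>UNIV - {i}. \<Sum>b\<in>UNIV - {a}. \<xi> a * \<xi> b * G (x $ a - x $ b))"
    unfolding energy_def by (rule sum.remove) auto
  also have "(\<Sum>j\<in>UNIV - {i}. \<xi> i * \<xi> j * G (x $ i - x $ j)) = \<xi> i * ham i x"
    by (simp add: ham_def sum_distrib_left mult.assoc)
  also have "(\<Sum>a\<in>UNIV - {i}. \<Sum>b\<in>UNIV - {a}. \<xi> a * \<xi> b * G (x $ a - x $ b))
     = (\<Sum>a\<in>UNIV - {i}. \<xi> i * (\<xi> a * G (x $ i - x $ a)) + (\<Sum>b\<in>UNIV - {a} - {i}. \<xi> a * \<xi> b * G (x $ a - x $ b)))"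
  proof (rule sum.cong[OF refl])
    fix a assume a: "a \<in> UNIV - {i}"
    have "G (x $ a - x $ i) = G (x $ i - x $ a)"
      using G_even[OF conf_diff[OF x, of i a]] a by auto
    moreover have "(\<Sum>b\<in>UNIV - {a}. \<xi> a * \<xi> b * G (x $ a - x $ b))
       = \<xi> a * \<xi> i * G (x $ a - x $ i) + (\<Sum>b\<in>UNIV - {a} - {i}. \<xi> a * \<xi> b * G (x $ a - x $ b))"
      by (rule sum.remove) (use a in auto)
    ultimately show "(\<Sum>b\<in>UNIV - {a}. \<xi> a * \<xi> b * G (x $ a - x $ b))
      = \<xi> i * (\<xi> a * G (x $ i - x $ a)) + (\<Sum>b\<in>UNIV - {a} - {i}. \<xi> a * \<xi> b * G (x $ a - x $ b))"
      by (simp add: mult_ac)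
  qed
  also have "\<dots> = \<xi> i * ham i x + rest i x"
    by (simp only: sum.distrib sum_distrib_left[symmetric] ham_def rest_def)
  finally show ?thesis by simp
qed

lemma energy_period: "k \<in> latticeN \<Longrightarrow> energy G \<xi> (x + k) = energy G \<xi> x"
  unfolding energy_def by (simp only: diff_shift(1) G_periodic[OF diff_shift(2)])

lemma energy_wrapN: "energy G \<xi> (wrapN x) = energy G \<xi> x"
  using energy_period[OF wrapN_diff[of x], of x] by simp

text \<open>What the invariance of the three measures draws on, in a form that is stable under
  composition. Preservation of volume is asked on the whole space, where lattice translations
  act.\<close>

definition invariant_map :: "(real^2^'n \<Rightarrow> real^2^'n) \<Rightarrow> bool" where
  "invariant_map F \<longleftrightarrow> (\<forall>x\<in>conf. F x \<in> conf) \<and> (\<forall>x. x \<notin> conf \<longrightarrow> F x = x) \<and> continuous_on conf F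
     \<and> F \<in> borel_measurable borel \<and> distr lborel borel F = lborel
     \<and> (\<forall>x\<in>conf. energy G \<xi> (F x) = energy G \<xi> x) \<and> (\<forall>k\<in>latticeN. \<forall>x. F (x + k) = F x + k)"

text \<open>The inverse is carried along because the passage to the torus uses invariance under
  it.\<close>

definition invariant_pair :: "(real^2^'n \<Rightarrow> real^2^'n) \<Rightarrow> (real^2^'n \<Rightarrow> real^2^'n) \<Rightarrow> bool" where
  "invariant_pair F F' \<longleftrightarrow> invariant_map F \<and> invariant_map F' \<and> (\<forall>x. F' (F x) = x) \<and> (\<forall>x. F (F' x) = x)"

lemma invariant_map_comp:
  assumes F: "invariant_map F" and K: "invariant_map K"
  shows "invariant_map (F \<circ> K)"
proof -
  have m: "F \<in> borel_measurable borel" "K \<in> borel_measurable borel"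
    using F K unfolding invariant_map_def by auto
  have "distr lborel borel (F \<circ> K) = distr (distr lborel borel K) borel F"
    using m by (simp add: distr_distr)
  also have "\<dots> = lborel" using F K unfolding invariant_map_def by simp
  finally have d: "distr lborel borel (F \<circ> K) = lborel" .
  have c: "continuous_on conf (F \<circ> K)"
    using F K unfolding invariant_map_def
    by (intro continuous_on_compose) (auto intro: continuous_on_subset)
  show ?thesis
    using F K m c d unfolding invariant_map_def by (auto intro: measurable_comp)
qed

lemma invariant_pair_comp:
  "invariant_pair F F' \<Longrightarrow> invariant_pair K K' \<Longrightarrow> invariant_pair (F \<circ> K) (K' \<circ> F')"
  unfolding invariant_pair_def by (auto intro: invariant_map_comp)

lemma invariant_pair_id: "invariant_pair (\<lambda>x. x) (\<lambda>x. x)"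
  using distr_id2[of borel lborel] by (simp add: invariant_pair_def invariant_map_def)

lemma conf_borel [measurable]: "(conf :: (real^2^'n) set) \<in> sets borel" using open_conf by simp

text \<open>Formulated for a general field \<open>V\<close> that moves only vortex \<open>i\<close>
  and conserves \<open>ham i\<close>, so that the negated field, which gives the inverse, is covered
  as well.\<close>

lemma invariant_map_cflow:
  assumes cf: "conserved_flow conf V DV B DB p q latticeN"
    and V0: "\<And>x j. j \<noteq> i \<Longrightarrow> V x $ j = 0"
    and V_ham: "\<And>x. x \<in> conf \<Longrightarrow> (\<Sum>j\<in>UNIV - {i}. \<xi> j * DG (x $ i - x $ j) (V x $ i - V x $ j)) = 0"
    and t: "0 \<le> t"
  shows "invariant_map (\<lambda>x. if x \<in> conf then conserved_flow.cflow conf V B t x else x)"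
proof -
  interpret conserved_flow conf V DV B DB p q latticeN by fact
  let ?F = "\<lambda>x. if x \<in> conf then cflow t x else x"
  have m: "?F \<in> borel_measurable borel"
    by (intro borel_measurable_continuous_on_if continuous_cflow[OF t]) auto
  have vol: "distr lborel borel ?F = lborel"
  proof (rule measure_eqI)
    fix A assume "A \<in> sets (distr lborel borel ?F)"
    then have A [measurable]: "A \<in> sets borel" by simp
    have "?F -` A \<in> sets borel" by (rule measurable_sets_borel[OF m A])
    then have "?F -` A \<inter> conf \<in> sets borel" by measurable
    moreover have "?F -` A \<inter> conf = {x \<in> conf. cflow t x \<in> A}" by auto
    ultimately have mA [measurable]: "{x \<in> conf. cflow t x \<in> A} \<in> sets borel" by simp
    have "emeasure (distr lborel borel ?F) A = emeasure lborel (?F -` A)"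
      using m by (subst emeasure_distr) auto
    also have "?F -` A = {x \<in> conf. cflow t x \<in> A} \<union> (A - conf)" by (auto split: if_splits)
    also have "emeasure lborel \<dots> = emeasure lborel {x \<in> conf. cflow t x \<in> A} + emeasure lborel (A - conf)"
      by (rule plus_emeasure[symmetric]) auto
    also have "\<dots> = emeasure lborel (A \<inter> conf) + emeasure lborel (A - conf)"
      by (simp only: emeasure_cflow[OF t A])
    also have "\<dots> = emeasure lborel ((A \<inter> conf) \<union> (A - conf))"
      by (rule plus_emeasure) auto
    also have "(A \<inter> conf) \<union> (A - conf) = A" by auto
    finally show "emeasure (distr lborel borel ?F) A = emeasure lborel A" .
  qed simp
  have energy: "energy G \<xi> (cflow t x) = energy G \<xi> x" if x: "x \<in> conf" for x
  proof -
    have "ham i (cflow t x) = ham i x"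
      by (rule cflow_conserved[OF x t ham_der V_ham])
    moreover have comp: "cflow t x $ j = x $ j" if j: "j \<noteq> i" for j
    proof -
      have "cflow t x $ j $ u = x $ j $ u" for u
        by (rule cflow_conserved[OF x t, where f = "\<lambda>x. x $ j $ u" and Df = "\<lambda>_ h. h $ j $ u"])
           (auto simp: V0[OF j] intro!: bounded_linear_imp_has_derivative
             bounded_linear_compose[OF bounded_linear_vec_nth bounded_linear_vec_nth])
      then show ?thesis by (simp add: vec_eq_iff)
    qed
    moreover have "rest i (cflow t x) = rest i x"
      unfolding rest_def by (intro sum.cong refl) (simp add: comp)
    ultimately show ?thesis
      using energy_eq[OF x, of i] energy_eq[OF cflow_in[OF x t], of i] by simp
  qed
  show ?thesis
    unfolding invariant_map_def
  proof (intro conjI ballI allI impI)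
    show "continuous_on conf ?F"
      by (rule continuous_on_eq[OF continuous_cflow[OF t]]) simp
    fix k x :: "real^2^'n" assume k: "k \<in> latticeN"
    show "?F (x + k) = ?F x + k"
      using cflow_period[OF _ k t, of x] conf_period[OF k, of x] by simp
  qed (use m vol energy cflow_in t in auto)
qed

text \<open>Extended by the identity to the collisions, where \<open>cflow\<close> is junk, to make them bijections of the whole space.\<close>

definition fflow :: "'n \<Rightarrow> real \<Rightarrow> real^2^'n \<Rightarrow> real^2^'n" where
  "fflow i t x = (if x \<in> conf then conserved_flow.cflow conf (slot_field G \<xi> i) (barrier i) t x else x)"

definition bflow :: "'n \<Rightarrow> real \<Rightarrow> real^2^'n \<Rightarrow> real^2^'n" where
  "bflow i t x = (if x \<in> conf then conserved_flow.cflow conf (\<lambda>x. - slot_field G \<xi> i x) (barrier i) t x else x)"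

lemma invariant_pair_fflow:
  assumes t: "0 \<le> t"
  shows "invariant_pair (fflow i t) (bflow i t)"
proof -
  interpret S: conserved_flow conf "slot_field G \<xi> i" "\<lambda>x h. d2ham i e2 x h *\<^sub>R px i - d2ham i e1 x h *\<^sub>R qx i"
    "barrier i" "dbarrier i" "px i" "qx i" latticeN by (rule slot_conserved_flow)
  interpret S': conserved_flow conf "\<lambda>x. - slot_field G \<xi> i x" "\<lambda>x h. - (d2ham i e2 x h *\<^sub>R px i - d2ham i e1 x h *\<^sub>R qx i)"
    "barrier i" "dbarrier i" "px i" "qx i" latticeN by (rule conserved_flow_uminus) (rule slot_conserved_flow)
  have 0: "slot_field G \<xi> i x $ j = 0" if "j \<noteq> i" for x j using that by (simp add: slot_field_def)
  have 1: "invariant_map (fflow i t)"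
    unfolding fflow_def[abs_def]
    by (rule invariant_map_cflow[OF slot_conserved_flow 0 slot_field_conserves_ham t])
  have "(\<Sum>j\<in>UNIV - {i}. \<xi> j * DG (x $ i - x $ j) ((- slot_field G \<xi> i x) $ i - (- slot_field G \<xi> i x) $ j)) = 0"
    if x: "x \<in> conf" for x
  proof -
    have "DG (x $ i - x $ j) ((- slot_field G \<xi> i x) $ i - (- slot_field G \<xi> i x) $ j)
      = - DG (x $ i - x $ j) (slot_field G \<xi> i x $ i - slot_field G \<xi> i x $ j)" if "j \<noteq> i" for j
      using linear_neg[OF bounded_linear.linear[OF has_derivative_bounded_linear[OF G_der[OF conf_diff[OF x, of i j]]]],
          of "slot_field G \<xi> i x $ i - slot_field G \<xi> i x $ j"] that by simp
    then have "(\<Sum>j\<in>UNIV - {i}. \<xi> j * DG (x $ i - x $ j) ((- slot_field G \<xi> i x) $ i - (- slot_field G \<xi> i x) $ j))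
       = (\<Sum>j\<in>UNIV - {i}. - (\<xi> j * DG (x $ i - x $ j) (slot_field G \<xi> i x $ i - slot_field G \<xi> i x $ j)))"
      by (intro sum.cong) auto
    then show ?thesis using slot_field_conserves_ham[OF x] by (simp only: sum_negf neg_0_equal_iff_equal)
  qed
  note ham' = this
  have V0: "(- slot_field G \<xi> i x) $ j = 0" if "j \<noteq> i" for x j using 0[OF that] by simp
  have 2: "invariant_map (bflow i t)"
    unfolding bflow_def[abs_def]
    by (rule invariant_map_cflow[OF conserved_flow_uminus[OF slot_conserved_flow] V0 ham' t])
  show ?thesis
    unfolding invariant_pair_def
    using 1 2 S.cflow_inverse S.cflow_inverse' S.cflow_in S'.cflow_in t by (auto simp: fflow_def bflow_def)
qed

text \<open>\<open>\<nu>\<close> stands for Lebesgue measure or for the lifted microcanonical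
  measure; invariance under the lattice lets its restriction to \<open>torusN\<close> act as a
  measure on the quotient.\<close>

lemma preserves_wrapped:
  fixes \<nu> :: "(real^2^'n) measure"
  assumes sets [simp, measurable_cong]: "sets \<nu> = sets borel" and pair: "invariant_pair F F'"
    and null: "emeasure \<nu> (- conf) = 0"
    and inv': "distr \<nu> borel F' = \<nu>"
    and transl: "\<And>k. k \<in> latticeN \<Longrightarrow> distr \<nu> borel (\<lambda>x. x + k) = \<nu>"
  shows "preserves_measure (\<lambda>x. wrapN (F x)) (restrict_space \<nu> torusN)"
proof -
  have F: "invariant_map F" "invariant_map F'" and F'F: "\<And>x. F' (F x) = x" and FF': "\<And>x. F (F' x) = x"
    using pair unfolding invariant_pair_def by auto
  have m [measurable]: "F \<in> borel_measurable borel" "F' \<in> borel_measurable borel"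
    using F unfolding invariant_map_def by auto
  have Fc: "F x \<in> conf \<longleftrightarrow> x \<in> conf" "F' x \<in> conf \<longleftrightarrow> x \<in> conf" for x
    using F unfolding invariant_map_def by metis+
  have space: "space \<nu> = UNIV" using sets_eq_imp_space_eq[OF sets] by simp
  have cs [measurable]: "conf_space \<in> sets (borel :: (real^2^'n) measure)" unfolding conf_space_eq by measurable
  have rr: "restrict_space (restrict_space \<nu> torusN) conf_space = restrict_space \<nu> conf_space"
    by (subst restrict_restrict_space) (auto simp: conf_space_eq Int_absorb1 Int_commute Int_left_commute)
  have f: "(\<lambda>x. wrapN (F x)) \<in> measurable (restrict_space \<nu> conf_space) (restrict_space \<nu> torusN)"
    by (intro measurable_restrict_space2 measurable_restrict_space1) (auto simp: wrapN_in)
  have transl': "emeasure \<nu> {x. x + k \<in> C} = emeasure \<nu> C" if k: "k \<in> latticeN" and C: "C \<in> sets borel" for C k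
  proof -
    have "emeasure \<nu> C = emeasure (distr \<nu> borel (\<lambda>x. x + k)) C" by (simp only: transl[OF k])
    also have "\<dots> = emeasure \<nu> ((\<lambda>x. x + k) -` C)" using C by (subst emeasure_distr) (auto simp: space)
    finally show ?thesis by (simp add: vimage_def)
  qed
  have inv2: "emeasure \<nu> {x \<in> conf. F' x \<in> C} = emeasure \<nu> (C \<inter> conf)" if C [measurable]: "C \<in> sets borel" for C
  proof -
    have "emeasure \<nu> (C \<inter> conf) = emeasure (distr \<nu> borel F') (C \<inter> conf)" by (simp only: inv')
    also have "\<dots> = emeasure \<nu> (F' -` (C \<inter> conf))" by (subst emeasure_distr) (auto simp: space)
    also have "F' -` (C \<inter> conf) = {x \<in> conf. F' x \<in> C}" using Fc by auto
    finally show ?thesis ..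
  qed
  have pre: "{x \<in> conf. K x \<in> C} \<in> sets borel" if C: "C \<in> sets borel" and K: "K \<in> borel_measurable borel" for K :: "real^2^'n \<Rightarrow> real^2^'n" and C
  proof -
    have "conf \<inter> K -` C \<in> sets borel" by (rule sets.Int[OF conf_borel]) (rule measurable_sets_borel[OF K C])
    moreover have "conf \<inter> K -` C = {x \<in> conf. K x \<in> C}" by auto
    ultimately show ?thesis by simp
  qed
  have null': "- conf \<in> null_sets \<nu>" using null borel_comp[OF conf_borel] by (intro null_setsI) auto
  have "distr (restrict_space \<nu> conf_space) (restrict_space \<nu> torusN) (\<lambda>x. wrapN (F x)) = restrict_space \<nu> torusN"
  proof (rule measure_eqI)
    fix A assume "A \<in> sets (distr (restrict_space \<nu> conf_space) (restrict_space \<nu> torusN) (\<lambda>x. wrapN (F x)))"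
    then have As: "A \<in> sets (restrict_space \<nu> torusN)" by simp
    then have AT: "A \<subseteq> torusN" and A [measurable]: "A \<in> sets borel" by (auto simp: sets_restrict_space)
    have "emeasure (distr (restrict_space \<nu> conf_space) (restrict_space \<nu> torusN) (\<lambda>x. wrapN (F x))) A
       = emeasure (restrict_space \<nu> conf_space) ((\<lambda>x. wrapN (F x)) -` A \<inter> space (restrict_space \<nu> conf_space))"
      by (rule emeasure_distr[OF f As])
    also have "\<dots> = emeasure \<nu> {x \<in> torusN \<inter> conf. wrapN (F x) \<in> A}"
    proof (subst emeasure_restrict_space)
      show "emeasure \<nu> ((\<lambda>x. wrapN (F x)) -` A \<inter> space (restrict_space \<nu> conf_space)) = emeasure \<nu> {x \<in> torusN \<inter> conf. wrapN (F x) \<in> A}"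
        by (rule arg_cong[where f = "emeasure \<nu>"]) (auto simp: space_restrict_space space conf_space_eq)
    qed (auto simp: space_restrict_space space)
    also have "\<dots> = emeasure \<nu> (A \<inter> torusN \<inter> conf)"
    proof (rule torusN.emeasure_wrapped_map[where F' = F'])
      show "F' (x + k) = F' x + k" if "k \<in> latticeN" for x k
        using F(2) that unfolding invariant_map_def by blast
      show "x + k \<in> conf \<longleftrightarrow> x \<in> conf" if "k \<in> latticeN" for x k :: "real^2^'n"
        by (rule conf_period[OF that])
      show "{x \<in> conf. F x \<in> C} \<in> sets borel" "{x \<in> conf. F' x \<in> C} \<in> sets borel" if "C \<in> sets borel" for C
        using pre[OF that] m by blast+
      show "emeasure \<nu> {x \<in> conf. F' x \<in> C} = emeasure \<nu> (C \<inter> conf)" if "C \<in> sets borel" for C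
        by (rule inv2[OF that])
      show "emeasure \<nu> {x. x + k \<in> C} = emeasure \<nu> C" if "C \<in> sets borel" "k \<in> latticeN" for C k
        by (rule transl'[OF that(2,1)])
    qed (use Fc F'F FF' sets A conf_borel in blast)+
    also have "A \<inter> torusN \<inter> conf = A - - conf" using AT by auto
    also have "emeasure \<nu> (A - - conf) = emeasure \<nu> A"
      by (rule emeasure_Diff_null_set[OF null']) simp
    also have "\<dots> = emeasure (restrict_space \<nu> torusN) A"
      using AT by (subst emeasure_restrict_space) (auto simp: space)
    finally show "emeasure (distr (restrict_space \<nu> conf_space) (restrict_space \<nu> torusN) (\<lambda>x. wrapN (F x))) A
       = emeasure (restrict_space \<nu> torusN) A" .
  qed simp
  then show ?thesis unfolding preserves_measure_def rr using f by simp
qed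

text \<open>A collision forces the first coordinate of some \<open>x $ i - x $ j\<close> to be an
  integer, which confines \<open>x\<close> to countably many hyperplanes.\<close>

lemma conf_null: "emeasure lborel (- conf :: (real^2^'n) set) = 0"
proof -
  let ?a = "\<lambda>i j. axis i e1 - axis j e1 :: real^2^'n"
  have hyp: "{x. ?a i j \<bullet> x = c} \<in> null_sets lborel" if "i \<noteq> j" for i j c
  proof -
    have "?a i j \<noteq> 0"
    proof
      assume "?a i j = 0"
      then have "?a i j $ i $ 1 = 0" by simp
      then show False using that by (simp add: axis_def)
    qed
    then have "negligible {x. ?a i j \<bullet> x = c}" by (intro negligible_hyperplane) simp
    moreover have "{x. ?a i j \<bullet> x = c} \<in> sets lborel"
      by (simp add: borel_closed closed_hyperplane)
    ultimately show ?thesis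
      by (simp add: negligible_iff_null_sets null_sets_completion_iff)
  qed
  have "(\<Union>p\<in>{(i, j). i \<noteq> j}. \<Union>k\<in>lattice2. {x. ?a (fst p) (snd p) \<bullet> x = k $ 1}) \<in> null_sets lborel"
    by (intro null_sets_UN' countable_lattice2 hyp) (auto intro: countable_finite)
  moreover have "- conf \<subseteq> (\<Union>p\<in>{(i, j). i \<noteq> j}. \<Union>k\<in>lattice2. {x. ?a (fst p) (snd p) \<bullet> x = k $ 1})"
  proof
    fix x :: "real^2^'n" assume "x \<in> - conf"
    then obtain i j where ij: "i \<noteq> j" "x $ i - x $ j \<in> lattice2" by (auto simp: lifted_conf_space_def)
    have "?a i j \<bullet> x = (x $ i - x $ j) $ 1" by (simp add: inner_diff_left inner_axis')
    then show "x \<in> (\<Union>p\<in>{(i, j). i \<noteq> j}. \<Union>k\<in>lattice2. {x. ?a (fst p) (snd p) \<bullet> x = k $ 1})"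
      using ij by (intro UN_I[of "(i, j)"] UN_I[of "x $ i - x $ j"]) auto
  qed
  ultimately show ?thesis
    by (metis (no_types, lifting) null_sets_subset null_setsD1 sets_lborel borel_comp[OF conf_borel])
qed

lemma distr_lborel_shift: "distr lborel borel (\<lambda>x::real^2^'n. x + k) = lborel"
proof -
  have "(\<lambda>x. x + k) = (+) k" by (simp add: fun_eq_iff add.commute)
  then show ?thesis using lborel_distr_plus[of k] by simp
qed

lemma preserves_volume:
  assumes "invariant_pair F F'"
  shows "preserves_measure (\<lambda>x. wrapN (F x)) vol_torusN"
  unfolding vol_torusN_def
  by (rule preserves_wrapped[OF _ assms conf_null _ distr_lborel_shift])
     (use assms in \<open>auto simp: invariant_pair_def invariant_map_def\<close>)

text \<open>\<open>G\<close> is arbitrary on the lattice, but the lattice is countable.\<close>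

lemma G_borel [measurable]: "G \<in> borel_measurable borel"
proof (rule measurable_discrete_difference[where X = lattice2 and f = "\<lambda>z. if z \<in> - lattice2 then G z else 0"])
  have "- lattice2 \<in> sets borel" using closed_lattice2 by simp
  then show "(\<lambda>z. if z \<in> - lattice2 then G z else 0) \<in> borel_measurable borel"
    by (intro borel_measurable_continuous_on_if G_continuous) auto
qed (auto simp: countable_lattice2)

lemma energy_borel [measurable]: "energy G \<xi> \<in> borel_measurable borel"
  unfolding energy_def
  by (intro borel_measurable_sum borel_measurable_times borel_measurable_const measurable_compose[OF _ G_borel]
      borel_measurable_continuous_onI continuous_difference)

lemma invariant_map_energy_wrap:
  assumes "invariant_pair F F'" "x \<in> conf"
  shows "energy G \<xi> (wrapN (F x)) = energy G \<xi> x"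
  using assms unfolding invariant_pair_def invariant_map_def by (simp add: energy_wrapN)

lemma preserves_canonical:
  assumes pair: "invariant_pair F F'"
  shows "preserves_measure (\<lambda>x. wrapN (F x)) (canonical G \<xi> \<beta>)"
  unfolding canonical_def
proof (rule preserves_measure_density[OF preserves_volume[OF pair]])
  show "(\<lambda>x. ennreal (exp (- \<beta> * energy G \<xi> x)) / Z_canonical G \<xi> \<beta>) \<in> borel_measurable vol_torusN"
    unfolding vol_torusN_def by (intro measurable_restrict_space1) simp
  have "conf_space \<inter> space vol_torusN = (conf_space :: (real^2^'n) set)"
    by (auto simp: vol_torusN_def space_restrict_space conf_space_eq)
  then show "conf_space \<inter> space vol_torusN \<in> sets (vol_torusN :: (real^2^'n) measure)"
    unfolding vol_torusN_def conf_space_eq by (auto simp: sets_restrict_space)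
qed (auto simp: invariant_map_energy_wrap[OF pair] conf_space_eq)

lemma energy_der:
  assumes x: "x \<in> conf"
  shows "(energy G \<xi> has_derivative (\<lambda>h. \<Sum>i\<in>UNIV. \<Sum>j\<in>UNIV - {i}. \<xi> i * \<xi> j * DG (x $ i - x $ j) (h $ i - h $ j))) (at x)"
  unfolding energy_def
proof (intro has_derivative_sum has_derivative_mult_right)
  fix i j :: 'n assume "j \<in> UNIV - {i}"
  then have "x $ i - x $ j \<notin> lattice2" using conf_diff[OF x] by auto
  from has_derivative_compose[OF vec_nth_component_der G_der[OF this]]
  show "((\<lambda>x. G (x $ i - x $ j)) has_derivative (\<lambda>h. DG (x $ i - x $ j) (h $ i - h $ j))) (at x)" .
qed

lemma grad_energy_cont: "continuous_on conf (grad (energy G \<xi>))"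
proof -
  have "continuous_on conf (\<lambda>x. \<Sum>b\<in>Basis. (\<Sum>i\<in>UNIV. \<Sum>j\<in>UNIV - {i}. \<xi> i * \<xi> j * DG (x $ i - x $ j) (b $ i - b $ j)) *\<^sub>R b)"
    by (intro continuous_on_sum continuous_on_scaleR continuous_on_const continuous_on_mult_left
        cont_diff[of "\<lambda>z. DG z (_ $ _ - _ $ _)"] DG_cont) auto
  moreover have "(\<Sum>b\<in>Basis. (\<Sum>i\<in>UNIV. \<Sum>j\<in>UNIV - {i}. \<xi> i * \<xi> j * DG (x $ i - x $ j) (b $ i - b $ j)) *\<^sub>R b)
     = grad (energy G \<xi>) x" if "x \<in> conf" for x
    unfolding grad_def frechet_derivative_at[OF energy_der[OF that], symmetric] ..
  ultimately show ?thesis by (rule continuous_on_eq)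
qed

text \<open>The level set argument is run on the periodic lift of the surface. There the flow and
  the lattice translations are volume and energy preserving bijections, continuous both ways on
  \<open>conf\<close>.\<close>

lemma preserves_microcanonical:
  assumes pair: "invariant_pair F F'" and reg: "regular_energy G \<xi> E"
    and surf: "surface_measure_on (energy_surface G \<xi> E) \<sigma>"
  shows "preserves_measure (\<lambda>x. wrapN (F x)) (microcanonical G \<xi> \<sigma>)"
proof -
  interpret L: level_set conf "energy G \<xi>" "grad (energy G \<xi>)" E \<sigma>
  proof
    show "open (conf :: (real^2^'n) set)" by (rule open_conf)
    show "continuous_on conf (grad (energy G \<xi>))" by (rule grad_energy_cont)
    fix x :: "real^2^'n" assume x: "x \<in> conf"
    show "(energy G \<xi> has_derivative (\<lambda>h. grad (energy G \<xi>) x \<bullet> h)) (at x)"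
      by (rule has_derivative_grad[OF energy_der[OF x]])
    assume E: "energy G \<xi> x = E"
    \<comment> \<open>Regularity is assumed on the fundamental domain only; periodicity of the
      gradient extends it to the cover.\<close>
    have "frechet_derivative (energy G \<xi>) (at (x + (wrapN x - x))) = frechet_derivative (energy G \<xi>) (at x)"
      by (rule frechet_derivative_periodic) (rule energy_period[OF wrapN_diff])
    then have "grad (energy G \<xi>) (wrapN x) = grad (energy G \<xi>) x" by (simp add: grad_def)
    moreover have "grad (energy G \<xi>) (wrapN x) \<noteq> 0"
      using reg x E unfolding regular_energy_def by (simp add: wrapN_conf_space energy_wrapN)
    ultimately show "grad (energy G \<xi>) x \<noteq> 0" by simp
  qed (use surf in \<open>simp add: energy_surface_def\<close>)
  have inv: "distr L.\<mu> borel K = L.\<mu>" if K: "invariant_pair K K'" for K K'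
  proof (rule L.distr_\<mu>[where F' = K'])
    show "\<And>x. x \<in> conf \<Longrightarrow> energy G \<xi> (K x) = energy G \<xi> x" "continuous_on conf K" "continuous_on conf K'"
      "K \<in> borel_measurable borel" "distr lborel borel K = lborel"
      "\<And>x. x \<in> conf \<Longrightarrow> K x \<in> conf" "\<And>x. x \<in> conf \<Longrightarrow> K' x \<in> conf" "\<And>x. K' (K x) = x" "\<And>x. K (K' x) = x"
      using K unfolding invariant_pair_def invariant_map_def by auto
  qed
  have pair': "invariant_pair F' F" using pair unfolding invariant_pair_def by blast
  \<comment> \<open>\<open>\<sigma>\<close> is any measure that meets the definition of surface
    measure; the invariance of its weighted version under the lattice is another instance of the
    shell argument.\<close>
  have sh: "distr L.\<mu> borel (\<lambda>x. x + k) = L.\<mu>" if k: "k \<in> latticeN" for k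
    by (rule L.distr_\<mu>[where F' = "\<lambda>x. x + - k"])
       (use k conf_period[OF k] conf_period[OF latticeN_minus[OF k]] in
         \<open>auto simp: distr_lborel_shift energy_period intro!: continuous_intros\<close>)
  have "emeasure L.\<mu> (- conf) \<le> emeasure L.\<mu> (- {x \<in> conf. energy G \<xi> x = E})"
    by (intro emeasure_mono) (use borel_comp[OF L.level_borel] in auto)
  then have "emeasure L.\<mu> (- conf) = 0" using L.\<mu>_null by simp
  from preserves_wrapped[OF L.sets_\<mu> pair this inv[OF pair'] sh]
  have 1: "preserves_measure (\<lambda>x. wrapN (F x)) (restrict_space L.\<mu> torusN)" .
  let ?w = "\<lambda>x. indicator conf x * ennreal (1 / norm (grad (energy G \<xi>) x))"
  have "delta_energy G \<xi> \<sigma> = density (restrict_space \<sigma> torusN) ?w"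
    unfolding delta_energy_def
  proof (rule density_cong)
    have w: "?w \<in> borel_measurable (restrict_space \<sigma> torusN)"
      by (intro measurable_restrict_space1) simp
    moreover have eq: "indicator conf_space x * ennreal (1 / norm (grad (energy G \<xi>) x)) = ?w x"
      if "x \<in> space (restrict_space \<sigma> torusN)" for x
      using that by (auto simp: space_restrict_space conf_space_eq indicator_def)
    ultimately show "(\<lambda>x. indicator conf_space x * ennreal (1 / norm (grad (energy G \<xi>) x))) \<in> borel_measurable (restrict_space \<sigma> torusN)"
      by (subst measurable_cong[OF eq]) auto
    show "?w \<in> borel_measurable (restrict_space \<sigma> torusN)" by (rule w)
    show "AE x in restrict_space \<sigma> torusN. indicator conf_space x * ennreal (1 / norm (grad (energy G \<xi>) x)) = ?w x"
      by (rule AE_I2) (rule eq)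
  qed
  also have "\<dots> = restrict_space L.\<mu> torusN"
    unfolding L.\<mu>_def by (rule density_restrict_space) auto
  finally have delta: "delta_energy G \<xi> \<sigma> = restrict_space L.\<mu> torusN" .
  have "microcanonical G \<xi> \<sigma> = density (restrict_space L.\<mu> torusN) (\<lambda>_. 1 / Z_microcanonical G \<xi> \<sigma>)"
    unfolding microcanonical_def delta
    by (rule measure_eqI) (auto simp: emeasure_density_const)
  moreover have "preserves_measure (\<lambda>x. wrapN (F x)) (density (restrict_space L.\<mu> torusN) (\<lambda>_. 1 / Z_microcanonical G \<xi> \<sigma>))"
  proof (rule preserves_measure_density[OF 1])
    have "conf_space \<inter> space (restrict_space L.\<mu> torusN) = (conf_space :: (real^2^'n) set)"
      using sets_eq_imp_space_eq[OF L.sets_\<mu>] by (auto simp: space_restrict_space conf_space_eq)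
    then show "conf_space \<inter> space (restrict_space L.\<mu> torusN) \<in> sets (restrict_space L.\<mu> torusN)"
      unfolding conf_space_eq by (auto simp: sets_restrict_space)
  qed auto
  ultimately show ?thesis by simp
qed

end

section \<open>Trajectories on the cover and curves on the torus\<close>

lemma has_vector_derivative_affine:
  fixes u :: "real \<Rightarrow> 'a::real_normed_vector"
  assumes "(u has_vector_derivative D) (at (a + k * t))"
  shows "((\<lambda>t. u (a + k * t)) has_vector_derivative k *\<^sub>R D) (at t)"
proof -
  have "((\<lambda>t. a + k * t) has_vector_derivative k) (at t)"
    by (auto intro!: derivative_eq_intros simp: has_real_derivative_iff_has_vector_derivative[symmetric])
  from vector_diff_chain_at[OF this assms] show ?thesis by (simp add: o_def)
qed

context vortices
begin

lemma invariant_map_wrapN: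
  assumes "invariant_map F"
  shows "wrapN (F (wrapN x)) = wrapN (F x)"
proof -
  have "F (x + (wrapN x - x)) = F x + (wrapN x - x)"
    using assms wrapN_diff[of x] unfolding invariant_map_def by blast
  then show ?thesis using wrapN_shift[OF wrapN_diff[of x], of "F x"] by simp
qed

lemma slot_field_wrapN: "slot_field G \<xi> i (wrapN x) = slot_field G \<xi> i x"
  using slot_field_period[OF wrapN_diff[of x], of i x] by simp

lemma fflow_trajectory: "x \<in> conf \<Longrightarrow> is_trajectory (slot_field G \<xi> i) T (\<lambda>s. fflow i s x)"
  using conserved_flow.cflow_trajectory[OF slot_conserved_flow] by (simp add: fflow_def)

lemma fflow_eqI:
  assumes "is_trajectory (slot_field G \<xi> i) T u" "0 \<le> T" "\<And>t. 0 \<le> t \<Longrightarrow> t \<le> T \<Longrightarrow> u t \<in> conf"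
  shows "u T = fflow i T (u 0)"
  using conserved_flow.cflow_eqI[OF slot_conserved_flow assms] assms(2,3) by (simp add: fflow_def)

lemma fflow_0 [simp]: "fflow i 0 x = x"
  using conserved_flow.cflow_0[OF slot_conserved_flow] by (simp add: fflow_def)

lemma invariant_map_fflow: "0 \<le> t \<Longrightarrow> invariant_map (fflow i t)"
  using invariant_pair_fflow unfolding invariant_pair_def by blast

lemma invariant_map_in: "invariant_map F \<Longrightarrow> x \<in> conf \<Longrightarrow> F x \<in> conf"
  unfolding invariant_map_def by blast

lemmas fflow_in = invariant_map_in[OF invariant_map_fflow]

lemma fflow_has_vector_derivative:
  assumes x: "x \<in> conf" and s: "0 \<le> s"
  shows "((\<lambda>s. fflow i s x) has_vector_derivative slot_field G \<xi> i (fflow i s x)) (at s within {0..})"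
proof -
  \<comment> \<open>Starting one unit of time earlier makes the derivative at \<open>s = 0\<close> two-sided.\<close>
  define y where "y = bflow i 1 x"
  have y: "y \<in> conf" "fflow i 1 y = x"
    using invariant_pair_fflow[of 1 i] x unfolding invariant_pair_def y_def by (auto intro: invariant_map_in)
  have eq: "fflow i (1 + r) y = fflow i r x" if r: "0 \<le> r" for r
  proof -
    have "is_trajectory (slot_field G \<xi> i) r (\<lambda>t. fflow i (1 + t) y)"
      by (rule is_trajectory_shift[OF fflow_trajectory[OF y(1), of i "1 + r"]]) simp_all
    from fflow_eqI[OF this r] show ?thesis using y fflow_in by simp
  qed
  have "((\<lambda>s. fflow i s y) has_vector_derivative slot_field G \<xi> i (fflow i (1 + s) y)) (at (1 + 1 * s))"
    using fflow_trajectory[OF y(1), of i "2 + s"] s unfolding is_trajectory_def by simp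
  from has_vector_derivative_affine[OF this]
  have "((\<lambda>s. fflow i (1 + s) y) has_vector_derivative slot_field G \<xi> i (fflow i s x)) (at s)"
    by (simp add: eq[OF s])
  then have "((\<lambda>s. fflow i (1 + s) y) has_vector_derivative slot_field G \<xi> i (fflow i s x)) (at s within {0..})"
    by (rule has_vector_derivative_at_within)
  then show ?thesis
    by (rule has_vector_derivative_transform[rotated 2]) (use s eq in simp_all)
qed

text \<open>A change of time by the factor \<open>k\<close>. The value \<open>k = 0\<close> is
  treated apart: a vanishing waiting time stops the vortex, and the time change would divide by
  0.\<close>

lemma fflow_scaled_eqI:
  assumes cont: "continuous_on {a..b} u" and ab: "a \<le> b" and k: "0 \<le> k"
    and inside: "\<And>t. a \<le> t \<Longrightarrow> t \<le> b \<Longrightarrow> u t \<in> conf"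
    and der: "\<And>t. a < t \<Longrightarrow> t < b \<Longrightarrow> (u has_vector_derivative k *\<^sub>R slot_field G \<xi> i (u t)) (at t)"
  shows "u b = fflow i (k * (b - a)) (u a)"
proof (cases "k = 0")
  case True
  have 1: "is_trajectory (\<lambda>_. 0) (b - a) (\<lambda>t. u (a + t))"
    unfolding is_trajectory_def
  proof (intro conjI allI impI)
    show "continuous_on {0..b - a} (\<lambda>t. u (a + t))"
      by (rule continuous_on_compose2[OF cont]) (auto intro!: continuous_intros)
    fix t assume t: "0 < t \<and> t < b - a"
    have "(u has_vector_derivative 0) (at (a + 1 * t))"
      using der[of "a + t"] t True by simp
    from has_vector_derivative_affine[OF this]
    show "((\<lambda>t. u (a + t)) has_vector_derivative 0) (at t)" by simp
  qed
  have 2: "is_trajectory (\<lambda>_. 0) (b - a) (\<lambda>_. u a)"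
    by (simp add: is_trajectory_def)
  have lip: "0-lipschitz_on UNIV (\<lambda>_::real^2^'n. 0::real^2^'n)" by (simp add: lipschitz_on_def)
  have "0 \<le> b - a" using ab by simp
  from trajectory_unique[OF lip this 1 2] show ?thesis using True by simp
next
  case False
  then have k: "0 < k" using k by simp
  define T where "T = k * (b - a)"
  have T: "0 \<le> T" using ab k by (simp add: T_def)
  have rng: "a + 1 / k * t \<le> b" if "t \<le> T" for t
    using that k by (simp add: T_def field_simps)
  have rng': "a + 1 / k * t < b" if "t < T" for t
    using that k by (simp add: T_def field_simps)
  have pos: "a \<le> a + 1 / k * t" if "0 \<le> t" for t using that k by simp
  have pos': "a < a + 1 / k * t" if "0 < t" for t using that k by simp
  have "is_trajectory (slot_field G \<xi> i) T (\<lambda>t. u (a + 1 / k * t))"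
    unfolding is_trajectory_def
  proof (intro conjI allI impI)
    show "continuous_on {0..T} (\<lambda>t. u (a + 1 / k * t))"
    proof (rule continuous_on_compose2[OF cont])
      show "(\<lambda>t. a + 1 / k * t) ` {0..T} \<subseteq> {a..b}"
        using rng pos by (intro image_subsetI) (simp only: atLeastAtMost_iff)
    qed (intro continuous_intros)
    fix t assume t: "0 < t \<and> t < T"
    have "(u has_vector_derivative k *\<^sub>R slot_field G \<xi> i (u (a + 1 / k * t))) (at (a + 1 / k * t))"
      by (rule der) (use t pos' rng' in blast)+
    from has_vector_derivative_affine[OF this]
    show "((\<lambda>t. u (a + 1 / k * t)) has_vector_derivative slot_field G \<xi> i (u (a + 1 / k * t))) (at t)"
      using k by simp
  qed
  from fflow_eqI[OF this T] have "u (a + 1 / k * T) = fflow i T (u (a + 1 / k * 0))"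
    using inside rng pos by blast
  moreover have "a + 1 / k * T = b" using k by (simp add: T_def)
  ultimately show ?thesis by (simp add: T_def)
qed

lemma integral_curve_exists:
  assumes x: "x \<in> conf_space"
  shows "integral_curve (slot_field G \<xi> i) T x (\<lambda>s. wrapN (fflow i s x))"
proof -
  have xc: "x \<in> conf" "wrapN x = x" using x by (auto simp: conf_space_eq wrapN_id)
  have "((\<lambda>s. fflow i s x) has_vector_derivative slot_field G \<xi> i (wrapN (fflow i s x))) (at s within {0..T})"
    if "s \<in> {0..T}" for s
    unfolding slot_field_wrapN
    by (rule has_vector_derivative_within_subset[OF fflow_has_vector_derivative[OF xc(1)]]) (use that in auto)
  then show ?thesis
    unfolding integral_curve_def wrapN_conf_space using xc fflow_in
    by (intro conjI exI[of _ "\<lambda>s. fflow i s x"] ballI) auto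
qed

text \<open>A lift of the curve is a trajectory on the cover, but it may start at any lattice
  translate of \<open>x\<close>; equivariance of \<open>fflow\<close> removes the ambiguity.\<close>

lemma integral_curve_eq:
  assumes \<gamma>: "integral_curve (slot_field G \<xi> i) T x \<gamma>" and s: "s \<in> {0..T}"
  shows "\<gamma> s = wrapN (fflow i s x)"
proof -
  obtain \<Gamma> where \<Gamma>: "\<And>s. s \<in> {0..T} \<Longrightarrow> \<gamma> s = wrapN (\<Gamma> s)" and inside: "\<And>s. s \<in> {0..T} \<Longrightarrow> \<gamma> s \<in> conf_space"
    and der': "\<And>s. s \<in> {0..T} \<Longrightarrow> (\<Gamma> has_vector_derivative slot_field G \<xi> i (\<gamma> s)) (at s within {0..T})"
    and \<gamma>0: "\<gamma> 0 = x"
    using \<gamma> unfolding integral_curve_def by blast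
  have der: "(\<Gamma> has_vector_derivative slot_field G \<xi> i (\<Gamma> s)) (at s within {0..T})" if "s \<in> {0..T}" for s
    using der'[OF that] unfolding \<Gamma>[OF that] slot_field_wrapN .
  have \<Gamma>c: "\<Gamma> s \<in> conf" if "s \<in> {0..T}" for s
    using inside[OF that] unfolding \<Gamma>[OF that] wrapN_conf_space .
  have "is_trajectory (slot_field G \<xi> i) T \<Gamma>"
    unfolding is_trajectory_def
  proof (intro conjI allI impI)
    show "continuous_on {0..T} \<Gamma>" by (rule continuous_on_vector_derivative[OF der])
    show "(\<Gamma> has_vector_derivative slot_field G \<xi> i (\<Gamma> t)) (at t)" if "0 < t \<and> t < T" for t
      using der[of t] that by (simp add: at_within_Icc_at)
  qed
  from is_trajectory_subinterval[OF this, of s]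
  have "is_trajectory (slot_field G \<xi> i) s \<Gamma>" using s by simp
  from fflow_eqI[OF this] have "\<Gamma> s = fflow i s (\<Gamma> 0)" using s \<Gamma>c by simp
  then have "\<gamma> s = wrapN (fflow i s (wrapN (\<Gamma> 0)))"
    using \<Gamma>[OF s] s by (simp add: invariant_map_wrapN[OF invariant_map_fflow])
  then show ?thesis using \<Gamma>[of 0] \<gamma>0 s by simp
qed

lemma flow_defined_slot_field:
  assumes "x \<in> conf_space"
  shows "flow_defined (slot_field G \<xi> i) T x"
  unfolding flow_defined_def
  using integral_curve_exists[OF assms] integral_curve_eq by metis

lemma flow_slot_field:
  assumes x: "x \<in> conf_space" and T: "0 \<le> T"
  shows "flow (slot_field G \<xi> i) T x = wrapN (fflow i T x)"
  unfolding flow_def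
proof (rule the_equality)
  show "\<exists>\<gamma>. integral_curve (slot_field G \<xi> i) T x \<gamma> \<and> \<gamma> T = wrapN (fflow i T x)"
    using integral_curve_exists[OF x] by blast
  show "y = wrapN (fflow i T x)" if "\<exists>\<gamma>. integral_curve (slot_field G \<xi> i) T x \<gamma> \<and> \<gamma> T = y" for y
    using that integral_curve_eq[of i T x _ T] T by auto
qed

end

text \<open>
  Step \<open>n\<close> moves the vortex \<open>a n\<close> for the time \<open>d n\<close>; the interpolation runs through it during
  \<open>[n / c, (n + 1) / c]\<close>.
\<close>

locale schedule = vortices G \<xi> for G and \<xi> :: "'n::finite \<Rightarrow> real" +
  fixes a :: "nat \<Rightarrow> 'n" and d :: "nat \<Rightarrow> real" and c :: real
  assumes d: "\<And>n. 0 \<le> d n" and c: "0 < c"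
begin

primrec chain :: "nat \<Rightarrow> real^2^'n \<Rightarrow> real^2^'n" where
  "chain 0 x = x"
| "chain (Suc n) x = fflow (a n) (d n) (chain n x)"

definition piece :: "nat \<Rightarrow> real \<Rightarrow> real^2^'n \<Rightarrow> real^2^'n" where
  "piece n s x = fflow (a n) (d n * (c * s - real n)) (chain n x)"

definition interp :: "real \<Rightarrow> real^2^'n \<Rightarrow> real^2^'n" where
  "interp s x = piece (nat \<lfloor>c * s\<rfloor>) s x"

lemma chain_pair: "\<exists>F'. invariant_pair (chain n) F'"
proof (induction n)
  case 0
  have "chain 0 = (\<lambda>x. x)" by (simp add: fun_eq_iff)
  then show ?case using invariant_pair_id by auto
next
  case (Suc n)
  have "chain (Suc n) = fflow (a n) (d n) \<circ> chain n" by (simp add: fun_eq_iff)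
  then show ?case using Suc invariant_pair_comp[OF invariant_pair_fflow[OF d]] by metis
qed

lemma chain_in: "x \<in> conf \<Longrightarrow> chain n x \<in> conf"
  using chain_pair[of n] invariant_map_in unfolding invariant_pair_def by blast

lemma floor_piece:
  assumes "0 \<le> s" "n = nat \<lfloor>c * s\<rfloor>"
  shows "real n \<le> c * s" "c * s < real n + 1"
proof -
  have "real n = of_int \<lfloor>c * s\<rfloor>" using assms c by (simp add: of_nat_nat)
  then show "real n \<le> c * s" "c * s < real n + 1" by linarith+
qed

lemma piece_floor:
  assumes "real n \<le> c * s" "c * s < real n + 1"
  shows "nat \<lfloor>c * s\<rfloor> = n"
proof -
  have "\<lfloor>c * s\<rfloor> = int n" using assms by linarith
  then show ?thesis by simp
qed

lemma divide_c: "real n / c \<le> s \<longleftrightarrow> real n \<le> c * s" "real n / c < s \<longleftrightarrow> real n < c * s"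
    "s \<le> (real n + 1) / c \<longleftrightarrow> c * s \<le> real n + 1" "s < (real n + 1) / c \<longleftrightarrow> c * s < real n + 1"
  using c by (simp_all add: field_simps)

lemma interp_pair:
  assumes s: "0 \<le> s"
  shows "\<exists>F'. invariant_pair (interp s) F'"
proof -
  define n where "n = nat \<lfloor>c * s\<rfloor>"
  have "0 \<le> d n * (c * s - real n)"
    by (rule mult_nonneg_nonneg[OF d]) (use floor_piece(1)[OF s n_def] in simp)
  from invariant_pair_comp[OF invariant_pair_fflow[OF this]] chain_pair
  have "\<exists>F'. invariant_pair (fflow (a n) (d n * (c * s - real n)) \<circ> chain n) F'"
    by blast
  moreover have "fflow (a n) (d n * (c * s - real n)) \<circ> chain n = interp s"
    by (simp add: fun_eq_iff interp_def piece_def n_def)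
  ultimately show ?thesis by simp
qed

lemma interp_in: "x \<in> conf \<Longrightarrow> 0 \<le> s \<Longrightarrow> interp s x \<in> conf"
  using interp_pair[of s] invariant_map_in unfolding invariant_pair_def by blast

lemma interp_0 [simp]: "interp 0 x = x" by (simp add: interp_def piece_def)

text \<open>Both ends are included: at the right end the next piece begins with running time 0 and
  continues from the full step of this one.\<close>

lemma interp_piece:
  assumes s: "real n \<le> c * s" "c * s \<le> real n + 1"
  shows "interp s x = piece n s x"
proof (cases "c * s = real n + 1")
  case True
  then have "nat \<lfloor>c * s\<rfloor> = Suc n" by (intro piece_floor) auto
  then show ?thesis by (simp add: interp_def piece_def True)
next
  case False
  then have "nat \<lfloor>c * s\<rfloor> = n" using s by (intro piece_floor) auto
  then show ?thesis by (simp add: interp_def)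
qed

lemma interp_continuous_piece:
  assumes x: "x \<in> conf"
  shows "continuous_on {real n / c..(real n + 1) / c} (\<lambda>s. interp s x)"
proof -
  have 1: "continuous_on {0..d n} (\<lambda>t. fflow (a n) t (chain n x))"
    using fflow_trajectory[OF chain_in[OF x]] unfolding is_trajectory_def by blast
  have 2: "(\<lambda>s. d n * (c * s - real n)) ` {real n / c..(real n + 1) / c} \<subseteq> {0..d n}"
  proof (rule image_subsetI)
    fix s assume "s \<in> {real n / c..(real n + 1) / c}"
    then have "0 \<le> c * s - real n" "c * s - real n \<le> 1" by (auto simp: divide_c)
    then show "d n * (c * s - real n) \<in> {0..d n}"
      using d[of n] mult_left_le[of "c * s - real n" "d n"] by simp
  qed
  have "continuous_on {real n / c..(real n + 1) / c} (\<lambda>s. piece n s x)"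
    unfolding piece_def by (rule continuous_on_compose2[OF 1 _ 2]) (intro continuous_intros)
  then show ?thesis by (rule continuous_on_eq) (simp add: interp_piece[symmetric] divide_c)
qed

lemma interp_continuous:
  assumes x: "x \<in> conf"
  shows "continuous_on {0..} (\<lambda>s. interp s x)"
proof -
  have init: "continuous_on {0..real n / c} (\<lambda>s. interp s x)" for n
  proof (induction n)
    case (Suc n)
    have S: "real (Suc n) / c = (real n + 1) / c" by (simp add: add.commute)
    have "0 \<le> real n / c" "real n / c \<le> (real n + 1) / c" using c by (simp_all add: divide_right_mono)
    from ivl_disj_un_two_touch(4)[OF this]
    show ?case
      unfolding S using continuous_on_closed_Un[OF closed_atLeastAtMost closed_atLeastAtMost Suc interp_continuous_piece[OF x, of n]]
      by (simp only:)
  qed simp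
  show ?thesis
    unfolding continuous_on_eq_continuous_within
  proof
    fix s :: real assume "s \<in> {0..}"
    then have s: "0 \<le> s" by simp
    obtain n :: nat where "c * s < n" using reals_Archimedean2 by blast
    then have n: "s < real n / c" using c by (simp add: field_simps)
    have "continuous (at s within {0..real n / c}) (\<lambda>s. interp s x)"
      using init[of n] s n by (simp add: continuous_on_eq_continuous_within)
    moreover have "at s within {0..real n / c} = at s within {0..}"
      by (rule at_within_nhd[where S = "{..<real n / c}"]) (use n in auto)
    ultimately show "continuous (at s within {0..}) (\<lambda>s. interp s x)" by simp
  qed
qed

lemma interp_derivative:
  assumes x: "x \<in> conf" and s: "0 \<le> s" "c * s \<notin> \<int>" and n: "n = nat \<lfloor>c * s\<rfloor>"
  shows "((\<lambda>s. interp s x) has_vector_derivative (c * d n) *\<^sub>R slot_field G \<xi> (a n) (interp s x)) (at s)"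
proof -
  define S where "S = {real n / c<..<(real n + 1) / c}"
  have S: "r \<in> S \<longleftrightarrow> real n < c * r \<and> c * r < real n + 1" for r by (simp add: S_def divide_c)
  have "c * s \<noteq> real n" using s(2) by (metis Ints_of_nat)
  then have sS: "s \<in> S" using floor_piece[OF s(1) n] by (simp add: S)
  define f where "f = (\<lambda>s. d n * (c * s - real n))"
  have f: "(f has_vector_derivative c * d n) (at s within S)"
    unfolding f_def
    by (auto intro!: derivative_eq_intros simp: has_real_derivative_iff_has_vector_derivative[symmetric])
  have rng: "f r \<in> {0..}" if "r \<in> S" for r
    using d[of n] that by (simp add: f_def S)
  have fs: "0 \<le> f s" using rng[OF sS] by simp
  have sub: "f ` S \<subseteq> {0..}" using rng by blast
  have p: "piece n r x = fflow (a n) (f r) (chain n x)" for r by (simp add: piece_def f_def)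
  have eq: "interp r x = piece n r x" if "r \<in> S" for r using that by (intro interp_piece) (simp_all add: S)
  \<comment> \<open>If \<open>d n = 0\<close> then \<open>f\<close> is constantly 0, the end of the
    half-line on which \<open>fflow\<close> is differentiable; the chain rule is therefore applied
    within sets.\<close>
  from vector_diff_chain_within[OF f has_vector_derivative_within_subset[OF
      fflow_has_vector_derivative[OF chain_in[OF x, of n] fs, of "a n"] sub]]
  have "((\<lambda>s. piece n s x) has_vector_derivative (c * d n) *\<^sub>R slot_field G \<xi> (a n) (interp s x)) (at s within S)"
    unfolding eq[OF sS] p o_def .
  then have "((\<lambda>s. interp s x) has_vector_derivative (c * d n) *\<^sub>R slot_field G \<xi> (a n) (interp s x)) (at s within S)"
    by (rule has_vector_derivative_transform[rotated 2]) (use sS eq in simp_all)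
  moreover have "open S" by (simp add: S_def)
  ultimately show ?thesis using sS by (simp only: at_within_open)
qed

text \<open>Between consecutive switching times the curve solves an autonomous equation with speed
  \<open>c * d n\<close>, and continuity joins the pieces, so its values at the switching times are
  given by \<open>chain\<close>.\<close>

lemma interp_unique:
  assumes cont: "continuous_on {0..} \<Gamma>" and inside: "\<And>s. 0 \<le> s \<Longrightarrow> \<Gamma> s \<in> conf"
    and der: "\<And>s n. 0 \<le> s \<Longrightarrow> c * s \<notin> \<int> \<Longrightarrow> n = nat \<lfloor>c * s\<rfloor> \<Longrightarrow>
       (\<Gamma> has_vector_derivative (c * d n) *\<^sub>R slot_field G \<xi> (a n) (\<Gamma> s)) (at s)"
    and s: "0 \<le> s"
  shows "\<Gamma> s = interp s (\<Gamma> 0)"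
proof -
  have step: "\<Gamma> s = fflow (a n) (d n * (c * s - real n)) (\<Gamma> (real n / c))"
    if ns: "real n \<le> c * s" "c * s \<le> real n + 1" for n s
  proof -
    have n0: "0 \<le> real n / c" using c by simp
    have "\<Gamma> s = fflow (a n) ((c * d n) * (s - real n / c)) (\<Gamma> (real n / c))"
    proof (rule fflow_scaled_eqI)
      show "continuous_on {real n / c..s} \<Gamma>" by (rule continuous_on_subset[OF cont]) (use n0 in auto)
      show "0 \<le> c * d n" using c d by simp
      show "real n / c \<le> s" using ns by (simp add: divide_c)
      show "\<Gamma> t \<in> conf" if "real n / c \<le> t" for t using that n0 by (intro inside) linarith
      fix t assume t: "real n / c < t" "t < s"
      have ct: "real n < c * t" "c * t < real n + 1"
        using t(1) mult_strict_left_mono[OF t(2) c] ns by (simp_all add: divide_c)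
      have "c * t \<notin> \<int>"
      proof
        assume "c * t \<in> \<int>"
        then obtain z where "c * t = of_int z" by (elim Ints_cases)
        with ct have "real_of_int (int n) < of_int z" "of_int z < real_of_int (int n + 1)" by simp_all
        then show False by (simp only: of_int_less_iff)
      qed
      moreover have "n = nat \<lfloor>c * t\<rfloor>" using piece_floor[of n t] ct by simp
      ultimately show "(\<Gamma> has_vector_derivative (c * d n) *\<^sub>R slot_field G \<xi> (a n) (\<Gamma> t)) (at t)"
        by (intro der) (use t n0 in linarith)
    qed
    moreover have "(c * d n) * (s - real n / c) = d n * (c * s - real n)" using c by (simp add: field_simps)
    ultimately show ?thesis by (simp only:)
  qed
  have grid: "\<Gamma> (real n / c) = chain n (\<Gamma> 0)" for n
  proof (induction n)
    case (Suc n)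
    have cS: "c * (real (Suc n) / c) = real n + 1" using c by simp
    show ?case
      using step[of n "real (Suc n) / c"] Suc unfolding cS by simp
  qed simp
  define n where "n = nat \<lfloor>c * s\<rfloor>"
  have ns: "real n \<le> c * s" "c * s \<le> real n + 1"
    using floor_piece[OF s n_def] by auto
  show ?thesis using step[OF ns] interp_piece[OF ns, of "\<Gamma> 0"] by (simp add: piece_def grid)
qed

end

lemma (in vortices) jumping_flow_facts:
  assumes \<tau>: "\<And>k. 1 \<le> k \<Longrightarrow> 0 \<le> \<tau> k"
  shows "\<exists>F F'. invariant_pair F F' \<and> (\<forall>x\<in>conf_space. jumping_flow G \<xi> e \<tau> m t x = wrapN (F x))"
    and "x \<in> conf_space \<Longrightarrow> jumping_flow_defined G \<xi> e \<tau> m t x"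
proof -
  \<comment> \<open>Step \<open>n\<close> of the schedule counts from 0 and uses the waiting time
    \<open>\<tau> (Suc n)\<close>. Jumps have no intermediate times, so any positive clock rate
    serves.\<close>
  interpret schedule G \<xi> "\<lambda>n. slot e (Suc n)" "\<lambda>n. \<tau> (Suc n) / real m" 1
    using \<tau> by unfold_locales auto
  have steps: "jump_steps G \<xi> e \<tau> m k x = wrapN (chain k x)" if x: "x \<in> conf_space" for k x
  proof (induction k)
    case 0 show ?case using x by (simp add: conf_space_eq wrapN_id)
  next
    case (Suc k)
    have xc: "x \<in> conf" using x by (simp add: conf_space_eq)
    have T: "0 \<le> \<tau> (Suc k) / real m" using \<tau> by simp
    show ?case
      using flow_slot_field[OF _ T, of "wrapN (chain k x)"] chain_in[OF xc] invariant_map_wrapN[OF invariant_map_fflow[OF T]]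
      by (simp add: Suc wrapN_conf_space)
  qed
  then show "\<exists>F F'. invariant_pair F F' \<and> (\<forall>x\<in>conf_space. jumping_flow G \<xi> e \<tau> m t x = wrapN (F x))"
    using chain_pair unfolding jumping_flow_def by blast
  assume x: "x \<in> conf_space"
  then have "x \<in> conf" by (simp add: conf_space_eq)
  then show "jumping_flow_defined G \<xi> e \<tau> m t x"
    unfolding jumping_flow_defined_def steps[OF x]
    by (intro allI impI flow_defined_slot_field) (simp add: wrapN_conf_space chain_in)
qed

lemma (in vortices) interpolated_flow_facts:
  fixes e :: "nat \<Rightarrow> 'n"
  assumes \<tau>: "\<And>k. 1 \<le> k \<Longrightarrow> 0 \<le> \<tau> k" and m: "1 \<le> m" and t: "0 \<le> t"
  shows "\<exists>F F'. invariant_pair F F' \<and> (\<forall>x\<in>conf_space. interpolated_flow G \<xi> e \<tau> m t x = wrapN (F x))"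
    and "x \<in> conf_space \<Longrightarrow> interpolated_flow_defined G \<xi> e \<tau> m x"
proof -
  define c where "c = real CARD('n) * real m"
  interpret schedule G \<xi> "\<lambda>n. slot e (Suc n)" "\<lambda>n. \<tau> (Suc n) / real m" c
    using \<tau> m by unfold_locales (auto simp: c_def)
  \<comment> \<open>Running for the time \<open>\<tau> / m\<close> within a clock interval of length
    \<open>1 / c\<close>, with \<open>c = N * m\<close>, means speed
    \<open>N * \<tau>\<close>.\<close>
  have rate: "c * (\<tau> (Suc n) / real m) = real CARD('n) * \<tau> (Suc n)" for n using m by (simp add: c_def)
  have ex: "interpolated_curve G \<xi> e \<tau> m x (\<lambda>s. wrapN (interp s x))" if x: "x \<in> conf_space" for x
  proof -
    have xc: "x \<in> conf" "wrapN x = x" using x by (auto simp: conf_space_eq wrapN_id)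
    show ?thesis
      unfolding interpolated_curve_def wrapN_conf_space slot_field_wrapN Let_def c_def[symmetric]
    proof (intro conjI exI[of _ "\<lambda>s. interp s x"] allI impI)
      fix s :: real assume s: "0 \<le> s" "c * s \<notin> \<int>"
      show "((\<lambda>s. interp s x) has_vector_derivative (real CARD('n) * \<tau> (nat \<lfloor>c * s\<rfloor> + 1)) *\<^sub>R
              slot_field G \<xi> (slot e (nat \<lfloor>c * s\<rfloor> + 1)) (interp s x)) (at s)"
        using interp_derivative[OF xc(1) s refl] unfolding rate by (simp only: Suc_eq_plus1)
    qed (use xc interp_in interp_continuous in simp_all)
  qed
  have uniq: "\<gamma> s = wrapN (interp s x)" if \<gamma>: "interpolated_curve G \<xi> e \<tau> m x \<gamma>" and s: "0 \<le> s" for \<gamma> s x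
  proof -
    obtain \<Gamma> where \<Gamma>0: "\<gamma> 0 = x" and cont: "continuous_on {0..} \<Gamma>" and \<Gamma>: "\<And>s. 0 \<le> s \<Longrightarrow> \<gamma> s = wrapN (\<Gamma> s)"
      and inside: "\<And>s. 0 \<le> s \<Longrightarrow> \<gamma> s \<in> conf_space"
      and der: "\<And>s. 0 \<le> s \<Longrightarrow> c * s \<notin> \<int> \<Longrightarrow>
         (\<Gamma> has_vector_derivative (real CARD('n) * \<tau> (nat \<lfloor>c * s\<rfloor> + 1)) *\<^sub>R
              slot_field G \<xi> (slot e (nat \<lfloor>c * s\<rfloor> + 1)) (\<gamma> s)) (at s)"
      using \<gamma> unfolding interpolated_curve_def Let_def c_def[symmetric] by blast
    have "\<Gamma> s = interp s (\<Gamma> 0)"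
    proof (rule interp_unique[OF cont _ _ s])
      show "\<Gamma> s \<in> conf" if "0 \<le> s" for s using inside[OF that] by (simp add: \<Gamma>[OF that] wrapN_conf_space)
      fix s n assume sn: "0 \<le> s" "c * s \<notin> \<int>" "n = nat \<lfloor>c * s\<rfloor>"
      show "(\<Gamma> has_vector_derivative (c * (\<tau> (Suc n) / real m)) *\<^sub>R slot_field G \<xi> (slot e (Suc n)) (\<Gamma> s)) (at s)"
        using der[OF sn(1,2)] unfolding rate \<Gamma>[OF sn(1)] slot_field_wrapN sn(3) by (simp only: Suc_eq_plus1)
    qed
    moreover have "wrapN (interp s (wrapN (\<Gamma> 0))) = wrapN (interp s (\<Gamma> 0))"
      using interp_pair[OF s] invariant_map_wrapN unfolding invariant_pair_def by blast
    ultimately show ?thesis using \<Gamma>[OF s] \<Gamma>[of 0] \<Gamma>0 by simp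
  qed
  have "interpolated_flow G \<xi> e \<tau> m t x = wrapN (interp t x)" if x: "x \<in> conf_space" for x
    unfolding interpolated_flow_def
  proof (rule the_equality)
    show "\<exists>\<gamma>. interpolated_curve G \<xi> e \<tau> m x \<gamma> \<and> \<gamma> t = wrapN (interp t x)" using ex[OF x] by blast
    show "y = wrapN (interp t x)" if "\<exists>\<gamma>. interpolated_curve G \<xi> e \<tau> m x \<gamma> \<and> \<gamma> t = y" for y
      using that uniq[OF _ t] by blast
  qed
  then show "\<exists>F F'. invariant_pair F F' \<and> (\<forall>x\<in>conf_space. interpolated_flow G \<xi> e \<tau> m t x = wrapN (F x))"
    using interp_pair[OF t] by blast
  assume "x \<in> conf_space"
  then show "interpolated_flow_defined G \<xi> e \<tau> m x"
    unfolding interpolated_flow_defined_def using ex uniq by metis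
qed

lemma (in vortices) invariant_consequences:
  fixes \<Phi> :: "real^2^'n \<Rightarrow> real^2^'n"
  assumes "\<exists>F F'. invariant_pair F F' \<and> (\<forall>x\<in>conf_space. \<Phi> x = wrapN (F x))"
  shows "x \<in> conf_space \<Longrightarrow> \<Phi> x \<in> conf_space" "x \<in> conf_space \<Longrightarrow> energy G \<xi> (\<Phi> x) = energy G \<xi> x"
    "preserves_measure \<Phi> vol_torusN" "preserves_measure \<Phi> (canonical G \<xi> \<beta>)"
    "regular_energy G \<xi> E \<Longrightarrow> surface_measure_on (energy_surface G \<xi> E) \<sigma> \<Longrightarrow>
       preserves_measure \<Phi> (microcanonical G \<xi> \<sigma>)"
proof -
  obtain F F' where pair: "invariant_pair F F'" and eq: "\<And>x. x \<in> conf_space \<Longrightarrow> \<Phi> x = wrapN (F x)"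
    using assms by blast
  have F: "invariant_map F" using pair by (simp add: invariant_pair_def)
  have c: "x \<in> conf" if "x \<in> conf_space" for x :: "real^2^'n" using that by (simp add: conf_space_eq)
  show "\<Phi> x \<in> conf_space" if "x \<in> conf_space"
    using invariant_map_in[OF F c[OF that]] by (simp add: eq[OF that] wrapN_conf_space)
  show "energy G \<xi> (\<Phi> x) = energy G \<xi> x" if "x \<in> conf_space"
    using invariant_map_energy_wrap[OF pair c[OF that]] by (simp add: eq[OF that])
  show "preserves_measure \<Phi> vol_torusN"
    by (rule preserves_measure_cong[OF preserves_volume[OF pair] eq])
  show "preserves_measure \<Phi> (canonical G \<xi> \<beta>)"
    by (rule preserves_measure_cong[OF preserves_canonical[OF pair] eq])
  show "preserves_measure \<Phi> (microcanonical G \<xi> \<sigma>)"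
    if "regular_energy G \<xi> E" "surface_measure_on (energy_surface G \<xi> E) \<sigma>"
    by (rule preserves_measure_cong[OF preserves_microcanonical[OF pair that] eq])
qed

theorem mainTheorem2:
  fixes G :: "real^2 \<Rightarrow> real"
    and \<xi> :: "'n::finite \<Rightarrow> real"
    and e :: "nat \<Rightarrow> 'n"
    and P :: "'w measure"
    and \<tau> :: "nat \<Rightarrow> 'w \<Rightarrow> real"
    and \<rho> :: "real measure"
    and m :: nat
  assumes green: "green_function G"
    and enumeration: "bij_betw e {1..CARD('n)} UNIV"
    and intensities: "\<And>i. \<xi> i \<noteq> 0"
    and prob: "prob_space P"
    and indep: "prob_space.indep_vars P (\<lambda>_. borel) \<tau> {1..}"
    and law: "\<And>i. i \<ge> 1 \<Longrightarrow> distr P borel (\<tau> i) = \<rho>"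
    and nonneg: "\<And>i \<omega>. i \<ge> 1 \<Longrightarrow> \<omega> \<in> space P \<Longrightarrow> \<tau> i \<omega> \<ge> 0"
    and tails: "\<exists>C c. C > 0 \<and> c > 0 \<and>
      (\<forall>r\<ge>0. measure P {\<omega> \<in> space P. \<tau> 1 \<omega> > r} \<le> C * exp (- c * r))"
    and mean: "\<And>i. i \<ge> 1 \<Longrightarrow> integral\<^sup>L P (\<tau> i) = 1"
    and m: "m \<ge> 1"
  shows "\<forall>\<omega>\<in>space P. \<forall>t\<ge>0.
    (let \<Phi> = jumping_flow G \<xi> e (\<lambda>i. \<tau> i \<omega>) m t;
         \<Psi> = interpolated_flow G \<xi> e (\<lambda>i. \<tau> i \<omega>) m t
     in
      (\<forall>x\<in>conf_space.
         jumping_flow_defined G \<xi> e (\<lambda>i. \<tau> i \<omega>) m t x \<and> \<Phi> x \<in> conf_space \<and>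
         interpolated_flow_defined G \<xi> e (\<lambda>i. \<tau> i \<omega>) m x \<and> \<Psi> x \<in> conf_space) \<and>
      (\<forall>x\<in>conf_space.
         energy G \<xi> (\<Phi> x) = energy G \<xi> x \<and> energy G \<xi> (\<Psi> x) = energy G \<xi> x) \<and>
      (preserves_measure \<Phi> vol_torusN \<and> preserves_measure \<Psi> vol_torusN) \<and>
      (\<forall>\<beta>. Z_canonical G \<xi> \<beta> < \<infinity> \<longrightarrow>
         preserves_measure \<Phi> (canonical G \<xi> \<beta>) \<and> preserves_measure \<Psi> (canonical G \<xi> \<beta>)) \<and>
      (\<forall>E \<sigma>. regular_energy G \<xi> E \<and> surface_measure_on (energy_surface G \<xi> E) \<sigma> \<and>
         0 < Z_microcanonical G \<xi> \<sigma> \<and> Z_microcanonical G \<xi> \<sigma> < \<infinity> \<longrightarrow>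
         preserves_measure \<Phi> (microcanonical G \<xi> \<sigma>) \<and>
         preserves_measure \<Psi> (microcanonical G \<xi> \<sigma>)))"
proof (intro ballI allI impI)
  fix \<omega> t assume \<omega>: "\<omega> \<in> space P" and t: "0 \<le> (t :: real)"
  interpret vortices G \<xi> using green intensities by unfold_locales
  have \<tau>: "0 \<le> \<tau> k \<omega>" if "1 \<le> k" for k by (rule nonneg[OF that \<omega>])
  note J = jumping_flow_facts[where \<tau> = "\<lambda>i. \<tau> i \<omega>" and e = e and m = m and t = t, OF \<tau>]
  note I = interpolated_flow_facts[where \<tau> = "\<lambda>i. \<tau> i \<omega>" and e = e, OF \<tau> m t]
  note J' = invariant_consequences[OF J(1)]
  note I' = invariant_consequences[OF I(1)]
  show "let \<Phi> = jumping_flow G \<xi> e (\<lambda>i. \<tau> i \<omega>) m t;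
         \<Psi> = interpolated_flow G \<xi> e (\<lambda>i. \<tau> i \<omega>) m t
     in
      (\<forall>x\<in>conf_space.
         jumping_flow_defined G \<xi> e (\<lambda>i. \<tau> i \<omega>) m t x \<and> \<Phi> x \<in> conf_space \<and>
         interpolated_flow_defined G \<xi> e (\<lambda>i. \<tau> i \<omega>) m x \<and> \<Psi> x \<in> conf_space) \<and>
      (\<forall>x\<in>conf_space.
         energy G \<xi> (\<Phi> x) = energy G \<xi> x \<and> energy G \<xi> (\<Psi> x) = energy G \<xi> x) \<and>
      (preserves_measure \<Phi> vol_torusN \<and> preserves_measure \<Psi> vol_torusN) \<and>
      (\<forall>\<beta>. Z_canonical G \<xi> \<beta> < \<infinity> \<longrightarrow>
         preserves_measure \<Phi> (canonical G \<xi> \<beta>) \<and> preserves_measure \<Psi> (canonical G \<xi> \<beta>)) \<and>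
      (\<forall>E \<sigma>. regular_energy G \<xi> E \<and> surface_measure_on (energy_surface G \<xi> E) \<sigma> \<and>
         0 < Z_microcanonical G \<xi> \<sigma> \<and> Z_microcanonical G \<xi> \<sigma> < \<infinity> \<longrightarrow>
         preserves_measure \<Phi> (microcanonical G \<xi> \<sigma>) \<and>
         preserves_measure \<Psi> (microcanonical G \<xi> \<sigma>))"
    unfolding Let_def using J(2) J' I(2) I' by (intro conjI ballI allI impI) ((simp; fail) | blast)+
qed

end
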